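(* There is a constant $C>0$, independent of $h$ and $\varepsilon$, such that for all $0\le\varepsilon\le\varepsilon_0$ and all $(\tilde{\boldsymbol\phi},\tilde r,\tilde{\boldsymbol p})\in V_h\times R_h\times Q_h$, $$\sup_{\boldsymbol0\ne(\boldsymbol\psi,s,\boldsymbol q)\in V_h\times R_h\times Q_h}\frac{B(\tilde{\boldsymbol\phi},\tilde r,\tilde{\boldsymbol p};\boldsymbol\psi,s,\boldsymbol q)}{\|(\boldsymbol\psi,s)\|_\varepsilon+\|\boldsymbol q\|_\varepsilon}\ \ge\ C\big(\|(\tilde{\boldsymbol\phi},\tilde r)\|_\varepsilon+\|\tilde{\boldsymbol p}\|_\varepsilon\big).$$
   Context: Let $\Omega\subset\mathbb R^3$ be a bounded polyhedral domain. $(\cdot,\cdot)$ and $\|\cdot\|_0$ are the $L^2(\Omega)$ inner product and norm (scalar or vector). Fix $\varepsilon_0>0$ and let $0\le\varepsilon\le\varepsilon_0$. Spaces and norms: $V=H_0^1(\Omega;\mathbb R^3)$ if $\varepsilon>0$ and $V=L^2(\Omega;\mathbb R^3)$ if $\varepsilon=0$, with $\|\boldsymbol\psi\|_\varepsilon^2=\varepsilon^2\|\nabla\boldsymbol\psi\|_0^2+\|\boldsymbol\psi\|_0^2$ (the first term being absent if $\varepsilon=0$); $R=L_0^2(\Omega)$ (mean-zero $L^2$ functions); $\|(\boldsymbol\psi,s)\|_\varepsilon^2=\|\boldsymbol\psi\|_\varepsilon^2+\|s\|_0^2$. $Q=H_0(\mathrm{div};\Omega)$ (fields in $H(\mathrm{div};\Omega)$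 with vanishing normal trace) if $\varepsilon>0$ and $Q=H_0(\mathrm{div};\Omega)\cap H(\mathrm{curl};\Omega)$ if $\varepsilon=0$. The pairing $\langle\boldsymbol\psi,\operatorname{curl}\boldsymbol q\rangle$ for $(\boldsymbol\psi,\boldsymbol q)\in V\times Q$ equals $(\operatorname{curl}\boldsymbol\psi,\boldsymbol q)$ if $\varepsilon>0$ and $(\boldsymbol\psi,\operatorname{curl}\boldsymbol q)$ if $\varepsilon=0$, and $$\|\boldsymbol q\|_\varepsilon^2=\Big(\sup_{\boldsymbol0\ne\boldsymbol\psi\in V}\frac{\langle\boldsymbol\psi,\operatorname{curl}\boldsymbol q\rangle}{\|\boldsymbol\psi\|_\varepsilon}\Big)^2+\|\operatorname{div}\boldsymbol q\|_0^2 .$$ Bilinear forms: $a_1(\boldsymbol\phi,\boldsymbol\psi)=\varepsilon^2(\nabla\boldsymbol\phi,\nabla\boldsymbol\psi)+(\boldsymbol\phi,\boldsymbol\psi)$, $a_2(r,s)=(r,s)$, $b_1(\boldsymbol\phi,\boldsymbol q)=\langle\boldsymbol\phi,\operatorname{curl}\boldsymbol q\rangle$, $b_2(r,\boldsymbol q)=(r,\operatorname{div}\boldsymbol q)$, and $$B(\boldsymbol\phi,r,\boldsymbol p;\boldsymbol\psi,s,\boldsymbol q)=a_1(\boldsymbol\phi,\boldsymbol\psi)+a_2(r,s)+b_1(\boldsymbol\phi,\boldsymbol q)+b_2(r,\boldsymbol q)+b_1(\boldsymbol\psi,\boldsymbol p)+b_2(s,\boldsymbol p).$$ Meshes: $\{\mathcal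 T_h\}_{h>0}$ is a shape-regular, quasi-uniform family of conforming tetrahedral triangulations of $\Omega$, $h=\max_{K\in\mathcal T_h}\operatorname{diam}K$. With $B_4(K)=P_4(K)\cap H_0^1(K)$ (quartic bubbles), set $V_h=\{\boldsymbol\psi\in V:\boldsymbol\psi|_K\in[P_1(K)\oplus B_4(K)]^3\ \forall K\in\mathcal T_h\}$, $R_h=\{s\in R: s|_K\in P_0(K)\ \forall K\in\mathcal T_h\}$, $Q_h=\{\boldsymbol q\in H_0(\mathrm{div};\Omega)\cap H^1(\Omega;\mathbb R^3):\boldsymbol q|_K\in P_1(K;\mathbb R^3)\ \forall K\in\mathcal T_h\}$. *)

theory Defs
  imports "HOL-Analysis.Analysis"
begin

section \<open>Lebesgue and Sobolev spaces on a domain of three-dimensional space\<close>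

text \<open>
  Elements of Lebesgue and Sobolev spaces are represented by functions on the whole of
  \<open>real^3\<close> of which only the almost-everywhere class on \<open>\<Omega>\<close> matters. In particular
  ``nonzero'' means ``not almost everywhere zero on \<open>\<Omega>\<close>''.
\<close>

type_synonym scalar_field = "real^3 \<Rightarrow> real"
type_synonym vector_field = "real^3 \<Rightarrow> real^3"

definition L2 :: "(real^3) set \<Rightarrow> (real^3 \<Rightarrow> 'b::euclidean_space) set" where
  "L2 \<Omega> = {f. f \<in> borel_measurable (lebesgue_on \<Omega>) \<and>
              integrable (lebesgue_on \<Omega>) (\<lambda>x. (norm (f x))\<^sup>2)}"

text \<open>For matrix-valued functions the pointwise inner product is the Frobenius product.\<close>

definition L2_inner :: "(real^3) set \<Rightarrow> (real^3 \<Rightarrow> 'b::euclidean_space) \<Rightarrow> (real^3 \<Rightarrow> 'b) \<Rightarrow> real" where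
  "L2_inner \<Omega> f g = (LINT x|lebesgue_on \<Omega>. f x \<bullet> g x)"

definition L2_norm :: "(real^3) set \<Rightarrow> (real^3 \<Rightarrow> 'b::euclidean_space) \<Rightarrow> real" where
  "L2_norm \<Omega> f = sqrt (L2_inner \<Omega> f f)"

definition ae_zero :: "(real^3) set \<Rightarrow> (real^3 \<Rightarrow> 'b::zero) \<Rightarrow> bool" where
  "ae_zero \<Omega> f \<longleftrightarrow> (AE x in lebesgue_on \<Omega>. f x = 0)"

definition partial :: "3 \<Rightarrow> scalar_field \<Rightarrow> scalar_field" where
  "partial i f x = frechet_derivative f (at x) (axis i 1)"

definition classical_grad :: "scalar_field \<Rightarrow> vector_field" where
  "classical_grad f x = (\<chi> i. partial i f x)"

definition classical_curl :: "vector_field \<Rightarrow> vector_field" where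
  "classical_curl f x =
     vector [partial 2 (\<lambda>y. f y $ 3) x - partial 3 (\<lambda>y. f y $ 2) x,
             partial 3 (\<lambda>y. f y $ 1) x - partial 1 (\<lambda>y. f y $ 3) x,
             partial 1 (\<lambda>y. f y $ 2) x - partial 2 (\<lambda>y. f y $ 1) x]"

fun C_k :: "nat \<Rightarrow> scalar_field \<Rightarrow> bool" where
  "C_k 0 f \<longleftrightarrow> continuous_on UNIV f"
| "C_k (Suc k) f \<longleftrightarrow> (\<forall>x. f differentiable (at x)) \<and> (\<forall>i. C_k k (partial i f))"

definition test_functions :: "(real^3) set \<Rightarrow> scalar_field set" where
  "test_functions \<Omega> = {f. (\<forall>k. C_k k f) \<and>
     compact (closure {x. f x \<noteq> 0}) \<and> closure {x. f x \<noteq> 0} \<subseteq> \<Omega>}"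

definition is_weak_grad :: "(real^3) set \<Rightarrow> scalar_field \<Rightarrow> vector_field \<Rightarrow> bool" where
  "is_weak_grad \<Omega> u g \<longleftrightarrow> g \<in> L2 \<Omega> \<and>
     (\<forall>f \<in> test_functions \<Omega>. \<forall>i.
        (LINT x|lebesgue_on \<Omega>. u x * partial i f x) = - (LINT x|lebesgue_on \<Omega>. g x $ i * f x))"

definition is_weak_curl :: "(real^3) set \<Rightarrow> vector_field \<Rightarrow> vector_field \<Rightarrow> bool" where
  "is_weak_curl \<Omega> q c \<longleftrightarrow> c \<in> L2 \<Omega> \<and>
     (\<forall>f. (\<forall>i. (\<lambda>x. f x $ i) \<in> test_functions \<Omega>) \<longrightarrow>
        L2_inner \<Omega> q (classical_curl f) = L2_inner \<Omega> c f)"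

definition is_weak_div :: "(real^3) set \<Rightarrow> vector_field \<Rightarrow> scalar_field \<Rightarrow> bool" where
  "is_weak_div \<Omega> q d \<longleftrightarrow> d \<in> L2 \<Omega> \<and>
     (\<forall>f \<in> test_functions \<Omega>. L2_inner \<Omega> q (classical_grad f) = - L2_inner \<Omega> d f)"

text \<open>
  Square-integrable weak derivatives are unique up to null sets; the following pick a
  representative, and are meaningful only when such a derivative exists.
\<close>

definition weak_grad :: "(real^3) set \<Rightarrow> scalar_field \<Rightarrow> vector_field" where
  "weak_grad \<Omega> u = (SOME g. is_weak_grad \<Omega> u g)"

definition weak_curl :: "(real^3) set \<Rightarrow> vector_field \<Rightarrow> vector_field" where
  "weak_curl \<Omega> q = (SOME c. is_weak_curl \<Omega> q c)"

definition weak_div :: "(real^3) set \<Rightarrow> vector_field \<Rightarrow> scalar_field" where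
  "weak_div \<Omega> q = (SOME d. is_weak_div \<Omega> q d)"

definition weak_jacobian :: "(real^3) set \<Rightarrow> vector_field \<Rightarrow> real^3 \<Rightarrow> real^3^3" where
  "weak_jacobian \<Omega> v x = (\<chi> i. weak_grad \<Omega> (\<lambda>y. v y $ i) x)"

definition H1 :: "(real^3) set \<Rightarrow> scalar_field set" where
  "H1 \<Omega> = {u \<in> L2 \<Omega>. \<exists>g. is_weak_grad \<Omega> u g}"

definition H1_norm :: "(real^3) set \<Rightarrow> scalar_field \<Rightarrow> real" where
  "H1_norm \<Omega> u = sqrt ((L2_norm \<Omega> u)\<^sup>2 + (L2_norm \<Omega> (weak_grad \<Omega> u))\<^sup>2)"

text \<open>The closure of the test functions in \<open>H1\<close>.\<close>

definition H1_0 :: "(real^3) set \<Rightarrow> scalar_field set" where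
  "H1_0 \<Omega> = {u \<in> H1 \<Omega>. \<forall>\<delta>>0. \<exists>f \<in> test_functions \<Omega>. H1_norm \<Omega> (\<lambda>x. u x - f x) < \<delta>}"

definition H1_vec :: "(real^3) set \<Rightarrow> vector_field set" where
  "H1_vec \<Omega> = {v. \<forall>i. (\<lambda>x. v x $ i) \<in> H1 \<Omega>}"

definition H1_0_vec :: "(real^3) set \<Rightarrow> vector_field set" where
  "H1_0_vec \<Omega> = {v. \<forall>i. (\<lambda>x. v x $ i) \<in> H1_0 \<Omega>}"

definition H_div :: "(real^3) set \<Rightarrow> vector_field set" where
  "H_div \<Omega> = {q \<in> L2 \<Omega>. \<exists>d. is_weak_div \<Omega> q d}"

text \<open>
  The normal trace of \<open>q\<close> is the functional on (traces of) \<open>H1\<close> functions given by Green's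
  formula, \<open>v \<mapsto> (q, grad v) + (div q, v)\<close>.
\<close>

definition H_div_0 :: "(real^3) set \<Rightarrow> vector_field set" where
  "H_div_0 \<Omega> = {q \<in> H_div \<Omega>. \<forall>v \<in> H1 \<Omega>.
      L2_inner \<Omega> q (weak_grad \<Omega> v) + L2_inner \<Omega> (weak_div \<Omega> q) v = 0}"

definition H_curl :: "(real^3) set \<Rightarrow> vector_field set" where
  "H_curl \<Omega> = {q \<in> L2 \<Omega>. \<exists>c. is_weak_curl \<Omega> q c}"


section \<open>Continuous spaces, parameter-dependent norms and bilinear forms\<close>

definition V_space :: "(real^3) set \<Rightarrow> real \<Rightarrow> vector_field set" where
  "V_space \<Omega> \<epsilon> = (if \<epsilon> > 0 then H1_0_vec \<Omega> else L2 \<Omega>)"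

definition R_space :: "(real^3) set \<Rightarrow> scalar_field set" where
  "R_space \<Omega> = {s \<in> L2 \<Omega>. (LINT x|lebesgue_on \<Omega>. s x) = 0}"

definition Q_space :: "(real^3) set \<Rightarrow> real \<Rightarrow> vector_field set" where
  "Q_space \<Omega> \<epsilon> = (if \<epsilon> > 0 then H_div_0 \<Omega> else H_div_0 \<Omega> \<inter> H_curl \<Omega>)"

definition a1 :: "(real^3) set \<Rightarrow> real \<Rightarrow> vector_field \<Rightarrow> vector_field \<Rightarrow> real" where
  "a1 \<Omega> \<epsilon> \<phi> \<psi> =
     (if \<epsilon> > 0 then \<epsilon>\<^sup>2 * L2_inner \<Omega> (weak_jacobian \<Omega> \<phi>) (weak_jacobian \<Omega> \<psi>) else 0)
     + L2_inner \<Omega> \<phi> \<psi>"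

definition a2 :: "(real^3) set \<Rightarrow> scalar_field \<Rightarrow> scalar_field \<Rightarrow> real" where
  "a2 \<Omega> r s = L2_inner \<Omega> r s"

definition curl_pairing :: "(real^3) set \<Rightarrow> real \<Rightarrow> vector_field \<Rightarrow> vector_field \<Rightarrow> real" where
  "curl_pairing \<Omega> \<epsilon> \<psi> q =
     (if \<epsilon> > 0 then L2_inner \<Omega> (weak_curl \<Omega> \<psi>) q else L2_inner \<Omega> \<psi> (weak_curl \<Omega> q))"

definition b1 :: "(real^3) set \<Rightarrow> real \<Rightarrow> vector_field \<Rightarrow> vector_field \<Rightarrow> real" where
  "b1 \<Omega> \<epsilon> \<phi> q = curl_pairing \<Omega> \<epsilon> \<phi> q"

definition b2 :: "(real^3) set \<Rightarrow> scalar_field \<Rightarrow> vector_field \<Rightarrow> real" where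
  "b2 \<Omega> r q = L2_inner \<Omega> r (weak_div \<Omega> q)"

definition B_form ::
  "(real^3) set \<Rightarrow> real \<Rightarrow> vector_field \<Rightarrow> scalar_field \<Rightarrow> vector_field \<Rightarrow>
    vector_field \<Rightarrow> scalar_field \<Rightarrow> vector_field \<Rightarrow> real" where
  "B_form \<Omega> \<epsilon> \<phi> r p \<psi> s q =
     a1 \<Omega> \<epsilon> \<phi> \<psi> + a2 \<Omega> r s + b1 \<Omega> \<epsilon> \<phi> q + b2 \<Omega> r q + b1 \<Omega> \<epsilon> \<psi> p + b2 \<Omega> s p"

definition V_norm :: "(real^3) set \<Rightarrow> real \<Rightarrow> vector_field \<Rightarrow> real" where
  "V_norm \<Omega> \<epsilon> \<psi> =
     sqrt ((if \<epsilon> > 0 then \<epsilon>\<^sup>2 * (L2_norm \<Omega> (weak_jacobian \<Omega> \<psi>))\<^sup>2 else 0) + (L2_norm \<Omega> \<psi>)\<^sup>2)"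

definition VR_norm :: "(real^3) set \<Rightarrow> real \<Rightarrow> vector_field \<Rightarrow> scalar_field \<Rightarrow> real" where
  "VR_norm \<Omega> \<epsilon> \<psi> s = sqrt ((V_norm \<Omega> \<epsilon> \<psi>)\<^sup>2 + (L2_norm \<Omega> s)\<^sup>2)"

text \<open>
  For \<open>q\<close> in \<^term>\<open>Q_space \<Omega> \<epsilon>\<close> the quotients below are bounded (Cauchy-Schwarz), so the
  supremum is that of a nonempty bounded set of reals.
\<close>

definition Q_norm :: "(real^3) set \<Rightarrow> real \<Rightarrow> vector_field \<Rightarrow> real" where
  "Q_norm \<Omega> \<epsilon> q =
     sqrt ((SUP \<psi> \<in> {\<psi> \<in> V_space \<Omega> \<epsilon>. \<not> ae_zero \<Omega> \<psi>}. curl_pairing \<Omega> \<epsilon> \<psi> q / V_norm \<Omega> \<epsilon> \<psi>)\<^sup>2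
           + (L2_norm \<Omega> (weak_div \<Omega> q))\<^sup>2)"


section \<open>Polyhedral domains, meshes and finite element spaces\<close>

text \<open>The condition \<open>\<Omega> = interior (closure \<Omega>)\<close> excludes slits; no Lipschitz condition is imposed.\<close>

definition bounded_polyhedral_domain :: "(real^3) set \<Rightarrow> bool" where
  "bounded_polyhedral_domain \<Omega> \<longleftrightarrow>
     \<Omega> \<noteq> {} \<and> open \<Omega> \<and> connected \<Omega> \<and> bounded \<Omega> \<and> \<Omega> = interior (closure \<Omega>) \<and>
     (\<exists>\<P>. finite \<P> \<and> (\<forall>P \<in> \<P>. polytope P) \<and> closure \<Omega> = \<Union>\<P>)"

text \<open>Conformity (two elements meet in a common face) is part of \<^const>\<open>triangulation\<close>.\<close>

definition tetrahedral_mesh :: "(real^3) set \<Rightarrow> (real^3) set set \<Rightarrow> bool" where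
  "tetrahedral_mesh \<Omega> \<T> \<longleftrightarrow> triangulation \<T> \<and> (\<forall>K \<in> \<T>. 3 simplex K) \<and> \<Union>\<T> = closure \<Omega>"

definition mesh_size :: "(real^3) set set \<Rightarrow> real" where
  "mesh_size \<T> = Max (diameter ` \<T>)"

definition inball_diameter :: "(real^3) set \<Rightarrow> real" where
  "inball_diameter K = Sup {2 * \<rho> | \<rho>. \<rho> \<ge> 0 \<and> (\<exists>x. cball x \<rho> \<subseteq> K)}"

definition shape_regular :: "real set \<Rightarrow> (real \<Rightarrow> (real^3) set set) \<Rightarrow> bool" where
  "shape_regular H \<T> \<longleftrightarrow>
     (\<exists>\<sigma>>0. \<forall>h \<in> H. \<forall>K \<in> \<T> h. diameter K \<le> \<sigma> * inball_diameter K)"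

definition quasi_uniform :: "real set \<Rightarrow> (real \<Rightarrow> (real^3) set set) \<Rightarrow> bool" where
  "quasi_uniform H \<T> \<longleftrightarrow>
     (\<exists>\<tau>>0. \<forall>h \<in> H. \<forall>K \<in> \<T> h. mesh_size (\<T> h) \<le> \<tau> * diameter K)"

text \<open>Polynomials in three variables of total degree at most \<open>k\<close>; the \<open>\<alpha>\<close> are multi-indices.\<close>

definition P_k :: "nat \<Rightarrow> scalar_field set" where
  "P_k k = {p. \<exists>c :: (3 \<Rightarrow> nat) \<Rightarrow> real.
      \<forall>x. p x = (\<Sum>\<alpha> \<in> {\<alpha>. sum \<alpha> UNIV \<le> k}. c \<alpha> * (\<Prod>i \<in> UNIV. (x $ i) ^ \<alpha> i))}"

definition B_4 :: "(real^3) set \<Rightarrow> scalar_field set" where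
  "B_4 K = P_k 4 \<inter> H1_0 (interior K)"

definition V_h :: "(real^3) set \<Rightarrow> (real^3) set set \<Rightarrow> real \<Rightarrow> vector_field set" where
  "V_h \<Omega> \<T> \<epsilon> = {\<psi> \<in> V_space \<Omega> \<epsilon>. \<forall>K \<in> \<T>. \<forall>i. \<exists>p \<in> P_k 1. \<exists>b \<in> B_4 K.
      AE x in lebesgue_on K. \<psi> x $ i = p x + b x}"

definition R_h :: "(real^3) set \<Rightarrow> (real^3) set set \<Rightarrow> scalar_field set" where
  "R_h \<Omega> \<T> = {s \<in> R_space \<Omega>. \<forall>K \<in> \<T>. \<exists>p \<in> P_k 0. AE x in lebesgue_on K. s x = p x}"

definition Q_h :: "(real^3) set \<Rightarrow> (real^3) set set \<Rightarrow> vector_field set" where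
  "Q_h \<Omega> \<T> = {q \<in> H_div_0 \<Omega> \<inter> H1_vec \<Omega>. \<forall>K \<in> \<T>. \<forall>i. \<exists>p \<in> P_k 1.
      AE x in lebesgue_on K. q x $ i = p x}"

definition nonzero_triples ::
  "(real^3) set \<Rightarrow> (real^3) set set \<Rightarrow> real \<Rightarrow> (vector_field \<times> scalar_field \<times> vector_field) set" where
  "nonzero_triples \<Omega> \<T> \<epsilon> = {(\<psi>, s, q). \<psi> \<in> V_h \<Omega> \<T> \<epsilon> \<and> s \<in> R_h \<Omega> \<T> \<and> q \<in> Q_h \<Omega> \<T> \<and>
      \<not> (ae_zero \<Omega> \<psi> \<and> ae_zero \<Omega> s \<and> ae_zero \<Omega> q)}"

end

theory Submission
  imports Defs "HOL-Computational_Algebra.Polynomial"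
begin

text \<open>
  The saddle point problem is stable once the curl part of the norm of a discrete \<open>q\<close>, which is a
  supremum over all of \<open>V\<close>, is controlled by a supremum over \<open>V\<^sub>h\<close>. Since \<open>curl q\<close> is piecewise constant,
  it suffices to replace a test field by a discrete one with the same cell means and a comparable
  \<open>\<epsilon>\<close>-norm, uniformly in \<open>\<epsilon>\<close> (a Fortin operator). Each nodal value is the average of the field over a
  ball of radius proportional to \<open>h\<close> around the node; at boundary nodes the ball is chosen outside
  \<open>\<Omega>\<close>, where the field vanishes, which polyhedral domains permit. The resulting piecewise linear
  interpolant is stable in \<open>L\<^sup>2\<close> and in \<open>H\<^sup>1\<close> and approximates to order \<open>h\<close>, and the cell means are
  corrected by quartic bubbles. For \<open>\<epsilon> = 0\<close> the bubbles alone suffice.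

  Given \<open>(\<phi>, r, p)\<close>, let \<open>\<psi>\<close> nearly realise the discrete supremum for \<open>p\<close>, scaled to the size of \<open>p\<close>.
  Testing with \<open>(\<phi> + \<beta> \<psi>, r + \<beta> div p, - p)\<close> for a small fixed \<open>\<beta>\<close> gives the inf-sup bound, because
  \<open>div p\<close> lies in \<open>R\<^sub>h\<close>.
\<close>

section \<open>Smooth functions and bumps\<close>

text \<open>Bubbles alone would repair the cell means, but not stably in \<open>H1\<close>: their
  gradients cost a factor \<open>1 / h\<close>, which only an interpolation error of order
  \<open>h\<close> can pay for. Uniformity in \<epsilon> asks for the \<open>L2\<close> norm and the
  gradient to be bounded separately, each by itself; this excludes point values at the nodes and
  leads to means over balls. As \<Omega> need not be Lipschitz, zero boundary values are obtained
  geometrically and not through traces: a test function, extended by zero, is averaged over balls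
  missing \<Omega> at every vertex within \<open>h\<close> of the complement, so that the
  interpolant vanishes on a whole layer of cells. Poincare inequalities on patches are replaced by
  the translation estimate in \<open>L2\<close>, integrated over all shifts of length at most
  \<open>3 * h\<close>. The averaging acts on test functions only; density costs a factor in the
  norm and half of the pairing. All constants depend on two numbers: \<open>c\<close>, comparing
  inscribed balls with \<open>h\<close>, and \<kappa>, comparing exterior balls with
  \<open>h\<close>.\<close>

lemma C_k_SucD: "C_k (Suc k) f \<Longrightarrow> C_k k f"
proof (induction k arbitrary: f)
  case 0
  then show ?case by (auto intro!: differentiable_imp_continuous_on simp: differentiable_on_def)
next
  case (Suc k)
  then show ?case by (metis C_k.simps(2))
qed

definition smooth :: "scalar_field \<Rightarrow> bool" where
  "smooth f \<longleftrightarrow> (\<forall>k. C_k k f)"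

lemma smooth_partial: "smooth f \<Longrightarrow> smooth (partial i f)"
  by (metis C_k.simps(2) smooth_def)

lemma smooth_differentiable: "smooth f \<Longrightarrow> f differentiable (at x)"
  using C_k.simps(2) smooth_def by blast

lemma smooth_continuous: "smooth f \<Longrightarrow> continuous_on A f"
  by (metis C_k.simps(1) smooth_def continuous_on_subset top_greatest)

lemma smoothI_differentiable:
  assumes "\<And>x. f differentiable (at x)" "\<And>i. smooth (partial i f)"
  shows "smooth f"
proof -
  have "C_k k f" for k
    using assms by (cases k) (auto simp: smooth_def intro!: differentiable_imp_continuous_on simp: differentiable_on_def)
  then show ?thesis by (simp add: smooth_def)
qed

text \<open>\<open>partial\<close> is itself the value of the Frechet derivative on an axis, so
  linearity and the expansion of \<open>v\<close> along the axes recover the whole derivative from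
  three numbers.\<close>

lemma has_derivative_partial:
  assumes "f differentiable (at x)"
  shows "(f has_derivative (\<lambda>v. classical_grad f x \<bullet> v)) (at x)"
proof -
  let ?D = "frechet_derivative f (at x)"
  have D: "(f has_derivative ?D) (at x)" using assms by (simp add: frechet_derivative_works)
  then interpret D: bounded_linear ?D by (rule has_derivative_bounded_linear)
  have "?D v = classical_grad f x \<bullet> v" for v
  proof -
    have "?D v = ?D (\<Sum>i\<in>UNIV. (v $ i) *\<^sub>R axis i 1)"
      by (metis basis_expansion scalar_mult_eq_scaleR)
    also have "\<dots> = (\<Sum>i\<in>UNIV. (v $ i) * ?D (axis i 1))"
      by (simp add: D.sum D.scale)
    also have "\<dots> = classical_grad f x \<bullet> v"
      by (simp add: inner_vec_def classical_grad_def partial_def mult.commute)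
    finally show ?thesis .
  qed
  then have "?D = (\<lambda>v. classical_grad f x \<bullet> v)" by auto
  then show ?thesis using D by simp
qed

lemma partial_eqI:
  assumes "(f has_derivative D) (at x)"
  shows "partial i f x = D (axis i 1)"
  using frechet_derivative_at[OF assms] by (simp add: partial_def)

lemma C_k_const: "C_k k (\<lambda>x. c)"
proof (induction k arbitrary: c)
  case (Suc k)
  have "partial i (\<lambda>x. c) = (\<lambda>x. 0)" for i
    by (rule ext, subst partial_eqI[OF has_derivative_const]) simp
  then show ?case using Suc by simp
qed (auto intro: continuous_intros)

lemma smooth_const: "smooth (\<lambda>x. c)" by (simp add: smooth_def C_k_const)

lemma partial_add:
  assumes "f differentiable (at x)" "g differentiable (at x)"
  shows "partial i (\<lambda>x. f x + g x) x = partial i f x + partial i g x"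
  unfolding partial_def using assms
  by (subst frechet_derivative_at[symmetric, OF has_derivative_add])
     (auto simp: frechet_derivative_works)

lemma partial_mult:
  assumes "f differentiable (at x)" "g differentiable (at x)"
  shows "partial i (\<lambda>x. f x * g x) x = f x * partial i g x + partial i f x * g x"
  unfolding partial_def using assms
  by (subst frechet_derivative_at[symmetric, OF has_derivative_mult])
     (auto simp: frechet_derivative_works)

lemma C_k_add: "C_k k f \<Longrightarrow> C_k k g \<Longrightarrow> C_k k (\<lambda>x. f x + g x)"
proof (induction k arbitrary: f g)
  case (Suc k)
  have "partial i (\<lambda>x. f x + g x) = (\<lambda>x. partial i f x + partial i g x)" for i
    using Suc.prems by (auto simp: partial_add)
  then show ?case using Suc by (auto simp: differentiable_add)
qed (auto intro: continuous_intros)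

lemma C_k_mult: "C_k k f \<Longrightarrow> C_k k g \<Longrightarrow> C_k k (\<lambda>x. f x * g x)"
proof (induction k arbitrary: f g)
  case (Suc k)
  have "partial i (\<lambda>x. f x * g x) = (\<lambda>x. f x * partial i g x + partial i f x * g x)" for i
    using Suc.prems by (auto simp: partial_mult)
  \<comment> \<open>The product rule pairs each undifferentiated factor with a derivative, so both
    factors are also needed at the lower order.\<close>
  moreover have "C_k k f" "C_k k g" using Suc.prems C_k_SucD by blast+
  ultimately show ?case using Suc by (auto simp: differentiable_mult intro!: C_k_add)
qed (auto intro: continuous_intros)

lemma smooth_add: "smooth f \<Longrightarrow> smooth g \<Longrightarrow> smooth (\<lambda>x. f x + g x)"
  and smooth_mult: "smooth f \<Longrightarrow> smooth g \<Longrightarrow> smooth (\<lambda>x. f x * g x)"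
  by (auto simp: smooth_def C_k_add C_k_mult)

lemma smooth_cmult: "smooth f \<Longrightarrow> smooth (\<lambda>x. c * f x)"
  by (intro smooth_mult smooth_const)

lemma smooth_prod: "(\<And>i. i \<in> I \<Longrightarrow> smooth (f i)) \<Longrightarrow> smooth (\<lambda>x. \<Prod>i\<in>I. f i x)"
  by (induction I rule: infinite_finite_induct) (auto intro: smooth_const smooth_mult)

lemma smooth_affine: "smooth (\<lambda>x. c + g \<bullet> x)"
proof (rule smoothI_differentiable)
  have *: "((\<lambda>x. c + g \<bullet> x) has_derivative (\<lambda>v. g \<bullet> v)) (at x)" for x :: "real^3"
    by (auto intro!: derivative_eq_intros)
  then show "(\<lambda>x. c + g \<bullet> x) differentiable at x" for x by (auto simp: differentiable_def)
  have "partial i (\<lambda>x. c + g \<bullet> x) = (\<lambda>x. g $ i)" for i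
    by (rule ext, subst partial_eqI[OF *]) (simp add: inner_axis)
  then show "smooth (partial i (\<lambda>x. c + g \<bullet> x))" for i by (simp add: smooth_const)
qed

text \<open>The functions \<open>p (1/t) exp (-1/t)\<close> are closed under differentiation, which makes
  \<open>exp (-1/t)\<close> smooth at the origin.\<close>

definition exp_bump :: "real poly \<Rightarrow> real \<Rightarrow> real" where
  "exp_bump p t = (if t > 0 then poly p (1/t) * exp (- (1/t)) else 0)"

text \<open>The derivative of \<open>p (1/t) * exp (- 1/t)\<close> is
  \<open>(p - p') (1/t) * exp (- 1/t) / t^2\<close>; the polynomial \<open>[:0,0,1:]\<close> is the
  square of the variable \<open>1/t\<close>.\<close>

definition bump_step :: "real poly \<Rightarrow> real poly" where
  "bump_step p = [:0,0,1:] * (p - pderiv p)"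

text \<open>From the right, the substitution \<open>y = 1/t\<close> turns the claim into the decay
  of a polynomial against \<open>exp y\<close> at infinity; from the left the function is
  zero.\<close>

lemma exp_bump_tendsto: "((\<lambda>t. exp_bump p t) \<longlongrightarrow> 0) (at 0)"
proof -
  have L: "((\<lambda>y. poly p y * exp (- y)) \<longlongrightarrow> 0) at_top"
  proof -
    have *: "((\<lambda>y::real. y ^ n / exp y) \<longlongrightarrow> 0) at_top" for n
      by (rule tendsto_power_div_exp_0)
    have "((\<lambda>y. \<Sum>i\<le>degree p. coeff p i * (y ^ i / exp y)) \<longlongrightarrow> (\<Sum>i\<le>degree p. coeff p i * (0::real))) at_top"
      by (intro tendsto_intros *)
    then show ?thesis
      by (simp add: poly_altdef sum_distrib_right exp_minus field_simps sum_divide_distrib)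
  qed
  have "((\<lambda>t. poly p (1/t) * exp (- (1/t))) \<longlongrightarrow> 0) (at_right (0::real))"
    using filterlim_compose[OF L filterlim_inverse_at_top_right] by (simp add: inverse_eq_divide)
  then have r: "(exp_bump p \<longlongrightarrow> 0) (at_right 0)"
    by (rule Lim_transform_eventually) (auto simp: exp_bump_def eventually_at_right_less intro!: eventually_mono[OF eventually_at_right_less])
  have l: "(exp_bump p \<longlongrightarrow> 0) (at_left 0)"
    by (rule tendsto_eventually) (auto simp: exp_bump_def eventually_at_left_field intro!: exI[of _ "-1"])
  show ?thesis using l r by (simp add: filterlim_at_split)
qed

lemma exp_bump_deriv: "(exp_bump p has_real_derivative exp_bump (bump_step p) t) (at t)"
proof -
  consider "t > 0" | "t < 0" | "t = 0" by linarith
  then show ?thesis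
  proof cases
    case 1
    have "((\<lambda>t. poly p (1/t) * exp (- (1/t))) has_real_derivative exp_bump (bump_step p) t) (at t)"
    proof -
      have i: "((\<lambda>t. 1/t) has_real_derivative - (1/t^2)) (at t)"
        using 1 by (auto intro!: derivative_eq_intros simp: power2_eq_square)
      show ?thesis
        by (rule DERIV_cong[OF DERIV_mult[OF DERIV_chain2[OF poly_DERIV i] DERIV_chain2[OF DERIV_exp DERIV_minus[OF i]]]])
           (use 1 in \<open>simp add: exp_bump_def bump_step_def power2_eq_square algebra_simps\<close>)
    qed
    moreover have "eventually (\<lambda>s. poly p (1/s) * exp (- (1/s)) = exp_bump p s) (nhds t)"
      using 1 by (intro eventually_mono[OF eventually_nhds_in_open[of "{0<..}" t]]) (auto simp: exp_bump_def)
    ultimately show ?thesis by (subst (asm) DERIV_cong_ev[OF refl _ refl]) auto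
  next
    case 2
    have "((\<lambda>t. 0) has_real_derivative exp_bump (bump_step p) t) (at t)"
      using 2 by (auto simp: exp_bump_def)
    moreover have "eventually (\<lambda>s. 0 = exp_bump p s) (nhds t)"
      using 2 by (intro eventually_mono[OF eventually_nhds_in_open[of "{..<0}" t]]) (auto simp: exp_bump_def)
    ultimately show ?thesis by (subst (asm) DERIV_cong_ev[OF refl _ refl]) auto
  next
    case 3
    \<comment> \<open>The difference quotient at the origin stays in the family, with
      \<open>p\<close> multiplied by the variable, so the limit already computed applies to
      it.\<close>
    have "exp_bump p h / h = exp_bump (pCons 0 p) h" for h by (simp add: exp_bump_def)
    then have "((\<lambda>h. (exp_bump p (0 + h) - exp_bump p 0) / h) \<longlongrightarrow> 0) (at 0)"
      using exp_bump_tendsto[of "pCons 0 p"] by (simp add: exp_bump_def[of p 0])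
    then show ?thesis using 3 by (simp add: DERIV_def exp_bump_def[of _ 0])
  qed
qed

text \<open>Each differentiation replaces \<open>p\<close> by \<open>bump_step p\<close> and leaves
  a constant factor from the affine argument, so the induction on the order has to run over all
  polynomials at once.\<close>

lemma smooth_exp_bump: "smooth (\<lambda>x. exp_bump p (m * x $ i + c))"
proof -
  have "C_k k (\<lambda>x. exp_bump p (m * x $ i + c))" for k
  proof (induction k arbitrary: p)
    case 0
    have "continuous_on UNIV (exp_bump p)"
      using exp_bump_deriv by (meson DERIV_isCont continuous_at_imp_continuous_on)
    then have "continuous_on UNIV (\<lambda>x. exp_bump p (m * x $ i + c))"
      by (rule continuous_on_compose2) (auto intro!: continuous_intros)
    then show ?case by simp
  next
    case (Suc k)
    have *: "((\<lambda>x. exp_bump p (m * x $ i + c)) has_derivative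
       (\<lambda>v. (m * v $ i) * exp_bump (bump_step p) (m * x $ i + c))) (at x)" for x :: "real^3"
    proof -
      have 1: "((\<lambda>x. m * x $ i + c) has_derivative (\<lambda>v. m * v $ i)) (at x)"
        by (auto intro!: derivative_eq_intros bounded_linear.has_derivative[OF bounded_linear_vec_nth])
      from DERIV_compose_FDERIV[OF exp_bump_deriv 1] show ?thesis .
    qed
    have p: "partial j (\<lambda>x. exp_bump p (m * x $ i + c)) =
         (\<lambda>x. (m * axis j 1 $ i) * exp_bump (bump_step p) (m * x $ i + c))" for j
      by (rule ext, subst partial_eqI[OF *]) auto
    show ?case unfolding C_k.simps p
      using * by (auto simp: differentiable_def intro!: C_k_mult C_k_const Suc)
  qed
  then show ?thesis by (simp add: smooth_def)
qed

text \<open>Each coordinate contributes \<open>exp (- 1 / (m * d))\<close> for its distance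
  \<open>d\<close> from either face. Letting \<open>m\<close> grow turns the product into the
  indicator of the open box, which is what the parameter is for.\<close>

definition box_bump :: "real \<Rightarrow> real^3 \<Rightarrow> real^3 \<Rightarrow> scalar_field" where
  "box_bump m a b x = (\<Prod>i\<in>UNIV. exp_bump 1 (m * (x $ i - a $ i)) * exp_bump 1 (m * (b $ i - x $ i)))"

lemma smooth_box_bump: "smooth (box_bump m a b)"
proof -
  have "smooth (\<lambda>x. exp_bump 1 (m * x $ i + (- m * a $ i)) * exp_bump 1 ((-m) * x $ i + m * b $ i))" for i
    by (intro smooth_mult smooth_exp_bump)
  then show ?thesis
    unfolding box_bump_def by (intro smooth_prod) (simp add: algebra_simps)
qed

lemma exp_bump_1: "exp_bump 1 t \<ge> 0" "exp_bump 1 t \<le> 1" "exp_bump 1 t > 0 \<longleftrightarrow> t > 0" "exp_bump 1 t = 0 \<longleftrightarrow> t \<le> 0"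
  by (auto simp: exp_bump_def)

lemma box_bump_nonneg: "box_bump m a b x \<ge> 0"
  by (auto simp: box_bump_def intro!: prod_nonneg mult_nonneg_nonneg exp_bump_1)

lemma box_bump_le_1: "box_bump m a b x \<le> 1"
  by (auto simp: box_bump_def intro!: prod_le_1 mult_le_one mult_nonneg_nonneg exp_bump_1)

lemma box_bump_nonzero: "m > 0 \<Longrightarrow> box_bump m a b x \<noteq> 0 \<longleftrightarrow> x \<in> box a b"
  by (auto simp: box_bump_def exp_bump_1 mem_box_cart mult_le_0_iff not_le)

lemma box_bump_tendsto:
  "(\<lambda>n. box_bump (real (Suc n)) a b x) \<longlonglongrightarrow> indicator (box a b) x"
proof (cases "x \<in> box a b")
  case False
  then have "box_bump (real (Suc n)) a b x = 0" for n using box_bump_nonzero[of "real (Suc n)" a b x] by auto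
  then show ?thesis using False by simp
next
  case True
  have *: "(\<lambda>n. exp_bump 1 (real (Suc n) * d)) \<longlonglongrightarrow> 1" if "d > 0" for d
  proof -
    have "(\<lambda>n. exp (- ((1/d) * inverse (real (Suc n))))) \<longlonglongrightarrow> exp (- ((1/d)*0))"
      by (intro tendsto_intros LIMSEQ_inverse_real_of_nat)
    then show ?thesis using that by (simp add: exp_bump_def field_simps add_pos_nonneg)
  qed
  have "(\<lambda>n. box_bump (real (Suc n)) a b x) \<longlonglongrightarrow> (\<Prod>i\<in>(UNIV::3 set). 1 * 1)"
    unfolding box_bump_def using True by (intro tendsto_intros *) (auto simp: mem_box_cart)
  then show ?thesis using True by simp
qed

lemma box_bump_test:
  assumes "m > 0" "cbox a b \<subseteq> \<Omega>"
  shows "box_bump m a b \<in> test_functions \<Omega>"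
proof -
  have "closure {x. box_bump m a b x \<noteq> 0} \<subseteq> cbox a b"
    using box_bump_nonzero[OF assms(1), of a b] box_subset_cbox[of a b] by (intro closure_minimal) auto
  moreover have "compact (closure {x. box_bump m a b x \<noteq> 0})"
    using calculation by (meson bounded_cbox bounded_subset closed_closure compact_eq_bounded_closed)
  ultimately show ?thesis using smooth_box_bump assms by (auto simp: test_functions_def smooth_def)
qed

lemma test_functions_iff:
  "f \<in> test_functions \<Omega> \<longleftrightarrow> smooth f \<and> compact (closure {x. f x \<noteq> 0}) \<and> closure {x. f x \<noteq> 0} \<subseteq> \<Omega>"
  by (auto simp: test_functions_def smooth_def)

text \<open>The integral runs over a fixed box, so that parameter integrals can be differentiated by
  the Leibniz rule. It is the true convolution as soon as \<open>u\<close> vanishes off the box, see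
  \<open>convol_eq\<close>.\<close>

definition convol :: "real^3 \<Rightarrow> real^3 \<Rightarrow> scalar_field \<Rightarrow> scalar_field \<Rightarrow> scalar_field" where
  "convol a b u \<eta> x = integral (cbox a b) (\<lambda>t. u t * \<eta> (x - t))"

lemma continuous_classical_grad: "smooth f \<Longrightarrow> continuous_on A (classical_grad f)"
  unfolding classical_grad_def[abs_def] using smooth_continuous smooth_partial
  by (intro continuous_on_vec_lambda) blast

lemma sum_axis: "(\<Sum>j\<in>UNIV. f j * axis i (1::real) $ j) = f i"
proof -
  have "(\<Sum>j\<in>UNIV. f j * axis i (1::real) $ j) = (\<Sum>j\<in>UNIV. if j = i then f i else 0)"
    by (intro sum.cong) (auto simp: axis_def)
  then show ?thesis by simp
qed

text \<open>Leibniz rule over the compact box. The derivative has to be a bounded linear map there,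
  hence the integrand \<open>?fx\<close>, which packages the inner product with the gradient of the
  kernel as such a map.\<close>

lemma convol_has_derivative:
  assumes u: "continuous_on UNIV u" and eta: "smooth \<eta>"
  shows "(convol a b u \<eta> has_derivative (\<lambda>v. (\<Sum>i\<in>UNIV. convol a b u (partial i \<eta>) x * v $ i))) (at x)"
proof -
  let ?fx = "\<lambda>x t. u t *\<^sub>R blinfun_inner_right (classical_grad \<eta> (x - t))"
  have cont: "continuous_on UNIV (\<lambda>(x,t). ?fx x t)"
    unfolding split_def
    by (intro continuous_intros bounded_linear.continuous_on[OF bounded_linear_blinfun_inner_right]
        continuous_on_compose2[OF u] continuous_on_compose2[OF continuous_classical_grad[OF eta, of UNIV]]) auto
  have D: "((\<lambda>x. u t * \<eta> (x - t)) has_derivative blinfun_apply (?fx x t)) (at x)" for x t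
  proof -
    have "((\<lambda>x. \<eta> (x - t)) has_derivative (\<lambda>v. classical_grad \<eta> (x - t) \<bullet> v)) (at x)"
      using has_derivative_compose[OF has_derivative_diff[OF has_derivative_ident has_derivative_const]
          has_derivative_partial[OF smooth_differentiable[OF eta]], of t x UNIV]
      by simp
    from has_derivative_mult_right[OF this, of "u t"] show ?thesis
      by (rule has_derivative_eq_rhs) (simp add: fun_eq_iff blinfun.scaleR_left)
  qed
  have "((\<lambda>x. integral (cbox a b) (\<lambda>t. u t * \<eta> (x - t))) has_derivative
     blinfun_apply (integral (cbox a b) (?fx x))) (at x within UNIV)"
  proof (rule leibniz_rule)
    show "(\<lambda>t. u t * \<eta> (x - t)) integrable_on cbox a b" for x
      by (intro integrable_continuous continuous_intros continuous_on_compose2[OF u]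
        continuous_on_compose2[OF smooth_continuous[OF eta, of UNIV]]) auto
    show "continuous_on (UNIV \<times> cbox a b) (\<lambda>(x, t). ?fx x t)"
      using cont continuous_on_subset by blast
  qed (use D in auto)
  moreover have "blinfun_apply (integral (cbox a b) (?fx x)) v = (\<Sum>i\<in>UNIV. convol a b u (partial i \<eta>) x * v $ i)" for v
  proof -
    have ig: "?fx x integrable_on cbox a b"
      by (intro integrable_continuous continuous_intros bounded_linear.continuous_on[OF bounded_linear_blinfun_inner_right]
        continuous_on_compose2[OF u] continuous_on_compose2[OF continuous_classical_grad[OF eta, of UNIV]]) auto
    have ig2: "(\<lambda>t. u t * partial i \<eta> (x - t)) integrable_on cbox a b" for i
      by (intro integrable_continuous continuous_intros
        continuous_on_compose2[OF u] continuous_on_compose2[OF smooth_continuous[OF smooth_partial[OF eta], of UNIV]]) auto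
    have "blinfun_apply (integral (cbox a b) (?fx x)) v = integral (cbox a b) (\<lambda>t. blinfun_apply (?fx x t) v)"
      using blinfun_apply_integral[OF ig] by simp
    also have "\<dots> = integral (cbox a b) (\<lambda>t. \<Sum>i\<in>UNIV. (u t * partial i \<eta> (x - t)) * v $ i)"
      by (simp add: blinfun.scaleR_left inner_vec_def classical_grad_def sum_distrib_left mult.assoc)
    also have "\<dots> = (\<Sum>i\<in>UNIV. convol a b u (partial i \<eta>) x * v $ i)"
      using ig2 by (subst integral_sum) (auto simp: convol_def intro!: integrable_on_mult_left)
    finally show ?thesis .
  qed
  then have "blinfun_apply (integral (cbox a b) (?fx x)) = (\<lambda>v. (\<Sum>i\<in>UNIV. convol a b u (partial i \<eta>) x * v $ i))"
    by auto
  ultimately show ?thesis by (simp add: convol_def[abs_def])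
qed

text \<open>Every derivative falls on the kernel while \<open>u\<close> stays fixed, so the
  induction on the order runs over kernels.\<close>

lemma smooth_convol:
  assumes u: "continuous_on UNIV u" and eta: "smooth \<eta>"
  shows "smooth (convol a b u \<eta>)"
proof -
  have "C_k k (convol a b u \<eta>)" for k using eta
  proof (induction k arbitrary: \<eta>)
    case 0
    then have "continuous_on UNIV (convol a b u \<eta>)"
      by (intro continuous_at_imp_continuous_on ballI has_derivative_continuous[OF convol_has_derivative[OF u]])
    then show ?case by simp
  next
    case (Suc k)
    have p: "partial i (convol a b u \<eta>) = convol a b u (partial i \<eta>)" for i
      by (rule ext, subst partial_eqI[OF convol_has_derivative[OF u Suc.prems]])
         (rule sum_axis)
    show ?case unfolding C_k.simps p
    proof (intro conjI allI)
      show "convol a b u \<eta> differentiable at x" for x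
        unfolding differentiable_def using convol_has_derivative[OF u Suc.prems, of a b x] by blast
    qed (intro Suc.IH smooth_partial Suc.prems)
  qed
  then show ?thesis by (simp add: smooth_def)
qed

section \<open>Square-integrable functions\<close>

lemma L2_D:
  assumes "f \<in> L2 \<Omega>"
  shows "f \<in> borel_measurable (lebesgue_on \<Omega>)" "integrable (lebesgue_on \<Omega>) (\<lambda>x. (norm (f x))\<^sup>2)"
  using assms by (auto simp: L2_def)

lemma L2_bound:
  assumes "f \<in> borel_measurable (lebesgue_on \<Omega>)" "integrable (lebesgue_on \<Omega>) g"
    "\<And>x. x \<in> \<Omega> \<Longrightarrow> (norm (f x))\<^sup>2 \<le> g x"
  shows "f \<in> L2 \<Omega>"
proof -
  have "integrable (lebesgue_on \<Omega>) (\<lambda>x. (norm (f x))\<^sup>2)"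
    using assms by (intro Bochner_Integration.integrable_bound[OF assms(2)]) (auto intro!: AE_I2 order_trans[OF assms(3)])
  then show ?thesis using assms by (auto simp: L2_def)
qed

text \<open>Nonnegativity of the squared norm of \<open>a - b\<close>. Stability bounds are kept in
  squared form below, where this takes the place of the triangle inequality.\<close>

lemma norm_add_sq_le: "(norm (a + b :: 'a::real_inner))\<^sup>2 \<le> 2 * (norm a)\<^sup>2 + 2 * (norm b)\<^sup>2"
proof -
  have "0 \<le> (norm (a - b))\<^sup>2" by simp
  then show ?thesis by (simp add: power2_norm_eq_inner inner_simps algebra_simps inner_commute)
qed

lemma L2_add:
  assumes "f \<in> L2 \<Omega>" "g \<in> L2 \<Omega>" shows "(\<lambda>x. f x + g x) \<in> L2 \<Omega>"
  using L2_D[OF assms(1)] L2_D[OF assms(2)]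
  by (intro L2_bound[where g = "\<lambda>x. 2 * (norm (f x))\<^sup>2 + 2 * (norm (g x))\<^sup>2"]) (auto intro: norm_add_sq_le)

lemma L2_scaleR:
  assumes "f \<in> L2 \<Omega>" shows "(\<lambda>x. c *\<^sub>R f x) \<in> L2 \<Omega>"
  using L2_D[OF assms]
  by (intro L2_bound[where g = "\<lambda>x. c\<^sup>2 * (norm (f x))\<^sup>2"]) (auto simp: power_mult_distrib)

lemma L2_mult:
  fixes f :: scalar_field
  shows "f \<in> L2 \<Omega> \<Longrightarrow> (\<lambda>x. c * f x) \<in> L2 \<Omega>"
  using L2_scaleR[of f \<Omega> c] by simp

lemma L2_uminus: assumes "f \<in> L2 \<Omega>" shows "(\<lambda>x. - f x) \<in> L2 \<Omega>"
  using L2_scaleR[OF assms, of "-1"] by simp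

lemma L2_diff:
  assumes "f \<in> L2 \<Omega>" "g \<in> L2 \<Omega>" shows "(\<lambda>x. f x - g x) \<in> L2 \<Omega>"
  using L2_add[OF assms(1) L2_uminus[OF assms(2)]] by simp

lemma L2_zero: "(\<lambda>x. 0) \<in> L2 \<Omega>" by (auto simp: L2_def)

lemma L2_sum: "(\<And>i. i \<in> I \<Longrightarrow> f i \<in> L2 \<Omega>) \<Longrightarrow> (\<lambda>x. \<Sum>i\<in>I. f i x) \<in> L2 \<Omega>"
  by (induction I rule: infinite_finite_induct) (auto intro: L2_zero L2_add)

lemma L2_inner_integrable:
  assumes "f \<in> L2 \<Omega>" "g \<in> L2 \<Omega>"
  shows "integrable (lebesgue_on \<Omega>) (\<lambda>x. f x \<bullet> g x)"
proof (rule Bochner_Integration.integrable_bound)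
  show "integrable (lebesgue_on \<Omega>) (\<lambda>x. (norm (f x))\<^sup>2 + (norm (g x))\<^sup>2)"
    using L2_D[OF assms(1)] L2_D[OF assms(2)] by auto
  show "(\<lambda>x. f x \<bullet> g x) \<in> borel_measurable (lebesgue_on \<Omega>)"
    using L2_D[OF assms(1)] L2_D[OF assms(2)] by auto
  have "\<bar>a \<bullet> b\<bar> \<le> (norm a)\<^sup>2 + (norm b)\<^sup>2" for a b :: 'a
  proof -
    have "\<bar>a \<bullet> b\<bar> \<le> norm a * norm b" by (rule Cauchy_Schwarz_ineq2)
    also have "\<dots> \<le> 2 * norm a * norm b" by simp
    also have "\<dots> \<le> (norm a)\<^sup>2 + (norm b)\<^sup>2" by (rule sum_squares_bound)
    finally show ?thesis .
  qed
  then show "AE x in lebesgue_on \<Omega>. norm (f x \<bullet> g x) \<le> norm ((norm (f x))\<^sup>2 + (norm (g x))\<^sup>2)"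
    by auto
qed

lemma L2_mult_integrable:
  fixes f g :: scalar_field
  shows "f \<in> L2 \<Omega> \<Longrightarrow> g \<in> L2 \<Omega> \<Longrightarrow> integrable (lebesgue_on \<Omega>) (\<lambda>x. f x * g x)"
  using L2_inner_integrable[of f \<Omega> g] by simp

lemma L2_inner_commute: "L2_inner \<Omega> f g = L2_inner \<Omega> g f"
  by (simp add: L2_inner_def inner_commute)

lemma L2_inner_add_left:
  "f \<in> L2 \<Omega> \<Longrightarrow> g \<in> L2 \<Omega> \<Longrightarrow> h \<in> L2 \<Omega> \<Longrightarrow>
    L2_inner \<Omega> (\<lambda>x. f x + g x) h = L2_inner \<Omega> f h + L2_inner \<Omega> g h"
  by (simp add: L2_inner_def inner_add_left L2_inner_integrable)

lemma L2_inner_scaleR_left: "L2_inner \<Omega> (\<lambda>x. c *\<^sub>R f x) h = c * L2_inner \<Omega> f h"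
  by (simp add: L2_inner_def)

lemma L2_inner_uminus_left: "L2_inner \<Omega> (\<lambda>x. - f x) h = - L2_inner \<Omega> f h"
  by (simp add: L2_inner_def)

lemma L2_inner_diff_left:
  "f \<in> L2 \<Omega> \<Longrightarrow> g \<in> L2 \<Omega> \<Longrightarrow> h \<in> L2 \<Omega> \<Longrightarrow>
    L2_inner \<Omega> (\<lambda>x. f x - g x) h = L2_inner \<Omega> f h - L2_inner \<Omega> g h"
  by (simp add: L2_inner_def inner_diff_left L2_inner_integrable)

lemma L2_inner_add_right:
  "f \<in> L2 \<Omega> \<Longrightarrow> g \<in> L2 \<Omega> \<Longrightarrow> h \<in> L2 \<Omega> \<Longrightarrow>
    L2_inner \<Omega> h (\<lambda>x. f x + g x) = L2_inner \<Omega> h f + L2_inner \<Omega> h g"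
  by (simp add: L2_inner_def inner_add_right L2_inner_integrable)

lemma L2_inner_scaleR_right: "L2_inner \<Omega> h (\<lambda>x. c *\<^sub>R f x) = c * L2_inner \<Omega> h f"
  by (simp add: L2_inner_def)

lemma L2_inner_uminus_right: "L2_inner \<Omega> h (\<lambda>x. - f x) = - L2_inner \<Omega> h f"
  by (simp add: L2_inner_def)

lemma L2_inner_diff_right:
  "f \<in> L2 \<Omega> \<Longrightarrow> g \<in> L2 \<Omega> \<Longrightarrow> h \<in> L2 \<Omega> \<Longrightarrow>
    L2_inner \<Omega> h (\<lambda>x. f x - g x) = L2_inner \<Omega> h f - L2_inner \<Omega> h g"
  by (simp add: L2_inner_def inner_diff_right L2_inner_integrable)

lemma L2_inner_cong_AE:
  assumes "AE x in lebesgue_on \<Omega>. f x = f' x" "AE x in lebesgue_on \<Omega>. g x = g' x"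
    "f \<in> L2 \<Omega>" "f' \<in> L2 \<Omega>" "g \<in> L2 \<Omega>" "g' \<in> L2 \<Omega>"
  shows "L2_inner \<Omega> f g = L2_inner \<Omega> f' g'"
  unfolding L2_inner_def
  using assms(1,2) L2_D(1)[OF assms(3)] L2_D(1)[OF assms(4)] L2_D(1)[OF assms(5)] L2_D(1)[OF assms(6)]
  by (intro integral_cong_AE) auto

lemma L2_inner_self_nonneg: "L2_inner \<Omega> f f \<ge> 0"
  by (simp add: L2_inner_def)

lemma L2_norm_sq: "(L2_norm \<Omega> f)\<^sup>2 = L2_inner \<Omega> f f"
  by (simp add: L2_norm_def L2_inner_self_nonneg)

lemma L2_norm_sq_integral: "(L2_norm \<Omega> f)\<^sup>2 = (LINT x|lebesgue_on \<Omega>. (norm (f x))\<^sup>2)"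
  by (simp add: L2_norm_sq L2_inner_def power2_norm_eq_inner)

lemma L2_norm_nonneg: "L2_norm \<Omega> f \<ge> 0" by (simp add: L2_norm_def L2_inner_self_nonneg)

lemma L2_norm_cong_AE:
  assumes "AE x in lebesgue_on \<Omega>. f x = f' x" "f \<in> L2 \<Omega>" "f' \<in> L2 \<Omega>"
  shows "L2_norm \<Omega> f = L2_norm \<Omega> f'"
  unfolding L2_norm_def using L2_inner_cong_AE[OF assms(1,1) assms(2,3,2,3)] by simp

text \<open>The discriminant criterion: evaluate at the minimiser \<open>- b / c\<close>, or, if
  \<open>c = 0\<close>, observe that an affine function bounded below is constant.\<close>

lemma quadratic_nonneg_imp:
  fixes a b c :: real
  assumes "\<And>t. 0 \<le> a + 2 * t * b + t\<^sup>2 * c" "c \<ge> 0"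
  shows "b\<^sup>2 \<le> a * c"
proof (cases "c = 0")
  case False
  then have "c > 0" using assms by simp
  with assms(1)[of "- b / c"] have "0 \<le> a - b\<^sup>2 / c"
    by (simp add: power2_eq_square field_simps)
  then show ?thesis using \<open>c > 0\<close> by (simp add: field_simps)
next
  case True
  have "b = 0"
  proof (rule ccontr)
    assume "b \<noteq> 0"
    \<comment> \<open>At this argument the affine function takes the value
      \<open>-1\<close>.\<close>
    with assms(1)[of "(- a - 1) / (2 * b)"] True show False by (simp add: field_simps)
  qed
  then show ?thesis using True by simp
qed

text \<open>Elements of \<open>L2\<close> are plain functions, on which \<open>L2_inner\<close> is
  only a semi-inner product; the inequality is the discriminant condition for the squared norm of
  \<open>f + t g\<close> as a quadratic in \<open>t\<close>.\<close>

lemma L2_Cauchy_Schwarz: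
  assumes "f \<in> L2 \<Omega>" "g \<in> L2 \<Omega>"
  shows "\<bar>L2_inner \<Omega> f g\<bar> \<le> L2_norm \<Omega> f * L2_norm \<Omega> g"
proof -
  have "0 \<le> L2_inner \<Omega> f f + 2 * t * L2_inner \<Omega> f g + t\<^sup>2 * L2_inner \<Omega> g g" for t
  proof -
    note tg = L2_scaleR[OF assms(2), of t]
    have "L2_inner \<Omega> (\<lambda>x. f x + t *\<^sub>R g x) (\<lambda>x. f x + t *\<^sub>R g x) =
       L2_inner \<Omega> f f + 2 * t * L2_inner \<Omega> f g + t\<^sup>2 * L2_inner \<Omega> g g"
      unfolding L2_inner_add_left[OF assms(1) tg L2_add[OF assms(1) tg]]
         L2_inner_add_right[OF assms(1) tg assms(1)] L2_inner_add_right[OF assms(1) tg tg]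
         L2_inner_scaleR_left L2_inner_add_right[OF assms(1) tg assms(2)] L2_inner_scaleR_right L2_inner_commute[of \<Omega> g f]
      by (simp add: power2_eq_square algebra_simps)
    then show ?thesis using L2_inner_self_nonneg[of \<Omega> "\<lambda>x. f x + t *\<^sub>R g x"] by linarith
  qed
  then have "(L2_inner \<Omega> f g)\<^sup>2 \<le> L2_inner \<Omega> f f * L2_inner \<Omega> g g"
    by (intro quadratic_nonneg_imp) (auto simp: L2_inner_self_nonneg)
  then have "(L2_inner \<Omega> f g)\<^sup>2 \<le> (L2_norm \<Omega> f * L2_norm \<Omega> g)\<^sup>2"
    by (simp add: power_mult_distrib L2_norm_sq)
  then show ?thesis by (rule abs_le_square_iff[THEN iffD2, THEN order_trans]) (simp add: L2_norm_nonneg)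
qed

lemma L2_norm_add_sq:
  assumes "f \<in> L2 \<Omega>" "g \<in> L2 \<Omega>"
  shows "(L2_norm \<Omega> (\<lambda>x. f x + g x))\<^sup>2 \<le> 2 * (L2_norm \<Omega> f)\<^sup>2 + 2 * (L2_norm \<Omega> g)\<^sup>2"
proof -
  have "0 \<le> L2_inner \<Omega> (\<lambda>x. f x - g x) (\<lambda>x. f x - g x)" by (rule L2_inner_self_nonneg)
  then show ?thesis
    using assms by (simp add: L2_norm_sq L2_inner_add_left L2_inner_add_right L2_add L2_diff
       L2_inner_diff_left L2_inner_diff_right L2_inner_commute[of \<Omega> g f])
qed

lemma L2_norm_scaleR: "L2_norm \<Omega> (\<lambda>x. c *\<^sub>R f x) = \<bar>c\<bar> * L2_norm \<Omega> f"
  by (simp add: L2_norm_def L2_inner_scaleR_left L2_inner_scaleR_right real_sqrt_mult flip: mult.assoc power2_eq_square)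

lemma L2_norm_mono:
  assumes "g \<in> L2 \<Omega>" "\<And>x. x \<in> \<Omega> \<Longrightarrow> norm (f x) \<le> norm (g x)"
  shows "(L2_norm \<Omega> f)\<^sup>2 \<le> (L2_norm \<Omega> g)\<^sup>2"
  unfolding L2_norm_sq_integral using L2_D[OF assms(1)] assms(2)
  by (intro integral_mono') auto

lemma L2_components:
  fixes f :: vector_field
  shows "f \<in> L2 \<Omega> \<longleftrightarrow> (\<forall>i. (\<lambda>x. f x $ i) \<in> L2 \<Omega>)"
proof
  assume f: "f \<in> L2 \<Omega>"
  have m: "(\<lambda>x. f x $ i) \<in> borel_measurable (lebesgue_on \<Omega>)" for i
    using measurable_compose[OF L2_D(1)[OF f], of "\<lambda>y. y $ i"] by (simp add: borel_measurable_continuous_onI continuous_intros)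
  show "\<forall>i. (\<lambda>x. f x $ i) \<in> L2 \<Omega>"
    by (intro allI L2_bound[OF m L2_D(2)[OF f]] power_mono norm_ge_zero) (simp add: component_le_norm_cart)
next
  assume *: "\<forall>i. (\<lambda>x. f x $ i) \<in> L2 \<Omega>"
  then have "f \<in> borel_measurable (lebesgue_on \<Omega>)"
    using L2_D(1)[OF *[rule_format]] by (subst borel_measurable_euclidean_space) (auto simp: Basis_vec_def inner_axis)
  moreover have "integrable (lebesgue_on \<Omega>) (\<lambda>x. \<Sum>i\<in>UNIV. (norm (f x $ i))\<^sup>2)"
    by (intro Bochner_Integration.integrable_sum L2_D(2)[OF *[rule_format]])
  ultimately show "f \<in> L2 \<Omega>"
    by (rule L2_bound) (unfold power2_norm_eq_inner inner_vec_def, rule order_refl)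
qed

lemma L2_inner_components:
  fixes f g :: vector_field
  assumes "f \<in> L2 \<Omega>" "g \<in> L2 \<Omega>"
  shows "L2_inner \<Omega> f g = (\<Sum>i\<in>UNIV. L2_inner \<Omega> (\<lambda>x. f x $ i) (\<lambda>x. g x $ i))"
proof -
  have "integrable (lebesgue_on \<Omega>) (\<lambda>x. f x $ i * g x $ i)" for i
    using assms L2_components L2_mult_integrable by blast
  then show ?thesis unfolding L2_inner_def inner_vec_def
    by (subst Bochner_Integration.integral_sum) auto
qed

lemma L2_bounded:
  assumes "bounded \<Omega>" "\<Omega> \<in> sets lebesgue" "f \<in> borel_measurable (lebesgue_on \<Omega>)" "\<And>x. x \<in> \<Omega> \<Longrightarrow> norm (f x) \<le> C"
  shows "f \<in> L2 \<Omega>"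
proof (rule L2_bound[OF assms(3)])
  show "integrable (lebesgue_on \<Omega>) (\<lambda>x. C\<^sup>2)"
    using assms(1,2) by (intro finite_measure.integrable_const finite_measure_lebesgue_on bounded_set_imp_lmeasurable)
  show "(norm (f x))\<^sup>2 \<le> C\<^sup>2" if "x \<in> \<Omega>" for x
    using assms(4)[OF that] by (intro power_mono) auto
qed

lemma L2_L1:
  fixes f :: scalar_field
  assumes "bounded \<Omega>" "\<Omega> \<in> sets lebesgue" "f \<in> L2 \<Omega>"
  shows "integrable (lebesgue_on \<Omega>) f"
  using L2_mult_integrable[OF L2_bounded[OF assms(1,2), of "\<lambda>x. 1" 1] assms(3)] by simp

lemma L2_subset:
  assumes "f \<in> L2 \<Omega>" "K \<subseteq> \<Omega>" "K \<in> sets lebesgue" "\<Omega> \<in> sets lebesgue"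
  shows "f \<in> L2 K"
  unfolding L2_def
proof safe
  have K: "K \<in> sets (lebesgue_on \<Omega>)" using assms by (auto simp: sets_restrict_space_iff)
  have r: "restrict_space (lebesgue_on \<Omega>) K = lebesgue_on K"
    using assms by (subst restrict_restrict_space) (auto simp: Int_absorb1)
  show "f \<in> borel_measurable (lebesgue_on K)"
    using measurable_restrict_space1[OF L2_D(1)[OF assms(1)], of K] r by simp
  show "integrable (lebesgue_on K) (\<lambda>x. (norm (f x))\<^sup>2)"
    unfolding r[symmetric] using K L2_D(2)[OF assms(1)]
    using integrable_mult_indicator[OF K L2_D(2)[OF assms(1)]] by (subst integrable_restrict_space) auto
qed

section \<open>Test functions as square-integrable functions\<close>

lemma closure_nonzero_zero: "x \<notin> closure {x. f x \<noteq> 0} \<Longrightarrow> f x = 0"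
  using closure_subset[of "{x. f x \<noteq> 0}"] by auto

lemma smooth_compact_bounded:
  assumes "smooth f" "compact (closure {x. f x \<noteq> 0})"
  obtains C where "\<And>x. \<bar>f x\<bar> \<le> C" "C \<ge> 0"
proof -
  have "compact (f ` closure {x. f x \<noteq> 0})"
    using assms smooth_continuous compact_continuous_image by blast
  then obtain C where C: "\<And>y. y \<in> f ` closure {x. f x \<noteq> 0} \<Longrightarrow> norm y \<le> C"
    by (meson bounded_iff compact_imp_bounded)
  have "\<bar>f x\<bar> \<le> max C 0" for x
    using C[of "f x"] closure_nonzero_zero[of x f] by (cases "x \<in> closure {x. f x \<noteq> 0}") (auto simp: max_def)
  then show ?thesis using that[of "max C 0"] by auto
qed

lemma borel_measurable_lebesgue_on:
  "f \<in> borel_measurable borel \<Longrightarrow> f \<in> borel_measurable (lebesgue_on S)"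
  by (simp add: measurable_restrict_space1 measurable_completion)

lemma test_L2:
  assumes "f \<in> test_functions \<Omega>" "\<Omega> \<in> sets lebesgue"
  shows "f \<in> L2 \<Omega>"
proof -
  let ?S = "closure {x. f x \<noteq> 0}"
  have f: "smooth f" "compact ?S" "?S \<subseteq> \<Omega>" using assms by (auto simp: test_functions_iff)
  obtain C where C: "\<And>x. \<bar>f x\<bar> \<le> C" "C \<ge> 0" using smooth_compact_bounded f by metis
  have m: "f \<in> borel_measurable borel" using f smooth_continuous borel_measurable_continuous_onI by blast
  show ?thesis
  proof (rule L2_bound)
    show "f \<in> borel_measurable (lebesgue_on \<Omega>)" using m by (rule borel_measurable_lebesgue_on)
    have "integrable (lebesgue_on \<Omega>) (\<lambda>x. indicator ?S x *\<^sub>R C\<^sup>2)"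
    proof (rule integrable_scaleR_left)
      have "integrable lebesgue (indicator ?S :: _ \<Rightarrow> real)"
        using f(2) by (simp add: lmeasurable_iff_integrable[symmetric] lmeasurable_compact)
      then show "integrable (lebesgue_on \<Omega>) (indicator ?S :: _ \<Rightarrow> real)"
        using assms(2) integrable_mult_indicator[of \<Omega> lebesgue "indicator ?S :: _ \<Rightarrow> real"]
        by (subst integrable_restrict_space) auto
    qed
    then show "integrable (lebesgue_on \<Omega>) (\<lambda>x. indicator ?S x * C\<^sup>2)" by simp
    show "(norm (f x))\<^sup>2 \<le> indicator ?S x * C\<^sup>2" for x
      using C(1)[of x] C(2) closure_nonzero_zero[of x f]
      by (auto simp: indicator_def power2_le_iff_abs_le)
  qed
qed

lemma partial_zero_outside:
  assumes "x \<notin> closure {x. f x \<noteq> 0}" shows "partial i f x = 0"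
proof -
  have "(f has_derivative (\<lambda>_. 0)) (at x)"
  proof (rule has_derivative_transform_within_open)
    show "((\<lambda>_. 0) has_derivative (\<lambda>_. 0)) (at x)" by simp
    show "open (- closure {x. f x \<noteq> 0})" by (intro open_Compl closed_closure)
    show "x \<in> - closure {x. f x \<noteq> 0}" using assms by simp
    show "0 = f y" if "y \<in> - closure {x. f x \<noteq> 0}" for y
      using that closure_nonzero_zero[of y f] by simp
  qed
  then show ?thesis by (simp add: partial_eqI)
qed

lemma test_functionsI:
  assumes "smooth f" "closure {x. f x \<noteq> 0} \<subseteq> B" "compact B" "B \<subseteq> \<Omega>"
  shows "f \<in> test_functions \<Omega>"
proof -
  have "compact (closure {x. f x \<noteq> 0})"
    using compact_Int_closed[OF assms(3) closed_closure, of "{x. f x \<noteq> 0}"] assms(2) by (simp only: inf.absorb2)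
  then show ?thesis
    unfolding test_functions_iff using assms(1) order_trans[OF assms(2,4)] by (intro conjI)
qed

lemma test_functionsD:
  assumes "f \<in> test_functions \<Omega>"
  shows "smooth f" "compact (closure {x. f x \<noteq> 0})" "closure {x. f x \<noteq> 0} \<subseteq> \<Omega>"
  using assms unfolding test_functions_iff by blast+

lemma partial_test:
  assumes "f \<in> test_functions \<Omega>" shows "partial i f \<in> test_functions \<Omega>"
proof (rule test_functionsI)
  show "closure {x. partial i f x \<noteq> 0} \<subseteq> closure {x. f x \<noteq> 0}"
    using partial_zero_outside by (intro closure_minimal) auto
qed (use test_functionsD[OF assms] smooth_partial in auto)

lemma test_add:
  assumes f: "f \<in> test_functions \<Omega>" and g: "g \<in> test_functions \<Omega>"
  shows "(\<lambda>x. f x + g x) \<in> test_functions \<Omega>"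
proof (rule test_functionsI)
  show "closure {x. f x + g x \<noteq> 0} \<subseteq> closure {x. f x \<noteq> 0} \<union> closure {x. g x \<noteq> 0}"
    unfolding closure_Un[symmetric] by (rule closure_mono) auto
  show "compact (closure {x. f x \<noteq> 0} \<union> closure {x. g x \<noteq> 0})"
    by (intro compact_Un test_functionsD[OF f] test_functionsD[OF g])
qed (use test_functionsD[OF f] test_functionsD[OF g] smooth_add in auto)

lemma test_cmult:
  assumes f: "f \<in> test_functions \<Omega>" shows "(\<lambda>x. c * f x) \<in> test_functions \<Omega>"
proof (rule test_functionsI)
  show "closure {x. c * f x \<noteq> 0} \<subseteq> closure {x. f x \<noteq> 0}"
    by (rule closure_mono) auto
qed (use test_functionsD[OF f] smooth_cmult in auto)

lemma test_zero: "(\<lambda>x. 0) \<in> test_functions \<Omega>" by (auto simp: test_functions_iff smooth_const)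

lemma test_mono: "f \<in> test_functions \<Omega> \<Longrightarrow> \<Omega> \<subseteq> \<Omega>' \<Longrightarrow> f \<in> test_functions \<Omega>'"
  by (auto simp: test_functions_iff)

lemma test_integral_UNIV:
  assumes "\<And>x. x \<notin> \<Omega> \<Longrightarrow> f x = (0::real)" "\<Omega> \<in> sets lebesgue"
  shows "(LINT x|lebesgue_on \<Omega>. f x) = (LINT x|lebesgue. f x)"
  using assms by (subst integral_restrict_space) (auto simp: indicator_def intro!: Bochner_Integration.integral_cong)

section \<open>Uniqueness of weak derivatives\<close>

lemma lebesgue_on_integral_subset:
  fixes f :: "'a::euclidean_space \<Rightarrow> 'b::{banach, second_countable_topology}"
  assumes "K \<subseteq> \<Omega>" "K \<in> sets lebesgue" "\<Omega> \<in> sets lebesgue" "\<And>x. x \<in> \<Omega> - K \<Longrightarrow> f x = 0"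
  shows "(LINT x|lebesgue_on \<Omega>. f x) = (LINT x|lebesgue_on K. f x)"
  using assms by (simp add: integral_restrict_space)
    (intro Bochner_Integration.integral_cong, auto simp: indicator_def)

lemma AE_lebesgue_on_iff:
  "S \<in> sets lebesgue \<Longrightarrow> (AE x in lebesgue_on S. P x) \<longleftrightarrow> (AE x in lebesgue. x \<in> S \<longrightarrow> P x)"
  by (simp add: AE_restrict_space_iff)

text \<open>The bumps of the box are admissible tests and increase in sharpness to the indicator of
  the open box, dominated by \<open>\<bar>g\<bar>\<close>; the faces that are lost form a null
  set.\<close>

lemma box_integral_zero:
  fixes g :: scalar_field
  assumes g: "g \<in> L2 \<Omega>" and \<Omega>: "\<Omega> \<in> sets lebesgue" and ab: "cbox a b \<subseteq> \<Omega>"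
    and z: "\<And>f. f \<in> test_functions \<Omega> \<Longrightarrow> (LINT x|lebesgue_on \<Omega>. g x * f x) = 0"
  shows "(LINT x|lebesgue_on (cbox a b). g x) = 0"
proof -
  let ?M = "lebesgue_on (cbox a b)"
  have gi: "integrable ?M g"
    using L2_L1[OF bounded_cbox _ L2_subset[OF g ab _ \<Omega>]] by simp
  have bm: "box_bump m a b \<in> borel_measurable ?M" for m
    by (intro borel_measurable_lebesgue_on borel_measurable_continuous_onI smooth_continuous smooth_box_bump)
  have "(\<lambda>n. LINT x|?M. g x * box_bump (real (Suc n)) a b x) \<longlonglongrightarrow> (LINT x|?M. g x * indicator (box a b) x)"
  proof (rule integral_dominated_convergence)
    show "integrable ?M (\<lambda>x. norm (g x))" using gi by simp
    show "AE x in ?M. (\<lambda>n. g x * box_bump (real (Suc n)) a b x) \<longlonglongrightarrow> g x * indicator (box a b) x"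
      by (intro AE_I2 tendsto_intros box_bump_tendsto)
    show "AE x in ?M. norm (g x * box_bump (real (Suc n)) a b x) \<le> norm (g x)" for n
      using box_bump_nonneg box_bump_le_1 by (intro AE_I2) (auto simp: abs_mult intro!: mult_right_le_one_le)
    show "(\<lambda>x. g x * indicat_real (box a b) x) \<in> borel_measurable ?M"
      by (intro borel_measurable_times borel_measurable_integrable[OF gi] borel_measurable_lebesgue_on) auto
  qed (use gi bm in auto)
  moreover have "(LINT x|?M. g x * box_bump (real (Suc n)) a b x) = 0" for n
  proof -
    have "(LINT x|lebesgue_on \<Omega>. g x * box_bump (real (Suc n)) a b x) = (LINT x|?M. g x * box_bump (real (Suc n)) a b x)"
      using ab \<Omega> box_bump_nonzero[of "real (Suc n)" a b] box_subset_cbox[of a b]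
      by (intro lebesgue_on_integral_subset) auto
    then show ?thesis using z[OF box_bump_test[OF _ ab]] by simp
  qed
  ultimately have "(LINT x|?M. g x * indicator (box a b) x) = 0"
    by (simp add: LIMSEQ_const_iff)
  moreover have "(LINT x|?M. g x * indicator (box a b) x) = (LINT x|?M. g x)"
  proof (rule integral_cong_AE)
    have "cbox a b - box a b \<in> null_sets lebesgue"
      using negligible_frontier_interval negligible_iff_null_sets by blast
    then have "AE x in lebesgue. x \<notin> cbox a b - box a b" by (rule AE_not_in)
    then show "AE x in ?M. g x * indicat_real (box a b) x = g x"
      by (subst AE_restrict_space_iff) (auto elim!: eventually_mono)
    show "(\<lambda>x. g x * indicat_real (box a b) x) \<in> borel_measurable ?M"
      by (intro borel_measurable_times borel_measurable_integrable[OF gi] borel_measurable_lebesgue_on) auto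
  qed (use gi in auto)
  ultimately show ?thesis by simp
qed

text \<open>Borel sets over whose trace in the box \<open>g\<close> integrates to zero are closed
  under complements and disjoint countable unions, and boxes form an intersection-stable generator;
  so all Borel sets are reached, and \<open>g\<close> vanishes almost everywhere once its integral
  over every measurable set is zero.\<close>

lemma AE_zero_if_box_integrals_zero:
  fixes g :: "'a::ordered_euclidean_space \<Rightarrow> real"
  assumes g: "integrable (lebesgue_on (cbox a b)) g"
    and z: "\<And>c d. cbox c d \<subseteq> cbox a b \<Longrightarrow> (LINT x|lebesgue_on (cbox c d). g x) = 0"
  shows "AE x in lebesgue_on (cbox a b). g x = 0"
proof (rule sigma_finite_measure.density_zero[OF _ g])
  show "sigma_finite_measure (lebesgue_on (cbox a b))"
    using finite_measure_lebesgue_on[of "cbox a b"] by (simp add: finite_measure_def)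
next
  let ?M = "lebesgue_on (cbox a b)"
  have meas: "A \<inter> cbox a b \<in> sets ?M" if "A \<in> sets borel" for A :: "'a set"
    using that by (auto simp: sets_restrict_space_iff)
  have integ: "set_integrable ?M (A \<inter> cbox a b) g" if "A \<in> sets borel" for A
    unfolding set_integrable_def by (intro integrable_mult_indicator meas that g)
  have borel: "set_lebesgue_integral ?M (A \<inter> cbox a b) g = 0" if A: "A \<in> sets borel" for A
  proof -
    let ?G = "range (\<lambda>(c,d). cbox c d :: 'a set)"
    have G: "sigma_sets UNIV ?G = sets (borel :: 'a measure)"
      unfolding borel_eq_atLeastAtMost cbox_interval[abs_def] by simp
    have "Int_stable ?G"
      by (auto simp: Int_stable_def Int_interval)
    moreover have "?G \<subseteq> Pow UNIV" by simp
    moreover have "A \<in> sigma_sets UNIV ?G" using A G by simp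
    ultimately show ?thesis
    proof (induction rule: sigma_sets_induct_disjoint[where \<Omega>=UNIV])
      case (basic A)
      then obtain c d where "A = cbox c d" by auto
      then obtain c' d' where cd: "A \<inter> cbox a b = cbox c' d'" by (simp add: Int_interval)
      then have "cbox c' d' \<subseteq> cbox a b" by auto
      then have "(LINT x|lebesgue_on (cbox c' d'). g x) = 0" by (rule z)
      moreover have "(LINT x|?M. indicator (cbox c' d') x *\<^sub>R g x) = (LINT x|lebesgue_on (cbox c' d'). indicator (cbox c' d') x *\<^sub>R g x)"
        using \<open>cbox c' d' \<subseteq> cbox a b\<close> by (intro lebesgue_on_integral_subset) auto
      moreover have "\<dots> = (LINT x|lebesgue_on (cbox c' d'). g x)"
        by (intro Bochner_Integration.integral_cong) auto
      ultimately show ?case by (simp add: cd set_lebesgue_integral_def)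
    next
      case empty
      show ?case by (simp add: set_lebesgue_integral_def)
    next
      case (compl A)
      then have A: "A \<in> sets borel" using G by simp
      have "set_lebesgue_integral ?M (cbox a b) g = 0"
      proof -
        have "set_lebesgue_integral ?M (cbox a b) g = (LINT x|?M. g x)"
          unfolding set_lebesgue_integral_def by (intro Bochner_Integration.integral_cong) auto
        then show ?thesis using z[of a b] by simp
      qed
      moreover have "set_lebesgue_integral ?M (cbox a b) g =
          set_lebesgue_integral ?M (A \<inter> cbox a b) g + set_lebesgue_integral ?M ((UNIV - A) \<inter> cbox a b) g"
      proof -
        have e: "cbox a b = (A \<inter> cbox a b) \<union> ((UNIV - A) \<inter> cbox a b)" by blast
        show ?thesis
          by (subst e, rule set_integral_Un) (use integ[OF A] integ[of "UNIV - A"] A in auto)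
      qed
      ultimately show ?case using compl by simp
    next
      case (union A)
      have A: "A i \<in> sets borel" for i using union G by auto
      have e: "(\<Union>i. A i) \<inter> cbox a b = (\<Union>i. A i \<inter> cbox a b)" by blast
      have "set_lebesgue_integral ?M (\<Union>i. A i \<inter> cbox a b) g = (\<Sum>i. set_lebesgue_integral ?M (A i \<inter> cbox a b) g)"
        using integ[of "\<Union>i. A i"] A union(1) unfolding e
        by (intro lebesgue_integral_countable_add meas) (auto simp: disjoint_family_on_def)
      then show ?case unfolding e using union by simp
    qed
  qed
  fix A assume A: "A \<in> sets ?M"
  then have "A \<in> sets lebesgue" by (auto simp: sets_restrict_space_iff)
  \<comment> \<open>A Lebesgue set differs from an F-sigma set by a null set, which reduces the
    claim to the Borel case.\<close>
  then obtain C T where CT: "fsigma C" "T \<in> null_sets lebesgue" "C \<union> T = A" "disjnt C T"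
    by (rule lebesgue_set_almost_fsigma)
  have C: "C \<in> sets borel" using CT(1) by (auto elim!: fsigma.cases intro!: sets.countable_UN)
  have "set_lebesgue_integral ?M A g = set_lebesgue_integral ?M (C \<inter> cbox a b) g"
    unfolding set_lebesgue_integral_def
  proof (rule integral_cong_AE)
    have "AE x in lebesgue. x \<notin> T" using CT(2) by (rule AE_not_in)
    then show "AE x in ?M. indicator A x *\<^sub>R g x = indicator (C \<inter> cbox a b) x *\<^sub>R g x"
      unfolding AE_lebesgue_on_iff[OF lmeasurable_cbox[THEN fmeasurableD]]
    proof (rule eventually_mono, intro impI)
      fix x assume "x \<notin> T" "x \<in> cbox a b"
      then have "x \<in> A \<longleftrightarrow> x \<in> C \<inter> cbox a b" using CT(3) by blast
      then show "indicator A x *\<^sub>R g x = indicator (C \<inter> cbox a b) x *\<^sub>R g x" by (simp add: indicator_def)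
    qed
    show "(\<lambda>x. indicator A x *\<^sub>R g x) \<in> borel_measurable ?M"
      by (intro borel_measurable_scaleR borel_measurable_indicator A borel_measurable_integrable[OF g])
    show "(\<lambda>x. indicator (C \<inter> cbox a b) x *\<^sub>R g x) \<in> borel_measurable ?M"
      by (intro borel_measurable_scaleR borel_measurable_indicator meas[OF C] borel_measurable_integrable[OF g])
  qed
  then show "set_lebesgue_integral ?M A g = 0" using borel[OF C] by simp
qed

lemma open_sets_lebesgue: "open S \<Longrightarrow> S \<in> sets lebesgue"
  by simp

text \<open>An open set is a countable union of closed boxes contained in it, so countably many
  exceptional null sets arise from the boxes.\<close>

lemma fundamental_lemma:
  fixes g :: scalar_field
  assumes g: "g \<in> L2 \<Omega>" and \<Omega>: "open \<Omega>"
    and z: "\<And>f. f \<in> test_functions \<Omega> \<Longrightarrow> (LINT x|lebesgue_on \<Omega>. g x * f x) = 0"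
  shows "AE x in lebesgue_on \<Omega>. g x = 0"
proof -
  have m: "\<Omega> \<in> sets lebesgue" using \<Omega> by (rule open_sets_lebesgue)
  obtain D where D: "countable D" "D \<subseteq> Pow \<Omega>" "\<And>X. X \<in> D \<Longrightarrow> \<exists>a b. X = cbox a b" "\<Union>D = \<Omega>"
    using open_countable_Union_open_cbox[OF \<Omega>] by metis
  have "AE x in lebesgue. x \<in> X \<longrightarrow> g x = 0" if X: "X \<in> D" for X
  proof -
    obtain a b where ab: "X = cbox a b" using D(3)[OF X] by blast
    have sub: "cbox a b \<subseteq> \<Omega>" using D(2) X ab by blast
    have "AE x in lebesgue_on (cbox a b). g x = 0"
    proof (rule AE_zero_if_box_integrals_zero)
      show "integrable (lebesgue_on (cbox a b)) g"
        using L2_L1[OF bounded_cbox _ L2_subset[OF g sub _ m]] by simp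
      show "(LINT x|lebesgue_on (cbox c d). g x) = 0" if "cbox c d \<subseteq> cbox a b" for c d
        using box_integral_zero[OF g m _ z] that sub by blast
    qed
    then show ?thesis by (subst (asm) AE_restrict_space_iff) (auto simp: ab)
  qed
  then have "AE x in lebesgue. \<forall>X\<in>D. x \<in> X \<longrightarrow> g x = 0"
    using D(1) by (subst AE_ball_countable) auto
  then show ?thesis using m D(4)
    by (subst AE_restrict_space_iff) (auto elim!: eventually_mono)
qed

lemma AE_vec_eq_0: "(AE x in M. f x = (0::real^'n)) \<longleftrightarrow> (\<forall>i. AE x in M. f x $ i = 0)"
proof -
  have "(AE x in M. \<forall>i. f x $ i = 0) \<longleftrightarrow> (\<forall>i. AE x in M. f x $ i = 0)"
    using AE_finite_all[of "UNIV :: 'n set" "\<lambda>x i. f x $ i = 0" "ae_filter M"] by simp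
  then show ?thesis by (simp add: vec_eq_iff)
qed

lemma vec_AE_eqI:
  fixes f g :: "'a \<Rightarrow> real^3"
  assumes "\<And>i. AE x in M. f x $ i = g x $ i"
  shows "AE x in M. f x = g x"
proof -
  have "AE x in M. f x - g x = 0"
    using assms unfolding AE_vec_eq_0 by simp
  then show ?thesis by simp
qed

lemma fundamental_lemma_eq:
  fixes g h :: scalar_field
  assumes g: "g \<in> L2 \<Omega>" "h \<in> L2 \<Omega>" and \<Omega>: "open \<Omega>"
    and z: "\<And>f. f \<in> test_functions \<Omega> \<Longrightarrow> (LINT x|lebesgue_on \<Omega>. g x * f x) = (LINT x|lebesgue_on \<Omega>. h x * f x)"
  shows "AE x in lebesgue_on \<Omega>. g x = h x"
proof -
  have "AE x in lebesgue_on \<Omega>. g x - h x = 0"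
  proof (rule fundamental_lemma[OF L2_diff[OF g] \<Omega>])
    fix f assume f: "f \<in> test_functions \<Omega>"
    then have "f \<in> L2 \<Omega>" using test_L2 open_sets_lebesgue[OF \<Omega>] by blast
    then show "(LINT x|lebesgue_on \<Omega>. (g x - h x) * f x) = 0"
      using z[OF f] g L2_mult_integrable by (simp add: left_diff_distrib)
  qed
  then show ?thesis by simp
qed

lemma weak_grad_unique:
  assumes "open \<Omega>" "is_weak_grad \<Omega> u g" "is_weak_grad \<Omega> u h"
  shows "AE x in lebesgue_on \<Omega>. g x = h x"
proof (rule vec_AE_eqI)
  fix i
  show "AE x in lebesgue_on \<Omega>. g x $ i = h x $ i"
    using assms(2,3) unfolding is_weak_grad_def
    by (intro fundamental_lemma_eq[OF _ _ assms(1)]) (auto simp: L2_components)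
qed

lemma weak_div_unique:
  assumes "open \<Omega>" "is_weak_div \<Omega> u g" "is_weak_div \<Omega> u h"
  shows "AE x in lebesgue_on \<Omega>. g x = h x"
proof (rule fundamental_lemma_eq[OF _ _ assms(1)])
  fix f assume "f \<in> test_functions \<Omega>"
  with assms(2,3) have "- L2_inner \<Omega> g f = - L2_inner \<Omega> h f" unfolding is_weak_div_def by metis
  then show "(LINT x|lebesgue_on \<Omega>. g x * f x) = (LINT x|lebesgue_on \<Omega>. h x * f x)"
    by (simp add: L2_inner_def)
qed (use assms(2,3) in \<open>auto simp: is_weak_div_def\<close>)

lemma weak_curl_unique:
  assumes "open \<Omega>" "is_weak_curl \<Omega> u g" "is_weak_curl \<Omega> u h"
  shows "AE x in lebesgue_on \<Omega>. g x = h x"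
proof (rule vec_AE_eqI)
  fix i :: 3
  show "AE x in lebesgue_on \<Omega>. g x $ i = h x $ i"
  proof (rule fundamental_lemma_eq[OF _ _ assms(1)])
    fix f assume f: "f \<in> test_functions \<Omega>"
    \<comment> \<open>A test field with a single nonzero component isolates the component
      \<open>i\<close> of the curl.\<close>
    have "(\<lambda>x. axis i (f x) $ j) \<in> test_functions \<Omega>" for j
      using f test_zero by (cases "i = j") (auto simp: axis_def)
    then have "L2_inner \<Omega> g (\<lambda>x. axis i (f x)) = L2_inner \<Omega> h (\<lambda>x. axis i (f x))"
      using assms(2,3) unfolding is_weak_curl_def by metis
    then show "(LINT x|lebesgue_on \<Omega>. g x $ i * f x) = (LINT x|lebesgue_on \<Omega>. h x $ i * f x)"
      by (simp add: L2_inner_def inner_axis)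
  qed (use assms(2,3) in \<open>auto simp: is_weak_curl_def L2_components\<close>)
qed

section \<open>Mollification\<close>

text \<open>The two cases are translation and reflection: reflection exchanges the arguments of a
  convolution, translation moves a difference quotient from one factor of a product to the
  other.\<close>

lemma lborel_integral_affine:
  fixes h :: "'a::euclidean_space \<Rightarrow> real"
  assumes "h \<in> borel_measurable borel" "c = 1 \<or> c = -1"
  shows "(LINT s|lborel. h (x + c *\<^sub>R s)) = (LINT s|lborel. h s)"
proof -
  have "(lborel :: 'a measure) = density (distr lborel borel (\<lambda>s. x + c *\<^sub>R s)) (\<lambda>_. ennreal (\<bar>c\<bar> ^ DIM('a)))"
    using lborel_affine[of c x] assms(2) by auto
  also have "\<dots> = distr lborel borel (\<lambda>s. x + c *\<^sub>R s)"
    using assms(2) by (auto simp: density_1)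
  finally have e: "(lborel :: 'a measure) = distr lborel borel (\<lambda>s. x + c *\<^sub>R s)" .
  have "(LINT s|lborel. h s) = (LINT s|distr lborel borel (\<lambda>s. x + c *\<^sub>R s). h s)"
    by (subst e) simp
  also have "\<dots> = (LINT s|lborel. h (x + c *\<^sub>R s))"
    using assms(1) by (subst integral_distr) auto
  finally show ?thesis by simp
qed

text \<open>Written along the sequence \<open>c / (n + 1)\<close>, as dominated convergence
  requires. The sign of \<open>c\<close> distinguishes forward from backward quotients; discrete
  integration by parts produces one of each.\<close>

lemma has_derivative_difference_quotient:
  fixes f :: scalar_field
  assumes "(f has_derivative D) (at x)" "c \<noteq> 0"
  shows "(\<lambda>n. (f (x + (c / real (Suc n)) *\<^sub>R e) - f x) / (c / real (Suc n))) \<longlonglongrightarrow> D e"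
proof -
  interpret D: bounded_linear D by (rule has_derivative_bounded_linear[OF assms(1)])
  have "((\<lambda>t. x + t *\<^sub>R e) has_derivative (\<lambda>t. t *\<^sub>R e)) (at 0)"
    by (auto intro!: derivative_eq_intros)
  from has_derivative_compose[OF this, of f D] assms(1)
  have "((\<lambda>t. f (x + t *\<^sub>R e)) has_derivative (\<lambda>t. D (t *\<^sub>R e))) (at 0)" by simp
  then have "((\<lambda>t. f (x + t *\<^sub>R e)) has_real_derivative D e) (at 0)"
    by (simp add: has_field_derivative_def D.scale mult_commute_abs)
  then have L: "((\<lambda>h. (f (x + h *\<^sub>R e) - f x) / h) \<longlongrightarrow> D e) (at 0)"
    by (simp add: DERIV_def)
  have "filterlim (\<lambda>n. c / real (Suc n)) (at 0) sequentially"
    using assms(2) LIMSEQ_Suc[OF lim_const_over_n[of c]] by (auto simp: filterlim_at)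
  from filterlim_compose[OF L this] show ?thesis .
qed

text \<open>Both sides are homogeneous in the increment, so scaling \<open>v\<close> into the ball
  of radius \<open>d\<close> loses nothing and the bound passes to the limit. It turns bounds on
  increments of a mollified function into gradient bounds without differentiating the
  kernel.\<close>

lemma derivative_bound_from_increments:
  fixes F :: scalar_field
  assumes D: "(F has_derivative D) (at x)" and d: "d > 0"
    and b: "\<And>h. norm h < d \<Longrightarrow> \<bar>F (x + h) - F x - g \<bullet> h\<bar> \<le> e * norm h"
  shows "\<bar>D v - g \<bullet> v\<bar> \<le> e * norm v"
proof -
  let ?q = "\<lambda>n. (F (x + (1 / real (Suc n)) *\<^sub>R v) - F x) / (1 / real (Suc n))"
  have "(\<lambda>n. \<bar>?q n - g \<bullet> v\<bar>) \<longlonglongrightarrow> \<bar>D v - g \<bullet> v\<bar>"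
    by (intro tendsto_intros has_derivative_difference_quotient[OF D]) simp
  moreover have "\<forall>\<^sub>F n in sequentially. \<bar>?q n - g \<bullet> v\<bar> \<le> e * norm v"
  proof -
    have "(\<lambda>n. (1 / real (Suc n)) * norm v) \<longlonglongrightarrow> 0 * norm v"
      by (intro tendsto_intros LIMSEQ_Suc[OF lim_const_over_n[of 1]])
    then have "\<forall>\<^sub>F n in sequentially. (1 / real (Suc n)) * norm v < d"
      using d by (intro order_tendstoD(2)) auto
    then show ?thesis
    proof (rule eventually_mono)
      fix n assume n: "1 / real (Suc n) * norm v < d"
      define t where "t = 1 / real (Suc n)"
      have t: "t > 0" by (simp add: t_def)
      have "\<bar>F (x + t *\<^sub>R v) - F x - g \<bullet> (t *\<^sub>R v)\<bar> \<le> e * norm (t *\<^sub>R v)"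
        using n t by (intro b) (simp add: t_def)
      then have "\<bar>F (x + t *\<^sub>R v) - F x - t * (g \<bullet> v)\<bar> / t \<le> e * norm v"
        using t by (simp add: divide_le_eq mult_ac)
      moreover have "\<bar>F (x + t *\<^sub>R v) - F x - t * (g \<bullet> v)\<bar> / t = \<bar>(F (x + t *\<^sub>R v) - F x) / t - g \<bullet> v\<bar>"
        using t by (simp add: diff_divide_distrib[of _ "t * _"] flip: abs_divide[of _ t, simplified abs_of_pos[OF t]])
      ultimately show "\<bar>?q n - g \<bullet> v\<bar> \<le> e * norm v" by (simp add: t_def)
    qed
  qed
  ultimately show ?thesis using tendsto_upperbound by force
qed

text \<open>The increment bound with reference gradient \<open>0\<close> is tested in the direction
  of the gradient itself, and one factor of its norm is cancelled.\<close>

lemma classical_grad_lipschitz_bound: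
  assumes "L-lipschitz_on UNIV F" "F differentiable (at x)"
  shows "norm (classical_grad F x) \<le> L"
proof -
  have "\<bar>classical_grad F x \<bullet> classical_grad F x - 0 \<bullet> classical_grad F x\<bar> \<le> L * norm (classical_grad F x)"
  proof (rule derivative_bound_from_increments[OF has_derivative_partial[OF assms(2)], of 1])
    show "\<bar>F (x + h) - F x - 0 \<bullet> h\<bar> \<le> L * norm h" for h
      using lipschitz_onD[OF assms(1), of "x + h" x] by (simp add: dist_norm)
  qed simp
  then have "(norm (classical_grad F x))\<^sup>2 \<le> L * norm (classical_grad F x)"
    by (simp add: power2_norm_eq_inner)
  then show ?thesis
    using lipschitz_on_nonneg[OF assms(1)] by (cases "norm (classical_grad F x) = 0") (auto simp: power2_eq_square)
qed

lemma test_lipschitz: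
  assumes "f \<in> test_functions \<Omega>"
  obtains L where "L-lipschitz_on UNIV f" "\<And>x. norm (classical_grad f x) \<le> L"
proof -
  have "\<exists>C. (\<forall>x. \<bar>partial i f x\<bar> \<le> C) \<and> C \<ge> 0" for i
    using smooth_compact_bounded[OF test_functionsD(1,2)[OF partial_test[OF assms]]] by metis
  then obtain C where C: "\<And>i x. \<bar>partial i f x\<bar> \<le> C i" "\<And>i. C i \<ge> 0" by metis
  have b: "norm (classical_grad f x) \<le> (\<Sum>i\<in>UNIV. C i)" for x
    using norm_le_l1_cart[of "classical_grad f x"] sum_mono[of UNIV "\<lambda>i. \<bar>partial i f x\<bar>" C] C
    by (simp add: classical_grad_def)
  have "(\<Sum>i\<in>UNIV. C i)-lipschitz_on UNIV f"
  proof (rule bounded_derivative_imp_lipschitz)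
    show "(f has_derivative (\<lambda>v. classical_grad f x \<bullet> v)) (at x within UNIV)" for x
      using has_derivative_partial[OF smooth_differentiable[OF test_functionsD(1)[OF assms]]] by simp
    show "onorm (\<lambda>v. classical_grad f x \<bullet> v) \<le> (\<Sum>i\<in>UNIV. C i)" for x
    proof (rule onorm_le)
      fix v show "norm (classical_grad f x \<bullet> v) \<le> (\<Sum>i\<in>UNIV. C i) * norm v"
        using Cauchy_Schwarz_ineq2[of "classical_grad f x" v] b[of x] by (simp add: mult_right_mono order_trans)
    qed
  qed (use C in \<open>auto intro: sum_nonneg\<close>)
  then show ?thesis using that b by blast
qed

lemma mollifier_exists:
  assumes "r > 0"
  obtains \<eta> :: scalar_field where "smooth \<eta>" "\<And>s. \<eta> s \<ge> 0" "\<And>s. \<eta> s \<noteq> 0 \<Longrightarrow> norm s < r"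
    "integrable lborel \<eta>" "(LINT s|lborel. \<eta> s) = 1"
proof -
  \<comment> \<open>With half-width \<open>r / 3\<close> the three coordinates of a point of the box
    sum to less than \<open>r\<close> in absolute value, and this sum bounds the Euclidean
    norm.\<close>
  define b where "b = (\<chi> i::3. r / 3)"
  define B where "B = box_bump 1 (- b) b"
  have nz: "B s \<noteq> 0 \<longleftrightarrow> s \<in> box (- b) b" for s unfolding B_def by (rule box_bump_nonzero) simp
  have nr: "norm s < r" if "B s \<noteq> 0" for s
  proof -
    have "- (r / 3) < s $ i \<and> s $ i < r / 3" for i using that unfolding nz by (simp add: mem_box_cart b_def)
    then have "\<bar>s $ i\<bar> < r / 3" for i unfolding abs_less_iff by (metis minus_less_iff)
    then have "(\<Sum>i\<in>UNIV. \<bar>s $ i\<bar>) < (\<Sum>i\<in>(UNIV::3 set). r / 3)" by (intro sum_strict_mono) auto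
    then show ?thesis using norm_le_l1_cart[of s] by simp
  qed
  have sm: "smooth B" unfolding B_def by (rule smooth_box_bump)
  have meas: "B \<in> borel_measurable lborel" using borel_measurable_continuous_onI[OF smooth_continuous[OF sm]] by simp
  have Bi: "integrable lborel B"
  proof (rule Bochner_Integration.integrable_bound)
    show "integrable lborel (indicator (cbox (- b) b) :: _ \<Rightarrow> real)" by (simp add: emeasure_lborel_cbox_eq)
    show "AE s in lborel. norm (B s) \<le> norm (indicat_real (cbox (- b) b) s)"
    proof (rule AE_I2)
      fix s show "norm (B s) \<le> norm (indicat_real (cbox (- b) b) s)"
        using box_bump_le_1[of 1 "-b" b s] box_bump_nonneg[of 1 "-b" b s] nz[of s] box_subset_cbox[of "-b" b]
        by (cases "B s = 0") (auto simp: indicator_def B_def)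
    qed
  qed (rule meas)
  have B0: "B s \<ge> 0" for s unfolding B_def by (rule box_bump_nonneg)
  have pos: "(LINT s|lborel. B s) > 0"
  proof -
    have "(LINT s|lborel. B s) \<noteq> 0"
    proof
      assume "(LINT s|lborel. B s) = 0"
      then have "AE s in lborel. B s = 0" using integral_nonneg_eq_0_iff_AE[OF Bi] B0 by simp
      then have "AE s in lborel. s \<notin> box (- b) b" by (rule eventually_mono) (use nz in auto)
      then have "emeasure lborel (box (- b) b) = 0"
        by (subst (asm) AE_iff_measurable[of "box (- b) b"]) auto
      moreover have "emeasure lborel (box (- b) b) = ennreal (\<Prod>i\<in>Basis. (b - (- b)) \<bullet> i)"
        by (rule emeasure_lborel_box) (use assms in \<open>auto simp: Basis_vec_def b_def inner_axis\<close>)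
      moreover have "(\<Prod>i\<in>Basis. (b - (- b)) \<bullet> i) > 0"
        by (rule prod_pos) (use assms in \<open>auto simp: Basis_vec_def b_def inner_axis\<close>)
      ultimately show False by (metis ennreal_eq_0_iff linorder_not_less)
    qed
    moreover have "(LINT s|lborel. B s) \<ge> 0" by (intro Bochner_Integration.integral_nonneg B0)
    ultimately show ?thesis by simp
  qed
  define c where "c = (LINT s|lborel. B s)"
  show ?thesis
  proof (rule that[of "\<lambda>s. (1 / c) * B s"])
    show "smooth (\<lambda>s. (1 / c) * B s)" by (rule smooth_cmult[OF sm])
    show "(1 / c) * B s \<ge> 0" for s using pos B0 by (simp add: c_def)
    show "norm s < r" if "(1 / c) * B s \<noteq> 0" for s using that nr by auto
    show "integrable lborel (\<lambda>s. (1 / c) * B s)" using Bi by simp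
    show "(LINT s|lborel. (1 / c) * B s) = 1" using pos by (simp add: c_def)
  qed
qed

lemma convol_eq:
  assumes u: "continuous_on UNIV u" and z: "\<And>t. t \<notin> cbox a b \<Longrightarrow> u t = 0" and eta: "continuous_on UNIV \<eta>"
  shows "convol a b u \<eta> x = (LINT s|lborel. u (x - s) * \<eta> s)"
proof -
  have c: "continuous_on A (\<lambda>t. u t * \<eta> (x - t))" for A
    by (intro continuous_intros continuous_on_compose2[OF u] continuous_on_compose2[OF eta]) auto
  have "convol a b u \<eta> x = (LINT t:cbox a b|lborel. u t * \<eta> (x - t))"
    unfolding convol_def using borel_integrable_compact[OF compact_cbox c]
    by (intro set_borel_integral_eq_integral(2)[symmetric]) (simp add: set_integrable_def)
  also have "\<dots> = (LINT t|lborel. u t * \<eta> (x - t))"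
    unfolding set_lebesgue_integral_def using z
    by (intro Bochner_Integration.integral_cong) (auto simp: indicator_def)
  also have "\<dots> = (LINT s|lborel. u (x + (-1) *\<^sub>R s) * \<eta> (x - (x + (-1) *\<^sub>R s)))"
    by (intro lborel_integral_affine[symmetric] borel_measurable_continuous_onI c) auto
  finally show ?thesis by simp
qed

text \<open>An average of shifts of \<open>u\<close> inherits every increment bound valid for all
  those shifts. The last property is the purpose: near a point where \<open>u\<close> is nearly
  linear with slope \<open>g\<close>, on a ball wider than the mollification radius, the gradient of
  \<open>F\<close> is close to \<open>g\<close>.\<close>

lemma mollify:
  assumes u: "L-lipschitz_on UNIV u" and z: "bounded {x. u x \<noteq> 0}" and r: "r > 0"
  obtains F where "smooth F" "L-lipschitz_on UNIV F" "\<And>x. \<bar>F x - u x\<bar> \<le> L * r"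
    "\<And>x. F x \<noteq> 0 \<Longrightarrow> \<exists>y. dist x y < r \<and> u y \<noteq> 0"
    "\<And>x g d e. \<lbrakk>d > r; \<And>y z. y \<in> ball x d \<Longrightarrow> z \<in> ball x d \<Longrightarrow> \<bar>u y - u z - g \<bullet> (y - z)\<bar> \<le> e * norm (y - z)\<rbrakk>
       \<Longrightarrow> norm (classical_grad F x - g) \<le> e"
proof -
  obtain \<eta> :: scalar_field where eta: "smooth \<eta>" "\<And>s. \<eta> s \<ge> 0" "\<And>s. \<eta> s \<noteq> 0 \<Longrightarrow> norm s < r"
    "integrable lborel \<eta>" "(LINT s|lborel. \<eta> s) = 1" using mollifier_exists[OF r] by metis
  obtain a where a: "{x. u x \<noteq> 0} \<subseteq> cbox (-a) a" using bounded_subset_cbox_symmetric[OF z] by blast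
  have uc: "continuous_on UNIV u" using u by (rule lipschitz_on_continuous_on)
  define F where "F = convol (-a) a u \<eta>"
  have F: "F x = (LINT s|lborel. u (x - s) * \<eta> s)" for x
    unfolding F_def using a by (intro convol_eq uc smooth_continuous eta) auto
  have L0: "L \<ge> 0" using u by (rule lipschitz_on_nonneg)
  have sm: "smooth F" unfolding F_def by (rule smooth_convol[OF uc eta(1)])
  have ub: "\<exists>C. \<forall>x. \<bar>u x\<bar> \<le> C"
  proof -
    have "compact (u ` cbox (-a) a)" using uc by (intro compact_continuous_image continuous_on_subset[OF uc]) auto
    then obtain C where C: "\<forall>y\<in>u ` cbox (-a) a. norm y \<le> C" using compact_imp_bounded bounded_iff by metis
    have "\<bar>u x\<bar> \<le> max C 0" for x
    proof (cases "u x = 0")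
      case False then have "x \<in> cbox (-a) a" using a by blast
      then show ?thesis using C by (force simp: max_def)
    qed auto
    then show ?thesis by blast
  qed
  then obtain C where C: "\<And>x. \<bar>u x\<bar> \<le> C" by blast
  have mu: "(\<lambda>s. u (x - s)) \<in> borel_measurable lborel" for x
    using borel_measurable_continuous_onI[of "\<lambda>s. u (x - s)"]
    by (simp add: continuous_on_compose2[OF uc] continuous_intros)
  have ui: "integrable lborel (\<lambda>s. u (x - s) * \<eta> s)" for x
  proof (rule Bochner_Integration.integrable_bound)
    show "integrable lborel (\<lambda>s. C * \<eta> s)" using eta(4) by simp
    show "AE s in lborel. norm (u (x - s) * \<eta> s) \<le> norm (C * \<eta> s)"
      using C eta(2) by (intro AE_I2) (auto simp: abs_mult intro!: mult_right_mono order_trans[OF C])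
  qed (use mu eta(4) in auto)
  \<comment> \<open>A weighted average of total weight one over shifts shorter than \<open>r\<close>
    obeys any bound that the integrand obeys on those shifts; the quantitative properties of
    \<open>F\<close> are instances of this.\<close>
  have key: "\<bar>LINT s|lborel. h s * \<eta> s\<bar> \<le> K"
    if "integrable lborel (\<lambda>s. h s * \<eta> s)" "\<And>s. norm s < r \<Longrightarrow> \<bar>h s\<bar> \<le> K" for h K
  proof -
    have "\<bar>LINT s|lborel. h s * \<eta> s\<bar> \<le> (LINT s|lborel. K * \<eta> s)"
    proof (rule order_trans[OF integral_abs_bound], rule integral_mono)
      fix s show "\<bar>h s * \<eta> s\<bar> \<le> K * \<eta> s"
        using that(2)[of s] eta(2)[of s] eta(3)[of s] by (cases "\<eta> s = 0") (auto simp: abs_mult intro!: mult_right_mono)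
    qed (use that(1) eta(4) in auto)
    then show ?thesis using eta(5) by simp
  qed
  have diff: "F y - F z - c = (LINT s|lborel. (u (y - s) - u (z - s) - c) * \<eta> s)"
    and diffi: "integrable lborel (\<lambda>s. (u (y - s) - u (z - s) - c) * \<eta> s)" for y z c
  proof -
    have e: "(\<lambda>s. (u (y - s) - u (z - s) - c) * \<eta> s) = (\<lambda>s. u (y - s) * \<eta> s - u (z - s) * \<eta> s - c * \<eta> s)"
      by (simp add: algebra_simps)
    show "integrable lborel (\<lambda>s. (u (y - s) - u (z - s) - c) * \<eta> s)"
      unfolding e using ui[of y] ui[of z] eta(4) by (intro Bochner_Integration.integrable_diff) auto
    show "F y - F z - c = (LINT s|lborel. (u (y - s) - u (z - s) - c) * \<eta> s)"
      unfolding e using ui[of y] ui[of z] eta(4,5) by (simp add: F)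
  qed
  show ?thesis
  proof (rule that[OF sm])
    show "L-lipschitz_on UNIV F"
    proof (rule lipschitz_onI[OF _ L0])
      fix y z :: "real^3"
      have "\<bar>F y - F z - 0\<bar> \<le> L * dist y z"
        unfolding diff using lipschitz_onD[OF u, of "y - s" "z - s" for s]
        by (intro key diffi) (auto simp: dist_norm)
      then show "dist (F y) (F z) \<le> L * dist y z" by (simp add: dist_real_def)
    qed
    show "\<bar>F x - u x\<bar> \<le> L * r" for x
    proof -
      have e: "(\<lambda>s. (u (x - s) - u x) * \<eta> s) = (\<lambda>s. u (x - s) * \<eta> s - u x * \<eta> s)" by (simp add: algebra_simps)
      have i: "integrable lborel (\<lambda>s. (u (x - s) - u x) * \<eta> s)"
        unfolding e using ui[of x] eta(4) by (intro Bochner_Integration.integrable_diff) auto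
      have "F x - u x = (LINT s|lborel. (u (x - s) - u x) * \<eta> s)"
        unfolding e using ui[of x] eta(4,5) by (simp add: F)
      moreover have "\<bar>LINT s|lborel. (u (x - s) - u x) * \<eta> s\<bar> \<le> L * r"
      proof (rule key[OF i])
        fix s :: "real^3" assume "norm s < r"
        then show "\<bar>u (x - s) - u x\<bar> \<le> L * r"
          using lipschitz_onD[OF u, of "x - s" x] L0 mult_left_mono[of "norm s" r L] by (simp add: dist_norm)
      qed
      ultimately show ?thesis by simp
    qed
    show "\<exists>y. dist x y < r \<and> u y \<noteq> 0" if "F x \<noteq> 0" for x
    proof (rule ccontr)
      assume c: "\<not> (\<exists>y. dist x y < r \<and> u y \<noteq> 0)"
      have "\<bar>LINT s|lborel. u (x - s) * \<eta> s\<bar> \<le> 0"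
        using c by (intro key[OF ui]) (auto simp: dist_norm)
      then show False using that F by simp
    qed
    show "norm (classical_grad F x - g) \<le> e" if dr: "d > r" and
      st: "\<And>y z. y \<in> ball x d \<Longrightarrow> z \<in> ball x d \<Longrightarrow> \<bar>u y - u z - g \<bullet> (y - z)\<bar> \<le> e * norm (y - z)" for x g d e
    proof -
      let ?v = "classical_grad F x - g"
      have "\<bar>classical_grad F x \<bullet> ?v - g \<bullet> ?v\<bar> \<le> e * norm ?v"
      proof (rule derivative_bound_from_increments[OF has_derivative_partial[OF smooth_differentiable[OF sm]]])
        show "d - r > 0" using dr by simp
        fix h :: "real^3" assume h: "norm h < d - r"
        show "\<bar>F (x + h) - F x - g \<bullet> h\<bar> \<le> e * norm h"
          unfolding diff
        proof (rule key[OF diffi])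
          fix s :: "real^3" assume s: "norm s < r"
          have "norm (h - s) \<le> norm h + norm s" by (rule norm_triangle_ineq4)
          then have "x + h - s \<in> ball x d" "x - s \<in> ball x d" using h s dr by (auto simp: dist_norm norm_minus_commute)
          from st[OF this] show "\<bar>u (x + h - s) - u (x - s) - g \<bullet> h\<bar> \<le> e * norm h" by simp
        qed
      qed
      then have "(norm ?v)\<^sup>2 \<le> e * norm ?v" by (simp add: power2_norm_eq_inner inner_diff_left inner_diff_right)
      \<comment> \<open>Extracted from the increment hypothesis at one nonzero increment; it settles
        the case in which \<open>?v\<close> vanishes.\<close>
      moreover have "e \<ge> 0"
      proof -
        obtain w :: "real^3" where w: "norm w = d / 2" using vector_choose_size[of "d/2"] dr r by auto
        then have "norm w > 0" using dr r by linarith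
        moreover have "0 \<le> e * norm w"
        proof -
          have b: "x + w \<in> ball x d" "x \<in> ball x d" using w dr r by (auto simp: dist_norm)
          show ?thesis using order_trans[OF abs_ge_zero st[OF b]] by simp
        qed
        ultimately show ?thesis by (simp add: zero_le_mult_iff)
      qed
      ultimately show ?thesis by (cases "norm ?v = 0") (auto simp: power2_eq_square)
    qed
  qed
qed

section \<open>Weak gradients of Lipschitz functions\<close>

lemma lborel_integral_lebesgue:
  fixes f :: "'a::euclidean_space \<Rightarrow> real"
  shows "f \<in> borel_measurable borel \<Longrightarrow> (LINT x|lebesgue. f x) = (LINT x|lborel. f x)"
  by (rule integral_completion) simp

lemma abs_quotient_le:
  fixes a d M :: real
  shows "\<bar>a\<bar> \<le> M * \<bar>d\<bar> \<Longrightarrow> d \<noteq> 0 \<Longrightarrow> \<bar>a / d\<bar> \<le> M"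
  by (simp add: abs_divide pos_divide_le_eq)

text \<open>Integration by parts for difference quotients: translation invariance moves the forward
  quotient of \<open>f\<close> to a backward quotient of \<open>u\<close>, and both sides pass to
  the limit. The Lipschitz constants of \<open>f\<close> and of \<open>u\<close> provide the
  dominating functions. The derivative almost everywhere is a hypothesis, since it is explicit in
  every application.\<close>

lemma is_weak_grad_lipschitz:
  assumes \<Omega>: "open \<Omega>" and u: "L-lipschitz_on UNIV u" and g: "g \<in> L2 \<Omega>"
    and D: "AE x in lebesgue_on \<Omega>. (u has_derivative (\<lambda>v. g x \<bullet> v)) (at x)"
  shows "is_weak_grad \<Omega> u g"
  unfolding is_weak_grad_def
proof (intro conjI ballI allI g)
  fix f and i :: 3 assume f: "f \<in> test_functions \<Omega>"
  have m\<Omega>: "\<Omega> \<in> sets lebesgue" using \<Omega> by (rule open_sets_lebesgue)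
  let ?S = "closure {x. f x \<noteq> 0}"
  let ?e = "axis i 1 :: real^3"
  note fD = test_functionsD[OF f]
  have fc: "continuous_on A f" for A using fD(1) by (rule smooth_continuous)
  have uc: "continuous_on A u" for A using lipschitz_on_continuous_on[OF u] continuous_on_subset by blast
  obtain M where M: "M-lipschitz_on UNIV f" using test_lipschitz[OF f] by metis
  obtain R where R: "R > 0" "?S \<subseteq> ball 0 R"
    using bounded_subset_ballD[OF compact_imp_bounded[OF fD(2)], of 0] by blast
  \<comment> \<open>The shifts have length at most one, so the difference quotients of
    \<open>f\<close> still vanish outside this enlarged ball.\<close>
  let ?B = "cball 0 (R + 1) :: (real^3) set"
  have f0: "f x = 0" if "x \<notin> ball 0 R" for x
    using closure_nonzero_zero[of x f] R that by blast
  have "compact (u ` ?B)" by (intro compact_continuous_image uc) auto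
  then obtain C where "\<forall>y\<in>u ` ?B. norm y \<le> C"
    using compact_imp_bounded[of "u ` ?B"] unfolding bounded_iff by blast
  then have C: "\<bar>u x\<bar> \<le> C" if "x \<in> ?B" for x using that by (metis imageI real_norm_def)
  have C0: "C \<ge> 0" using C[of 0] R(1) by auto
  have Bi: "integrable lborel (\<lambda>x. indicator ?B x * K)" for K :: real
    using borel_integrable_compact[of ?B "\<lambda>_. K"] by simp
  define q where "q n x = (f (x + (1 / real (Suc n)) *\<^sub>R ?e) - f x) / (1 / real (Suc n))" for n x
  define q' where "q' n x = (u (x + (- 1 / real (Suc n)) *\<^sub>R ?e) - u x) / (- 1 / real (Suc n))" for n x
  have qc: "continuous_on UNIV (q n)" and qc': "continuous_on UNIV (q' n)" for n
    unfolding q_def[abs_def] q'_def[abs_def]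
    by (intro continuous_intros continuous_on_compose2[OF fc[of UNIV]] continuous_on_compose2[OF uc[of UNIV]]; simp)+
  have qb: "\<bar>q n x\<bar> \<le> M" for n x
  proof -
    have "\<bar>f (x + (1 / real (Suc n)) *\<^sub>R ?e) - f x\<bar> \<le> M * (1 / real (Suc n))"
      using lipschitz_onD[OF M, of "x + (1 / real (Suc n)) *\<^sub>R ?e" x] by (simp add: dist_norm)
    then show ?thesis unfolding q_def by (intro abs_quotient_le) auto
  qed
  have qb': "\<bar>q' n x\<bar> \<le> L" for n x
  proof -
    have "\<bar>u (x + (- 1 / real (Suc n)) *\<^sub>R ?e) - u x\<bar> \<le> L * (1 / real (Suc n))"
      using lipschitz_onD[OF u, of "x + (- 1 / real (Suc n)) *\<^sub>R ?e" x] by (simp add: dist_norm)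
    then show ?thesis unfolding q'_def by (intro abs_quotient_le) auto
  qed
  have q0: "q n x = 0" if "x \<notin> ?B" for n x
  proof -
    have "norm (x + (1 / real (Suc n)) *\<^sub>R ?e) \<ge> norm x - norm ((1 / real (Suc n)) *\<^sub>R ?e)"
      using norm_diff_ineq[of x "(1 / real (Suc n)) *\<^sub>R ?e"] .
    moreover have "norm ((1 / real (Suc n)) *\<^sub>R ?e) \<le> 1" by simp
    moreover have "norm x > R + 1" using that by simp
    ultimately have "norm (x + (1 / real (Suc n)) *\<^sub>R ?e) > R" by linarith
    then have "x + (1 / real (Suc n)) *\<^sub>R ?e \<notin> ball 0 R" "x \<notin> ball 0 R" using that by simp_all
    then show ?thesis by (simp add: q_def f0)
  qed
  have fqi: "continuous_on UNIV (\<lambda>x. u x * q n x)" "continuous_on UNIV (\<lambda>x. q' n x * f x)"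
     "continuous_on UNIV (\<lambda>x. u x * partial i f x)" for n
    by (intro continuous_intros qc qc' uc fc smooth_continuous smooth_partial fD(1))+
  note bm = borel_measurable_continuous_onI[OF fqi(1)] borel_measurable_continuous_onI[OF fqi(2)] borel_measurable_continuous_onI[OF fqi(3)]
  have lim1: "(\<lambda>n. LINT x|lborel. u x * q n x) \<longlonglongrightarrow> (LINT x|lborel. u x * partial i f x)"
  proof (rule integral_dominated_convergence)
    show "integrable lborel (\<lambda>x. indicator ?B x * (C * M))" by (rule Bi)
    show "AE x in lborel. (\<lambda>n. u x * q n x) \<longlonglongrightarrow> u x * partial i f x"
    proof (intro AE_I2 tendsto_intros)
      fix x
      have "(f has_derivative (\<lambda>v. classical_grad f x \<bullet> v)) (at x)"
        by (intro has_derivative_partial smooth_differentiable fD(1))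
      from has_derivative_difference_quotient[OF this, of 1 ?e]
      show "(\<lambda>n. q n x) \<longlonglongrightarrow> partial i f x" by (simp add: q_def inner_axis classical_grad_def)
    qed
    show "AE x in lborel. norm (u x * q n x) \<le> indicator ?B x * (C * M)" for n
      using q0 C qb C0 by (intro AE_I2) (auto simp: indicator_def abs_mult intro!: mult_mono)
  qed (use bm in auto)
  have shift: "(LINT x|lborel. u x * q n x) = - (LINT x|lborel. q' n x * f x)" for n
  proof -
    let ?t = "1 / real (Suc n)"
    have c1: "continuous_on UNIV (\<lambda>x. u x * f (x + ?t *\<^sub>R ?e))" "continuous_on UNIV (\<lambda>x. u x * f x)"
      "continuous_on UNIV (\<lambda>x. u (x + (-1/ real (Suc n)) *\<^sub>R ?e) * f x)"
      by (intro continuous_intros uc fc continuous_on_compose2[OF fc[of UNIV]] continuous_on_compose2[OF uc[of UNIV]]; simp)+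
    have ic: "integrable lborel h" if c: "continuous_on UNIV h" and z: "\<And>x. x \<notin> ?B \<Longrightarrow> h x = 0" for h :: scalar_field
    proof -
      have "(\<lambda>x. indicator ?B x *\<^sub>R h x) = h" using z by (intro ext) (auto simp: indicator_def)
      then show ?thesis using borel_integrable_compact[of ?B h] c continuous_on_subset[OF c] by simp
    qed
    have i1: "integrable lborel (\<lambda>x. u x * f (x + ?t *\<^sub>R ?e))"
    proof (rule ic[OF c1(1)])
      fix x :: "real^3" assume x: "x \<notin> ?B"
      then have "f x = 0" using f0[of x] by auto
      moreover have "q n x = 0" by (rule q0[OF x])
      ultimately show "u x * f (x + ?t *\<^sub>R ?e) = 0" by (simp add: q_def)
    qed
    have i2: "integrable lborel (\<lambda>x. u x * f x)"
      by (rule ic[OF c1(2)]) (use f0 in auto)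
    have i3: "integrable lborel (\<lambda>x. u (x + (-1/ real (Suc n)) *\<^sub>R ?e) * f x)"
      by (rule ic[OF c1(3)]) (use f0 in auto)
    have "(LINT x|lborel. u x * f (x + ?t *\<^sub>R ?e)) = (LINT x|lborel. u (x + (-1/ real (Suc n)) *\<^sub>R ?e) * f x)"
      using lborel_integral_affine[OF borel_measurable_continuous_onI[OF c1(3)], of 1 "?t *\<^sub>R ?e"]
      by (simp add: algebra_simps)
    then have "(LINT x|lborel. (u x * f (x + ?t *\<^sub>R ?e) - u x * f x) * real (Suc n)) =
       (LINT x|lborel. (u (x + (-1/ real (Suc n)) *\<^sub>R ?e) * f x - u x * f x) * real (Suc n))"
      using i1 i2 i3 by simp
    moreover have "(\<lambda>x. (u x * f (x + ?t *\<^sub>R ?e) - u x * f x) * real (Suc n)) = (\<lambda>x. u x * q n x)"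
      by (auto simp: q_def algebra_simps)
    moreover have "(\<lambda>x. (u (x + (-1/ real (Suc n)) *\<^sub>R ?e) * f x - u x * f x) * real (Suc n)) = (\<lambda>x. - (q' n x * f x))"
      by (auto simp: q'_def algebra_simps)
    ultimately have "(LINT x|lborel. u x * q n x) = (LINT x|lborel. - (q' n x * f x))" by metis
    then show ?thesis by simp
  qed
  have onO: "(LINT x|lborel. h x) = (LINT x|lebesgue_on \<Omega>. h x)"
    if "h \<in> borel_measurable borel" "\<And>x. x \<notin> ?S \<Longrightarrow> h x = 0" for h :: scalar_field
  proof -
    have "h x = 0" if "x \<notin> \<Omega>" for x using that fD(3) \<open>\<And>x. x \<notin> ?S \<Longrightarrow> h x = 0\<close> by blast
    then show ?thesis using lborel_integral_lebesgue[OF that(1)] test_integral_UNIV[of \<Omega> h, OF _ m\<Omega>] by simp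
  qed
  have lim2: "(\<lambda>n. LINT x|lebesgue_on \<Omega>. q' n x * f x) \<longlonglongrightarrow> (LINT x|lebesgue_on \<Omega>. g x $ i * f x)"
  proof (rule integral_dominated_convergence)
    have "integrable (lebesgue_on \<Omega>) (\<lambda>x. \<bar>f x\<bar>)"
    proof -
      have "integrable lborel (\<lambda>x. indicator ?S x *\<^sub>R f x)" by (intro borel_integrable_compact fD(2) fc)
      moreover have "(\<lambda>x. indicator ?S x *\<^sub>R f x) = f"
      proof
        fix x show "indicator ?S x *\<^sub>R f x = f x" using closure_nonzero_zero[of x f] by (cases "x \<in> ?S") simp_all
      qed
      ultimately have "integrable lborel f" by metis
      then have "integrable lebesgue f" by (simp add: integrable_completion borel_measurable_continuous_onI fc)
      then have "integrable (lebesgue_on \<Omega>) f"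
        using integrable_mult_indicator[OF m\<Omega>, of f] m\<Omega> by (subst integrable_restrict_space) auto
      then show ?thesis by simp
    qed
    then show "integrable (lebesgue_on \<Omega>) (\<lambda>x. L * \<bar>f x\<bar>)" by simp
    show "AE x in lebesgue_on \<Omega>. (\<lambda>n. q' n x * f x) \<longlonglongrightarrow> g x $ i * f x"
      using D
    proof (rule eventually_mono)
      fix x assume "(u has_derivative (\<lambda>v. g x \<bullet> v)) (at x)"
      from has_derivative_difference_quotient[OF this, of "-1" ?e]
      show "(\<lambda>n. q' n x * f x) \<longlonglongrightarrow> g x $ i * f x" by (intro tendsto_intros) (simp add: q'_def inner_axis)
    qed
    show "AE x in lebesgue_on \<Omega>. norm (q' n x * f x) \<le> L * \<bar>f x\<bar>" for n
      using qb' by (intro AE_I2) (auto simp: abs_mult intro!: mult_right_mono)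
    show "(\<lambda>x. q' n x * f x) \<in> borel_measurable (lebesgue_on \<Omega>)" for n
      by (rule borel_measurable_lebesgue_on[OF bm(2)])
    show "(\<lambda>x. g x $ i * f x) \<in> borel_measurable (lebesgue_on \<Omega>)"
      using g test_L2[OF f m\<Omega>] L2_D(1) L2_components by (intro borel_measurable_times) blast+
  qed
  have "(LINT x|lborel. q' n x * f x) = (LINT x|lebesgue_on \<Omega>. q' n x * f x)" for n
  proof (rule onO[OF bm(2)])
    fix x assume "x \<notin> ?S"
    from closure_nonzero_zero[OF this] show "q' n x * f x = 0" by (simp only: mult_zero_right)
  qed
  then have "(\<lambda>n. LINT x|lborel. u x * q n x) \<longlonglongrightarrow> - (LINT x|lebesgue_on \<Omega>. g x $ i * f x)"
    using tendsto_minus[OF lim2] shift by simp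
  then have "(LINT x|lborel. u x * partial i f x) = - (LINT x|lebesgue_on \<Omega>. g x $ i * f x)"
    using lim1 LIMSEQ_unique by blast
  moreover have "(LINT x|lborel. u x * partial i f x) = (LINT x|lebesgue_on \<Omega>. u x * partial i f x)"
  proof (rule onO[OF bm(3)])
    fix x assume "x \<notin> ?S"
    from partial_zero_outside[OF this] show "u x * partial i f x = 0" by (simp only: mult_zero_right)
  qed
  ultimately show "(LINT x|lebesgue_on \<Omega>. u x * partial i f x) = - (LINT x|lebesgue_on \<Omega>. g x $ i * f x)"
    by simp
qed

section \<open>Linearity of weak gradients and their representatives\<close>

lemma is_weak_grad_add:
  assumes "\<Omega> \<in> sets lebesgue" "u \<in> L2 \<Omega>" "v \<in> L2 \<Omega>" "is_weak_grad \<Omega> u g" "is_weak_grad \<Omega> v h"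
  shows "is_weak_grad \<Omega> (\<lambda>x. u x + v x) (\<lambda>x. g x + h x)"
  unfolding is_weak_grad_def
proof (intro conjI ballI allI)
  have gh: "g \<in> L2 \<Omega>" "h \<in> L2 \<Omega>" using assms(4,5) by (auto simp: is_weak_grad_def)
  then show "(\<lambda>x. g x + h x) \<in> L2 \<Omega>" by (rule L2_add)
  fix f i assume f: "f \<in> test_functions \<Omega>"
  have fL: "f \<in> L2 \<Omega>" "partial i f \<in> L2 \<Omega>" using test_L2 partial_test f assms(1) by blast+
  have c: "(\<lambda>x. g x $ i) \<in> L2 \<Omega>" "(\<lambda>x. h x $ i) \<in> L2 \<Omega>" using gh L2_components by blast+
  have "(LINT x|lebesgue_on \<Omega>. u x * partial i f x) = - (LINT x|lebesgue_on \<Omega>. g x $ i * f x)"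
    "(LINT x|lebesgue_on \<Omega>. v x * partial i f x) = - (LINT x|lebesgue_on \<Omega>. h x $ i * f x)"
    using assms(4,5) f unfolding is_weak_grad_def by blast+
  then show "(LINT x|lebesgue_on \<Omega>. (u x + v x) * partial i f x) = - (LINT x|lebesgue_on \<Omega>. (g x + h x) $ i * f x)"
    using L2_mult_integrable[OF assms(2) fL(2)] L2_mult_integrable[OF assms(3) fL(2)]
      L2_mult_integrable[OF c(1) fL(1)] L2_mult_integrable[OF c(2) fL(1)]
    by (simp add: distrib_right)
qed

lemma is_weak_grad_cmult:
  assumes "is_weak_grad \<Omega> u g"
  shows "is_weak_grad \<Omega> (\<lambda>x. c * u x) (\<lambda>x. c *\<^sub>R g x)"
  using assms by (auto simp: is_weak_grad_def L2_scaleR mult.assoc)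

lemma is_weak_grad_diff:
  assumes "\<Omega> \<in> sets lebesgue" "u \<in> L2 \<Omega>" "v \<in> L2 \<Omega>" "is_weak_grad \<Omega> u g" "is_weak_grad \<Omega> v h"
  shows "is_weak_grad \<Omega> (\<lambda>x. u x - v x) (\<lambda>x. g x - h x)"
  using is_weak_grad_add[OF assms(1,2) L2_mult[OF assms(3), of "-1"] assms(4) is_weak_grad_cmult[OF assms(5), of "-1"]]
  by simp

lemma weak_grad_AE:
  assumes "open \<Omega>" "is_weak_grad \<Omega> u g"
  shows "AE x in lebesgue_on \<Omega>. weak_grad \<Omega> u x = g x"
  using weak_grad_unique[OF assms(1) _ assms(2)] someI[of "is_weak_grad \<Omega> u", OF assms(2)]
  unfolding weak_grad_def by blast

lemma is_weak_grad_weak_grad: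
  assumes "u \<in> H1 \<Omega>" shows "is_weak_grad \<Omega> u (weak_grad \<Omega> u)"
  using assms someI_ex[of "is_weak_grad \<Omega> u"] by (auto simp: H1_def weak_grad_def)

lemma weak_grad_L2: "u \<in> H1 \<Omega> \<Longrightarrow> weak_grad \<Omega> u \<in> L2 \<Omega>"
  using is_weak_grad_weak_grad is_weak_grad_def by blast

text \<open>\<open>weak_grad\<close> is an arbitrary representative; uniqueness almost everywhere
  lets its norm be computed from any explicit weak gradient.\<close>

lemma L2_norm_weak_grad:
  assumes "open \<Omega>" "is_weak_grad \<Omega> u g" "u \<in> L2 \<Omega>"
  shows "L2_norm \<Omega> (weak_grad \<Omega> u) = L2_norm \<Omega> g"
proof (rule L2_norm_cong_AE[OF weak_grad_AE[OF assms(1,2)]])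
  show "weak_grad \<Omega> u \<in> L2 \<Omega>" using assms by (intro weak_grad_L2) (auto simp: H1_def)
  show "g \<in> L2 \<Omega>" using assms by (auto simp: is_weak_grad_def)
qed

lemma test_is_weak_grad:
  assumes "open \<Omega>" "f \<in> test_functions \<Omega>'" "bounded \<Omega>"
  shows "is_weak_grad \<Omega> f (classical_grad f)" "classical_grad f \<in> L2 \<Omega>" "f \<in> L2 \<Omega>"
proof -
  obtain L where L: "L-lipschitz_on UNIV f" "\<And>x. norm (classical_grad f x) \<le> L" using test_lipschitz[OF assms(2)] by metis
  note fD = test_functionsD[OF assms(2)]
  obtain C where C: "\<And>x. \<bar>f x\<bar> \<le> C" using smooth_compact_bounded[OF fD(1,2)] by metis
  have m: "\<Omega> \<in> sets lebesgue" using assms(1) by (rule open_sets_lebesgue)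
  show g: "classical_grad f \<in> L2 \<Omega>"
    by (rule L2_bounded[OF assms(3) m borel_measurable_lebesgue_on[OF borel_measurable_continuous_onI[OF continuous_classical_grad[OF fD(1)]]] L(2)])
  show "f \<in> L2 \<Omega>"
    by (rule L2_bounded[OF assms(3) m borel_measurable_lebesgue_on[OF borel_measurable_continuous_onI[OF smooth_continuous[OF fD(1)]]], of C]) (simp add: C)
  show "is_weak_grad \<Omega> f (classical_grad f)"
    by (rule is_weak_grad_lipschitz[OF assms(1) L(1) g]) (intro AE_I2 has_derivative_partial smooth_differentiable fD(1))
qed

text \<open>The case \<open>z = x\<close> of a two-point estimate. The two-point form is the one
  that survives mollification, because averages compare values at two shifted points.\<close>

lemma has_derivative_from_strict:
  fixes v :: scalar_field
  assumes "\<And>e. e > 0 \<Longrightarrow> \<exists>d>0. \<forall>y\<in>ball x d. \<forall>z\<in>ball x d. \<bar>v y - v z - g \<bullet> (y - z)\<bar> \<le> e * norm (y - z)"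
  shows "(v has_derivative (\<lambda>h. g \<bullet> h)) (at x)"
  unfolding has_derivative_at_alt
proof (intro conjI allI impI bounded_linear_inner_right)
  fix e :: real assume "e > 0"
  then obtain d where d: "d > 0" "\<forall>y\<in>ball x d. \<forall>z\<in>ball x d. \<bar>v y - v z - g \<bullet> (y - z)\<bar> \<le> e * norm (y - z)"
    using assms by blast
  then show "\<exists>d>0. \<forall>y. norm (y - x) < d \<longrightarrow> norm (v y - v x - g \<bullet> (y - x)) \<le> e * norm (y - x)"
    by (intro exI[of _ d]) (auto simp: dist_norm norm_minus_commute)
qed

text \<open>An approximating sequence \<open>u\<close> is allowed so that functions which vanish exactly on the
  complement of \<open>\<Omega>\<close>, and are not compactly supported in \<open>\<Omega>\<close>, can be treated after truncation.\<close>

lemma H1_0_limit: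
  fixes u :: "nat \<Rightarrow> scalar_field" and v :: scalar_field
  assumes \<Omega>: "open \<Omega>" "bounded \<Omega>"
    and uL: "\<And>n. L-lipschitz_on UNIV (u n)" and vL: "L-lipschitz_on UNIV v"
    and supp: "\<And>n. closure {x. u n x \<noteq> 0} \<subseteq> \<Omega>"
    and lim: "\<And>x. (\<lambda>n. u n x) \<longlonglongrightarrow> v x"
    and g: "g \<in> L2 \<Omega>"
    and strict: "AE x in lebesgue_on \<Omega>. \<forall>e>0. \<exists>d>0. \<forall>\<^sub>F n in sequentially. \<forall>y\<in>ball x d. \<forall>z\<in>ball x d.
       \<bar>u n y - u n z - g x \<bullet> (y - z)\<bar> \<le> e * norm (y - z)"
  shows "v \<in> H1_0 \<Omega>" "is_weak_grad \<Omega> v g"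
proof -
  have m: "\<Omega> \<in> sets lebesgue" using \<Omega>(1) by (rule open_sets_lebesgue)
  have L0: "L \<ge> 0" using vL by (rule lipschitz_on_nonneg)
  have vc: "continuous_on UNIV v" using vL by (rule lipschitz_on_continuous_on)
  obtain R where R: "\<Omega> \<subseteq> ball 0 R" "R > 0" using bounded_subset_ballD[OF \<Omega>(2), of 0] by blast
  \<comment> \<open>A point outside \<Omega> at which all functions involved vanish. Combined with
    the common Lipschitz constant it bounds them on \<Omega> by \<open>L * (2 * R)\<close>.\<close>
  obtain x0 :: "real^3" where x0: "norm x0 = R" using vector_choose_size[of R] R by auto
  then have "x0 \<notin> \<Omega>" using R by auto
  then have ux0: "u n x0 = 0" for n using supp[of n] closure_nonzero_zero[of x0 "u n"] by blast
  have vx0: "v x0 = 0" using lim[of x0] by (simp add: ux0 LIMSEQ_const_iff)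
  have vb: "\<bar>v x\<bar> \<le> L * (2 * R)" if "x \<in> \<Omega>" for x
  proof -
    have "\<bar>v x\<bar> \<le> L * norm (x - x0)" using lipschitz_onD[OF vL, of x x0] vx0 by (simp add: dist_norm)
    also have "\<dots> \<le> L * (2 * R)"
      using norm_triangle_ineq4[of x x0] x0 R that L0 by (intro mult_left_mono) auto
    finally show ?thesis .
  qed
  have vL2: "v \<in> L2 \<Omega>"
    by (rule L2_bounded[OF \<Omega>(2) m borel_measurable_lebesgue_on[OF borel_measurable_continuous_onI[OF vc]], of "L * (2 * R)"])
       (simp add: vb)
  show wg: "is_weak_grad \<Omega> v g"
  proof (rule is_weak_grad_lipschitz[OF \<Omega>(1) vL g])
    show "AE x in lebesgue_on \<Omega>. (v has_derivative (\<lambda>h. g x \<bullet> h)) (at x)"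
      using strict
    proof (rule eventually_mono)
      fix x assume s: "\<forall>e>0. \<exists>d>0. \<forall>\<^sub>F n in sequentially. \<forall>y\<in>ball x d. \<forall>z\<in>ball x d.
       \<bar>u n y - u n z - g x \<bullet> (y - z)\<bar> \<le> e * norm (y - z)"
      show "(v has_derivative (\<lambda>h. g x \<bullet> h)) (at x)"
      proof (rule has_derivative_from_strict)
        fix e :: real assume "e > 0"
        then obtain d where d: "d > 0" "\<forall>\<^sub>F n in sequentially. \<forall>y\<in>ball x d. \<forall>z\<in>ball x d.
          \<bar>u n y - u n z - g x \<bullet> (y - z)\<bar> \<le> e * norm (y - z)" using s by blast
        have "\<bar>v y - v z - g x \<bullet> (y - z)\<bar> \<le> e * norm (y - z)" if "y \<in> ball x d" "z \<in> ball x d" for y z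
        proof (rule tendsto_upperbound)
          show "(\<lambda>n. \<bar>u n y - u n z - g x \<bullet> (y - z)\<bar>) \<longlonglongrightarrow> \<bar>v y - v z - g x \<bullet> (y - z)\<bar>"
            by (intro tendsto_intros lim)
          show "\<forall>\<^sub>F n in sequentially. \<bar>u n y - u n z - g x \<bullet> (y - z)\<bar> \<le> e * norm (y - z)"
            using d(2) by (rule eventually_mono) (use that in blast)
        qed simp
        then show "\<exists>d>0. \<forall>y\<in>ball x d. \<forall>z\<in>ball x d. \<bar>v y - v z - g x \<bullet> (y - z)\<bar> \<le> e * norm (y - z)"
          using d(1) by blast
      qed
    qed
  qed
  \<comment> \<open>The mollification radius has to tend to zero and to be small enough, depending
    on \<open>n\<close>, that the closed neighbourhood of this radius around the support of
    \<open>u n\<close> remains in \<Omega>.\<close>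
  have "\<exists>r. r > 0 \<and> r \<le> 1 / real (Suc n) \<and> (\<forall>x. (\<exists>y. dist x y \<le> r \<and> y \<in> closure {x. u n x \<noteq> 0}) \<longrightarrow> x \<in> \<Omega>)" for n
  proof -
    have "compact (closure {x. u n x \<noteq> 0})"
      using supp[of n] \<Omega>(2) by (meson bounded_subset closed_closure compact_eq_bounded_closed)
    then obtain d where d: "d > 0" "(\<Union>x\<in>closure {x. u n x \<noteq> 0}. ball x d) \<subseteq> \<Omega>"
      using compact_subset_open_imp_ball_epsilon_subset[OF _ \<Omega>(1) supp] by blast
    show ?thesis
    proof (intro exI[of _ "min (d / 2) (1 / real (Suc n))"] conjI allI impI)
      fix x assume "\<exists>y. dist x y \<le> min (d / 2) (1 / real (Suc n)) \<and> y \<in> closure {x. u n x \<noteq> 0}"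
      then obtain y where "dist x y \<le> d / 2" "y \<in> closure {x. u n x \<noteq> 0}" by auto
      then have "x \<in> ball y d" using d(1) by (auto simp: dist_commute)
      then show "x \<in> \<Omega>" using d(2) \<open>y \<in> _\<close> by blast
    qed (use d(1) in auto)
  qed
  then obtain r where r: "\<And>n. r n > 0" "\<And>n. r n \<le> 1 / real (Suc n)"
    "\<And>n x y. dist x y \<le> r n \<Longrightarrow> y \<in> closure {x. u n x \<noteq> 0} \<Longrightarrow> x \<in> \<Omega>" by metis
  have bd: "bounded {x. u n x \<noteq> 0}" for n
    using bounded_subset[OF \<Omega>(2), of "{x. u n x \<noteq> 0}"] supp[of n] closure_subset[of "{x. u n x \<noteq> 0}"] by blast
  have "\<exists>F. smooth F \<and> L-lipschitz_on UNIV F \<and> (\<forall>x. \<bar>F x - u n x\<bar> \<le> L * r n) \<and>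
    (\<forall>x. F x \<noteq> 0 \<longrightarrow> (\<exists>y. dist x y < r n \<and> u n y \<noteq> 0)) \<and>
    (\<forall>x g d e. d > r n \<longrightarrow> (\<forall>y\<in>ball x d. \<forall>z\<in>ball x d. \<bar>u n y - u n z - g \<bullet> (y - z)\<bar> \<le> e * norm (y - z))
       \<longrightarrow> norm (classical_grad F x - g) \<le> e)" for n
    by (rule mollify[OF uL[of n] bd[of n] r(1)[of n]]) blast
  then obtain F where F: "\<And>n. smooth (F n)" "\<And>n. L-lipschitz_on UNIV (F n)" "\<And>n x. \<bar>F n x - u n x\<bar> \<le> L * r n"
    "\<And>n x. F n x \<noteq> 0 \<Longrightarrow> \<exists>y. dist x y < r n \<and> u n y \<noteq> 0"
    "\<And>n x g d e. d > r n \<Longrightarrow> \<forall>y\<in>ball x d. \<forall>z\<in>ball x d. \<bar>u n y - u n z - g \<bullet> (y - z)\<bar> \<le> e * norm (y - z)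
       \<Longrightarrow> norm (classical_grad (F n) x - g) \<le> e" by metis
  have r0: "r \<longlonglongrightarrow> 0"
    by (rule tendsto_sandwich[OF _ _ tendsto_const LIMSEQ_Suc[OF lim_const_over_n[of 1]]]) (use r in \<open>auto intro!: always_eventually less_imp_le simp del: of_nat_Suc\<close>)
  have Ft: "F n \<in> test_functions \<Omega>" for n
  proof -
    let ?K = "closure {x. u n x \<noteq> 0}"
    have sub: "closure {x. F n x \<noteq> 0} \<subseteq> \<Omega>"
    proof
      fix x assume "x \<in> closure {x. F n x \<noteq> 0}"
      have "closed {x. \<exists>y\<in>?K. dist x y \<le> r n}"
      proof -
        have "closed (\<Union>y\<in>?K. \<Union>s\<in>cball 0 (r n). {y + s})" by (intro closed_compact_sums closed_closure compact_cball)
        moreover have "(\<Union>y\<in>?K. \<Union>s\<in>cball 0 (r n). {y + s}) = {x. \<exists>y\<in>?K. dist x y \<le> r n}"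
        proof safe
          fix x y assume "y \<in> ?K" "dist x y \<le> r n"
          then show "x \<in> (\<Union>y\<in>?K. \<Union>s\<in>cball 0 (r n). {y + s})"
            by (intro UN_I[of y] UN_I[of "x - y"]) (auto simp: dist_norm norm_minus_commute)
        next
          fix y s :: "real^3" assume "y \<in> ?K" "s \<in> cball 0 (r n)"
          then show "\<exists>ya\<in>?K. dist (y + s) ya \<le> r n" by (intro bexI[of _ y]) (auto simp: dist_norm)
        qed
        ultimately show ?thesis by simp
      qed
      moreover have "{x. F n x \<noteq> 0} \<subseteq> {x. \<exists>y\<in>?K. dist x y \<le> r n}"
        using F(4)[of n] closure_subset[of "{x. u n x \<noteq> 0}"] by (fastforce intro: less_imp_le)
      ultimately have "closure {x. F n x \<noteq> 0} \<subseteq> {x. \<exists>y\<in>?K. dist x y \<le> r n}" by (rule closure_minimal[rotated])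
      then show "x \<in> \<Omega>" using \<open>x \<in> _\<close> r(3)[of x _ n] by blast
    qed
    then have "compact (closure {x. F n x \<noteq> 0})"
      using \<Omega>(2) by (meson bounded_subset closed_closure compact_eq_bounded_closed)
    then show ?thesis using sub F(1) by (simp only: test_functions_iff)
  qed
  have Fm: "F n \<in> borel_measurable (lebesgue_on \<Omega>)" "classical_grad (F n) \<in> borel_measurable (lebesgue_on \<Omega>)" for n
    using F(1) by (intro borel_measurable_lebesgue_on borel_measurable_continuous_onI smooth_continuous continuous_classical_grad; simp)+
  have Flim: "(\<lambda>n. F n x) \<longlonglongrightarrow> v x" for x
  proof -
    have "(\<lambda>n. L * r n) \<longlonglongrightarrow> L * 0" by (intro tendsto_intros r0)
    then have "(\<lambda>n. F n x - u n x) \<longlonglongrightarrow> 0"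
      using F(3) by (intro Lim_null_comparison[of "\<lambda>n. F n x - u n x" "\<lambda>n. L * r n"]) auto
    from tendsto_add[OF this lim[of x]] show ?thesis by simp
  qed
  have Gb: "norm (classical_grad (F n) x) \<le> L" for n x
    by (rule classical_grad_lipschitz_bound[OF F(2) smooth_differentiable[OF F(1)]])
  \<comment> \<open>The ball on which \<open>u n\<close> is nearly linear has a radius
    \<open>d\<close> independent of \<open>n\<close>, so it eventually contains the mollification
    radius \<open>r n\<close> and the gradient bound for \<open>F n\<close> applies. Together with
    the bound \<open>L\<close> this gives convergence of gradients in \<open>L2\<close>.\<close>
  have Glim: "AE x in lebesgue_on \<Omega>. (\<lambda>n. classical_grad (F n) x) \<longlonglongrightarrow> g x"
    using strict
  proof (rule eventually_mono)
    fix x assume s: "\<forall>e>0. \<exists>d>0. \<forall>\<^sub>F n in sequentially. \<forall>y\<in>ball x d. \<forall>z\<in>ball x d.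
       \<bar>u n y - u n z - g x \<bullet> (y - z)\<bar> \<le> e * norm (y - z)"
    show "(\<lambda>n. classical_grad (F n) x) \<longlonglongrightarrow> g x"
    proof (rule tendstoI)
      fix e :: real assume e: "e > 0"
      then have "e / 2 > 0" by simp
      with s obtain d where d: "d > 0" "\<forall>\<^sub>F n in sequentially. \<forall>y\<in>ball x d. \<forall>z\<in>ball x d.
          \<bar>u n y - u n z - g x \<bullet> (y - z)\<bar> \<le> (e / 2) * norm (y - z)" by blast
      have "\<forall>\<^sub>F n in sequentially. r n < d" using order_tendstoD(2)[OF r0 d(1)] .
      then show "\<forall>\<^sub>F n in sequentially. dist (classical_grad (F n) x) (g x) < e"
        using d(2)
      proof eventually_elim
        case (elim n)
        have "norm (classical_grad (F n) x - g x) \<le> e / 2" by (rule F(5)[OF elim])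
        then show ?case using e by (simp add: dist_norm)
      qed
    qed
  qed
  have conv: "(\<lambda>n. (L2_norm \<Omega> (\<lambda>x. v x - F n x))\<^sup>2) \<longlonglongrightarrow> 0"
  proof -
    have "(\<lambda>n. LINT x|lebesgue_on \<Omega>. (norm (v x - F n x))\<^sup>2) \<longlonglongrightarrow> (LINT x|lebesgue_on \<Omega>. 0)"
    proof (rule integral_dominated_convergence)
      have "finite_measure (lebesgue_on \<Omega>)" using \<Omega>(2) m by (intro finite_measure_lebesgue_on bounded_set_imp_lmeasurable)
      then show "integrable (lebesgue_on \<Omega>) (\<lambda>x. (2 * (L * (2 * R)))\<^sup>2)" by (rule finite_measure.integrable_const)
      show "AE x in lebesgue_on \<Omega>. (\<lambda>n. (norm (v x - F n x))\<^sup>2) \<longlonglongrightarrow> 0"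
      proof (rule AE_I2)
        fix x
        from tendsto_power[OF tendsto_norm[OF tendsto_diff[OF tendsto_const Flim[of x]]], of "v x" 2]
        show "(\<lambda>n. (norm (v x - F n x))\<^sup>2) \<longlonglongrightarrow> 0" by simp
      qed
      show "AE x in lebesgue_on \<Omega>. norm ((norm (v x - F n x))\<^sup>2) \<le> (2 * (L * (2 * R)))\<^sup>2" for n
      proof (rule AE_I2)
        fix x assume x: "x \<in> space (lebesgue_on \<Omega>)"
        have Fx0: "F n x0 = 0" using test_functionsD(3)[OF Ft[of n]] closure_nonzero_zero[of x0 "F n"] \<open>x0 \<notin> \<Omega>\<close> by blast
        have "\<bar>F n x\<bar> \<le> L * norm (x - x0)" using lipschitz_onD[OF F(2)[of n], of x x0] Fx0 by (simp add: dist_norm)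
        also have "\<dots> \<le> L * (2 * R)"
          using norm_triangle_ineq4[of x x0] x0 R x L0 by (intro mult_left_mono) auto
        finally have "\<bar>F n x\<bar> \<le> L * (2 * R)" .
        then have "norm (v x - F n x) \<le> 2 * (L * (2 * R))" using vb[of x] x by simp
        then have "(norm (v x - F n x))\<^sup>2 \<le> (2 * (L * (2 * R)))\<^sup>2" by (intro power_mono norm_ge_zero)
        then show "norm ((norm (v x - F n x))\<^sup>2) \<le> (2 * (L * (2 * R)))\<^sup>2" by (simp only: real_norm_def abs_power2 power2_abs)
      qed
    qed (use Fm(1) L2_D(1)[OF vL2] in auto)
    then show ?thesis by (simp add: L2_norm_sq_integral)
  qed
  have convg: "(\<lambda>n. (L2_norm \<Omega> (\<lambda>x. g x - classical_grad (F n) x))\<^sup>2) \<longlonglongrightarrow> 0"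
  proof -
    have "(\<lambda>n. LINT x|lebesgue_on \<Omega>. (norm (g x - classical_grad (F n) x))\<^sup>2) \<longlonglongrightarrow> (LINT x|lebesgue_on \<Omega>. 0)"
    proof (rule integral_dominated_convergence)
      have "finite_measure (lebesgue_on \<Omega>)" using \<Omega>(2) m by (intro finite_measure_lebesgue_on bounded_set_imp_lmeasurable)
      then have "integrable (lebesgue_on \<Omega>) (\<lambda>x. 2 * L\<^sup>2)" by (rule finite_measure.integrable_const)
      then show "integrable (lebesgue_on \<Omega>) (\<lambda>x. 2 * (norm (g x))\<^sup>2 + 2 * L\<^sup>2)"
        using L2_D(2)[OF g] by simp
      show "AE x in lebesgue_on \<Omega>. (\<lambda>n. (norm (g x - classical_grad (F n) x))\<^sup>2) \<longlonglongrightarrow> 0"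
        using Glim
      proof (rule eventually_mono)
        fix x assume "(\<lambda>n. classical_grad (F n) x) \<longlonglongrightarrow> g x"
        from tendsto_power[OF tendsto_norm[OF tendsto_diff[OF tendsto_const this]], of "g x" 2]
        show "(\<lambda>n. (norm (g x - classical_grad (F n) x))\<^sup>2) \<longlonglongrightarrow> 0" by simp
      qed
      show "AE x in lebesgue_on \<Omega>. norm ((norm (g x - classical_grad (F n) x))\<^sup>2) \<le> 2 * (norm (g x))\<^sup>2 + 2 * L\<^sup>2" for n
      proof (rule AE_I2)
        fix x
        have "(norm (g x - classical_grad (F n) x))\<^sup>2 \<le> 2 * (norm (g x))\<^sup>2 + 2 * (norm (classical_grad (F n) x))\<^sup>2"
          using norm_add_sq_le[of "g x" "- classical_grad (F n) x"] by simp
        moreover have "(norm (classical_grad (F n) x))\<^sup>2 \<le> L\<^sup>2" by (intro power_mono Gb norm_ge_zero)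
        ultimately show "norm ((norm (g x - classical_grad (F n) x))\<^sup>2) \<le> 2 * (norm (g x))\<^sup>2 + 2 * L\<^sup>2" by simp
      qed
    qed (use Fm(2) L2_D(1)[OF g] in auto)
    then show ?thesis by (simp add: L2_norm_sq_integral)
  qed
  have H: "H1_norm \<Omega> (\<lambda>x. v x - F n x) = sqrt ((L2_norm \<Omega> (\<lambda>x. v x - F n x))\<^sup>2 + (L2_norm \<Omega> (\<lambda>x. g x - classical_grad (F n) x))\<^sup>2)" for n
  proof -
    note t = test_is_weak_grad[OF \<Omega>(1) Ft[of n] \<Omega>(2)]
    have "L2_norm \<Omega> (weak_grad \<Omega> (\<lambda>x. v x - F n x)) = L2_norm \<Omega> (\<lambda>x. g x - classical_grad (F n) x)"
      by (intro L2_norm_weak_grad \<Omega> is_weak_grad_diff m vL2 wg t L2_diff)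
    then show ?thesis by (simp add: H1_norm_def)
  qed
  have "(\<lambda>n. H1_norm \<Omega> (\<lambda>x. v x - F n x)) \<longlonglongrightarrow> sqrt (0 + 0)"
    unfolding H by (intro tendsto_intros conv convg)
  then have Hlim: "(\<lambda>n. H1_norm \<Omega> (\<lambda>x. v x - F n x)) \<longlonglongrightarrow> 0" by simp
  show "v \<in> H1_0 \<Omega>"
    unfolding H1_0_def
  proof (intro CollectI conjI allI impI)
    show "v \<in> H1 \<Omega>" using vL2 wg by (auto simp: H1_def)
    fix \<delta> :: real assume "\<delta> > 0"
    from order_tendstoD(2)[OF Hlim this] obtain n where "H1_norm \<Omega> (\<lambda>x. v x - F n x) < \<delta>"
      by (auto simp: eventually_sequentially)
    then show "\<exists>f\<in>test_functions \<Omega>. H1_norm \<Omega> (\<lambda>x. v x - f x) < \<delta>" using Ft by blast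
  qed
qed

section \<open>Local oscillation estimates\<close>

lemma nn_integral_lborel_shift:
  fixes h :: "'a::euclidean_space \<Rightarrow> ennreal"
  assumes "h \<in> borel_measurable borel"
  shows "(\<integral>\<^sup>+x. h (x + c) \<partial>lborel) = (\<integral>\<^sup>+x. h x \<partial>lborel)"
proof -
  have "(\<integral>\<^sup>+x. h x \<partial>lborel) = (\<integral>\<^sup>+x. h x \<partial>distr lborel borel ((+) c))"
    by (simp add: lborel_distr_plus)
  also have "\<dots> = (\<integral>\<^sup>+x. h (c + x) \<partial>lborel)"
    using assms by (subst nn_integral_distr) auto
  finally show ?thesis by (simp add: add.commute)
qed

text \<open>Fundamental theorem along the segment from \<open>x\<close> to \<open>x + z\<close>,
  then Cauchy-Schwarz in the parameter \<open>t\<close>. Extended nonnegative integrals allow a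
  later exchange of the order of integration on the strength of measurability alone.\<close>

lemma increment_sq_le_integral:
  assumes f: "smooth f"
  shows "ennreal ((f (x + z) - f x)\<^sup>2) \<le>
    (\<integral>\<^sup>+t. indicator {0..1} t * ennreal ((norm z)\<^sup>2 * (norm (classical_grad f (x + t *\<^sub>R z)))\<^sup>2) \<partial>lborel)"
proof -
  define g where "g t = classical_grad f (x + t *\<^sub>R z) \<bullet> z" for t
  define G where "G t = (norm z)\<^sup>2 * (norm (classical_grad f (x + t *\<^sub>R z)))\<^sup>2" for t
  define m where "m = f (x + z) - f x"
  have gc: "continuous_on A g" and Gc: "continuous_on A G" for A
    unfolding g_def G_def
    by (intro continuous_intros continuous_on_compose2[OF continuous_classical_grad[OF f, of UNIV]]; simp)+
  have "(g has_integral (f (x + 1 *\<^sub>R z) - f (x + 0 *\<^sub>R z))) {0..1}"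
  proof (rule fundamental_theorem_of_calculus)
    fix t :: real
    have "((\<lambda>t. x + t *\<^sub>R z) has_derivative (\<lambda>t. t *\<^sub>R z)) (at t within {0..1})"
      by (auto intro!: derivative_eq_intros)
    from has_derivative_compose[OF this has_derivative_partial[OF smooth_differentiable[OF f]]]
    show "((\<lambda>t. f (x + t *\<^sub>R z)) has_vector_derivative g t) (at t within {0..1})"
      by (simp add: has_vector_derivative_def g_def)
  qed simp
  then have gI: "(g has_integral m) {0..1}" by (simp add: m_def)
  have g2: "((\<lambda>t. (g t)\<^sup>2) has_integral (integral {0..1} (\<lambda>t. (g t)\<^sup>2))) {0..1}"
    using gc by (intro integrable_integral integrable_continuous_real continuous_intros)
  have GI: "(G has_integral (integral {0..1} G)) {0..1}"
    using Gc by (intro integrable_integral integrable_continuous_real)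
  \<comment> \<open>The integrand is the square of \<open>g t - m\<close> with \<open>m\<close> the
    mean of \<open>g\<close> over the unit interval; its nonnegativity gives
    \<open>m\<^sup>2\<close> as a lower bound for the mean of the square.\<close>
  have "((\<lambda>t. (g t)\<^sup>2 - (2 * m) * g t + m\<^sup>2) has_integral (integral {0..1} (\<lambda>t. (g t)\<^sup>2) - (2 * m) * m + m\<^sup>2)) {0..1}"
    using has_integral_add[OF has_integral_diff[OF g2 has_integral_mult_right[OF gI, of "2 * m"]] has_integral_const_real[of "m\<^sup>2" 0 1]]
    by simp
  then have "0 \<le> integral {0..1} (\<lambda>t. (g t)\<^sup>2) - (2 * m) * m + m\<^sup>2"
  proof (rule has_integral_nonneg)
    fix t
    have "(g t)\<^sup>2 - (2 * m) * g t + m\<^sup>2 = (g t - m)\<^sup>2" by (simp add: power2_diff)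
    then show "0 \<le> (g t)\<^sup>2 - (2 * m) * g t + m\<^sup>2" by simp
  qed
  then have "m\<^sup>2 \<le> integral {0..1} (\<lambda>t. (g t)\<^sup>2)" by (simp add: power2_eq_square)
  also have "\<dots> \<le> integral {0..1} G"
  proof (rule has_integral_le[OF g2 GI])
    fix t
    have "\<bar>g t\<bar> \<le> norm (classical_grad f (x + t *\<^sub>R z)) * norm z" unfolding g_def by (rule Cauchy_Schwarz_ineq2)
    then have "\<bar>g t\<bar>\<^sup>2 \<le> (norm (classical_grad f (x + t *\<^sub>R z)) * norm z)\<^sup>2" by (intro power_mono) auto
    then show "(g t)\<^sup>2 \<le> G t" by (simp add: G_def power_mult_distrib mult.commute)
  qed
  finally have "ennreal (m\<^sup>2) \<le> ennreal (integral {0..1} G)" by (rule ennreal_leI)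
  also have "\<dots> = (\<integral>\<^sup>+t. indicator {0..1} t * ennreal (G t) \<partial>lborel)"
  proof -
    let ?G = "\<lambda>t. if t \<in> {0..1} then G t else 0"
    have "?G = (\<lambda>t. indicator {0..1} t * G t)" by auto
    moreover have "(\<lambda>t. indicator {0..1} t * G t) \<in> borel_measurable borel"
      using borel_measurable_continuous_onI[OF Gc] by measurable
    ultimately have "?G \<in> borel_measurable borel" by metis
    then have "(\<integral>\<^sup>+t. ennreal (?G t) \<partial>lborel) = ennreal (integral {0..1} G)"
    proof (rule nn_integral_has_integral_lborel)
      show "(?G has_integral integral {0..1} G) UNIV" using GI by (simp only: has_integral_restrict_UNIV)
    qed (simp add: G_def)
    moreover have "(\<integral>\<^sup>+t. ennreal (?G t) \<partial>lborel) = (\<integral>\<^sup>+t. indicator {0..1} t * ennreal (G t) \<partial>lborel)"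
      by (intro nn_integral_cong) (auto simp: indicator_def)
    ultimately show ?thesis by simp
  qed
  finally show ?thesis by (simp add: m_def G_def)
qed

lemma L2_norm_sq_nn:
  assumes "f \<in> L2 \<Omega>"
  shows "ennreal ((L2_norm \<Omega> f)\<^sup>2) = (\<integral>\<^sup>+x. ennreal ((norm (f x))\<^sup>2) \<partial>lebesgue_on \<Omega>)"
  unfolding L2_norm_sq_integral using L2_D(2)[OF assms] by (subst nn_integral_eq_integral) auto

lemma nn_integral_lebesgue_on_eq:
  fixes h :: "'a::euclidean_space \<Rightarrow> ennreal"
  assumes "h \<in> borel_measurable borel" "\<Omega> \<in> sets lebesgue" "\<And>x. x \<notin> \<Omega> \<Longrightarrow> h x = 0"
  shows "(\<integral>\<^sup>+x. h x \<partial>lebesgue_on \<Omega>) = (\<integral>\<^sup>+x. h x \<partial>lborel)"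
proof -
  have "(\<integral>\<^sup>+x. h x \<partial>lebesgue_on \<Omega>) = (\<integral>\<^sup>+x. h x * indicator \<Omega> x \<partial>lebesgue)"
    using assms(2) by (intro nn_integral_restrict_space) simp
  also have "\<dots> = (\<integral>\<^sup>+x. h x \<partial>lebesgue)"
    using assms(3) by (intro nn_integral_cong) (auto simp: indicator_def)
  also have "\<dots> = (\<integral>\<^sup>+x. h x \<partial>lborel)" using assms(1) by (intro nn_integral_completion)
  finally show ?thesis .
qed

lemma nn_integral_lebesgue_on_le:
  fixes h :: "'a::euclidean_space \<Rightarrow> ennreal"
  assumes "h \<in> borel_measurable borel" "\<Omega> \<in> sets lebesgue"
  shows "(\<integral>\<^sup>+x. h x \<partial>lebesgue_on \<Omega>) \<le> (\<integral>\<^sup>+x. h x \<partial>lborel)"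
proof -
  have "(\<integral>\<^sup>+x. h x \<partial>lebesgue_on \<Omega>) = (\<integral>\<^sup>+x. h x * indicator \<Omega> x \<partial>lebesgue)"
    using assms(2) by (intro nn_integral_restrict_space) simp
  also have "\<dots> \<le> (\<integral>\<^sup>+x. h x \<partial>lebesgue)"
    by (intro nn_integral_mono) (auto simp: indicator_def)
  also have "\<dots> = (\<integral>\<^sup>+x. h x \<partial>lborel)" using assms(1) by (intro nn_integral_completion)
  finally show ?thesis .
qed

lemma emeasure_cball_measure:
  "emeasure lborel (cball c r :: 'a::euclidean_space set) = ennreal (measure lborel (cball c r))"
  using emeasure_bounded_finite[OF bounded_cball, of c r] by (intro emeasure_eq_ennreal_measure) auto

lemma pair_measurable:
  fixes g :: "real^3 \<Rightarrow> real^3 \<Rightarrow> real" and S :: "(real^3) set"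
  assumes "continuous_on UNIV (\<lambda>p. g (fst p) (snd p))" "S \<in> sets borel"
  shows "(\<lambda>(x, z). indicator S z * ennreal (g x z)) \<in> borel_measurable (lborel \<Otimes>\<^sub>M lborel)"
proof -
  have "(\<lambda>p. g (fst p) (snd p)) \<in> borel_measurable (borel \<Otimes>\<^sub>M borel)"
    unfolding borel_prod using assms(1) by (rule borel_measurable_continuous_onI)
  then have m1: "(\<lambda>p. g (fst p) (snd p)) \<in> borel_measurable (lborel \<Otimes>\<^sub>M lborel)"
    by (simp cong: measurable_cong_sets sets_pair_measure_cong)
  have [measurable]: "S \<in> sets lborel" using assms(2) by simp
  show ?thesis unfolding split_beta using m1 by measurable
qed

section \<open>Translation and oscillation estimates for test functions\<close>

context
  fixes f :: scalar_field and \<Omega> :: "(real^3) set"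
  assumes f: "f \<in> test_functions \<Omega>" and \<Omega>: "open \<Omega>" "bounded \<Omega>"
begin

text \<open>A test function and its gradient vanish off \<Omega>, so integrals over all of space are
  norms on \<Omega>. Working in the whole space is what allows sampling balls to leave
  \<Omega>.\<close>

lemma grad_nn: "(\<integral>\<^sup>+x. ennreal ((norm (classical_grad f x))\<^sup>2) \<partial>lborel) = ennreal ((L2_norm \<Omega> (classical_grad f))\<^sup>2)"
proof -
  have "classical_grad f x = 0" if "x \<notin> \<Omega>" for x
    using that test_functionsD(3)[OF f] partial_zero_outside[of x f] by (auto simp: classical_grad_def vec_eq_iff)
  moreover have "(\<lambda>x. ennreal ((norm (classical_grad f x))\<^sup>2)) \<in> borel_measurable borel"
    using borel_measurable_continuous_onI[OF continuous_classical_grad[OF test_functionsD(1)[OF f]]] by measurable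
  ultimately show ?thesis
    unfolding L2_norm_sq_nn[OF test_is_weak_grad(2)[OF \<Omega>(1) f \<Omega>(2)]]
    by (intro nn_integral_lebesgue_on_eq[symmetric] open_sets_lebesgue \<Omega>) auto
qed

lemma value_nn: "(\<integral>\<^sup>+x. ennreal ((f x)\<^sup>2) \<partial>lborel) = ennreal ((L2_norm \<Omega> f)\<^sup>2)"
proof -
  have "f x = 0" if "x \<notin> \<Omega>" for x
    using that test_functionsD(3)[OF f] closure_nonzero_zero[of x f] by auto
  moreover have "(\<lambda>x. ennreal ((f x)\<^sup>2)) \<in> borel_measurable borel"
    using borel_measurable_continuous_onI[OF smooth_continuous[OF test_functionsD(1)[OF f]]] by measurable
  ultimately show ?thesis
    unfolding L2_norm_sq_nn[OF test_is_weak_grad(3)[OF \<Omega>(1) f \<Omega>(2)]]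
    by (subst nn_integral_lebesgue_on_eq[symmetric, of _ \<Omega>]) (auto intro: \<Omega> open_sets_lebesgue)
qed

text \<open>After the segment bound is integrated over \<open>x\<close> and the order exchanged,
  translation invariance makes the inner integral the same for every parameter
  \<open>t\<close>.\<close>

lemma translation_estimate:
  "(\<integral>\<^sup>+x. ennreal ((f (x + z) - f x)\<^sup>2) \<partial>lborel) \<le> ennreal ((norm z)\<^sup>2 * (L2_norm \<Omega> (classical_grad f))\<^sup>2)"
proof -
  let ?G = "\<lambda>x. ennreal ((norm (classical_grad f x))\<^sup>2)"
  have cg: "continuous_on UNIV (classical_grad f)" using continuous_classical_grad test_functionsD(1)[OF f] by blast
  have Gm: "?G \<in> borel_measurable borel"
    using borel_measurable_continuous_onI[OF cg] by measurable
  have Gm2: "(\<lambda>(x, t). indicator {0..1::real} t * ennreal ((norm z)\<^sup>2 * (norm (classical_grad f (x + t *\<^sub>R z)))\<^sup>2))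
      \<in> borel_measurable (lborel \<Otimes>\<^sub>M lborel)"
  proof -
    have "continuous_on UNIV (\<lambda>p. (norm z)\<^sup>2 * (norm (classical_grad f (fst p + snd p *\<^sub>R z)))\<^sup>2)"
      by (intro continuous_intros continuous_on_compose2[OF cg]) auto
    then have "(\<lambda>p. (norm z)\<^sup>2 * (norm (classical_grad f (fst p + snd p *\<^sub>R z)))\<^sup>2) \<in> borel_measurable (borel \<Otimes>\<^sub>M borel)"
      unfolding borel_prod by (rule borel_measurable_continuous_onI)
    then have m1: "(\<lambda>p. (norm z)\<^sup>2 * (norm (classical_grad f (fst p + snd p *\<^sub>R z)))\<^sup>2) \<in> borel_measurable (lborel \<Otimes>\<^sub>M lborel)"
      by (simp cong: measurable_cong_sets sets_pair_measure_cong)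
    show ?thesis unfolding split_beta using m1 by measurable
  qed
  have "(\<integral>\<^sup>+x. ennreal ((f (x + z) - f x)\<^sup>2) \<partial>lborel) \<le>
     (\<integral>\<^sup>+x. (\<integral>\<^sup>+t. indicator {0..1::real} t * ennreal ((norm z)\<^sup>2 * (norm (classical_grad f (x + t *\<^sub>R z)))\<^sup>2) \<partial>lborel) \<partial>lborel)"
    by (intro nn_integral_mono increment_sq_le_integral test_functionsD(1)[OF f])
  also have "\<dots> = (\<integral>\<^sup>+t. (\<integral>\<^sup>+x. indicator {0..1::real} t * ennreal ((norm z)\<^sup>2 * (norm (classical_grad f (x + t *\<^sub>R z)))\<^sup>2) \<partial>lborel) \<partial>lborel)"
    by (rule pair_sigma_finite.Fubini'[symmetric, OF _ Gm2]) (simp add: pair_sigma_finite_def sigma_finite_lborel)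
  also have "\<dots> = (\<integral>\<^sup>+t. indicator {0..1::real} t * (ennreal ((norm z)\<^sup>2) * ennreal ((L2_norm \<Omega> (classical_grad f))\<^sup>2)) \<partial>lborel)"
  proof (rule nn_integral_cong)
    fix t :: real
    have m: "(\<lambda>x. ennreal ((norm (classical_grad f (x + t *\<^sub>R z)))\<^sup>2)) \<in> borel_measurable lborel"
      using measurable_compose[OF _ Gm, of "\<lambda>x. x + t *\<^sub>R z" borel] by simp
    have "(\<integral>\<^sup>+x. indicator {0..1::real} t * ennreal ((norm z)\<^sup>2 * (norm (classical_grad f (x + t *\<^sub>R z)))\<^sup>2) \<partial>lborel) =
      (\<integral>\<^sup>+x. (indicator {0..1::real} t * ennreal ((norm z)\<^sup>2)) * ennreal ((norm (classical_grad f (x + t *\<^sub>R z)))\<^sup>2) \<partial>lborel)"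
      by (simp add: ennreal_mult mult.assoc)
    also have "\<dots> = indicator {0..1::real} t * ennreal ((norm z)\<^sup>2) * (\<integral>\<^sup>+x. ennreal ((norm (classical_grad f (x + t *\<^sub>R z)))\<^sup>2) \<partial>lborel)"
      by (rule nn_integral_cmult[OF m])
    also have "(\<integral>\<^sup>+x. ennreal ((norm (classical_grad f (x + t *\<^sub>R z)))\<^sup>2) \<partial>lborel) = ennreal ((L2_norm \<Omega> (classical_grad f))\<^sup>2)"
      using nn_integral_lborel_shift[OF Gm, of "t *\<^sub>R z"] grad_nn by simp
    finally show "(\<integral>\<^sup>+x. indicator {0..1::real} t * ennreal ((norm z)\<^sup>2 * (norm (classical_grad f (x + t *\<^sub>R z)))\<^sup>2) \<partial>lborel) =
       indicator {0..1::real} t * (ennreal ((norm z)\<^sup>2) * ennreal ((L2_norm \<Omega> (classical_grad f))\<^sup>2))"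
      by (simp add: mult.assoc)
  qed
  also have "\<dots> = ennreal ((norm z)\<^sup>2 * (L2_norm \<Omega> (classical_grad f))\<^sup>2)"
    by (subst nn_integral_multc) (auto simp: ennreal_mult)
  finally show ?thesis .
qed

text \<open>This takes the role of a Poincare inequality on patches: with the order of integration
  exchanged, each shift \<open>z\<close> in the ball contributes a translation estimate with
  \<open>norm z \<le> \<rho>\<close>.\<close>

lemma local_oscillation_total:
  "(\<integral>\<^sup>+x. (\<integral>\<^sup>+z. indicator (cball (0::real^3) \<rho>) z * ennreal ((f (x + z) - f x)\<^sup>2) \<partial>lborel) \<partial>lborel)
     \<le> ennreal (measure lborel (cball 0 \<rho> :: (real^3) set) * (\<rho>\<^sup>2 * (L2_norm \<Omega> (classical_grad f))\<^sup>2))"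
proof -
  have fc: "continuous_on UNIV f" using smooth_continuous test_functionsD(1)[OF f] by blast
  have pm: "(\<lambda>(x, z). indicator (cball 0 \<rho>) z * ennreal ((f (x + z) - f x)\<^sup>2)) \<in> borel_measurable (lborel \<Otimes>\<^sub>M lborel)"
    by (rule pair_measurable) (auto intro!: continuous_intros continuous_on_compose2[OF fc])
  have "(\<integral>\<^sup>+x. (\<integral>\<^sup>+z. indicator (cball (0::real^3) \<rho>) z * ennreal ((f (x + z) - f x)\<^sup>2) \<partial>lborel) \<partial>lborel) =
    (\<integral>\<^sup>+z. (\<integral>\<^sup>+x. indicator (cball 0 \<rho>) z * ennreal ((f (x + z) - f x)\<^sup>2) \<partial>lborel) \<partial>lborel)"
    by (rule pair_sigma_finite.Fubini'[symmetric, OF _ pm]) (simp add: pair_sigma_finite_def sigma_finite_lborel)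
  also have "\<dots> = (\<integral>\<^sup>+z. indicator (cball (0::real^3) \<rho>) z * (\<integral>\<^sup>+x. ennreal ((f (x + z) - f x)\<^sup>2) \<partial>lborel) \<partial>lborel)"
  proof (intro nn_integral_cong nn_integral_cmult)
    fix z
    have "continuous_on UNIV (\<lambda>x. (f (x + z) - f x)\<^sup>2)"
      by (intro continuous_intros continuous_on_compose2[OF fc]) auto
    then show "(\<lambda>x. ennreal ((f (x + z) - f x)\<^sup>2)) \<in> borel_measurable lborel"
      using borel_measurable_continuous_onI by fastforce
  qed
  also have "\<dots> \<le> (\<integral>\<^sup>+z. indicator (cball (0::real^3) \<rho>) z * ennreal (\<rho>\<^sup>2 * (L2_norm \<Omega> (classical_grad f))\<^sup>2) \<partial>lborel)"
  proof (rule nn_integral_mono)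
    fix z :: "real^3"
    show "indicator (cball 0 \<rho>) z * (\<integral>\<^sup>+x. ennreal ((f (x + z) - f x)\<^sup>2) \<partial>lborel) \<le>
       indicator (cball 0 \<rho>) z * ennreal (\<rho>\<^sup>2 * (L2_norm \<Omega> (classical_grad f))\<^sup>2)"
    proof (cases "z \<in> cball 0 \<rho>")
      case True
      then have "(norm z)\<^sup>2 \<le> \<rho>\<^sup>2" by (intro power_mono) auto
      then have "ennreal ((norm z)\<^sup>2 * (L2_norm \<Omega> (classical_grad f))\<^sup>2) \<le> ennreal (\<rho>\<^sup>2 * (L2_norm \<Omega> (classical_grad f))\<^sup>2)"
        by (intro ennreal_leI mult_right_mono) auto
      from order_trans[OF translation_estimate[of z] this] show ?thesis using True by simp
    qed simp
  qed
  also have "\<dots> = emeasure lborel (cball 0 \<rho> :: (real^3) set) * ennreal (\<rho>\<^sup>2 * (L2_norm \<Omega> (classical_grad f))\<^sup>2)"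
    by (subst nn_integral_multc) (auto intro: borel_measurable_indicator)
  also have "\<dots> = ennreal (measure lborel (cball 0 \<rho> :: (real^3) set) * (\<rho>\<^sup>2 * (L2_norm \<Omega> (classical_grad f))\<^sup>2))"
    by (simp add: ennreal_mult emeasure_cball_measure)
  finally show ?thesis .
qed

text \<open>The counterpart without derivatives, which yields stability in \<open>L2\<close> and
  hence bounds that do not deteriorate as \<epsilon> becomes small.\<close>

lemma local_mass_total:
  "(\<integral>\<^sup>+x. (\<integral>\<^sup>+z. indicator (cball (0::real^3) \<rho>) z * ennreal ((f (x + z))\<^sup>2) \<partial>lborel) \<partial>lborel)
     = ennreal (measure lborel (cball 0 \<rho> :: (real^3) set) * (L2_norm \<Omega> f)\<^sup>2)"
proof -
  have fc: "continuous_on UNIV f" using smooth_continuous test_functionsD(1)[OF f] by blast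
  have f2m: "(\<lambda>x. ennreal ((f x)\<^sup>2)) \<in> borel_measurable borel"
    using borel_measurable_continuous_onI[OF fc] by measurable
  have pm: "(\<lambda>(x, z). indicator (cball 0 \<rho>) z * ennreal ((f (x + z))\<^sup>2)) \<in> borel_measurable (lborel \<Otimes>\<^sub>M lborel)"
    by (rule pair_measurable) (auto intro!: continuous_intros continuous_on_compose2[OF fc])
  have "(\<integral>\<^sup>+x. (\<integral>\<^sup>+z. indicator (cball (0::real^3) \<rho>) z * ennreal ((f (x + z))\<^sup>2) \<partial>lborel) \<partial>lborel) =
    (\<integral>\<^sup>+z. (\<integral>\<^sup>+x. indicator (cball 0 \<rho>) z * ennreal ((f (x + z))\<^sup>2) \<partial>lborel) \<partial>lborel)"
    by (rule pair_sigma_finite.Fubini'[symmetric, OF _ pm]) (simp add: pair_sigma_finite_def sigma_finite_lborel)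
  also have "\<dots> = (\<integral>\<^sup>+z. indicator (cball (0::real^3) \<rho>) z * (\<integral>\<^sup>+x. ennreal ((f (x + z))\<^sup>2) \<partial>lborel) \<partial>lborel)"
  proof (intro nn_integral_cong nn_integral_cmult)
    fix z
    show "(\<lambda>x. ennreal ((f (x + z))\<^sup>2)) \<in> borel_measurable lborel"
      using measurable_compose[OF _ f2m, of "\<lambda>x. x + z" borel] by simp
  qed
  also have "\<dots> = (\<integral>\<^sup>+z. indicator (cball (0::real^3) \<rho>) z * ennreal ((L2_norm \<Omega> f)\<^sup>2) \<partial>lborel)"
    using nn_integral_lborel_shift[OF f2m] value_nn by simp
  also have "\<dots> = emeasure lborel (cball 0 \<rho> :: (real^3) set) * ennreal ((L2_norm \<Omega> f)\<^sup>2)"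
    by (subst nn_integral_multc) (auto intro: borel_measurable_indicator)
  also have "\<dots> = ennreal (measure lborel (cball 0 \<rho> :: (real^3) set) * (L2_norm \<Omega> f)\<^sup>2)"
    by (simp add: ennreal_mult emeasure_cball_measure)
  finally show ?thesis .
qed

end

section \<open>Means over balls\<close>

definition ball_mean :: "scalar_field \<Rightarrow> real^3 \<Rightarrow> real \<Rightarrow> real" where
  "ball_mean f y s = (LINT t|lborel. indicator (cball y s) t * f t) / measure lborel (cball y s)"

text \<open>The variance identity: with mean \<open>m\<close> and volume \<open>V\<close>, the
  integral of \<open>(f - c)\<^sup>2\<close> over the ball exceeds that of
  \<open>(f - m)\<^sup>2\<close> by \<open>V * (m - c)\<^sup>2\<close>. Afterwards the ball is
  enlarged to one centred at \<open>x\<close>, which makes the bound independent of the sampling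
  position.\<close>

lemma ball_mean_deviation:
  assumes f: "continuous_on UNIV f" and s: "s > 0" and sub: "cball y s \<subseteq> cball x \<rho>"
  shows "ennreal (measure lborel (cball y s) * (ball_mean f y s - c)\<^sup>2)
    \<le> (\<integral>\<^sup>+z. indicator (cball (0::real^3) \<rho>) z * ennreal ((f (x + z) - c)\<^sup>2) \<partial>lborel)"
proof -
  let ?B = "cball y s"
  define V where "V = measure lborel ?B"
  define m where "m = ball_mean f y s"
  have V: "V > 0" using s unfolding V_def by simp
  have i: "integrable lborel (\<lambda>t. indicator ?B t * h t)" if "continuous_on UNIV h" for h :: scalar_field
    using borel_integrable_compact[of ?B h] continuous_on_subset[OF that, of ?B] by simp
  have m: "(LINT t|lborel. indicator ?B t * f t) = V * m" using V by (simp add: m_def ball_mean_def V_def)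
  have one: "(LINT t|lborel. indicator ?B t * (1::real)) = V" by (simp add: V_def)
  have i1: "integrable lborel (\<lambda>t. indicator ?B t * f t)" "integrable lborel (\<lambda>t. indicator ?B t * (f t - c)\<^sup>2)"
     "integrable lborel (\<lambda>t. indicator ?B t * (1::real))" "integrable lborel (\<lambda>t. indicator ?B t * (f t - m)\<^sup>2)"
    by (intro i continuous_intros f)+
  have "0 \<le> (LINT t|lborel. indicator ?B t * (f t - m)\<^sup>2)" by (intro Bochner_Integration.integral_nonneg) auto
  also have "\<dots> = (LINT t|lborel. indicator ?B t * (f t - c)\<^sup>2 - 2 * (m - c) * (indicator ?B t * f t) + (m\<^sup>2 - c\<^sup>2) * (indicator ?B t * 1))"
    by (intro Bochner_Integration.integral_cong) (auto simp: power2_eq_square algebra_simps)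
  also have "\<dots> = (LINT t|lborel. indicator ?B t * (f t - c)\<^sup>2) - 2 * (m - c) * (V * m) + (m\<^sup>2 - c\<^sup>2) * V"
    by (subst Bochner_Integration.integral_add, use i1 in \<open>intro Bochner_Integration.integrable_diff integrable_mult_right; simp\<close>, use i1 in \<open>intro integrable_mult_right; simp\<close>,
      subst Bochner_Integration.integral_diff, use i1 in simp, use i1 in \<open>intro integrable_mult_right; simp\<close>)
     (simp only: integral_mult_right_zero m one)
  also have "\<dots> = (LINT t|lborel. indicator ?B t * (f t - c)\<^sup>2) - V * (m - c)\<^sup>2"
    by (simp add: power2_eq_square algebra_simps)
  finally have "ennreal (V * (m - c)\<^sup>2) \<le> ennreal (LINT t|lborel. indicator ?B t * (f t - c)\<^sup>2)"
    by (intro ennreal_leI) simp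
  also have "\<dots> = (\<integral>\<^sup>+t. ennreal (indicator ?B t * (f t - c)\<^sup>2) \<partial>lborel)"
    by (rule nn_integral_eq_integral[symmetric, OF i1(2)]) auto
  also have "\<dots> \<le> (\<integral>\<^sup>+t. indicator (cball x \<rho>) t * ennreal ((f t - c)\<^sup>2) \<partial>lborel)"
    using sub by (intro nn_integral_mono) (auto simp: indicator_def)
  also have "\<dots> = (\<integral>\<^sup>+z. indicator (cball x \<rho>) (z + x) * ennreal ((f (z + x) - c)\<^sup>2) \<partial>lborel)"
  proof (rule nn_integral_lborel_shift[symmetric])
    show "(\<lambda>t. indicator (cball x \<rho>) t * ennreal ((f t - c)\<^sup>2)) \<in> borel_measurable borel"
    proof -
      have [measurable]: "f \<in> borel_measurable borel" "cball x \<rho> \<in> sets borel"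
        using borel_measurable_continuous_onI[OF f] by simp_all
      show ?thesis by measurable
    qed
  qed
  also have "\<dots> = (\<integral>\<^sup>+z. indicator (cball (0::real^3) \<rho>) z * ennreal ((f (x + z) - c)\<^sup>2) \<partial>lborel)"
    by (intro nn_integral_cong) (auto simp: indicator_def dist_norm add.commute)
  finally show ?thesis by (simp add: V_def m_def)
qed

section \<open>Barycentric coordinates and interpolation on simplices\<close>

definition verts :: "(real^3) set \<Rightarrow> (real^3) set" where
  "verts K = {x. x extreme_point_of K}"

text \<open>Gradient of the affine function that is one at \<open>v\<close> and zero at the other
  vertices, selected by this property; its existence for a nondegenerate simplex is shown in
  \<open>bary_vert\<close>.\<close>

definition bary_grad :: "(real^3) set \<Rightarrow> real^3 \<Rightarrow> real^3" where
  "bary_grad K v = (SOME g. \<forall>w\<in>verts K. 1 + g \<bullet> (w - v) = of_bool (w = v))"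

definition bary :: "(real^3) set \<Rightarrow> real^3 \<Rightarrow> real^3 \<Rightarrow> real" where
  "bary K v x = 1 + bary_grad K v \<bullet> (x - v)"

text \<open>The extreme points of the hull of an affinely independent set are exactly its points, so
  \<open>verts\<close> recovers the generating set of the simplex.\<close>

lemma simplex_verts:
  assumes "3 simplex K"
  shows "\<not> affine_dependent (verts K)" "card (verts K) = 4" "finite (verts K)" "K = convex hull (verts K)"
proof -
  obtain C where C: "\<not> affine_dependent C" "int (card C) = 3 + 1" "K = convex hull C"
    using assms unfolding simplex_def by blast
  then have "verts K = C"
    unfolding verts_def using extreme_point_of_convex_hull_affine_independent[OF C(1)] by auto
  then show "\<not> affine_dependent (verts K)" "card (verts K) = 4" "K = convex hull (verts K)" using C by auto
  then show "finite (verts K)" by (metis card.infinite zero_neq_numeral)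
qed

text \<open>The edge vectors issuing from \<open>v\<close> are linearly independent, so some linear
  functional equals \<open>-1\<close> on all of them; the vector representing it is the required
  gradient.\<close>

lemma bary_vert:
  assumes K: "3 simplex K" and v: "v \<in> verts K" and w: "w \<in> verts K"
  shows "bary K v w = of_bool (w = v)"
proof -
  have "independent ((\<lambda>x. - v + x) ` (verts K - {v}))"
    using simplex_verts(1)[OF K] affine_dependent_iff_dependent2[OF v] by blast
  then obtain f :: "real^3 \<Rightarrow> real" where f: "linear f" "\<And>x. x \<in> (\<lambda>x. - v + x) ` (verts K - {v}) \<Longrightarrow> f x = -1"
    using linear_independent_extend[of "(\<lambda>x. - v + x) ` (verts K - {v})" "\<lambda>_. -1"] by auto
  have "\<forall>w\<in>verts K. 1 + adjoint f 1 \<bullet> (w - v) = of_bool (w = v)"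
  proof
    fix w assume w: "w \<in> verts K"
    have e: "adjoint f 1 \<bullet> (w - v) = f (w - v)"
      using adjoint_works[OF f(1), of "w - v" 1] by (simp add: inner_commute)
    show "1 + adjoint f 1 \<bullet> (w - v) = of_bool (w = v)"
    proof (cases "w = v")
      case False
      then have "f (- v + w) = -1" using w by (intro f(2) imageI) auto
      then show ?thesis using e False by simp
    qed simp
  qed
  from someI[of "\<lambda>g. \<forall>w\<in>verts K. 1 + g \<bullet> (w - v) = of_bool (w = v)", OF this] w
  show ?thesis unfolding bary_def bary_grad_def by blast
qed

lemma bary_combination:
  assumes K: "3 simplex K" and v: "v \<in> verts K" and u: "sum u (verts K) = 1"
  shows "bary K v (\<Sum>w\<in>verts K. u w *\<^sub>R w) = u v"
proof -
  have "bary K v (\<Sum>w\<in>verts K. u w *\<^sub>R w) = (\<Sum>w\<in>verts K. u w * (1 - bary_grad K v \<bullet> v)) + (\<Sum>w\<in>verts K. u w * (bary_grad K v \<bullet> w))"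
    by (simp add: bary_def inner_diff_right inner_sum_right u flip: sum_distrib_right)
  also have "\<dots> = (\<Sum>w\<in>verts K. u w * bary K v w)"
    by (simp add: bary_def inner_diff_right algebra_simps flip: sum.distrib)
  also have "\<dots> = (\<Sum>w\<in>verts K. if w = v then u v else 0)"
    using bary_vert[OF K v] by (intro sum.cong) auto
  also have "\<dots> = u v" using v simplex_verts(3)[OF K] by simp
  finally show ?thesis .
qed

text \<open>Four affinely independent points span all of space affinely, so each point, inside the
  simplex or not, is an affine combination of the vertices, and the coefficients are its
  coordinates.\<close>

lemma bary_sum:
  assumes K: "3 simplex K"
  shows "(\<Sum>v\<in>verts K. bary K v x) = 1" "(\<Sum>v\<in>verts K. bary K v x *\<^sub>R v) = x"
proof -
  note S = simplex_verts[OF K]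
  have "affine hull (verts K) = UNIV"
    using S by (intro affine_independent_span_eq) auto
  then have "x \<in> {y. \<exists>u. sum u (verts K) = 1 \<and> (\<Sum>v\<in>verts K. u v *\<^sub>R v) = y}"
    using affine_hull_finite[OF S(3)] by auto
  then obtain u where u: "sum u (verts K) = 1" "(\<Sum>v\<in>verts K. u v *\<^sub>R v) = x" by blast
  then have "bary K v x = u v" if "v \<in> verts K" for v using bary_combination[OF K that u(1)] by simp
  then show "(\<Sum>v\<in>verts K. bary K v x) = 1" "(\<Sum>v\<in>verts K. bary K v x *\<^sub>R v) = x" using u by auto
qed

text \<open>The coordinates add up to the constant one. Comparing this identity at the origin and at
  the sum of the gradients shows that the sum is orthogonal to itself.\<close>

lemma bary_grad_sum:
  assumes K: "3 simplex K"
  shows "(\<Sum>v\<in>verts K. bary_grad K v) = 0"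
proof -
  let ?g = "\<Sum>v\<in>verts K. bary_grad K v"
  have d: "bary K v x = bary K v 0 + bary_grad K v \<bullet> x" for v x
    by (simp add: bary_def inner_diff_right)
  have "(\<Sum>v\<in>verts K. bary K v ?g) = (\<Sum>v\<in>verts K. bary K v 0) + ?g \<bullet> ?g"
    by (subst d) (simp add: sum.distrib inner_sum_left)
  then show ?thesis using bary_sum(1)[OF K] by simp
qed

lemma simplex_iff_bary:
  assumes K: "3 simplex K"
  shows "x \<in> K \<longleftrightarrow> (\<forall>v\<in>verts K. bary K v x \<ge> 0)"
proof
  assume "x \<in> K"
  then have "x \<in> convex hull (verts K)" by (subst simplex_verts(4)[OF K, symmetric])
  then obtain u where u: "\<And>v. v \<in> verts K \<Longrightarrow> 0 \<le> u v" "sum u (verts K) = 1" "(\<Sum>v\<in>verts K. u v *\<^sub>R v) = x"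
    unfolding convex_hull_finite[OF simplex_verts(3)[OF K]] by blast
  then show "\<forall>v\<in>verts K. bary K v x \<ge> 0" using bary_combination[OF K _ u(2)] by auto
next
  assume "\<forall>v\<in>verts K. bary K v x \<ge> 0"
  then have "x \<in> convex hull (verts K)"
    unfolding convex_hull_finite[OF simplex_verts(3)[OF K]] using bary_sum[OF K, of x]
    by (intro CollectI exI[of _ "\<lambda>v. bary K v x"] conjI)
  then show "x \<in> K" by (simp only: simplex_verts(4)[OF K, symmetric])
qed

lemma bary_le_1:
  assumes K: "3 simplex K" and "x \<in> K" "v \<in> verts K"
  shows "bary K v x \<le> 1"
  using member_le_sum[of v "verts K" "\<lambda>v. bary K v x"] bary_sum(1)[OF K, of x] simplex_iff_bary[OF K] simplex_verts(3)[OF K] assms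
  by auto

lemma bary_diff: "bary K v y - bary K v z = bary_grad K v \<bullet> (y - z)"
  by (simp add: bary_def inner_diff_right)

lemma smooth_bary: "smooth (bary K v)"
  using smooth_affine[of "1 - bary_grad K v \<bullet> v" "bary_grad K v"]
  by (simp add: bary_def[abs_def] inner_diff_right algebra_simps)

lemma continuous_bary: "continuous_on A (bary K v)"
  by (intro smooth_continuous smooth_bary)

lemma bary_grad_nonzero:
  assumes K: "3 simplex K" and v: "v \<in> verts K"
  obtains w where "w \<in> verts K" "w \<noteq> v" "bary_grad K v \<bullet> (v - w) = 1"
proof -
  have "verts K \<noteq> {v}" using simplex_verts(2)[OF K] by auto
  then obtain w where w: "w \<in> verts K" "w \<noteq> v" using v by blast
  have "bary_grad K v \<bullet> (v - w) = bary K v v - bary K v w" by (simp add: bary_diff)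
  then have "bary_grad K v \<bullet> (v - w) = 1" using bary_vert[OF K v v] bary_vert[OF K v w(1)] w by simp
  then show ?thesis using that w by blast
qed

lemma verts_subset: "verts K \<subseteq> K"
  by (auto simp: verts_def extreme_point_of_def)

text \<open>At an interior point with a vanishing coordinate, a short step against the gradient
  would stay in the simplex and make the coordinate negative.\<close>

lemma bary_pos_interior:
  assumes K: "3 simplex K" and x: "x \<in> interior K" and v: "v \<in> verts K"
  shows "bary K v x > 0"
proof (rule ccontr)
  assume "\<not> bary K v x > 0"
  moreover have "bary K v x \<ge> 0" using x v simplex_iff_bary[OF K] interior_subset by blast
  ultimately have z: "bary K v x = 0" by simp
  obtain w where w: "bary_grad K v \<bullet> (v - w) = 1" using bary_grad_nonzero[OF K v] by metis
  then have nz: "bary_grad K v \<noteq> 0" by auto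
  obtain e where e: "e > 0" "cball x e \<subseteq> K" using x mem_interior_cball by blast
  define t where "t = e / norm (bary_grad K v)"
  have t: "t > 0" "t * norm (bary_grad K v) = e" using e nz by (auto simp: t_def)
  have "x - t *\<^sub>R bary_grad K v \<in> K" using e t by (intro subsetD[OF e(2)]) (auto simp: dist_norm)
  then have "bary K v (x - t *\<^sub>R bary_grad K v) \<ge> 0" using v simplex_iff_bary[OF K] by blast
  moreover have "bary K v (x - t *\<^sub>R bary_grad K v) = - t * (norm (bary_grad K v))\<^sup>2"
    using bary_diff[of K v "x - t *\<^sub>R bary_grad K v" x] z by (simp add: power2_norm_eq_inner)
  ultimately show False using t nz by (simp add: mult_le_0_iff)
qed

lemma interior_if_bary_pos:
  assumes K: "3 simplex K" and p: "\<And>v. v \<in> verts K \<Longrightarrow> bary K v x > 0"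
  shows "x \<in> interior K"
proof (rule interiorI)
  have e: "{x. \<forall>v\<in>verts K. bary K v x > 0} = (\<Inter>v\<in>verts K. {x. 0 < bary K v x})" by auto
  show "open {x. \<forall>v\<in>verts K. bary K v x > 0}"
    unfolding e using simplex_verts(3)[OF K]
    by (intro open_INT ballI open_Collect_less continuous_bary continuous_on_const) auto
  show "{x. \<forall>v\<in>verts K. bary K v x > 0} \<subseteq> K"
    using simplex_iff_bary[OF K] by (auto intro: less_imp_le)
qed (use p in auto)

text \<open>Across the inscribed ball, along the gradient, the coordinate changes by
  \<open>2 * \<rho>\<close> times the norm of the gradient, while its values lie between zero and
  one.\<close>

lemma bary_grad_upper:
  assumes K: "3 simplex K" and v: "v \<in> verts K" and c: "cball c \<rho> \<subseteq> K" and r: "\<rho> > 0"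
  shows "norm (bary_grad K v) \<le> 1 / (2 * \<rho>)"
proof (cases "bary_grad K v = 0")
  case False
  define d where "d = (\<rho> / norm (bary_grad K v)) *\<^sub>R bary_grad K v"
  have nd: "norm d = \<rho>" using False r by (simp add: d_def)
  have in1: "c + d \<in> K" "c - d \<in> K" using nd by (intro subsetD[OF c], simp add: dist_norm)+
  have "bary_grad K v \<bullet> d = \<rho> * norm (bary_grad K v)"
    using False by (simp add: d_def power2_norm_eq_inner[symmetric] power2_eq_square)
  then have "bary K v (c + d) - bary K v (c - d) = 2 * \<rho> * norm (bary_grad K v)"
    unfolding bary_diff by (simp add: inner_add_right inner_diff_right flip: scaleR_2)
  moreover have "bary K v (c + d) \<le> 1" by (rule bary_le_1[OF K in1(1) v])
  moreover have "bary K v (c - d) \<ge> 0" using in1(2) v simplex_iff_bary[OF K] by blast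
  ultimately have "2 * \<rho> * norm (bary_grad K v) \<le> 1" by linarith
  then show ?thesis using r by (simp add: field_simps)
qed (use r in simp)

text \<open>Along an edge starting at \<open>v\<close>, of length at most \<open>h\<close>, the
  coordinate falls from one to zero.\<close>

lemma bary_grad_lower:
  assumes K: "3 simplex K" and v: "v \<in> verts K" and d: "diameter K \<le> h"
  shows "1 \<le> norm (bary_grad K v) * h"
proof -
  obtain w where w: "w \<in> verts K" "bary_grad K v \<bullet> (v - w) = 1" using bary_grad_nonzero[OF K v] by metis
  have "norm (v - w) \<le> h"
    using diameter_bounded_bound[of K v w] compact_imp_bounded[OF compact_simplex[OF K]] v w(1) verts_subset d
    by (force simp: dist_norm)
  have "1 \<le> norm (bary_grad K v) * norm (v - w)" using w(2) norm_cauchy_schwarz[of "bary_grad K v" "v - w"] by simp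
  also have "\<dots> \<le> norm (bary_grad K v) * h" using \<open>norm (v - w) \<le> h\<close> by (intro mult_left_mono) auto
  finally show ?thesis .
qed

text \<open>The coordinate is nonnegative even where the inscribed ball reaches farthest against the
  gradient, so at the centre it is at least \<open>\<rho>\<close> times the gradient norm. Moving by
  \<open>\<rho> / 2\<close> loses at most half of this, and the gradient norm is at least
  \<open>1 / h\<close>.\<close>

lemma bary_lower_inball:
  assumes K: "3 simplex K" and v: "v \<in> verts K" and d: "diameter K \<le> h" "h > 0"
    and c: "cball c \<rho> \<subseteq> K" and r: "\<rho> > 0" and y: "y \<in> cball c (\<rho> / 2)"
  shows "bary K v y \<ge> \<rho> / (2 * h)"
proof -
  let ?g = "bary_grad K v"
  have low: "1 \<le> norm ?g * h" by (rule bary_grad_lower[OF K v d(1)])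
  then have nz: "?g \<noteq> 0" by auto
  define e where "e = (\<rho> / norm ?g) *\<^sub>R ?g"
  have "norm e = \<rho>" using nz r by (simp add: e_def)
  then have "c - e \<in> K" by (intro subsetD[OF c]) (simp add: dist_norm)
  then have p: "bary K v (c - e) \<ge> 0" using v simplex_iff_bary[OF K] by blast
  have "?g \<bullet> e = \<rho> * norm ?g" using nz by (simp add: e_def power2_norm_eq_inner[symmetric] power2_eq_square)
  then have c1: "bary K v c \<ge> \<rho> * norm ?g" using p bary_diff[of K v c "c - e"] by simp
  have "\<bar>?g \<bullet> (y - c)\<bar> \<le> norm ?g * norm (y - c)" by (rule Cauchy_Schwarz_ineq2)
  also have "\<dots> \<le> norm ?g * (\<rho> / 2)" using y by (intro mult_left_mono) (auto simp: dist_norm norm_minus_commute)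
  finally have "bary K v y \<ge> \<rho> * norm ?g - norm ?g * (\<rho> / 2)" using c1 bary_diff[of K v y c] by linarith
  also have "\<rho> * norm ?g - norm ?g * (\<rho> / 2) = norm ?g * \<rho> / 2" by simp
  finally have "norm ?g * \<rho> / 2 \<le> bary K v y" .
  moreover have "\<rho> / (2 * h) \<le> norm ?g * \<rho> / 2"
  proof -
    have "1 / h \<le> norm ?g" using low d(2) by (simp add: field_simps)
    then have "(1 / h) * (\<rho> / 2) \<le> norm ?g * (\<rho> / 2)" using r by (intro mult_right_mono) auto
    then show ?thesis by simp
  qed
  ultimately show ?thesis by linarith
qed

section \<open>Linear interpolation of vertex values\<close>

definition interp :: "(real^3) set \<Rightarrow> (real^3 \<Rightarrow> real) \<Rightarrow> scalar_field" where
  "interp K W x = (\<Sum>v\<in>verts K. W v * bary K v x)"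

lemma interp_diff:
  "interp K W y - interp K W z = (\<Sum>v\<in>verts K. W v *\<^sub>R bary_grad K v) \<bullet> (y - z)"
proof -
  have "interp K W y - interp K W z = (\<Sum>v\<in>verts K. W v * (bary K v y - bary K v z))"
    by (simp add: interp_def right_diff_distrib sum_subtractf)
  then show ?thesis by (simp add: bary_diff inner_sum_left)
qed

text \<open>A point of a face is a combination of the extreme points of that face, and uniqueness of
  barycentric coordinates gives the other vertices weight zero. The value therefore depends on the
  face and not on the simplex around it.\<close>

lemma interp_face:
  assumes K: "3 simplex K" and F: "F face_of K" and x: "x \<in> F" and E: "E = {v. v extreme_point_of F}"
    and u: "sum u E = 1" "(\<Sum>v\<in>E. u v *\<^sub>R v) = x"
  shows "interp K W x = (\<Sum>v\<in>E. W v * u v)"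
proof -
  have sub: "E \<subseteq> verts K" unfolding E verts_def using extreme_point_of_face[OF F] by auto
  have fin: "finite (verts K)" by (rule simplex_verts(3)[OF K])
  define u' where "u' v = (if v \<in> E then u v else 0)" for v
  have s: "sum u' (verts K) = 1"
    using sum.mono_neutral_right[OF fin sub, of u'] u(1) by (simp add: u'_def cong: sum.cong)
  have "(\<Sum>v\<in>verts K. u' v *\<^sub>R v) = (\<Sum>v\<in>E. u' v *\<^sub>R v)"
    by (rule sum.mono_neutral_right[OF fin sub]) (simp add: u'_def)
  then have x': "(\<Sum>v\<in>verts K. u' v *\<^sub>R v) = x" using u(2) by (simp add: u'_def cong: sum.cong)
  have "interp K W x = (\<Sum>v\<in>verts K. W v * u' v)"
    unfolding interp_def using bary_combination[OF K _ s] x' by (intro sum.cong) auto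
  also have "\<dots> = (\<Sum>v\<in>E. W v * u' v)"
    by (rule sum.mono_neutral_right[OF fin sub]) (simp add: u'_def)
  finally show ?thesis by (simp add: u'_def cong: sum.cong)
qed

text \<open>The common part of two conforming cells is a face of both and, by Krein-Milman, the hull
  of its own extreme points; these are vertices of either cell.\<close>

lemma interp_conforming:
  assumes K: "3 simplex K" and K': "3 simplex K'" and F: "(K \<inter> K') face_of K" "(K \<inter> K') face_of K'"
    and x: "x \<in> K" "x \<in> K'"
  shows "interp K W x = interp K' W x"
proof -
  let ?F = "K \<inter> K'" let ?E = "{v. v extreme_point_of (K \<inter> K')}"
  have cp: "compact ?F" "convex ?F"
    using compact_simplex[OF K] compact_simplex[OF K'] convex_simplex[OF K] convex_simplex[OF K']
    by (auto intro: compact_Int convex_Int)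
  have hull: "?F = convex hull ?E" by (rule Krein_Milman_Minkowski[OF cp])
  have "?E \<subseteq> verts K" unfolding verts_def using extreme_point_of_face[OF F(1)] by auto
  then have "finite ?E" using simplex_verts(3)[OF K] finite_subset by blast
  moreover have "x \<in> convex hull ?E" using hull x by blast
  ultimately obtain u where u: "sum u ?E = 1" "(\<Sum>v\<in>?E. u v *\<^sub>R v) = x"
    using convex_hull_finite[of ?E] by auto
  have "x \<in> ?F" using x by blast
  show ?thesis
    using interp_face[OF K F(1) \<open>x \<in> ?F\<close> refl u, of W] interp_face[OF K' F(2) \<open>x \<in> ?F\<close> refl u, of W] by simp
qed

text \<open>Along the segment from \<open>x\<close> to \<open>y\<close> the pieces become closed
  subsets of an interval, where Lipschitz bounds on finitely many closed pieces glue without loss in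
  the constant.\<close>

lemma lipschitz_on_closed_cover:
  fixes f :: "'a::real_normed_vector \<Rightarrow> 'b::metric_space"
  assumes "finite \<U>" "\<And>U. U \<in> \<U> \<Longrightarrow> closed U" "\<Union>\<U> = UNIV" "\<And>U. U \<in> \<U> \<Longrightarrow> L-lipschitz_on U f" "L \<ge> 0"
  shows "L-lipschitz_on UNIV f"
proof (rule lipschitz_onI[OF _ assms(5)])
  fix x y :: 'a
  define p where "p t = x + t *\<^sub>R (y - x)" for t :: real
  have pl: "dist (p s) (p t) = dist s t * dist x y" for s t
  proof -
    have "p s - p t = (s - t) *\<^sub>R (y - x)" by (simp add: p_def algebra_simps)
    then show ?thesis by (simp add: dist_norm norm_minus_commute)
  qed
  have "(L * dist x y)-lipschitz_on {0..1} (f \<circ> p)"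
  proof (rule lipschitz_on_closed_Union[where U = "\<lambda>U. p -` U" and I = \<U>])
    fix U assume U: "U \<in> \<U>"
    show "(L * dist x y)-lipschitz_on (p -` U) (f \<circ> p)"
    proof (rule lipschitz_onI)
      fix s t assume "s \<in> p -` U" "t \<in> p -` U"
      then have "dist (f (p s)) (f (p t)) \<le> L * dist (p s) (p t)" using lipschitz_onD[OF assms(4)[OF U]] by auto
      then show "dist ((f \<circ> p) s) ((f \<circ> p) t) \<le> L * dist x y * dist s t" by (simp add: pl mult_ac)
    qed (use assms(5) in auto)
    show "closed (p -` U)"
      by (rule closed_vimage[OF assms(2)[OF U]]) (auto simp: p_def intro!: continuous_intros)
  qed (use assms in \<open>auto simp: vimage_def\<close>)
  from lipschitz_onD[OF this, of 0 1] show "dist (f x) (f y) \<le> L * dist x y" by (simp add: p_def)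
qed

section \<open>Exterior balls of polyhedral domains\<close>

text \<open>The complement of a polytope is a finite union of open half-spaces, and intersecting
  such unions one polytope at a time keeps the pieces open, convex and finite in number.\<close>

lemma complement_polytopes:
  fixes \<P> :: "'a::euclidean_space set set"
  assumes "finite \<P>" "\<forall>P\<in>\<P>. polytope P"
  shows "\<exists>\<C>. finite \<C> \<and> (\<forall>C\<in>\<C>. open C \<and> convex C) \<and> - \<Union>\<P> = \<Union>\<C>"
  using assms
proof (induction \<P> rule: finite_induct)
  case empty
  show ?case by (rule exI[of _ "{UNIV}"]) auto
next
  case (insert P \<P>)
  then obtain \<C> where C: "finite \<C>" "\<forall>C\<in>\<C>. open C \<and> convex C" "- \<Union>\<P> = \<Union>\<C>" by auto
  have "polyhedron P" using insert.prems polytope_imp_polyhedron by auto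
  then have "\<exists>F. finite F \<and> P = \<Inter>F \<and> (\<forall>h\<in>F. \<exists>a b. a \<noteq> 0 \<and> h = {x. a \<bullet> x \<le> b})"
    unfolding polyhedron_def .
  then obtain F where "finite F \<and> P = \<Inter>F \<and> (\<forall>h\<in>F. \<exists>a b. a \<noteq> 0 \<and> h = {x. a \<bullet> x \<le> b})"
    by (rule exE)
  note F = this[THEN conjunct1] this[THEN conjunct2, THEN conjunct1] this[THEN conjunct2, THEN conjunct2]
  have half: "open (- h) \<and> convex (- h)" if h: "h \<in> F" for h
  proof -
    obtain a b where "h = {x. a \<bullet> x \<le> b}" using F(3) h by blast
    then have "- h = {x. a \<bullet> x > b}" by auto
    then show ?thesis by (simp add: open_halfspace_gt convex_halfspace_gt)
  qed
  define \<D> where "\<D> = (\<lambda>(h, C). - h \<inter> C) ` (F \<times> \<C>)"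
  have "finite \<D>" using F(1) C(1) by (simp add: \<D>_def)
  moreover have "\<forall>D\<in>\<D>. open D \<and> convex D" using half C(2) by (auto simp: \<D>_def intro: open_Int convex_Int)
  moreover have "- \<Union>(insert P \<P>) = \<Union>\<D>"
  proof -
    have "- \<Union>(insert P \<P>) = (- \<Inter>F) \<inter> \<Union>\<C>" using C(3) F(2) by auto
    also have "\<dots> = \<Union>\<D>" by (auto simp: \<D>_def)
    finally show ?thesis .
  qed
  ultimately show ?case by blast
qed

text \<open>The smaller ball is the image of \<open>ball z r\<close> under the homothety with centre
  \<open>b\<close> and ratio \<open>t\<close>. Since \<open>b\<close> is only a limit point of
  \<open>C\<close>, interior points are moved towards it by a factor short of one.\<close>

lemma convex_cone_ball:
  fixes C :: "'a::euclidean_space set"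
  assumes C: "convex C" "ball z r \<subseteq> C" "r > 0" and b: "b \<in> closure C" and t: "0 < t" "t \<le> 1"
  shows "ball ((1 - t) *\<^sub>R b + t *\<^sub>R z) (t * r) \<subseteq> C"
proof
  fix y assume y: "y \<in> ball ((1 - t) *\<^sub>R b + t *\<^sub>R z) (t * r)"
  define c where "c = b + (1 / t) *\<^sub>R (y - b)"
  have "t *\<^sub>R (c - z) = y - ((1 - t) *\<^sub>R b + t *\<^sub>R z)" using t by (simp add: c_def algebra_simps)
  then have "t * norm (c - z) = norm (y - ((1 - t) *\<^sub>R b + t *\<^sub>R z))" using t by (metis norm_scaleR abs_of_pos)
  then have "t * norm (c - z) < t * r" using y by (simp add: dist_norm norm_minus_commute)
  then have "c \<in> ball z r" using t by (simp add: dist_norm norm_minus_commute)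
  then have "c \<in> interior C" using C(2) by (meson interiorI open_ball)
  from mem_interior_closure_convex_shrink[OF C(1) this b t]
  have "b - t *\<^sub>R (b - c) \<in> interior C" .
  moreover have "b - t *\<^sub>R (b - c) = y" using t by (simp add: c_def algebra_simps)
  ultimately show "y \<in> C" using interior_subset by blast
qed

text \<open>The complement of the closure is a finite union of open convex sets, and \<open>b\<close> lies in the closure of
  one of them; shrinking a fixed ball of that set towards \<open>b\<close> gives the required ball.\<close>

lemma exterior_ball:
  assumes \<Omega>: "bounded_polyhedral_domain \<Omega>" and D: "D > 0"
  shows "\<exists>\<kappa>. 0 < \<kappa> \<and> \<kappa> \<le> 1 \<and> (\<forall>h b. 0 < h \<longrightarrow> h \<le> D \<longrightarrow> b \<notin> \<Omega> \<longrightarrow> (\<exists>x\<in>\<Omega>. dist x b \<le> D) \<longrightarrow>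
    (\<exists>y. cball y (\<kappa> * h) \<subseteq> cball b h \<and> cball y (\<kappa> * h) \<inter> \<Omega> = {}))"
proof -
  obtain \<P> where P: "finite \<P>" "\<forall>P\<in>\<P>. polytope P" "closure \<Omega> = \<Union>\<P>" and
    O: "bounded \<Omega>" "\<Omega> = interior (closure \<Omega>)" using \<Omega> unfolding bounded_polyhedral_domain_def by blast
  obtain \<C> where C: "finite \<C>" "\<forall>C\<in>\<C>. open C \<and> convex C" "- \<Union>\<P> = \<Union>\<C>"
    using complement_polytopes[OF P(1,2)] by blast
  obtain R where R: "R > 0" "\<Omega> \<subseteq> ball 0 R" using bounded_subset_ballD[OF O(1), of 0] by blast
  have "\<exists>\<kappa>. 0 < \<kappa> \<and> \<kappa> \<le> 1 \<and> (\<forall>h b. 0 < h \<longrightarrow> h \<le> D \<longrightarrow> b \<in> closure C \<longrightarrow> norm b \<le> R + D \<longrightarrow>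
    (\<exists>y. cball y (\<kappa> * h) \<subseteq> cball b h \<and> cball y (\<kappa> * h) \<subseteq> C))" if CC: "C \<in> \<C>" for C
  proof (cases "C = {}")
    case True then show ?thesis by (intro exI[of _ 1]) auto
  next
    case False
    then obtain z where "z \<in> C" by blast
    then obtain r where r: "r > 0" "ball z r \<subseteq> C" using C(2) CC open_contains_ball by blast
    \<comment> \<open>\<open>N\<close> exceeds every possible distance from \<open>b\<close> to
      \<open>z\<close> by at least \<open>r\<close>. With \<open>t = h / N\<close> the shrunken
      ball, its distance from \<open>b\<close> included, fits into radius \<open>h\<close>, and
      \<open>N \<ge> D\<close> keeps \<open>t \<le> 1\<close>.\<close>
    define N where "N = norm z + R + D + r"
    have N: "N > 0" "N \<ge> r" "N \<ge> D" using R D r by (auto simp: N_def add_nonneg_pos)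
    define \<kappa> where "\<kappa> = r / (2 * N)"
    show ?thesis
    proof (intro exI[of _ \<kappa>] conjI allI impI)
      show "0 < \<kappa>" "\<kappa> \<le> 1" using r N by (auto simp: \<kappa>_def)
      fix h :: real and b :: "real^3" assume h: "0 < h" "h \<le> D" and b: "b \<in> closure C" "norm b \<le> R + D"
      define t where "t = h / N"
      have t: "0 < t" "t \<le> 1" using h N by (auto simp: t_def)
      define y where "y = (1 - t) *\<^sub>R b + t *\<^sub>R z"
      have kt: "\<kappa> * h = t * r / 2" by (simp add: \<kappa>_def t_def mult.commute)
      have "t * r > 0" using t r by simp
      have bC: "ball y (t * r) \<subseteq> C" unfolding y_def using convex_cone_ball[OF _ r(2,1) b(1) t] C(2) CC by blast
      have "dist b y = t * norm (b - z)"
      proof -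
        have "b - y = t *\<^sub>R (b - z)" by (simp add: y_def algebra_simps)
        then show ?thesis using t by (simp add: dist_norm)
      qed
      also have "\<dots> \<le> t * (norm z + R + D)"
        using norm_triangle_ineq4[of b z] b(2) t by (intro mult_left_mono) auto
      finally have "dist b y + t * r \<le> t * N" by (simp add: N_def algebra_simps)
      then have dby: "dist b y + t * r \<le> h" using N by (simp add: t_def)
      show "\<exists>y. cball y (\<kappa> * h) \<subseteq> cball b h \<and> cball y (\<kappa> * h) \<subseteq> C"
      proof (intro exI[of _ y] conjI)
        show "cball y (\<kappa> * h) \<subseteq> C" using bC kt \<open>t * r > 0\<close> by (force simp: subset_iff)
        show "cball y (\<kappa> * h) \<subseteq> cball b h"
        proof
          fix s assume "s \<in> cball y (\<kappa> * h)"
          then have "dist y s \<le> t * r" using kt \<open>t * r > 0\<close> by simp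
          then show "s \<in> cball b h" using dby dist_triangle[of b s y] by simp
        qed
      qed
    qed
  qed
  then obtain k where k: "\<And>C. C \<in> \<C> \<Longrightarrow> 0 < k C" "\<And>C. C \<in> \<C> \<Longrightarrow> k C \<le> 1"
    "\<And>C h b. C \<in> \<C> \<Longrightarrow> 0 < h \<Longrightarrow> h \<le> D \<Longrightarrow> b \<in> closure C \<Longrightarrow> norm b \<le> R + D \<Longrightarrow>
    (\<exists>y. cball y (k C * h) \<subseteq> cball b h \<and> cball y (k C * h) \<subseteq> C)" by metis
  \<comment> \<open>The minimum over finitely many convex pieces; the inserted \<open>1\<close>
    makes the set nonempty and supplies \<open>\<kappa> \<le> 1\<close>.\<close>
  define \<kappa> where "\<kappa> = Min (insert 1 (k ` \<C>))"
  have fin: "finite (insert 1 (k ` \<C>))" using C(1) by simp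
  have \<kappa>0: "0 < \<kappa>" unfolding \<kappa>_def using fin k(1) by (subst Min_gr_iff) auto
  have \<kappa>1: "\<kappa> \<le> 1" unfolding \<kappa>_def using fin by (intro Min_le) auto
  have \<kappa>k: "\<kappa> \<le> k C" if "C \<in> \<C>" for C unfolding \<kappa>_def using fin that by (intro Min_le) auto
  show ?thesis
  proof (intro exI[of _ \<kappa>] conjI allI impI \<kappa>0 \<kappa>1)
    fix h :: real and b :: "real^3" assume h: "0 < h" "h \<le> D" and b: "b \<notin> \<Omega>" "\<exists>x\<in>\<Omega>. dist x b \<le> D"
    \<comment> \<open>Here the exclusion of slits enters: a point outside \<Omega> is a limit of
      points outside the closure of \<Omega>, in particular on the boundary.\<close>
    have "b \<in> closure (- closure \<Omega>)" using b(1) O(2) by (simp add: closure_complement)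
    then have "b \<in> closure (\<Union>\<C>)" using P(3) C(3) by simp
    moreover have "closure (\<Union>\<C>) \<subseteq> (\<Union>C\<in>\<C>. closure C)"
      using C(1) closure_subset by (intro closure_minimal closed_UN) auto
    ultimately have "b \<in> (\<Union>C\<in>\<C>. closure C)" by blast
    then obtain C where CC: "C \<in> \<C>" "b \<in> closure C" by blast
    obtain x where x: "x \<in> \<Omega>" "dist x b \<le> D" using b(2) by blast
    have "norm b \<le> norm x + norm (x - b)" using norm_triangle_sub[of b x] by (simp add: norm_minus_commute)
    moreover have "norm x \<le> R" using R(2) x(1) by auto
    ultimately have "norm b \<le> R + D" using x(2) by (simp add: dist_norm)
    then obtain y where y: "cball y (k C * h) \<subseteq> cball b h" "cball y (k C * h) \<subseteq> C" using k(3)[OF CC(1) h CC(2)] by blast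
    have "cball y (\<kappa> * h) \<subseteq> cball y (k C * h)" using \<kappa>k[OF CC(1)] h by (intro subset_cball mult_right_mono) auto
    moreover have "C \<inter> \<Omega> = {}" using C(3) CC(1) P(3) closure_subset[of \<Omega>] by blast
    ultimately show "\<exists>y. cball y (\<kappa> * h) \<subseteq> cball b h \<and> cball y (\<kappa> * h) \<inter> \<Omega> = {}" using y by blast
  qed
qed

section \<open>Polynomials and bubbles\<close>

definition multi_indices :: "nat \<Rightarrow> (3 \<Rightarrow> nat) set" where
  "multi_indices k = {\<alpha>. sum \<alpha> UNIV \<le> k}"

definition monomial :: "(3 \<Rightarrow> nat) \<Rightarrow> scalar_field" where
  "monomial \<alpha> x = (\<Prod>i\<in>UNIV. (x $ i) ^ \<alpha> i)"

lemma finite_multi_indices: "finite (multi_indices k)"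
proof (rule finite_subset)
  show "multi_indices k \<subseteq> (UNIV \<rightarrow>\<^sub>E {..k})"
  proof
    fix \<alpha> assume "\<alpha> \<in> multi_indices k"
    then have "\<alpha> i \<le> k" for i using member_le_sum[of i UNIV \<alpha>] by (simp add: multi_indices_def)
    then show "\<alpha> \<in> UNIV \<rightarrow>\<^sub>E {..k}" by (simp add: PiE_def extensional_def)
  qed
  show "finite ((UNIV :: 3 set) \<rightarrow>\<^sub>E {..k})" by (intro finite_PiE) auto
qed

lemma P_k_iff: "p \<in> P_k k \<longleftrightarrow> (\<exists>c. p = (\<lambda>x. \<Sum>\<alpha>\<in>multi_indices k. c \<alpha> * monomial \<alpha> x))"
  by (simp add: P_k_def multi_indices_def monomial_def fun_eq_iff)

lemma P_k_monomial:
  assumes "\<alpha> \<in> multi_indices k" shows "monomial \<alpha> \<in> P_k k"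
  unfolding P_k_iff
proof (intro exI[of _ "\<lambda>\<beta>. of_bool (\<beta> = \<alpha>)"] ext)
  fix x :: "real^3"
  have "(\<Sum>\<beta>\<in>multi_indices k. of_bool (\<beta> = \<alpha>) * monomial \<beta> x) = (\<Sum>\<beta>\<in>multi_indices k. if \<beta> = \<alpha> then monomial \<alpha> x else 0)"
    by (intro sum.cong) auto
  also have "\<dots> = monomial \<alpha> x"
    using finite_multi_indices[of k] assms by simp
  finally show "monomial \<alpha> x = (\<Sum>\<beta>\<in>multi_indices k. of_bool (\<beta> = \<alpha>) * monomial \<beta> x)" by simp
qed

lemma P_k_add: assumes "p \<in> P_k k" "q \<in> P_k k" shows "(\<lambda>x. p x + q x) \<in> P_k k"
proof -
  obtain c d where e: "p = (\<lambda>x. \<Sum>\<alpha>\<in>multi_indices k. c \<alpha> * monomial \<alpha> x)" "q = (\<lambda>x. \<Sum>\<alpha>\<in>multi_indices k. d \<alpha> * monomial \<alpha> x)"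
    using assms unfolding P_k_iff by blast
  show ?thesis unfolding P_k_iff e
    by (intro exI[of _ "\<lambda>\<alpha>. c \<alpha> + d \<alpha>"]) (simp add: distrib_right sum.distrib)
qed

lemma P_k_cmult: assumes "p \<in> P_k k" shows "(\<lambda>x. a * p x) \<in> P_k k"
proof -
  obtain c where e: "p = (\<lambda>x. \<Sum>\<alpha>\<in>multi_indices k. c \<alpha> * monomial \<alpha> x)"
    using assms unfolding P_k_iff by blast
  show ?thesis unfolding P_k_iff e
    by (intro exI[of _ "\<lambda>\<alpha>. a * c \<alpha>"]) (simp add: sum_distrib_left mult.assoc)
qed

lemma P_k_zero: "(\<lambda>x. 0) \<in> P_k k"
  unfolding P_k_iff by (intro exI[of _ "\<lambda>\<alpha>. 0"]) simp

lemma P_k_sum: "(\<And>i. i \<in> I \<Longrightarrow> f i \<in> P_k k) \<Longrightarrow> (\<lambda>x. \<Sum>i\<in>I. f i x) \<in> P_k k"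
  by (induction I rule: infinite_finite_induct) (simp_all add: P_k_zero P_k_add)

lemma P_k_mult: assumes "p \<in> P_k k" "q \<in> P_k l" shows "(\<lambda>x. p x * q x) \<in> P_k (k + l)"
proof -
  obtain c where c: "p = (\<lambda>x. \<Sum>\<alpha>\<in>multi_indices k. c \<alpha> * monomial \<alpha> x)"
    using assms(1) unfolding P_k_iff by blast
  obtain d where d: "q = (\<lambda>x. \<Sum>\<alpha>\<in>multi_indices l. d \<alpha> * monomial \<alpha> x)"
    using assms(2) unfolding P_k_iff by blast
  have e: "(\<lambda>x. p x * q x) = (\<lambda>x. \<Sum>\<alpha>\<in>multi_indices k. \<Sum>\<beta>\<in>multi_indices l. (c \<alpha> * d \<beta>) * monomial (\<lambda>i. \<alpha> i + \<beta> i) x)"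
    by (simp add: c d sum_product power_add prod.distrib monomial_def mult_ac)
  show ?thesis unfolding e
  proof (intro P_k_sum P_k_cmult)
    fix \<alpha> \<beta> assume "\<alpha> \<in> multi_indices k" "\<beta> \<in> multi_indices l"
    then have "(\<lambda>i. \<alpha> i + \<beta> i) \<in> multi_indices (k + l)" by (simp add: sum.distrib multi_indices_def)
    then show "monomial (\<lambda>i. \<alpha> i + \<beta> i) \<in> P_k (k + l)" by (rule P_k_monomial)
  qed
qed

lemma P_k_const: "(\<lambda>x. a) \<in> P_k k"
proof -
  have "monomial (\<lambda>_. 0) \<in> P_k k" by (rule P_k_monomial) (simp add: multi_indices_def)
  from P_k_cmult[OF this, of a] show ?thesis by (simp add: monomial_def)
qed

lemma monomial_coord: "monomial (\<lambda>i. of_bool (i = j)) x = x $ j"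
proof -
  have "(\<Prod>i\<in>UNIV. (x $ i) ^ of_bool (i = j)) = (\<Prod>i\<in>UNIV. if i = j then x $ j else 1)"
    by (intro prod.cong) auto
  then show ?thesis by (simp add: monomial_def)
qed

lemma P_k_coord: assumes "k \<ge> 1" shows "(\<lambda>x. x $ j) \<in> P_k k"
proof -
  have "(\<lambda>i. of_bool (i = j)) \<in> multi_indices k" using assms by (simp add: multi_indices_def)
  then have "monomial (\<lambda>i. of_bool (i = j)) \<in> P_k k" by (rule P_k_monomial)
  moreover have "monomial (\<lambda>i. of_bool (i = j)) = (\<lambda>x. x $ j)" by (rule ext) (rule monomial_coord)
  ultimately show ?thesis by simp
qed

lemma P_k_affine: assumes "k \<ge> 1" shows "(\<lambda>x. c + g \<bullet> x) \<in> P_k k"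
proof -
  have "(\<lambda>x. c + (\<Sum>i\<in>UNIV. g $ i * x $ i)) \<in> P_k k"
    by (intro P_k_add P_k_const P_k_sum P_k_cmult P_k_coord assms)
  then show ?thesis by (simp add: inner_vec_def)
qed

lemma P_k_prod: "finite I \<Longrightarrow> (\<And>i. i \<in> I \<Longrightarrow> f i \<in> P_k 1) \<Longrightarrow> (\<lambda>x. \<Prod>i\<in>I. f i x) \<in> P_k (card I)"
proof (induction I rule: finite_induct)
  case empty show ?case using P_k_const[of 1 0] by simp
next
  case (insert i I)
  then show ?case using P_k_mult[of "f i" 1 "\<lambda>x. \<Prod>i\<in>I. f i x" "card I"] by simp
qed

text \<open>A multi-index of total degree at most one is zero or a unit index, so only constants and
  coordinates occur. This gives discrete fields a constant gradient on each cell.\<close>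

lemma P_k_1_affine:
  assumes "p \<in> P_k 1" shows "\<exists>a g. \<forall>x. p x = a + g \<bullet> x"
proof -
  obtain c where c: "p = (\<lambda>x. \<Sum>\<alpha>\<in>multi_indices 1. c \<alpha> * monomial \<alpha> x)"
    using assms unfolding P_k_iff by blast
  have mono: "\<exists>a g. \<forall>x. monomial \<alpha> x = a + g \<bullet> x" if \<alpha>: "\<alpha> \<in> multi_indices 1" for \<alpha>
  proof (cases "\<forall>i. \<alpha> i = 0")
    case True
    then show ?thesis by (intro exI[of _ 1] exI[of _ 0]) (simp add: monomial_def)
  next
    case False
    then obtain j where j: "\<alpha> j \<noteq> 0" by blast
    have "sum \<alpha> UNIV = \<alpha> j + sum \<alpha> (UNIV - {j})" by (rule sum.remove) auto
    moreover have "sum \<alpha> UNIV \<le> 1" using \<alpha> by (simp add: multi_indices_def)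
    ultimately have "\<alpha> j = 1" "sum \<alpha> (UNIV - {j}) = 0" using j by linarith+
    then have "\<alpha> i = of_bool (i = j)" for i by (cases "i = j") auto
    then have "\<alpha> = (\<lambda>i. of_bool (i = j))" by blast
    then have "monomial \<alpha> x = 0 + axis j 1 \<bullet> x" for x
      using monomial_coord[of j x] by (simp add: inner_axis inner_commute[of "axis j 1"])
    then show ?thesis by blast
  qed
  then obtain a g where ag: "\<And>\<alpha> x. \<alpha> \<in> multi_indices 1 \<Longrightarrow> monomial \<alpha> x = a \<alpha> + g \<alpha> \<bullet> x" by metis
  have "p x = (\<Sum>\<alpha>\<in>multi_indices 1. c \<alpha> * a \<alpha>) + (\<Sum>\<alpha>\<in>multi_indices 1. c \<alpha> *\<^sub>R g \<alpha>) \<bullet> x" for x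
  proof -
    have "p x = (\<Sum>\<alpha>\<in>multi_indices 1. c \<alpha> * (a \<alpha> + g \<alpha> \<bullet> x))"
      unfolding c using ag by (intro sum.cong) auto
    then show ?thesis by (simp add: inner_sum_left distrib_left sum.distrib)
  qed
  then show ?thesis by blast
qed

section \<open>Vector space structure of \<open>H1\<close> and of its zero-trace subspace\<close>

lemma weak_grad_cong:
  assumes "\<And>x. x \<in> \<Omega> \<Longrightarrow> u x = v x"
  shows "is_weak_grad \<Omega> u = is_weak_grad \<Omega> v"
proof -
  have "(LINT x|lebesgue_on \<Omega>. u x * h x) = (LINT x|lebesgue_on \<Omega>. v x * h x)" for h
    using assms by (intro Bochner_Integration.integral_cong) auto
  then show ?thesis unfolding is_weak_grad_def fun_eq_iff by simp
qed

lemma L2_cong: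
  assumes "\<And>x. x \<in> \<Omega> \<Longrightarrow> u x = v x"
  shows "u \<in> L2 \<Omega> \<longleftrightarrow> v \<in> L2 \<Omega>"
proof -
  have "u \<in> borel_measurable (lebesgue_on \<Omega>) \<longleftrightarrow> v \<in> borel_measurable (lebesgue_on \<Omega>)"
    using assms by (intro measurable_cong) auto
  moreover have "integrable (lebesgue_on \<Omega>) (\<lambda>x. (norm (u x))\<^sup>2) \<longleftrightarrow> integrable (lebesgue_on \<Omega>) (\<lambda>x. (norm (v x))\<^sup>2)"
    using assms by (intro Bochner_Integration.integrable_cong) auto
  ultimately show ?thesis by (simp add: L2_def)
qed

lemma L2_norm_cong:
  assumes "\<And>x. x \<in> \<Omega> \<Longrightarrow> u x = v x"
  shows "L2_norm \<Omega> u = L2_norm \<Omega> v"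
  unfolding L2_norm_def L2_inner_def using assms
  by (intro arg_cong[where f = sqrt] Bochner_Integration.integral_cong) auto

lemma H1_norm_cong:
  assumes "\<And>x. x \<in> \<Omega> \<Longrightarrow> u x = v x"
  shows "H1_norm \<Omega> u = H1_norm \<Omega> v"
  unfolding H1_norm_def weak_grad_def using L2_norm_cong[of \<Omega> u v] weak_grad_cong[of \<Omega> u v] assms by simp

lemma H1_0_cong:
  assumes "\<And>x. x \<in> \<Omega> \<Longrightarrow> u x = v x" "u \<in> H1_0 \<Omega>"
  shows "v \<in> H1_0 \<Omega>"
proof -
  have "H1_norm \<Omega> (\<lambda>x. u x - f x) = H1_norm \<Omega> (\<lambda>x. v x - f x)" for f
    using assms by (intro H1_norm_cong) auto
  then show ?thesis
    using assms L2_cong[of \<Omega> u v] weak_grad_cong[of \<Omega> u v] by (auto simp: H1_0_def H1_def)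
qed

lemma H1_add:
  assumes "open \<Omega>" "u \<in> H1 \<Omega>" "v \<in> H1 \<Omega>" shows "(\<lambda>x. u x + v x) \<in> H1 \<Omega>"
  using assms is_weak_grad_add[OF open_sets_lebesgue[OF assms(1)]] L2_add unfolding H1_def by blast

lemma H1_cmult:
  assumes "u \<in> H1 \<Omega>" shows "(\<lambda>x. c * u x) \<in> H1 \<Omega>"
  using assms is_weak_grad_cmult[of \<Omega> u _ c] L2_mult[of u \<Omega> c] unfolding H1_def by blast

lemma H1_norm_add_sq:
  assumes "open \<Omega>" "u \<in> H1 \<Omega>" "v \<in> H1 \<Omega>"
  shows "(H1_norm \<Omega> (\<lambda>x. u x + v x))\<^sup>2 \<le> 2 * (H1_norm \<Omega> u)\<^sup>2 + 2 * (H1_norm \<Omega> v)\<^sup>2"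
proof -
  have L: "u \<in> L2 \<Omega>" "v \<in> L2 \<Omega>" using assms by (auto simp: H1_def)
  have "L2_norm \<Omega> (weak_grad \<Omega> (\<lambda>x. u x + v x)) = L2_norm \<Omega> (\<lambda>x. weak_grad \<Omega> u x + weak_grad \<Omega> v x)"
    using assms by (intro L2_norm_weak_grad is_weak_grad_add open_sets_lebesgue is_weak_grad_weak_grad L L2_add)
  then show ?thesis
    using L2_norm_add_sq[OF L] L2_norm_add_sq[OF weak_grad_L2[OF assms(2)] weak_grad_L2[OF assms(3)]]
    by (simp add: H1_norm_def)
qed

lemma H1_norm_cmult:
  assumes "open \<Omega>" "u \<in> H1 \<Omega>"
  shows "H1_norm \<Omega> (\<lambda>x. c * u x) = \<bar>c\<bar> * H1_norm \<Omega> u"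
proof -
  have L: "u \<in> L2 \<Omega>" using assms by (auto simp: H1_def)
  have "L2_norm \<Omega> (weak_grad \<Omega> (\<lambda>x. c * u x)) = L2_norm \<Omega> (\<lambda>x. c *\<^sub>R weak_grad \<Omega> u x)"
    using assms by (intro L2_norm_weak_grad is_weak_grad_cmult is_weak_grad_weak_grad L2_mult L)
  moreover have "L2_norm \<Omega> (\<lambda>x. c * u x) = \<bar>c\<bar> * L2_norm \<Omega> u" using L2_norm_scaleR[of \<Omega> c u] by simp
  ultimately show ?thesis
    by (simp add: H1_norm_def L2_norm_scaleR power_mult_distrib flip: distrib_left) (simp add: real_sqrt_mult)
qed

lemma test_H1:
  assumes "open \<Omega>" "bounded \<Omega>" "f \<in> test_functions \<Omega>" shows "f \<in> H1 \<Omega>"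
  using test_is_weak_grad[OF assms(1,3,2)] by (auto simp: H1_def)

lemma H1_norm_nonneg: "H1_norm \<Omega> u \<ge> 0" by (simp add: H1_norm_def)

lemma H1_0_approx: "u \<in> H1_0 \<Omega> \<Longrightarrow> \<delta> > 0 \<Longrightarrow> \<exists>f\<in>test_functions \<Omega>. H1_norm \<Omega> (\<lambda>x. u x - f x) < \<delta>"
  by (simp add: H1_0_def)

lemma H1_0_add:
  assumes "open \<Omega>" "bounded \<Omega>" "u \<in> H1_0 \<Omega>" "v \<in> H1_0 \<Omega>" shows "(\<lambda>x. u x + v x) \<in> H1_0 \<Omega>"
  unfolding H1_0_def
proof (intro CollectI conjI allI impI)
  have H: "u \<in> H1 \<Omega>" "v \<in> H1 \<Omega>" using assms by (auto simp: H1_0_def)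
  then show "(\<lambda>x. u x + v x) \<in> H1 \<Omega>" using assms(1) by (intro H1_add)
  fix \<delta> :: real assume d: "\<delta> > 0"
  \<comment> \<open>Half the tolerance for each summand suffices in the squared triangle inequality:
    twice the square of \<open>\<delta> / 2\<close>, taken for both summands, is the square of
    \<delta>.\<close>
  then have d2: "\<delta> / 2 > 0" by simp
  obtain f where f: "f \<in> test_functions \<Omega>" "H1_norm \<Omega> (\<lambda>x. u x - f x) < \<delta> / 2"
    using H1_0_approx[OF assms(3) d2] by (elim bexE)
  obtain g where g: "g \<in> test_functions \<Omega>" "H1_norm \<Omega> (\<lambda>x. v x - g x) < \<delta> / 2"
    using H1_0_approx[OF assms(4) d2] by (elim bexE)
  have H2: "(\<lambda>x. u x + (-1) * f x) \<in> H1 \<Omega>" "(\<lambda>x. v x + (-1) * g x) \<in> H1 \<Omega>"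
    by (rule H1_add[OF assms(1) H(1) H1_cmult[OF test_H1[OF assms(1,2) f(1)]]],
        rule H1_add[OF assms(1) H(2) H1_cmult[OF test_H1[OF assms(1,2) g(1)]]])
  have s: "(H1_norm \<Omega> (\<lambda>x. u x + (-1) * f x))\<^sup>2 < (\<delta> / 2)\<^sup>2" "(H1_norm \<Omega> (\<lambda>x. v x + (-1) * g x))\<^sup>2 < (\<delta> / 2)\<^sup>2"
    using f g H1_norm_nonneg by (intro power_strict_mono; simp)+
  have "(H1_norm \<Omega> (\<lambda>x. (u x + (-1) * f x) + (v x + (-1) * g x)))\<^sup>2 \<le>
     2 * (H1_norm \<Omega> (\<lambda>x. u x + (-1) * f x))\<^sup>2 + 2 * (H1_norm \<Omega> (\<lambda>x. v x + (-1) * g x))\<^sup>2"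
    by (rule H1_norm_add_sq[OF assms(1) H2])
  also have "\<dots> < \<delta>\<^sup>2" using s by (simp add: power2_eq_square)
  also have "(\<lambda>x. (u x + (-1) * f x) + (v x + (-1) * g x)) = (\<lambda>x. (u x + v x) - (f x + g x))" by (rule ext) simp
  finally have "(H1_norm \<Omega> (\<lambda>x. (u x + v x) - (f x + g x)))\<^sup>2 < \<delta>\<^sup>2" .
  then have "H1_norm \<Omega> (\<lambda>x. (u x + v x) - (f x + g x)) < \<delta>" by (rule power2_less_imp_less) (use d in simp)
  then show "\<exists>f\<in>test_functions \<Omega>. H1_norm \<Omega> (\<lambda>x. (u x + v x) - f x) < \<delta>"
    by (rule bexI[OF _ test_add[OF f(1) g(1)]])
qed

lemma H1_0_cmult:
  assumes "open \<Omega>" "bounded \<Omega>" "u \<in> H1_0 \<Omega>" shows "(\<lambda>x. c * u x) \<in> H1_0 \<Omega>"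
  unfolding H1_0_def
proof (intro CollectI conjI allI impI)
  have H: "u \<in> H1 \<Omega>" using assms by (auto simp: H1_0_def)
  then show "(\<lambda>x. c * u x) \<in> H1 \<Omega>" by (rule H1_cmult)
  fix \<delta> :: real assume d: "\<delta> > 0"
  \<comment> \<open>The denominator \<open>\<bar>c\<bar> + 1\<close> also covers a vanishing
    factor.\<close>
  then have d2: "\<delta> / (\<bar>c\<bar> + 1) > 0" by simp
  obtain f where f: "f \<in> test_functions \<Omega>" "H1_norm \<Omega> (\<lambda>x. u x - f x) < \<delta> / (\<bar>c\<bar> + 1)"
    using H1_0_approx[OF assms(3) d2] by (elim bexE)
  have "(\<lambda>x. u x + (-1) * f x) \<in> H1 \<Omega>" by (rule H1_add[OF assms(1) H H1_cmult[OF test_H1[OF assms(1,2) f(1)]]])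
  then have "H1_norm \<Omega> (\<lambda>x. c * (u x + (-1) * f x)) = \<bar>c\<bar> * H1_norm \<Omega> (\<lambda>x. u x + (-1) * f x)"
    by (rule H1_norm_cmult[OF assms(1)])
  also have "\<dots> \<le> (\<bar>c\<bar> + 1) * H1_norm \<Omega> (\<lambda>x. u x - f x)" using H1_norm_nonneg by (intro mult_mono) auto
  also have "\<dots> < \<delta>" using f(2) by (simp add: field_simps)
  finally have "H1_norm \<Omega> (\<lambda>x. c * u x - c * f x) < \<delta>" by (simp add: algebra_simps)
  then show "\<exists>f\<in>test_functions \<Omega>. H1_norm \<Omega> (\<lambda>x. c * u x - f x) < \<delta>"
    by (rule bexI[OF _ test_cmult[OF f(1)]])
qed

lemma test_H1_0:
  assumes "open \<Omega>" "bounded \<Omega>" "f \<in> test_functions \<Omega>" shows "f \<in> H1_0 \<Omega>"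
  unfolding H1_0_def
proof (intro CollectI conjI allI impI test_H1 assms)
  fix \<delta> :: real assume d: "\<delta> > 0"
  have "H1_norm \<Omega> (\<lambda>x. 0 * f x) = 0" using H1_norm_cmult[OF assms(1) test_H1[OF assms], of 0] by simp
  then have "H1_norm \<Omega> (\<lambda>x. f x - f x) < \<delta>" using d by simp
  then show "\<exists>g\<in>test_functions \<Omega>. H1_norm \<Omega> (\<lambda>x. f x - g x) < \<delta>" using assms(3) by blast
qed

lemma H1_0_zero: "open \<Omega> \<Longrightarrow> bounded \<Omega> \<Longrightarrow> (\<lambda>x. 0) \<in> H1_0 \<Omega>"
  by (intro test_H1_0 test_zero)

lemma H1_0_sum:
  assumes "open \<Omega>" "bounded \<Omega>"
  shows "(\<And>i. i \<in> I \<Longrightarrow> f i \<in> H1_0 \<Omega>) \<Longrightarrow> (\<lambda>x. \<Sum>i\<in>I. f i x) \<in> H1_0 \<Omega>"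
  by (induction I rule: infinite_finite_induct) (auto intro: H1_0_zero H1_0_add assms)

lemma is_weak_grad_sum:
  assumes "open \<Omega>" "bounded \<Omega>"
  shows "(\<And>i. i \<in> I \<Longrightarrow> f i \<in> L2 \<Omega> \<and> is_weak_grad \<Omega> (f i) (g i)) \<Longrightarrow> is_weak_grad \<Omega> (\<lambda>x. \<Sum>i\<in>I. f i x) (\<lambda>x. \<Sum>i\<in>I. g i x)"
proof (induction I rule: infinite_finite_induct)
  case (insert i I)
  then show ?case using L2_sum[of I f \<Omega>] open_sets_lebesgue[OF assms(1)] by (auto intro!: is_weak_grad_add)
qed (auto simp: is_weak_grad_def L2_zero)

section \<open>Quartic bubbles as products of barycentric coordinates\<close>

definition bubble_poly :: "(real^3) set \<Rightarrow> scalar_field" where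
  "bubble_poly K x = (\<Prod>v\<in>verts K. bary K v x)"

definition bubble :: "(real^3) set \<Rightarrow> scalar_field" where
  "bubble K x = (if x \<in> K then bubble_poly K x else 0)"

lemma smooth_bubble_poly: "smooth (bubble_poly K)"
  unfolding bubble_poly_def[abs_def] by (intro smooth_prod smooth_bary)

lemma bubble_poly_P4: "3 simplex K \<Longrightarrow> bubble_poly K \<in> P_k 4"
proof -
  assume K: "3 simplex K"
  have "bary K v \<in> P_k 1" for v
    using P_k_affine[of 1 "1 - bary_grad K v \<bullet> v" "bary_grad K v"]
    by (simp add: bary_def[abs_def] inner_diff_right algebra_simps)
  then have "(\<lambda>x. \<Prod>v\<in>verts K. bary K v x) \<in> P_k (card (verts K))"
    by (intro P_k_prod simplex_verts(3)[OF K])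
  then show ?thesis using simplex_verts(2)[OF K] by (simp add: bubble_poly_def[abs_def])
qed

lemma bubble_range:
  assumes K: "3 simplex K" shows "0 \<le> bubble K x" "bubble K x \<le> 1"
  using simplex_iff_bary[OF K, of x] bary_le_1[OF K, of x]
  by (auto simp: bubble_def bubble_poly_def intro: prod_nonneg prod_le_1)

lemma bubble_pos: "3 simplex K \<Longrightarrow> x \<in> interior K \<Longrightarrow> bubble K x > 0"
  using bary_pos_interior[of K x] interior_subset[of K] by (auto simp: bubble_def bubble_poly_def intro: prod_pos)

lemma bubble_eq_0:
  assumes K: "3 simplex K" and x: "x \<notin> interior K" shows "bubble K x = 0"
proof (cases "x \<in> K")
  case True
  obtain v where v: "v \<in> verts K" "\<not> bary K v x > 0" using interior_if_bary_pos[OF K, of x] x by blast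
  then have "bary K v x = 0" using True simplex_iff_bary[OF K, of x] by force
  then show ?thesis using v simplex_verts(3)[OF K] by (auto simp: bubble_def bubble_poly_def)
qed (simp add: bubble_def)

text \<open>In the product rule each of the four terms consists of factors between zero and one and
  of a single gradient of norm at most \<open>1 / (2 * \<rho>)\<close>.\<close>

lemma bubble_grad_bound:
  assumes K: "3 simplex K" and c: "cball z \<rho> \<subseteq> K" "\<rho> > 0" and x: "x \<in> K"
  shows "norm (classical_grad (bubble_poly K) x) \<le> 2 / \<rho>"
proof -
  let ?g = "\<Sum>v\<in>verts K. (\<Prod>w\<in>verts K - {v}. bary K w x) *\<^sub>R bary_grad K v"
  have "(bubble_poly K has_derivative (\<lambda>y. \<Sum>v\<in>verts K. (bary_grad K v \<bullet> y) * (\<Prod>w\<in>verts K - {v}. bary K w x))) (at x)"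
    unfolding bubble_poly_def[abs_def]
  proof (rule has_derivative_prod)
    fix v show "(bary K v has_derivative (\<lambda>y. bary_grad K v \<bullet> y)) (at x)"
      unfolding bary_def[abs_def] by (auto intro!: derivative_eq_intros)
  qed
  then have "(\<lambda>y. \<Sum>v\<in>verts K. (bary_grad K v \<bullet> y) * (\<Prod>w\<in>verts K - {v}. bary K w x)) = (\<lambda>y. classical_grad (bubble_poly K) x \<bullet> y)"
    using has_derivative_partial[OF smooth_differentiable[OF smooth_bubble_poly]] has_derivative_unique by blast
  moreover have "(\<lambda>y. \<Sum>v\<in>verts K. (bary_grad K v \<bullet> y) * (\<Prod>w\<in>verts K - {v}. bary K w x)) = (\<lambda>y. ?g \<bullet> y)"
    by (simp add: inner_sum_left mult.commute)
  ultimately have "\<forall>y. classical_grad (bubble_poly K) x \<bullet> y = ?g \<bullet> y" by metis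
  then have "classical_grad (bubble_poly K) x = ?g" unfolding vector_eq_rdot .
  also have "norm \<dots> \<le> (\<Sum>v\<in>verts K. 1 / (2 * \<rho>))"
  proof (rule order_trans[OF norm_sum], rule sum_mono)
    fix v assume v: "v \<in> verts K"
    let ?P = "\<Prod>w\<in>verts K - {v}. bary K w x"
    have P: "0 \<le> ?P" "?P \<le> 1"
      using x simplex_iff_bary[OF K, of x] bary_le_1[OF K x] by (auto intro!: prod_nonneg prod_le_1)
    have "norm (?P *\<^sub>R bary_grad K v) = ?P * norm (bary_grad K v)" using P(1) by simp
    also have "\<dots> \<le> 1 * norm (bary_grad K v)" using P(2) by (rule mult_right_mono) simp
    also have "\<dots> \<le> 1 / (2 * \<rho>)" using bary_grad_upper[OF K v c] by simp
    finally show "norm (?P *\<^sub>R bary_grad K v) \<le> 1 / (2 * \<rho>)" .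
  qed
  also have "\<dots> = 2 / \<rho>" using simplex_verts(2)[OF K] by simp
  finally show ?thesis .
qed

text \<open>The simplex and the complement of its interior form a closed cover. On the convex
  simplex the gradient bound integrates; on the other piece the bubble is zero, also on the
  faces.\<close>

lemma bubble_lipschitz:
  assumes K: "3 simplex K" and c: "cball z \<rho> \<subseteq> K" "\<rho> > 0"
  shows "(2 / \<rho>)-lipschitz_on UNIV (bubble K)"
proof (rule lipschitz_on_closed_cover[where \<U> = "{K, - interior K}"])
  have 1: "(2 / \<rho>)-lipschitz_on K (bubble_poly K)"
  proof (rule bounded_derivative_imp_lipschitz)
    show "convex K" by (rule convex_simplex[OF K])
    fix x assume x: "x \<in> K"
    show "(bubble_poly K has_derivative (\<lambda>v. classical_grad (bubble_poly K) x \<bullet> v)) (at x within K)"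
      by (rule has_derivative_at_withinI[OF has_derivative_partial[OF smooth_differentiable[OF smooth_bubble_poly]]])
    show "onorm (\<lambda>v. classical_grad (bubble_poly K) x \<bullet> v) \<le> 2 / \<rho>"
    proof (rule onorm_le)
      fix v show "norm (classical_grad (bubble_poly K) x \<bullet> v) \<le> 2 / \<rho> * norm v"
        using order_trans[OF Cauchy_Schwarz_ineq2[of "classical_grad (bubble_poly K) x" v]
           mult_right_mono[OF bubble_grad_bound[OF K c x] norm_ge_zero[of v]]] by simp
    qed
  qed (use c in auto)
  have 2: "(2 / \<rho>)-lipschitz_on K (bubble K)"
    using lipschitz_onD[OF 1] c by (intro lipschitz_onI) (auto simp: bubble_def)
  have 3: "(2 / \<rho>)-lipschitz_on (- interior K) (bubble K)"
    using c by (intro lipschitz_onI) (auto simp: bubble_eq_0[OF K])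
  show "(2 / \<rho>)-lipschitz_on U (bubble K)" if "U \<in> {K, - interior K}" for U using that 2 3 by auto
  show "closed U" if "U \<in> {K, - interior K}" for U using that closed_simplex[OF K] by (auto intro: closed_Compl)
  show "\<Union>{K, - interior K} = UNIV" using interior_subset by auto
qed (use c in auto)

text \<open>Mean value inequality on a small ball for the difference between \<open>f\<close> and
  its linear part at \<open>x\<close>, whose gradient is small there by continuity.\<close>

lemma smooth_strict:
  assumes "smooth f" "e > 0"
  shows "\<exists>d>0. \<forall>y\<in>ball x d. \<forall>z\<in>ball x d. \<bar>f y - f z - classical_grad f x \<bullet> (y - z)\<bar> \<le> e * norm (y - z)"
proof -
  have "continuous (at x) (classical_grad f)"
    using continuous_classical_grad[OF assms(1), of UNIV] by (simp add: continuous_on_eq_continuous_at)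
  then obtain d where d: "d > 0" "\<And>y. dist y x < d \<Longrightarrow> dist (classical_grad f y) (classical_grad f x) < e"
    using assms(2) unfolding continuous_at_eps_delta by metis
  show ?thesis
  proof (intro exI[of _ d] conjI ballI d(1))
    fix y z assume yz: "y \<in> ball x d" "z \<in> ball x d"
    define F where "F y = f y - classical_grad f x \<bullet> y" for y
    have "norm (F y - F z) \<le> e * norm (y - z)"
    proof (rule differentiable_bound[where S = "ball x d" and f' = "\<lambda>y v. (classical_grad f y - classical_grad f x) \<bullet> v"])
      fix w assume w: "w \<in> ball x d"
      show "(F has_derivative (\<lambda>v. (classical_grad f w - classical_grad f x) \<bullet> v)) (at w within ball x d)"
        unfolding F_def inner_diff_left
        by (rule has_derivative_at_withinI[OF has_derivative_diff[OF has_derivative_partial[OF smooth_differentiable[OF assms(1)]]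
            bounded_linear.has_derivative[OF bounded_linear_inner_right has_derivative_ident]]])
      have "norm (classical_grad f w - classical_grad f x) \<le> e"
        using d(2)[of w] w by (simp add: dist_norm dist_commute norm_minus_commute)
      then have "\<bar>(classical_grad f w - classical_grad f x) \<bullet> v\<bar> \<le> e * norm v" for v
        using order_trans[OF Cauchy_Schwarz_ineq2[of "classical_grad f w - classical_grad f x" v]
           mult_right_mono[OF _ norm_ge_zero[of v]]] by blast
      then show "onorm (\<lambda>v. (classical_grad f w - classical_grad f x) \<bullet> v) \<le> e"
        by (intro onorm_le) simp
    qed (use yz in auto)
    then show "\<bar>f y - f z - classical_grad f x \<bullet> (y - z)\<bar> \<le> e * norm (y - z)"
      by (simp add: F_def inner_diff_right algebra_simps)
  qed
qed

definition bubble_grad :: "(real^3) set \<Rightarrow> vector_field" where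
  "bubble_grad K x = (if x \<in> interior K then classical_grad (bubble_poly K) x else 0)"

text \<open>The bubble is positive up to the faces, so its support is not compact in the interior.
  The truncations at height \<open>1 / (n + 1)\<close> are compactly supported there, share the
  Lipschitz constant, and near an interior point eventually differ from the bubble by a constant
  only. The set \<open>O'\<close> is the cell itself for membership in \<open>B_4\<close> and the
  whole domain for membership in the discrete space.\<close>

lemma bubble_H1_0:
  assumes K: "3 simplex K" and c: "cball z \<rho> \<subseteq> K" "\<rho> > 0" and O: "open O'" "bounded O'" "interior K \<subseteq> O'"
  shows "bubble K \<in> H1_0 O'" "is_weak_grad O' (bubble K) (bubble_grad K)"
proof -
  define u where "u n x = max (bubble K x - 1 / real (Suc n)) 0" for n x
  note bl = bubble_lipschitz[OF K c]
  have cK: "closed K" by (rule closed_simplex[OF K])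
  have ul: "(2 / \<rho>)-lipschitz_on UNIV (u n)" for n
  proof (rule lipschitz_onI)
    fix x y
    have "dist (u n x) (u n y) \<le> dist (bubble K x) (bubble K y)" by (auto simp: u_def dist_real_def max_def)
    also have "\<dots> \<le> 2 / \<rho> * dist x y" using lipschitz_onD[OF bl] by auto
    finally show "dist (u n x) (u n y) \<le> 2 / \<rho> * dist x y" .
  qed (use c in auto)
  have supp: "closure {x. u n x \<noteq> 0} \<subseteq> O'" for n
  proof -
    have "closed {x. 1 / real (Suc n) \<le> bubble K x}"
      by (intro closed_Collect_le continuous_on_const lipschitz_on_continuous_on[OF bl])
    then have "closure {x. u n x \<noteq> 0} \<subseteq> {x. 1 / real (Suc n) \<le> bubble K x}"
      by (intro closure_minimal) (auto simp: u_def max_def)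
    also have "\<dots> \<subseteq> interior K"
    proof
      fix x assume "x \<in> {x. 1 / real (Suc n) \<le> bubble K x}"
      then have "bubble K x \<noteq> 0" by (auto simp del: of_nat_Suc)
      then show "x \<in> interior K" using bubble_eq_0[OF K] by blast
    qed
    finally show ?thesis using O(3) by blast
  qed
  have lim: "(\<lambda>n. u n x) \<longlonglongrightarrow> bubble K x" for x
  proof -
    have "(\<lambda>n. u n x) \<longlonglongrightarrow> max (bubble K x - 0) 0"
      unfolding u_def by (intro tendsto_intros LIMSEQ_Suc[OF lim_const_over_n[of 1]])
    then show ?thesis using bubble_range(1)[OF K, of x] by (simp add: max_def split: if_splits)
  qed
  have m: "O' \<in> sets lebesgue" using O(1) by (rule open_sets_lebesgue)
  have g: "bubble_grad K \<in> L2 O'"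
  proof (rule L2_bounded[OF O(2) m])
    have "(\<lambda>x. indicator (interior K) x *\<^sub>R classical_grad (bubble_poly K) x) \<in> borel_measurable borel"
      by (intro borel_measurable_scaleR borel_measurable_indicator borel_measurable_continuous_onI continuous_classical_grad smooth_bubble_poly) auto
    moreover have "bubble_grad K = (\<lambda>x. indicator (interior K) x *\<^sub>R classical_grad (bubble_poly K) x)"
      by (auto simp: bubble_grad_def)
    ultimately show "bubble_grad K \<in> borel_measurable (lebesgue_on O')" by (intro borel_measurable_lebesgue_on) metis
    show "norm (bubble_grad K x) \<le> 2 / \<rho>" for x
      using bubble_grad_bound[OF K c, of x] interior_subset[of K] c by (auto simp: bubble_grad_def)
  qed
  have ae: "AE x in lebesgue_on O'. x \<notin> K - interior K"
  proof -
    have "negligible (K - interior K)"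
      using negligible_convex_frontier[OF convex_simplex[OF K]] by (simp add: frontier_def closure_closed[OF cK])
    then have "AE x in lebesgue. x \<notin> K - interior K" unfolding negligible_iff_null_sets by (rule AE_not_in)
    then show ?thesis unfolding AE_lebesgue_on_iff[OF m] by (rule eventually_mono) blast
  qed
  have strict: "AE x in lebesgue_on O'. \<forall>e>0. \<exists>d>0. \<forall>\<^sub>F n in sequentially. \<forall>y\<in>ball x d. \<forall>z\<in>ball x d.
       \<bar>u n y - u n z - bubble_grad K x \<bullet> (y - z)\<bar> \<le> e * norm (y - z)"
    using ae
  proof (rule eventually_mono, intro allI impI)
    fix x and e :: real assume x: "x \<notin> K - interior K" and e: "e > 0"
    show "\<exists>d>0. \<forall>\<^sub>F n in sequentially. \<forall>y\<in>ball x d. \<forall>z\<in>ball x d.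
       \<bar>u n y - u n z - bubble_grad K x \<bullet> (y - z)\<bar> \<le> e * norm (y - z)"
    proof (cases "x \<in> interior K")
      case True
      obtain d1 where d1: "d1 > 0" "\<forall>y\<in>ball x d1. \<forall>z\<in>ball x d1.
        \<bar>bubble_poly K y - bubble_poly K z - classical_grad (bubble_poly K) x \<bullet> (y - z)\<bar> \<le> e * norm (y - z)"
        using smooth_strict[OF smooth_bubble_poly e, of x K] by blast
      obtain d2 where d2: "d2 > 0" "ball x d2 \<subseteq> interior K" using True open_contains_ball[of "interior K"] by auto
      have "continuous (at x) (bubble K)"
        using lipschitz_on_continuous_on[OF bl] by (simp add: continuous_on_eq_continuous_at)
      moreover have "bubble K x / 2 > 0" using bubble_pos[OF K True] by simp
      \<comment> \<open>Within this distance the bubble stays above half its value at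
        \<open>x\<close>, hence above the truncation level for large \<open>n\<close>, and the
        maximum in \<open>u\<close> is never attained by zero.\<close>
      ultimately obtain d3 where d3: "d3 > 0" "\<And>y. dist y x < d3 \<Longrightarrow> dist (bubble K y) (bubble K x) < bubble K x / 2"
        unfolding continuous_at_eps_delta by metis
      define d where "d = min d1 (min d2 d3)"
      have d: "d > 0" "d \<le> d1" "d \<le> d2" "d \<le> d3" using d1(1) d2(1) d3(1) by (auto simp: d_def)
      have "\<forall>\<^sub>F n in sequentially. 1 / real (Suc n) < bubble K x / 2"
        using \<open>bubble K x / 2 > 0\<close> by (intro order_tendstoD(2)[OF LIMSEQ_Suc[OF lim_const_over_n[of 1]]])
      then have "\<forall>\<^sub>F n in sequentially. \<forall>y\<in>ball x d. \<forall>z\<in>ball x d.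
        \<bar>u n y - u n z - bubble_grad K x \<bullet> (y - z)\<bar> \<le> e * norm (y - z)"
      proof (rule eventually_mono, intro ballI)
        fix n y z assume n: "1 / real (Suc n) < bubble K x / 2" and yz: "y \<in> ball x d" "z \<in> ball x d"
        have un: "u n s = bubble_poly K s - 1 / real (Suc n)" if s: "s \<in> ball x d" for s
        proof -
          have "dist (bubble K s) (bubble K x) < bubble K x / 2" using s d(4) by (intro d3(2)) (simp add: dist_commute)
          then have "bubble K s > bubble K x / 2" by (simp add: dist_real_def abs_if split: if_splits)
          moreover have "s \<in> K" using s d(3) d2(2) interior_subset by (metis mem_ball order.strict_trans2 subsetD)
          ultimately show ?thesis using n by (simp add: u_def bubble_def max_def)
        qed
        have "y \<in> ball x d1" "z \<in> ball x d1" using yz d(2) by auto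
        then show "\<bar>u n y - u n z - bubble_grad K x \<bullet> (y - z)\<bar> \<le> e * norm (y - z)"
          using d1(2) True un[OF yz(1)] un[OF yz(2)] by (simp add: bubble_grad_def)
      qed
      then show ?thesis using d(1) by blast
    next
      case False
      then have "x \<in> - K" using x by blast
      then obtain d where d: "d > 0" "ball x d \<subseteq> - K" using open_contains_ball[of "- K"] cK by (auto simp: open_Compl)
      have "u n y = 0" if "y \<in> ball x d" for n y
        using that d(2) by (auto simp: u_def bubble_def max_def)
      then show ?thesis using d(1) False e by (intro exI[of _ d]) (auto simp: bubble_grad_def)
    qed
  qed
  show "bubble K \<in> H1_0 O'" "is_weak_grad O' (bubble K) (bubble_grad K)"
    using H1_0_limit[OF O(1,2) ul bl supp lim g strict] by blast+
qed

text \<open>\<open>B_4\<close> asks for a global polynomial whose restriction to the interior has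
  zero trace; there the polynomial agrees with its extension by zero, to which the truncation
  argument applies.\<close>

lemma bubble_poly_B4:
  assumes K: "3 simplex K" and c: "cball z \<rho> \<subseteq> K" "\<rho> > 0"
  shows "bubble_poly K \<in> B_4 K"
proof -
  have "bubble K \<in> H1_0 (interior K)"
    using bounded_subset[OF compact_imp_bounded[OF compact_simplex[OF K]] interior_subset]
    by (intro bubble_H1_0[OF K c]) auto
  then have "bubble_poly K \<in> H1_0 (interior K)"
    by (rule H1_0_cong[rotated]) (use interior_subset[of K] in \<open>auto simp: bubble_def\<close>)
  then show ?thesis using bubble_poly_P4[OF K] by (simp add: B_4_def)
qed

section \<open>Meshes and bubble corrections\<close>

text \<open>What the analysis uses of one mesh. The number \<open>c\<close> condenses shape
  regularity and quasi-uniformity, and \<kappa> comes from the geometry of \<Omega>. Every stability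
  constant is an expression in these two, so uniformity in \<open>h\<close> amounts to finding one
  pair for the whole family.\<close>

locale fe_mesh =
  fixes \<Omega> :: "(real^3) set" and \<T> :: "(real^3) set set" and h c \<kappa> :: real
  assumes open_dom: "open \<Omega>" and bdd_dom: "bounded \<Omega>" and regular_dom: "\<Omega> = interior (closure \<Omega>)"
    and finite_mesh: "finite \<T>" and simplex_mesh: "\<And>K. K \<in> \<T> \<Longrightarrow> 3 simplex K" and cover: "\<Union>\<T> = closure \<Omega>"
    and conforming: "\<And>K K'. K \<in> \<T> \<Longrightarrow> K' \<in> \<T> \<Longrightarrow> (K \<inter> K') face_of K"
    and h_pos: "h > 0" and c_pos: "c > 0" and diam: "\<And>K. K \<in> \<T> \<Longrightarrow> diameter K \<le> h"
    and inball: "\<And>K. K \<in> \<T> \<Longrightarrow> \<exists>z. cball z (c * h) \<subseteq> K"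
    and \<kappa>_pos: "0 < \<kappa>" and \<kappa>_le_1: "\<kappa> \<le> 1"
    and exterior: "\<And>b x. b \<notin> \<Omega> \<Longrightarrow> x \<in> closure \<Omega> \<Longrightarrow> dist x b \<le> h \<Longrightarrow>
      \<exists>y. cball y (\<kappa> * h) \<subseteq> cball b h \<and> cball y (\<kappa> * h) \<inter> \<Omega> = {}"
begin

lemma dom_sets: "\<Omega> \<in> sets lebesgue" using open_dom by (rule open_sets_lebesgue)

lemma interior_cell_subset: "K \<in> \<T> \<Longrightarrow> interior K \<subseteq> \<Omega>"
  using cover regular_dom interior_mono[of K "closure \<Omega>"] by auto

lemma interior_sets: "interior K \<in> sets lebesgue" by (intro open_sets_lebesgue open_interior)

lemma cell_compact: "K \<in> \<T> \<Longrightarrow> compact K" by (rule compact_simplex[OF simplex_mesh])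

lemma cell_bounded: "K \<in> \<T> \<Longrightarrow> bounded K" by (intro compact_imp_bounded cell_compact)

lemma interior_cell_bounded: "K \<in> \<T> \<Longrightarrow> bounded (interior K)"
  using cell_bounded bounded_subset interior_subset by blast

lemma interior_cell_nonempty: "K \<in> \<T> \<Longrightarrow> interior K \<noteq> {}"
proof -
  assume K: "K \<in> \<T>"
  obtain z where "cball z (c * h) \<subseteq> K" using inball[OF K] by blast
  then have "ball z (c * h) \<subseteq> interior K" by (intro interior_maximal) (auto intro: order_trans[OF ball_subset_cball])
  moreover have "z \<in> ball z (c * h)" using c_pos h_pos by simp
  ultimately show ?thesis by blast
qed

text \<open>A proper face misses the interior of its cell. If the interior of one cell meets another
  cell, their intersection is thus the whole first cell; the argument then applies with the roles
  exchanged and makes the cells equal.\<close>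

lemma cells_disjoint:
  assumes K: "K \<in> \<T>" and K': "K' \<in> \<T>" and ne: "K \<noteq> K'"
  shows "interior K \<inter> K' = {}"
proof (rule ccontr)
  have key: "A \<subseteq> B" if "A \<in> \<T>" "B \<in> \<T>" "interior A \<inter> B \<noteq> {}" for A B
  proof -
    have "A \<inter> B = A"
    proof (rule ccontr)
      assume "A \<inter> B \<noteq> A"
      then have "(A \<inter> B) \<inter> interior A = {}"
        using face_of_disjoint_interior[OF conforming[OF that(1,2)]] by blast
      then show False using that(3) interior_subset[of A] by blast
    qed
    then show ?thesis by blast
  qed
  assume "interior K \<inter> K' \<noteq> {}"
  then have s: "K \<subseteq> K'" by (rule key[OF K K'])
  then have "interior K \<subseteq> interior K'" by (rule interior_mono)
  then have "interior K' \<inter> K \<noteq> {}" using interior_cell_nonempty[OF K] interior_subset[of K] by blast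
  then have "K' \<subseteq> K" by (rule key[OF K' K])
  then show False using s ne by blast
qed

text \<open>The boundaries of the finitely many cells are frontiers of convex sets and therefore
  null.\<close>

lemma AE_interior_cell: "AE x in lebesgue_on \<Omega>. \<exists>K\<in>\<T>. x \<in> interior K"
proof -
  have "negligible (K - interior K)" if "K \<in> \<T>" for K
    using negligible_convex_frontier[OF convex_simplex[OF simplex_mesh[OF that]]]
    by (simp add: frontier_def closure_closed[OF closed_simplex[OF simplex_mesh[OF that]]])
  then have "negligible (\<Union>K\<in>\<T>. K - interior K)" using finite_mesh by (intro negligible_Union) auto
  then have "AE x in lebesgue. x \<notin> (\<Union>K\<in>\<T>. K - interior K)" unfolding negligible_iff_null_sets by (rule AE_not_in)
  then show ?thesis unfolding AE_lebesgue_on_iff[OF dom_sets]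
  proof (rule eventually_mono, intro impI)
    fix x assume x: "x \<notin> (\<Union>K\<in>\<T>. K - interior K)" "x \<in> \<Omega>"
    then have "x \<in> \<Union>\<T>" using cover closure_subset by blast
    then show "\<exists>K\<in>\<T>. x \<in> interior K" using x(1) by blast
  qed
qed

lemma AE_cell_interior:
  assumes "K \<in> \<T>" shows "AE x in lebesgue_on K. x \<in> interior K"
proof -
  have "negligible (K - interior K)"
    using negligible_convex_frontier[OF convex_simplex[OF simplex_mesh[OF assms]]]
    by (simp add: frontier_def closure_closed[OF closed_simplex[OF simplex_mesh[OF assms]]])
  then have "AE x in lebesgue. x \<notin> K - interior K" unfolding negligible_iff_null_sets by (rule AE_not_in)
  then have "AE x in lebesgue. x \<in> K \<longrightarrow> x \<in> interior K" by (rule eventually_mono) blast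
  moreover have "K \<in> sets lebesgue" using closed_simplex[OF simplex_mesh[OF assms]] by simp
  ultimately show ?thesis using AE_lebesgue_on_iff by blast
qed

text \<open>Piecewise objects are encoded as sums over all cells of terms vanishing off their own
  cell; at an interior point of a cell one term survives.\<close>

lemma sum_single_cell:
  fixes F :: "(real^3) set \<Rightarrow> 'b::comm_monoid_add"
  assumes "K \<in> \<T>" "x \<in> interior K" "\<And>K'. K' \<in> \<T> \<Longrightarrow> x \<notin> K' \<Longrightarrow> F K' = 0"
  shows "(\<Sum>K'\<in>\<T>. F K') = F K"
proof -
  have "F K' = 0" if "K' \<in> \<T> - {K}" for K'
    using assms(3)[of K'] cells_disjoint[OF assms(1), of K'] that assms(2) by blast
  then show ?thesis using sum.mono_neutral_right[OF finite_mesh, of "{K}" F] assms(1) by simp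
qed

lemma cell_integral:
  fixes g :: scalar_field
  assumes g: "integrable (lebesgue_on \<Omega>) g"
  shows "(LINT x|lebesgue_on \<Omega>. g x) = (\<Sum>K\<in>\<T>. LINT x|lebesgue_on (interior K). g x)"
proof -
  have i: "integrable (lebesgue_on \<Omega>) (\<lambda>x. indicator (interior K) x *\<^sub>R g x)" if "K \<in> \<T>" for K
    using interior_cell_subset[OF that] interior_sets[of K] dom_sets
    by (intro integrable_mult_indicator g) (auto simp: sets_restrict_space_iff)
  have "(LINT x|lebesgue_on \<Omega>. g x) = (LINT x|lebesgue_on \<Omega>. (\<Sum>K\<in>\<T>. indicator (interior K) x *\<^sub>R g x))"
  proof (rule integral_cong_AE)
    show "AE x in lebesgue_on \<Omega>. g x = (\<Sum>K\<in>\<T>. indicator (interior K) x *\<^sub>R g x)"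
      using AE_interior_cell
    proof (rule eventually_mono)
      fix x assume "\<exists>K\<in>\<T>. x \<in> interior K"
      then obtain K where K: "K \<in> \<T>" "x \<in> interior K" by blast
      have "(\<Sum>K\<in>\<T>. indicator (interior K) x *\<^sub>R g x) = indicator (interior K) x *\<^sub>R g x"
        by (rule sum_single_cell[OF K]) (use interior_subset in \<open>auto simp: indicator_def\<close>)
      then show "g x = (\<Sum>K\<in>\<T>. indicator (interior K) x *\<^sub>R g x)" using K by simp
    qed
    show "(\<lambda>x. \<Sum>K\<in>\<T>. indicator (interior K) x *\<^sub>R g x) \<in> borel_measurable (lebesgue_on \<Omega>)"
      using i by (intro borel_measurable_sum borel_measurable_integrable)
  qed (use g in auto)
  also have "\<dots> = (\<Sum>K\<in>\<T>. LINT x|lebesgue_on \<Omega>. indicator (interior K) x *\<^sub>R g x)"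
    by (rule Bochner_Integration.integral_sum) (rule i)
  also have "\<dots> = (\<Sum>K\<in>\<T>. LINT x|lebesgue_on (interior K). g x)"
  proof (rule sum.cong[OF refl])
    fix K assume K: "K \<in> \<T>"
    have "(LINT x|lebesgue_on \<Omega>. indicator (interior K) x *\<^sub>R g x) = (LINT x|lebesgue_on (interior K). indicator (interior K) x *\<^sub>R g x)"
      by (intro lebesgue_on_integral_subset interior_cell_subset K interior_sets dom_sets) (simp add: indicator_def)
    also have "\<dots> = (LINT x|lebesgue_on (interior K). g x)"
      by (intro Bochner_Integration.integral_cong) auto
    finally show "(LINT x|lebesgue_on \<Omega>. indicator (interior K) x *\<^sub>R g x) = (LINT x|lebesgue_on (interior K). g x)" .
  qed
  finally show ?thesis .
qed

lemma L2_cell: "f \<in> L2 \<Omega> \<Longrightarrow> K \<in> \<T> \<Longrightarrow> f \<in> L2 (interior K)"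
  by (rule L2_subset[OF _ interior_cell_subset interior_sets dom_sets])

definition ball_const :: real where "ball_const = unit_ball_vol (real DIM(real^3))"

lemma ball_const_pos: "ball_const > 0" by (simp add: ball_const_def)

lemma cball_volume: "r \<ge> 0 \<Longrightarrow> measure lborel (cball (z::real^3) r) = ball_const * r ^ 3"
  using content_cball[of r z] by (simp add: ball_const_def)

lemma cball_volume': "r \<ge> 0 \<Longrightarrow> measure lebesgue (cball (z::real^3) r) = ball_const * r ^ 3"
  using cball_volume by simp

lemma cell_subset_cball: "K \<in> \<T> \<Longrightarrow> v \<in> K \<Longrightarrow> x \<in> K \<Longrightarrow> dist v x \<le> h"
  using diameter_bounded_bound[OF cell_bounded, of K v x] diam[of K] by linarith

lemma cell_volume: "K \<in> \<T> \<Longrightarrow> measure lebesgue (interior K) \<le> ball_const * h ^ 3"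
proof -
  assume K: "K \<in> \<T>"
  obtain v where v: "v \<in> K" using interior_cell_nonempty[OF K] interior_subset by blast
  have "measure lebesgue (interior K) \<le> measure lebesgue (cball v h)"
    using cell_subset_cball[OF K v] interior_subset[of K] interior_sets
    by (intro measure_mono_fmeasurable) auto
  then show ?thesis using cball_volume'[of h v] h_pos by simp
qed

text \<open>Cauchy-Schwarz against the constant function one.\<close>

lemma cell_L1_bound:
  fixes e :: scalar_field
  assumes e: "e \<in> L2 \<Omega>" and K: "K \<in> \<T>"
  shows "(LINT x|lebesgue_on (interior K). e x)\<^sup>2 \<le> measure lebesgue (interior K) * (L2_norm (interior K) e)\<^sup>2"
proof -
  have eK: "e \<in> L2 (interior K)" by (rule L2_cell[OF e K])
  have one: "(\<lambda>x. 1::real) \<in> L2 (interior K)"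
    by (rule L2_bounded[OF interior_cell_bounded[OF K] interior_sets, of _ 1]) auto
  have "L2_inner (interior K) (\<lambda>x. 1::real) (\<lambda>x. 1) = measure lebesgue (interior K)"
    using interior_sets[of K] by (simp add: L2_inner_def measure_restrict_space)
  then have n1: "(L2_norm (interior K) (\<lambda>x. 1::real))\<^sup>2 = measure lebesgue (interior K)" by (simp add: L2_norm_sq)
  have "\<bar>LINT x|lebesgue_on (interior K). e x\<bar> \<le> L2_norm (interior K) e * L2_norm (interior K) (\<lambda>x. 1::real)"
    using L2_Cauchy_Schwarz[OF eK one] by (simp add: L2_inner_def)
  then have "\<bar>LINT x|lebesgue_on (interior K). e x\<bar>\<^sup>2 \<le> (L2_norm (interior K) e * L2_norm (interior K) (\<lambda>x. 1::real))\<^sup>2"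
    by (intro power_mono) auto
  then show ?thesis by (simp add: power_mult_distrib n1 mult.commute)
qed

section \<open>Correction of cell means by bubbles\<close>

definition bubble_mass :: "(real^3) set \<Rightarrow> real" where
  "bubble_mass K = (LINT x|lebesgue_on (interior K). bubble K x)"

lemma bubble_measurable: "K \<in> \<T> \<Longrightarrow> bubble K \<in> borel_measurable borel"
proof -
  assume K: "K \<in> \<T>"
  obtain z where z: "cball z (c * h) \<subseteq> K" using inball[OF K] by blast
  show ?thesis using bubble_lipschitz[OF simplex_mesh[OF K] z] c_pos h_pos
    by (intro borel_measurable_continuous_onI lipschitz_on_continuous_on) auto
qed

text \<open>On the half-size inscribed ball all four coordinates are at least \<open>c / 2\<close>,
  which gives the fourth power; the volume of that ball, of radius \<open>c * h / 2\<close>,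
  contributes three more factors.\<close>

lemma bubble_mass_lower:
  assumes K: "K \<in> \<T>" shows "(c / 2) ^ 7 * (ball_const * h ^ 3) \<le> bubble_mass K"
proof -
  note S = simplex_mesh[OF K]
  obtain z where z: "cball z (c * h) \<subseteq> K" using inball[OF K] by blast
  let ?B = "cball z (c * h / 2)"
  have ch: "c * h > 0" using c_pos h_pos by simp
  have low: "bary K v y \<ge> c / 2" if "v \<in> verts K" "y \<in> ?B" for v y
    using bary_lower_inball[OF S that(1) diam[OF K] h_pos z ch that(2)] h_pos by simp
  have BI: "?B \<subseteq> interior K"
  proof
    fix y assume y: "y \<in> ?B"
    show "y \<in> interior K" by (rule interior_if_bary_pos[OF S]) (use low[OF _ y] c_pos in force)
  qed
  have bl: "(c / 2) ^ 4 \<le> bubble K y" if "y \<in> ?B" for y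
  proof -
    have "(\<Prod>v\<in>verts K. c / 2) \<le> (\<Prod>v\<in>verts K. bary K v y)"
      using low[OF _ that] c_pos by (intro prod_mono) auto
    then have "(c / 2) ^ 4 \<le> bubble_poly K y" using simplex_verts(2)[OF S] by (simp add: bubble_poly_def)
    then show ?thesis using BI that interior_subset[of K] by (auto simp: bubble_def)
  qed
  have fin: "finite_measure (lebesgue_on (interior K))"
    using interior_cell_bounded[OF K] interior_sets by (intro finite_measure_lebesgue_on bounded_set_imp_lmeasurable)
  have Bs: "?B \<in> sets (lebesgue_on (interior K))" using BI interior_sets by (auto simp: sets_restrict_space_iff)
  have "(c / 2) ^ 4 * (ball_const * (c * h / 2) ^ 3) = (c / 2) ^ 4 * measure (lebesgue_on (interior K)) ?B"
    using cball_volume'[of "c * h / 2" z] ch BI interior_sets[of K] by (simp add: measure_restrict_space)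
  also have "\<dots> = (LINT x|lebesgue_on (interior K). (c / 2) ^ 4 * indicator ?B x)"
    using BI by (simp add: Int_absorb2)
  also have "\<dots> \<le> bubble_mass K" unfolding bubble_mass_def
  proof (rule integral_mono)
    show "integrable (lebesgue_on (interior K)) (\<lambda>x. (c / 2) ^ 4 * indicator ?B x)"
      using finite_measure.emeasure_finite[OF fin, of ?B] Bs by (intro integrable_mult_right) (auto simp: less_top)
    show "integrable (lebesgue_on (interior K)) (bubble K)"
      using bubble_range[OF S] bubble_measurable[OF K]
      by (intro finite_measure.integrable_const_bound[OF fin, of _ 1]) (auto intro!: AE_I2 borel_measurable_lebesgue_on)
    fix x show "(c / 2) ^ 4 * indicator ?B x \<le> bubble K x"
      using bl[of x] bubble_range(1)[OF S, of x] by (auto simp: indicator_def)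
  qed
  also have "(c / 2) ^ 4 * (ball_const * (c * h / 2) ^ 3) = (c / 2) ^ 7 * (ball_const * h ^ 3)"
    by (simp add: power_divide power_mult_distrib)
  finally show ?thesis .
qed

lemma bubble_mass_pos: "K \<in> \<T> \<Longrightarrow> bubble_mass K > 0"
proof -
  assume K: "K \<in> \<T>"
  have "0 < (c / 2) ^ 7 * (ball_const * h ^ 3)" using c_pos h_pos ball_const_pos by simp
  also have "\<dots> \<le> bubble_mass K" by (rule bubble_mass_lower[OF K])
  finally show ?thesis .
qed

text \<open>The multiple of the bubble that has the same integral over the cell as
  \<open>e\<close>.\<close>

definition bubble_coeff :: "scalar_field \<Rightarrow> (real^3) set \<Rightarrow> real" where
  "bubble_coeff e K = (LINT x|lebesgue_on (interior K). e x) / bubble_mass K"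

definition bubble_part :: "scalar_field \<Rightarrow> scalar_field" where
  "bubble_part e x = (\<Sum>K\<in>\<T>. bubble_coeff e K * bubble K x)"

definition bubble_part_grad :: "scalar_field \<Rightarrow> vector_field" where
  "bubble_part_grad e x = (\<Sum>K\<in>\<T>. bubble_coeff e K *\<^sub>R bubble_grad K x)"

lemma bubble_part_cell: "K \<in> \<T> \<Longrightarrow> x \<in> interior K \<Longrightarrow> bubble_part e x = bubble_coeff e K * bubble K x"
  unfolding bubble_part_def by (rule sum_single_cell) (auto simp: bubble_def)

lemma bubble_part_grad_cell: "K \<in> \<T> \<Longrightarrow> x \<in> interior K \<Longrightarrow> bubble_part_grad e x = bubble_coeff e K *\<^sub>R bubble_grad K x"
  unfolding bubble_part_grad_def by (rule sum_single_cell) (use interior_subset in \<open>auto simp: bubble_grad_def\<close>)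

text \<open>The inverse square of the factor \<open>(c / 2) ^ 7\<close> in
  \<open>bubble_mass_lower\<close>.\<close>

definition bubble_const :: real where "bubble_const = (2 / c) ^ 14"

text \<open>The squared integral of \<open>e\<close> and the cell measure bring in two volumes of
  order \<open>h ^ 3\<close>, and the squared bubble mass in the denominator carries the same two.
  All powers of \<open>h\<close> cancel.\<close>

lemma bubble_coeff_bound:
  assumes e: "e \<in> L2 \<Omega>" and K: "K \<in> \<T>"
  shows "(bubble_coeff e K)\<^sup>2 * measure lebesgue (interior K) \<le> bubble_const * (L2_norm (interior K) e)\<^sup>2"
proof -
  let ?V = "ball_const * h ^ 3" let ?m = "measure lebesgue (interior K)"
  have V: "?V > 0" using ball_const_pos h_pos by simp
  have q: "(c / 2) ^ 7 > 0" using c_pos by simp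
  have mass: "((c / 2) ^ 7 * ?V)\<^sup>2 \<le> (bubble_mass K)\<^sup>2"
    using bubble_mass_lower[OF K] V q by (intro power_mono) (auto intro: less_imp_le)
  have mp: "(bubble_mass K)\<^sup>2 > 0" using bubble_mass_pos[OF K] by simp
  have m: "0 \<le> ?m" "?m \<le> ?V" using cell_volume[OF K] by auto
  have "(LINT x|lebesgue_on (interior K). e x)\<^sup>2 * ?m \<le> (?m * (L2_norm (interior K) e)\<^sup>2) * ?m"
    by (intro mult_right_mono cell_L1_bound[OF e K] m)
  also have "\<dots> = ?m\<^sup>2 * (L2_norm (interior K) e)\<^sup>2" by (simp add: power2_eq_square)
  also have "\<dots> \<le> ?V\<^sup>2 * (L2_norm (interior K) e)\<^sup>2"
    using m by (intro mult_right_mono power_mono) auto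
  also have "\<dots> = bubble_const * (L2_norm (interior K) e)\<^sup>2 * ((c / 2) ^ 7 * ?V)\<^sup>2"
  proof -
    have "bubble_const * ((c / 2) ^ 7)\<^sup>2 = 1"
      using c_pos by (simp add: bubble_const_def power_mult[symmetric] power_mult_distrib[symmetric])
    moreover have "bubble_const * (L2_norm (interior K) e)\<^sup>2 * ((c / 2) ^ 7 * ?V)\<^sup>2 =
        (bubble_const * ((c / 2) ^ 7)\<^sup>2) * (?V\<^sup>2 * (L2_norm (interior K) e)\<^sup>2)"
      unfolding power_mult_distrib[of "(c / 2) ^ 7" ?V] by (simp only: mult_ac)
    ultimately show ?thesis by (simp only: mult_1)
  qed
  also have "\<dots> \<le> bubble_const * (L2_norm (interior K) e)\<^sup>2 * (bubble_mass K)\<^sup>2"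
    by (intro mult_left_mono mass) (simp add: bubble_const_def c_pos less_imp_le)
  finally show ?thesis using mp by (simp add: bubble_coeff_def power_divide pos_divide_le_eq)
qed

lemma L2_norm_cells:
  assumes "f \<in> L2 \<Omega>"
  shows "(L2_norm \<Omega> f)\<^sup>2 = (\<Sum>K\<in>\<T>. (L2_norm (interior K) f)\<^sup>2)"
  unfolding L2_norm_sq_integral by (rule cell_integral[OF L2_D(2)[OF assms]])

text \<open>Stated for a general \<open>G\<close>, so that it serves the correction itself with
  \<open>M = 1\<close> and its gradient with \<open>M = 2 / (c * h)\<close>.\<close>

lemma bubble_part_bound:
  fixes G :: "real^3 \<Rightarrow> 'b::euclidean_space"
  assumes e: "e \<in> L2 \<Omega>" and G: "G \<in> L2 \<Omega>"
    and b: "\<And>K x. K \<in> \<T> \<Longrightarrow> x \<in> interior K \<Longrightarrow> norm (G x) \<le> M * \<bar>bubble_coeff e K\<bar>"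
  shows "(L2_norm \<Omega> G)\<^sup>2 \<le> M\<^sup>2 * bubble_const * (L2_norm \<Omega> e)\<^sup>2"
proof -
  have "(L2_norm \<Omega> G)\<^sup>2 = (\<Sum>K\<in>\<T>. (L2_norm (interior K) G)\<^sup>2)" by (rule L2_norm_cells[OF G])
  also have "\<dots> \<le> (\<Sum>K\<in>\<T>. M\<^sup>2 * bubble_const * (L2_norm (interior K) e)\<^sup>2)"
  proof (rule sum_mono)
    fix K assume K: "K \<in> \<T>"
    have fin: "finite_measure (lebesgue_on (interior K))"
      using interior_cell_bounded[OF K] interior_sets by (intro finite_measure_lebesgue_on bounded_set_imp_lmeasurable)
    have GK: "G \<in> L2 (interior K)" using L2_subset[OF G interior_cell_subset[OF K] interior_sets dom_sets] .
    have "(L2_norm (interior K) G)\<^sup>2 \<le> (LINT x|lebesgue_on (interior K). M\<^sup>2 * (bubble_coeff e K)\<^sup>2)"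
      unfolding L2_norm_sq_integral
    proof (rule integral_mono[OF L2_D(2)[OF GK] finite_measure.integrable_const[OF fin]])
      fix x assume "x \<in> space (lebesgue_on (interior K))"
      then have "(norm (G x))\<^sup>2 \<le> (M * \<bar>bubble_coeff e K\<bar>)\<^sup>2" using b[OF K] by (intro power_mono) auto
      then show "(norm (G x))\<^sup>2 \<le> M\<^sup>2 * (bubble_coeff e K)\<^sup>2" by (simp add: power_mult_distrib)
    qed
    also have "\<dots> = M\<^sup>2 * ((bubble_coeff e K)\<^sup>2 * measure lebesgue (interior K))"
      using interior_sets[of K] by (simp add: measure_restrict_space)
    also have "\<dots> \<le> M\<^sup>2 * (bubble_const * (L2_norm (interior K) e)\<^sup>2)"
      by (intro mult_left_mono bubble_coeff_bound[OF e K]) simp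
    finally show "(L2_norm (interior K) G)\<^sup>2 \<le> M\<^sup>2 * bubble_const * (L2_norm (interior K) e)\<^sup>2" by simp
  qed
  also have "\<dots> = M\<^sup>2 * bubble_const * (L2_norm \<Omega> e)\<^sup>2"
    by (simp add: L2_norm_cells[OF e] sum_distrib_left)
  finally show ?thesis .
qed

lemma bubble_part_H1_0:
  shows "bubble_part e \<in> H1_0 \<Omega>" "is_weak_grad \<Omega> (bubble_part e) (bubble_part_grad e)"
proof -
  have b: "bubble K \<in> H1_0 \<Omega>" "is_weak_grad \<Omega> (bubble K) (bubble_grad K)" if K: "K \<in> \<T>" for K
  proof -
    obtain z where z: "cball z (c * h) \<subseteq> K" using inball[OF K] by blast
    have ch: "c * h > 0" using c_pos h_pos by simp
    show "bubble K \<in> H1_0 \<Omega>" "is_weak_grad \<Omega> (bubble K) (bubble_grad K)"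
      by (rule bubble_H1_0[OF simplex_mesh[OF K] z ch open_dom bdd_dom interior_cell_subset[OF K]])+
  qed
  show "bubble_part e \<in> H1_0 \<Omega>" unfolding bubble_part_def[abs_def]
    by (intro H1_0_sum H1_0_cmult open_dom bdd_dom b)
  show "is_weak_grad \<Omega> (bubble_part e) (bubble_part_grad e)" unfolding bubble_part_def[abs_def] bubble_part_grad_def[abs_def]
  proof (rule is_weak_grad_sum[OF open_dom bdd_dom], intro conjI)
    fix K assume K: "K \<in> \<T>"
    show "(\<lambda>x. bubble_coeff e K * bubble K x) \<in> L2 \<Omega>"
      using b(1)[OF K] by (intro L2_mult) (simp add: H1_0_def H1_def)
    show "is_weak_grad \<Omega> (\<lambda>x. bubble_coeff e K * bubble K x) (\<lambda>x. bubble_coeff e K *\<^sub>R bubble_grad K x)"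
      by (intro is_weak_grad_cmult b K)
  qed
qed

lemma H1_0_L2: "u \<in> H1_0 \<Omega> \<Longrightarrow> u \<in> L2 \<Omega>" by (simp add: H1_0_def H1_def)

lemma bubble_part_L2_bound:
  assumes e: "e \<in> L2 \<Omega>"
  shows "(L2_norm \<Omega> (bubble_part e))\<^sup>2 \<le> bubble_const * (L2_norm \<Omega> e)\<^sup>2"
proof -
  have "norm (bubble_part e x) \<le> 1 * \<bar>bubble_coeff e K\<bar>" if "K \<in> \<T>" "x \<in> interior K" for K x
    using bubble_range[OF simplex_mesh[OF that(1)], of x]
    by (auto simp: bubble_part_cell[OF that] abs_mult intro!: mult_left_le)
  from bubble_part_bound[OF e H1_0_L2[OF bubble_part_H1_0(1)] this] show ?thesis by simp
qed

text \<open>An inverse estimate: the gradient of the correction costs a factor of order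
  \<open>1 / h\<close>, to be compensated by applying it to an \<open>e\<close> of order
  \<open>h\<close>.\<close>

lemma bubble_part_grad_bound:
  assumes e: "e \<in> L2 \<Omega>"
  shows "(L2_norm \<Omega> (bubble_part_grad e))\<^sup>2 \<le> (2 / (c * h))\<^sup>2 * bubble_const * (L2_norm \<Omega> e)\<^sup>2"
proof (rule bubble_part_bound[OF e])
  show "bubble_part_grad e \<in> L2 \<Omega>" using bubble_part_H1_0(2) by (simp add: is_weak_grad_def)
  fix K x assume K: "K \<in> \<T>" and x: "x \<in> interior K"
  obtain z where z: "cball z (c * h) \<subseteq> K" using inball[OF K] by blast
  have ch: "c * h > 0" using c_pos h_pos by simp
  have "norm (bubble_grad K x) \<le> 2 / (c * h)"
    using bubble_grad_bound[OF simplex_mesh[OF K] z ch] x interior_subset[of K] by (auto simp: bubble_grad_def)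
  then show "norm (bubble_part_grad e x) \<le> 2 / (c * h) * \<bar>bubble_coeff e K\<bar>"
    unfolding bubble_part_grad_cell[OF K x] norm_scaleR mult.commute[of _ "\<bar>bubble_coeff e K\<bar>"]
    by (intro mult_left_mono) auto
qed

lemma bubble_part_mean:
  assumes K: "K \<in> \<T>"
  shows "(LINT x|lebesgue_on (interior K). bubble_part e x) = (LINT x|lebesgue_on (interior K). e x)"
proof -
  have "(LINT x|lebesgue_on (interior K). bubble_part e x) = (LINT x|lebesgue_on (interior K). bubble_coeff e K * bubble K x)"
    by (intro Bochner_Integration.integral_cong) (auto simp: bubble_part_cell[OF K])
  also have "\<dots> = bubble_coeff e K * bubble_mass K" by (simp add: bubble_mass_def)
  also have "\<dots> = (LINT x|lebesgue_on (interior K). e x)" using bubble_mass_pos[OF K] by (simp add: bubble_coeff_def)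
  finally show ?thesis .
qed

lemma B_4_cmult: assumes "b \<in> B_4 K" "bounded K" shows "(\<lambda>x. a * b x) \<in> B_4 K"
proof -
  have "bounded (interior K)" using assms(2) bounded_subset interior_subset by blast
  then show ?thesis using assms(1) P_k_cmult[of b 4 a] H1_0_cmult[of "interior K" b a] by (simp add: B_4_def)
qed

lemma B_4_add: assumes "b \<in> B_4 K" "b' \<in> B_4 K" "bounded K" shows "(\<lambda>x. b x + b' x) \<in> B_4 K"
proof -
  have "bounded (interior K)" using assms(3) bounded_subset interior_subset by blast
  then show ?thesis using assms(1,2) P_k_add[of b 4 b'] H1_0_add[of "interior K" b b'] by (simp add: B_4_def)
qed

lemma bubble_part_B_4:
  assumes K: "K \<in> \<T>"
  shows "\<exists>b\<in>B_4 K. \<forall>x\<in>interior K. bubble_part e x = b x"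
proof -
  obtain z where z: "cball z (c * h) \<subseteq> K" using inball[OF K] by blast
  have ch: "c * h > 0" using c_pos h_pos by simp
  have "bubble_poly K \<in> B_4 K" by (rule bubble_poly_B4[OF simplex_mesh[OF K] z ch])
  then have "(\<lambda>x. bubble_coeff e K * bubble_poly K x) \<in> B_4 K" by (rule B_4_cmult[OF _ cell_bounded[OF K]])
  moreover have "\<forall>x\<in>interior K. bubble_part e x = bubble_coeff e K * bubble_poly K x"
    using bubble_part_cell[OF K] interior_subset[of K] by (auto simp: bubble_def)
  ultimately show ?thesis by (intro bexI[of _ "\<lambda>x. bubble_coeff e K * bubble_poly K x"])
qed

end

section \<open>Quasi-interpolation and the Fortin operator\<close>

lemma finite_abs_argmax:
  fixes a :: "'a \<Rightarrow> real"
  assumes "finite S" "S \<noteq> {}"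
  obtains v where "v \<in> S" "\<And>w. w \<in> S \<Longrightarrow> \<bar>a w\<bar> \<le> \<bar>a v\<bar>"
proof -
  have fin: "finite ((\<lambda>w. \<bar>a w\<bar>) ` S)" "(\<lambda>w. \<bar>a w\<bar>) ` S \<noteq> {}" using assms by auto
  from Max_in[OF this] obtain v where "v \<in> S" "\<bar>a v\<bar> = Max ((\<lambda>w. \<bar>a w\<bar>) ` S)" by auto
  then show ?thesis using that[of v] Max_ge[OF fin(1)] by auto
qed

lemma oscillation_measurable:
  assumes "continuous_on UNIV f" "continuous_on UNIV g"
  shows "(\<lambda>x. \<integral>\<^sup>+z. indicator (cball (0::real^3) \<rho>) z * ennreal ((f (x + z) - g x)\<^sup>2) \<partial>lborel) \<in> borel_measurable borel"
proof -
  have "(\<lambda>(x, z). indicator (cball (0::real^3) \<rho>) z * ennreal ((f (x + z) - g x)\<^sup>2)) \<in> borel_measurable (lborel \<Otimes>\<^sub>M lborel)"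
    by (rule pair_measurable) (auto intro!: continuous_intros continuous_on_compose2[OF assms(1)] continuous_on_compose2[OF assms(2)])
  then have "(\<lambda>x. \<integral>\<^sup>+z. indicator (cball (0::real^3) \<rho>) z * ennreal ((f (x + z) - g x)\<^sup>2) \<partial>lborel) \<in> borel_measurable lborel"
    by (rule lborel.borel_measurable_nn_integral)
  then show ?thesis by simp
qed

context fe_mesh
begin

text \<open>A layer of width \<open>h\<close> and not just the boundary nodes: it contains every
  vertex of a cell that meets the complement of the open set \<Omega>. The interpolant then vanishes
  on all such cells, and its support is a compact union of cells inside \<Omega>.\<close>

definition near_boundary :: "real^3 \<Rightarrow> bool" where
  "near_boundary v \<longleftrightarrow> (\<exists>b. b \<notin> \<Omega> \<and> dist v b \<le> h)"

text \<open>Radius \<open>2 * h\<close> allows a distance \<open>h\<close> from the vertex to a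
  point \<open>b\<close> off \<Omega> and another \<open>h\<close> for the exterior ball near
  \<open>b\<close>. Away from the boundary layer only the distance matters, and the vertex itself
  shows that a centre exists.\<close>

definition sample_centre :: "real^3 \<Rightarrow> real^3" where
  "sample_centre v = (SOME y. cball y (\<kappa> * h) \<subseteq> cball v (2 * h) \<and> (near_boundary v \<longrightarrow> cball y (\<kappa> * h) \<inter> \<Omega> = {}))"

lemma sample_centre:
  assumes v: "v \<in> closure \<Omega>"
  shows "cball (sample_centre v) (\<kappa> * h) \<subseteq> cball v (2 * h)"
    "near_boundary v \<Longrightarrow> cball (sample_centre v) (\<kappa> * h) \<inter> \<Omega> = {}"
proof -
  have "\<exists>y. cball y (\<kappa> * h) \<subseteq> cball v (2 * h) \<and> (near_boundary v \<longrightarrow> cball y (\<kappa> * h) \<inter> \<Omega> = {})"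
  proof (cases "near_boundary v")
    case True
    then obtain b where b: "b \<notin> \<Omega>" "dist v b \<le> h" by (auto simp: near_boundary_def)
    obtain y where y: "cball y (\<kappa> * h) \<subseteq> cball b h" "cball y (\<kappa> * h) \<inter> \<Omega> = {}" using exterior[OF b(1) v b(2)] by blast
    have "cball b h \<subseteq> cball v (2 * h)" using b(2) by (simp add: cball_subset_cball_iff dist_commute)
    then show ?thesis using y by blast
  next
    case False
    have "\<kappa> * h \<le> 2 * h" using \<kappa>_le_1 h_pos by (intro mult_right_mono) auto
    then show ?thesis using False by (intro exI[of _ v]) (auto intro: order_trans)
  qed
  from someI_ex[OF this]
  show "cball (sample_centre v) (\<kappa> * h) \<subseteq> cball v (2 * h)" "near_boundary v \<Longrightarrow> cball (sample_centre v) (\<kappa> * h) \<inter> \<Omega> = {}"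
    unfolding sample_centre_def by blast+
qed

definition node_value :: "scalar_field \<Rightarrow> real^3 \<Rightarrow> real" where
  "node_value f v = ball_mean f (sample_centre v) (\<kappa> * h)"

text \<open>An arbitrary cell containing the point is chosen; by conformity all of them give the
  same value, as \<open>quasi_interp_cell\<close> records. That lemma also covers cells reaching out
  of \<Omega>, where both sides are zero.\<close>

definition quasi_interp :: "scalar_field \<Rightarrow> scalar_field" where
  "quasi_interp f x = (if x \<in> \<Omega> then interp (SOME K. K \<in> \<T> \<and> x \<in> K) (node_value f) x else 0)"

lemma verts_closure: "K \<in> \<T> \<Longrightarrow> v \<in> verts K \<Longrightarrow> v \<in> closure \<Omega>"
  using verts_subset cover by blast

lemma node_value_near_boundary:
  assumes f: "f \<in> test_functions \<Omega>" and v: "v \<in> closure \<Omega>" "near_boundary v"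
  shows "node_value f v = 0"
proof -
  have "indicator (cball (sample_centre v) (\<kappa> * h)) t * f t = 0" for t
  proof (cases "t \<in> cball (sample_centre v) (\<kappa> * h)")
    case True
    then have "t \<notin> \<Omega>" using sample_centre(2)[OF v] by blast
    then have "t \<notin> closure {x. f x \<noteq> 0}" using test_functionsD(3)[OF f] by blast
    from closure_nonzero_zero[OF this] show ?thesis by (simp only: mult_zero_right)
  qed simp
  then have z: "(\<lambda>t. indicator (cball (sample_centre v) (\<kappa> * h)) t * f t) = (\<lambda>t. 0)" by (intro ext)
  show ?thesis unfolding node_value_def ball_mean_def z by simp
qed

lemma interp_boundary_cell:
  assumes f: "f \<in> test_functions \<Omega>" and K: "K \<in> \<T>" and b: "b \<in> K" "b \<notin> \<Omega>"
  shows "interp K (node_value f) x = 0"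
proof -
  have "node_value f v = 0" if v: "v \<in> verts K" for v
  proof (rule node_value_near_boundary[OF f verts_closure[OF K v]])
    show "near_boundary v" unfolding near_boundary_def
      using b cell_subset_cball[OF K _ b(1), of v] v verts_subset by blast
  qed
  then show ?thesis by (simp add: interp_def)
qed

lemma quasi_interp_cell:
  assumes f: "f \<in> test_functions \<Omega>" and K: "K \<in> \<T>" and x: "x \<in> K"
  shows "quasi_interp f x = interp K (node_value f) x"
proof (cases "x \<in> \<Omega>")
  case True
  define K' where "K' = (SOME K. K \<in> \<T> \<and> x \<in> K)"
  have K': "K' \<in> \<T>" "x \<in> K'" unfolding K'_def using someI[of "\<lambda>K. K \<in> \<T> \<and> x \<in> K", OF conjI[OF K x]] by auto
  have "interp K' (node_value f) x = interp K (node_value f) x"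
    using conforming[OF K'(1) K] conforming[OF K K'(1)]
    by (intro interp_conforming simplex_mesh K K' x) (auto simp: Int_commute)
  then show ?thesis using True by (simp add: quasi_interp_def K'_def)
next
  case False
  then show ?thesis using interp_boundary_cell[OF f K x False] by (simp add: quasi_interp_def)
qed

text \<open>The sum of the gradient norms over all cells is a crude constant. It only makes the
  interpolant admissible for \<open>H1_0_limit\<close> and never enters an estimate.\<close>

lemma quasi_interp_lipschitz:
  assumes f: "f \<in> test_functions \<Omega>"
  obtains L where "L-lipschitz_on UNIV (quasi_interp f)"
proof -
  let ?g = "\<lambda>K. \<Sum>v\<in>verts K. node_value f v *\<^sub>R bary_grad K v"
  define L where "L = (\<Sum>K\<in>\<T>. norm (?g K))"
  have L0: "L \<ge> 0" unfolding L_def by (intro sum_nonneg) simp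
  have "L-lipschitz_on UNIV (quasi_interp f)"
  proof (rule lipschitz_on_closed_cover[where \<U> = "insert (- \<Omega>) \<T>"])
    show "\<Union>(insert (- \<Omega>) \<T>) = UNIV" using cover closure_subset by auto
    show "closed U" if "U \<in> insert (- \<Omega>) \<T>" for U
      using that open_dom closed_simplex[OF simplex_mesh] by auto
    show "L-lipschitz_on U (quasi_interp f)" if "U \<in> insert (- \<Omega>) \<T>" for U
    proof (cases "U = - \<Omega>")
      case True
      then show ?thesis using L0 by (intro lipschitz_onI) (auto simp: quasi_interp_def)
    next
      case False
      then have U: "U \<in> \<T>" using that by simp
      show ?thesis
      proof (rule lipschitz_onI[OF _ L0])
        fix y z assume yz: "y \<in> U" "z \<in> U"
        have "\<bar>?g U \<bullet> (y - z)\<bar> \<le> norm (?g U) * norm (y - z)" by (rule Cauchy_Schwarz_ineq2)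
        also have "\<dots> \<le> L * norm (y - z)"
          unfolding L_def using finite_mesh U by (intro mult_right_mono member_le_sum) auto
        finally show "dist (quasi_interp f y) (quasi_interp f z) \<le> L * dist y z"
          by (simp add: quasi_interp_cell[OF f U] yz interp_diff dist_norm)
      qed
    qed
  qed (use finite_mesh L0 in auto)
  then show ?thesis using that by blast
qed

lemma quasi_interp_support:
  assumes f: "f \<in> test_functions \<Omega>"
  shows "closure {x. quasi_interp f x \<noteq> 0} \<subseteq> \<Omega>"
proof -
  have "{x. quasi_interp f x \<noteq> 0} \<subseteq> \<Union>{K \<in> \<T>. K \<subseteq> \<Omega>}"
  proof
    fix x assume "x \<in> {x. quasi_interp f x \<noteq> 0}"
    then have nz: "quasi_interp f x \<noteq> 0" by simp
    then have "x \<in> \<Omega>" by (auto simp: quasi_interp_def split: if_splits)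
    then obtain K where K: "K \<in> \<T>" "x \<in> K" using cover closure_subset by blast
    have "K \<subseteq> \<Omega>"
    proof
      fix b assume "b \<in> K" show "b \<in> \<Omega>"
        using interp_boundary_cell[OF f K(1) \<open>b \<in> K\<close>, of x] nz quasi_interp_cell[OF f K] by auto
    qed
    then show "x \<in> \<Union>{K \<in> \<T>. K \<subseteq> \<Omega>}" using K by blast
  qed
  moreover have "closed (\<Union>{K \<in> \<T>. K \<subseteq> \<Omega>})"
    using finite_mesh closed_simplex[OF simplex_mesh] by (intro closed_Union) auto
  ultimately have "closure {x. quasi_interp f x \<noteq> 0} \<subseteq> \<Union>{K \<in> \<T>. K \<subseteq> \<Omega>}" by (rule closure_minimal)
  then show ?thesis by blast
qed

definition quasi_interp_grad :: "scalar_field \<Rightarrow> vector_field" where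
  "quasi_interp_grad f x = (\<Sum>K\<in>\<T>. indicator (interior K) x *\<^sub>R (\<Sum>v\<in>verts K. node_value f v *\<^sub>R bary_grad K v))"

lemma quasi_interp_grad_cell:
  assumes "K \<in> \<T>" "x \<in> interior K"
  shows "quasi_interp_grad f x = (\<Sum>v\<in>verts K. node_value f v *\<^sub>R bary_grad K v)"
  unfolding quasi_interp_grad_def
  by (subst sum_single_cell[OF assms]) (use assms interior_subset in \<open>auto simp: indicator_def\<close>)

lemma quasi_interp_grad_L2: "quasi_interp_grad f \<in> L2 \<Omega>"
proof (rule L2_bounded[OF bdd_dom dom_sets, of _ "\<Sum>K\<in>\<T>. norm (\<Sum>v\<in>verts K. node_value f v *\<^sub>R bary_grad K v)"])
  show "quasi_interp_grad f \<in> borel_measurable (lebesgue_on \<Omega>)"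
    unfolding quasi_interp_grad_def[abs_def]
    by (intro borel_measurable_lebesgue_on borel_measurable_sum borel_measurable_scaleR borel_measurable_indicator) auto
  show "norm (quasi_interp_grad f x) \<le> (\<Sum>K\<in>\<T>. norm (\<Sum>v\<in>verts K. node_value f v *\<^sub>R bary_grad K v))" for x
    unfolding quasi_interp_grad_def
    by (rule order_trans[OF norm_sum], rule sum_mono) (auto simp: indicator_def)
qed

text \<open>The support is already compact in \<Omega>, so the constant sequence serves as
  approximation in \<open>H1_0_limit\<close>. Inside a cell the interpolant is affine and its
  two-point linearisation exact.\<close>

lemma quasi_interp_H1_0:
  assumes f: "f \<in> test_functions \<Omega>"
  shows "quasi_interp f \<in> H1_0 \<Omega>" "is_weak_grad \<Omega> (quasi_interp f) (quasi_interp_grad f)"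
proof -
  obtain L where L: "L-lipschitz_on UNIV (quasi_interp f)" using quasi_interp_lipschitz[OF f] by blast
  have strict: "AE x in lebesgue_on \<Omega>. \<forall>e>0. \<exists>d>0. \<forall>\<^sub>F n in sequentially. \<forall>y\<in>ball x d. \<forall>z\<in>ball x d.
       \<bar>quasi_interp f y - quasi_interp f z - quasi_interp_grad f x \<bullet> (y - z)\<bar> \<le> e * norm (y - z)"
    using AE_interior_cell
  proof (rule eventually_mono, intro allI impI)
    fix x and e :: real assume "\<exists>K\<in>\<T>. x \<in> interior K" and e: "e > 0"
    then obtain K where K: "K \<in> \<T>" "x \<in> interior K" by blast
    obtain d where d: "d > 0" "ball x d \<subseteq> interior K" using K(2) open_contains_ball[of "interior K"] by auto
    have "\<bar>quasi_interp f y - quasi_interp f z - quasi_interp_grad f x \<bullet> (y - z)\<bar> \<le> e * norm (y - z)"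
      if "y \<in> ball x d" "z \<in> ball x d" for y z
    proof -
      have "y \<in> K" "z \<in> K" using that d(2) interior_subset by blast+
      then show ?thesis using e
        by (simp add: quasi_interp_cell[OF f K(1)] interp_diff quasi_interp_grad_cell[OF K])
    qed
    then show "\<exists>d>0. \<forall>\<^sub>F n in sequentially. \<forall>y\<in>ball x d. \<forall>z\<in>ball x d.
       \<bar>quasi_interp f y - quasi_interp f z - quasi_interp_grad f x \<bullet> (y - z)\<bar> \<le> e * norm (y - z)"
      using d(1) by (intro exI[of _ d]) simp
  qed
  show "quasi_interp f \<in> H1_0 \<Omega>" "is_weak_grad \<Omega> (quasi_interp f) (quasi_interp_grad f)"
    by (rule H1_0_limit[OF open_dom bdd_dom L L quasi_interp_support[OF f] tendsto_const quasi_interp_grad_L2 strict])+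
qed

text \<open>A sampling ball lies within \<open>2 * h\<close> of its vertex and the vertex within
  \<open>h\<close> of any point of the cell, so the ball around \<open>x\<close> of radius
  \<open>3 * h\<close> contains it.\<close>

lemma node_deviation:
  assumes f: "f \<in> test_functions \<Omega>" and K: "K \<in> \<T>" and x: "x \<in> K" and v: "v \<in> verts K"
  shows "ennreal (ball_const * (\<kappa> * h) ^ 3 * (node_value f v - a)\<^sup>2)
    \<le> (\<integral>\<^sup>+z. indicator (cball 0 (3 * h)) z * ennreal ((f (x + z) - a)\<^sup>2) \<partial>lborel)"
proof -
  have kh: "\<kappa> * h > 0" using \<kappa>_pos h_pos by simp
  have "dist v x \<le> h" using cell_subset_cball[OF K _ x] v verts_subset by blast
  then have "cball v (2 * h) \<subseteq> cball x (3 * h)" by (simp add: cball_subset_cball_iff)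
  then have sub: "cball (sample_centre v) (\<kappa> * h) \<subseteq> cball x (3 * h)"
    using sample_centre(1)[OF verts_closure[OF K v]] by blast
  have fc: "continuous_on UNIV f" using smooth_continuous test_functionsD(1)[OF f] by blast
  show ?thesis
    using ball_mean_deviation[OF fc kh sub, of a] cball_volume[of "\<kappa> * h" "sample_centre v"] kh
    by (simp add: node_value_def)
qed

text \<open>Inside the cell the barycentric coordinates are the weights of a convex combination, so
  the distance to the constant \<open>a\<close> is at most that of the worst vertex value. The
  choice \<open>a = f x\<close> yields the interpolation error and \<open>a = 0\<close> stability in
  \<open>L2\<close>.\<close>

lemma quasi_interp_deviation:
  assumes f: "f \<in> test_functions \<Omega>" and K: "K \<in> \<T>" and x: "x \<in> K"
  shows "ennreal (ball_const * (\<kappa> * h) ^ 3 * (quasi_interp f x - a)\<^sup>2)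
    \<le> (\<integral>\<^sup>+z. indicator (cball 0 (3 * h)) z * ennreal ((f (x + z) - a)\<^sup>2) \<partial>lborel)"
proof -
  note S = simplex_mesh[OF K]
  have kh: "ball_const * (\<kappa> * h) ^ 3 \<ge> 0" using \<kappa>_pos h_pos ball_const_pos by simp
  have ne: "verts K \<noteq> {}" using simplex_verts(2)[OF S] by auto
  obtain v where v: "v \<in> verts K" "\<And>w. w \<in> verts K \<Longrightarrow> \<bar>node_value f w - a\<bar> \<le> \<bar>node_value f v - a\<bar>"
    using finite_abs_argmax[OF simplex_verts(3)[OF S] ne, of "\<lambda>w. node_value f w - a"] by blast
  have "quasi_interp f x - a = (\<Sum>w\<in>verts K. node_value f w * bary K w x) - (\<Sum>w\<in>verts K. bary K w x) * a"
    by (simp add: quasi_interp_cell[OF f K x] interp_def bary_sum(1)[OF S])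
  also have "\<dots> = (\<Sum>w\<in>verts K. bary K w x * (node_value f w - a))"
    unfolding right_diff_distrib sum_subtractf sum_distrib_right by (simp add: mult.commute)
  finally have "\<bar>quasi_interp f x - a\<bar> \<le> (\<Sum>w\<in>verts K. \<bar>bary K w x * (node_value f w - a)\<bar>)" by simp
  also have "\<dots> \<le> (\<Sum>w\<in>verts K. bary K w x * \<bar>node_value f v - a\<bar>)"
    using v(2) simplex_iff_bary[OF S, of x] x by (intro sum_mono) (auto simp: abs_mult intro!: mult_mono)
  also have "\<dots> = \<bar>node_value f v - a\<bar>" by (simp add: bary_sum(1)[OF S] flip: sum_distrib_right)
  finally have "(quasi_interp f x - a)\<^sup>2 \<le> (node_value f v - a)\<^sup>2" by (simp add: abs_le_square_iff)
  then have "ennreal (ball_const * (\<kappa> * h) ^ 3 * (quasi_interp f x - a)\<^sup>2) \<le> ennreal (ball_const * (\<kappa> * h) ^ 3 * (node_value f v - a)\<^sup>2)"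
    by (intro ennreal_leI mult_left_mono kh)
  also have "\<dots> \<le> (\<integral>\<^sup>+z. indicator (cball 0 (3 * h)) z * ennreal ((f (x + z) - a)\<^sup>2) \<partial>lborel)"
    by (rule node_deviation[OF f K x v(1)])
  finally show ?thesis .
qed

text \<open>Since the barycentric gradients sum to zero, the constant \<open>f x\<close> may be subtracted from all nodal values.\<close>

lemma quasi_interp_grad_deviation:
  assumes f: "f \<in> test_functions \<Omega>" and K: "K \<in> \<T>" and x: "x \<in> interior K"
  shows "ennreal (ball_const * (\<kappa> * h) ^ 3 * (c * h / 2)\<^sup>2 * (norm (quasi_interp_grad f x))\<^sup>2)
    \<le> (\<integral>\<^sup>+z. indicator (cball 0 (3 * h)) z * ennreal ((f (x + z) - f x)\<^sup>2) \<partial>lborel)"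
proof -
  note S = simplex_mesh[OF K]
  have kh: "ball_const * (\<kappa> * h) ^ 3 \<ge> 0" using \<kappa>_pos h_pos ball_const_pos by simp
  have ch: "c * h > 0" using c_pos h_pos by simp
  have xK: "x \<in> K" using x interior_subset by blast
  obtain z0 where z0: "cball z0 (c * h) \<subseteq> K" using inball[OF K] by blast
  have ne: "verts K \<noteq> {}" using simplex_verts(2)[OF S] by auto
  obtain v where v: "v \<in> verts K" "\<And>w. w \<in> verts K \<Longrightarrow> \<bar>node_value f w - f x\<bar> \<le> \<bar>node_value f v - f x\<bar>"
    using finite_abs_argmax[OF simplex_verts(3)[OF S] ne, of "\<lambda>w. node_value f w - f x"] by blast
  have "quasi_interp_grad f x = (\<Sum>w\<in>verts K. node_value f w *\<^sub>R bary_grad K w) - f x *\<^sub>R (\<Sum>w\<in>verts K. bary_grad K w)"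
    by (simp add: quasi_interp_grad_cell[OF K x] bary_grad_sum[OF S])
  also have "\<dots> = (\<Sum>w\<in>verts K. (node_value f w - f x) *\<^sub>R bary_grad K w)"
    by (simp add: scaleR_diff_left sum_subtractf scaleR_sum_right)
  finally have "norm (quasi_interp_grad f x) \<le> (\<Sum>w\<in>verts K. norm ((node_value f w - f x) *\<^sub>R bary_grad K w))"
    by (simp only: norm_sum)
  also have "\<dots> \<le> (\<Sum>w\<in>verts K. \<bar>node_value f v - f x\<bar> * (1 / (2 * (c * h))))"
    using v(2) bary_grad_upper[OF S _ z0 ch] by (intro sum_mono) (simp only: norm_scaleR, intro mult_mono, auto)
  \<comment> \<open>Four vertices, each with a gradient of norm at most
    \<open>1 / (2 * (c * h))\<close>.\<close>
  also have "\<dots> = \<bar>node_value f v - f x\<bar> / (c * h / 2)" using simplex_verts(2)[OF S] by simp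
  finally have "c * h / 2 * norm (quasi_interp_grad f x) \<le> \<bar>node_value f v - f x\<bar>"
    using ch by (simp add: field_simps)
  then have "(c * h / 2 * norm (quasi_interp_grad f x))\<^sup>2 \<le> \<bar>node_value f v - f x\<bar>\<^sup>2"
    using ch by (intro power_mono) auto
  then have "(c * h / 2)\<^sup>2 * (norm (quasi_interp_grad f x))\<^sup>2 \<le> (node_value f v - f x)\<^sup>2"
    by (simp only: power_mult_distrib power2_abs)
  then have "ennreal (ball_const * (\<kappa> * h) ^ 3 * ((c * h / 2)\<^sup>2 * (norm (quasi_interp_grad f x))\<^sup>2)) \<le> ennreal (ball_const * (\<kappa> * h) ^ 3 * (node_value f v - f x)\<^sup>2)"
    by (intro ennreal_leI mult_left_mono kh)
  also have "\<dots> \<le> (\<integral>\<^sup>+z. indicator (cball 0 (3 * h)) z * ennreal ((f (x + z) - f x)\<^sup>2) \<partial>lborel)"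
    by (rule node_deviation[OF f K xK v(1)])
  finally show ?thesis by (simp only: mult.assoc)
qed

text \<open>Pointwise bounds are available in the interiors of cells only, which is enough for the
  integral over \<Omega>; the integral of \<open>H\<close> may then be taken over all of space,
  where the oscillation estimates live.\<close>

lemma L2_from_pointwise:
  fixes G :: "real^3 \<Rightarrow> 'b::euclidean_space"
  assumes G: "G \<in> L2 \<Omega>" and V: "V \<ge> 0" and H: "H \<in> borel_measurable borel" and b: "b \<ge> 0"
    and p: "\<And>K x. K \<in> \<T> \<Longrightarrow> x \<in> interior K \<Longrightarrow> ennreal (V * (norm (G x))\<^sup>2) \<le> H x"
    and i: "(\<integral>\<^sup>+x. H x \<partial>lborel) \<le> ennreal b"
  shows "V * (L2_norm \<Omega> G)\<^sup>2 \<le> b"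
proof -
  have "ennreal (V * (L2_norm \<Omega> G)\<^sup>2) = ennreal V * (\<integral>\<^sup>+x. ennreal ((norm (G x))\<^sup>2) \<partial>lebesgue_on \<Omega>)"
    using V by (simp add: ennreal_mult L2_norm_sq_nn[OF G])
  also have "\<dots> = (\<integral>\<^sup>+x. ennreal V * ennreal ((norm (G x))\<^sup>2) \<partial>lebesgue_on \<Omega>)"
    using borel_measurable_integrable[OF L2_D(2)[OF G]] by (intro nn_integral_cmult[symmetric]) simp
  also have "\<dots> = (\<integral>\<^sup>+x. ennreal (V * (norm (G x))\<^sup>2) \<partial>lebesgue_on \<Omega>)"
    using V by (simp add: ennreal_mult)
  also have "\<dots> \<le> (\<integral>\<^sup>+x. H x \<partial>lebesgue_on \<Omega>)"
    using AE_interior_cell by (intro nn_integral_mono_AE) (auto elim!: eventually_mono intro: p)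
  also have "\<dots> \<le> (\<integral>\<^sup>+x. H x \<partial>lborel)" by (rule nn_integral_lebesgue_on_le[OF H dom_sets])
  also have "\<dots> \<le> ennreal b" by (rule i)
  finally show ?thesis using b by simp
qed

text \<open>The volumes of balls with radii \<open>3 * h\<close> and \<open>\<kappa> * h\<close>
  have ratio \<open>27 / \<kappa> ^ 3\<close>, and the squared radius of the larger ball contributes
  the remaining factor nine.\<close>

definition interp_const :: real where "interp_const = 243 / \<kappa> ^ 3"

lemma interp_const_nonneg: "interp_const \<ge> 0" using \<kappa>_pos by (simp add: interp_const_def)

lemma sample_volume_pos: "ball_const * (\<kappa> * h) ^ 3 > 0" using \<kappa>_pos h_pos ball_const_pos by simp

lemma oscillation_bound:
  assumes f: "f \<in> test_functions \<Omega>"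
  shows "(\<integral>\<^sup>+x. (\<integral>\<^sup>+z. indicator (cball 0 (3 * h)) z * ennreal ((f (x + z) - f x)\<^sup>2) \<partial>lborel) \<partial>lborel)
    \<le> ennreal ((ball_const * (\<kappa> * h) ^ 3) * (interp_const * h\<^sup>2 * (L2_norm \<Omega> (classical_grad f))\<^sup>2))"
proof -
  have e: "measure lborel (cball 0 (3 * h) :: (real^3) set) * ((3 * h)\<^sup>2 * (L2_norm \<Omega> (classical_grad f))\<^sup>2) =
     (ball_const * (\<kappa> * h) ^ 3) * (interp_const * h\<^sup>2 * (L2_norm \<Omega> (classical_grad f))\<^sup>2)"
    using cball_volume[of "3 * h" 0] h_pos \<kappa>_pos by (simp add: interp_const_def power_mult_distrib)
  show ?thesis using local_oscillation_total[OF f open_dom bdd_dom, of "3 * h"] unfolding e .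
qed

text \<open>The subtracted constant may depend on the point: with \<open>a = f x\<close> the
  deviation bound becomes the local oscillation, whose total is of order \<open>h\<^sup>2\<close>
  times the squared gradient norm.\<close>

lemma quasi_interp_error:
  assumes f: "f \<in> test_functions \<Omega>"
  shows "(L2_norm \<Omega> (\<lambda>x. f x - quasi_interp f x))\<^sup>2 \<le> interp_const * h\<^sup>2 * (L2_norm \<Omega> (classical_grad f))\<^sup>2"
proof -
  have fc: "continuous_on UNIV f" using smooth_continuous test_functionsD(1)[OF f] by blast
  have "(ball_const * (\<kappa> * h) ^ 3) * (L2_norm \<Omega> (\<lambda>x. f x - quasi_interp f x))\<^sup>2
     \<le> (ball_const * (\<kappa> * h) ^ 3) * (interp_const * h\<^sup>2 * (L2_norm \<Omega> (classical_grad f))\<^sup>2)"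
  proof (rule L2_from_pointwise[OF _ _ oscillation_measurable[OF fc fc] _ _ oscillation_bound[OF f]])
    show "(\<lambda>x. f x - quasi_interp f x) \<in> L2 \<Omega>"
      by (intro L2_diff test_L2[OF f dom_sets] H1_0_L2 quasi_interp_H1_0 f)
    show "ennreal (ball_const * (\<kappa> * h) ^ 3 * (norm (f x - quasi_interp f x))\<^sup>2)
       \<le> (\<integral>\<^sup>+z. indicator (cball 0 (3 * h)) z * ennreal ((f (x + z) - f x)\<^sup>2) \<partial>lborel)" if "K \<in> \<T>" "x \<in> interior K" for K x
      using quasi_interp_deviation[OF f that(1), of x "f x"] that(2) interior_subset[of K] by (auto simp: power2_commute)
  qed (use sample_volume_pos interp_const_nonneg in auto)
  then show ?thesis using sample_volume_pos by (simp only: mult_le_cancel_left_pos)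
qed

text \<open>The factor \<open>h\<^sup>2\<close> of the oscillation estimate cancels against the
  squared barycentric gradients of order \<open>1 / h\<close>.\<close>

lemma quasi_interp_grad_bound:
  assumes f: "f \<in> test_functions \<Omega>"
  shows "(L2_norm \<Omega> (quasi_interp_grad f))\<^sup>2 \<le> 4 / c\<^sup>2 * interp_const * (L2_norm \<Omega> (classical_grad f))\<^sup>2"
proof -
  have fc: "continuous_on UNIV f" using smooth_continuous test_functionsD(1)[OF f] by blast
  have "(ball_const * (\<kappa> * h) ^ 3 * (c * h / 2)\<^sup>2) * (L2_norm \<Omega> (quasi_interp_grad f))\<^sup>2
     \<le> (ball_const * (\<kappa> * h) ^ 3) * (interp_const * h\<^sup>2 * (L2_norm \<Omega> (classical_grad f))\<^sup>2)"
  proof (rule L2_from_pointwise[OF quasi_interp_grad_L2 _ oscillation_measurable[OF fc fc] _ _ oscillation_bound[OF f]])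
    show "ennreal (ball_const * (\<kappa> * h) ^ 3 * (c * h / 2)\<^sup>2 * (norm (quasi_interp_grad f x))\<^sup>2)
       \<le> (\<integral>\<^sup>+z. indicator (cball 0 (3 * h)) z * ennreal ((f (x + z) - f x)\<^sup>2) \<partial>lborel)" if "K \<in> \<T>" "x \<in> interior K" for K x
      by (rule quasi_interp_grad_deviation[OF f that])
  qed (use sample_volume_pos interp_const_nonneg in auto)
  then have "(c * h / 2)\<^sup>2 * (L2_norm \<Omega> (quasi_interp_grad f))\<^sup>2 \<le> interp_const * h\<^sup>2 * (L2_norm \<Omega> (classical_grad f))\<^sup>2"
    using sample_volume_pos unfolding mult.assoc[of "ball_const * (\<kappa> * h) ^ 3" "(c * h / 2)\<^sup>2"]
    by (simp only: mult_le_cancel_left_pos)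
  then have "h\<^sup>2 * (c\<^sup>2 * (L2_norm \<Omega> (quasi_interp_grad f))\<^sup>2) \<le> h\<^sup>2 * (4 * interp_const * (L2_norm \<Omega> (classical_grad f))\<^sup>2)"
    by (simp add: power_divide power_mult_distrib mult_ac)
  then have "c\<^sup>2 * (L2_norm \<Omega> (quasi_interp_grad f))\<^sup>2 \<le> 4 * interp_const * (L2_norm \<Omega> (classical_grad f))\<^sup>2"
    using h_pos by simp
  then show ?thesis using c_pos by (simp add: field_simps)
qed

text \<open>With \<open>a = 0\<close> the deviation bound becomes the local mass, and no derivative
  of \<open>f\<close> enters; this keeps the operator stable when \<epsilon> is small compared with
  \<open>h\<close>.\<close>

lemma quasi_interp_L2_bound:
  assumes f: "f \<in> test_functions \<Omega>"
  shows "(L2_norm \<Omega> (quasi_interp f))\<^sup>2 \<le> interp_const * (L2_norm \<Omega> f)\<^sup>2"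
proof -
  have fc: "continuous_on UNIV f" using smooth_continuous test_functionsD(1)[OF f] by blast
  have m: "(\<lambda>x. \<integral>\<^sup>+z. indicator (cball (0::real^3) (3 * h)) z * ennreal ((f (x + z))\<^sup>2) \<partial>lborel) \<in> borel_measurable borel"
    using oscillation_measurable[OF fc continuous_on_const[of _ 0], of "3 * h"] by simp
  have "measure lborel (cball 0 (3 * h) :: (real^3) set) * (L2_norm \<Omega> f)\<^sup>2 = (ball_const * (\<kappa> * h) ^ 3) * (27 / \<kappa> ^ 3 * (L2_norm \<Omega> f)\<^sup>2)"
    using cball_volume[of "3 * h" 0] h_pos \<kappa>_pos by (simp add: power_mult_distrib)
  then have i: "(\<integral>\<^sup>+x. (\<integral>\<^sup>+z. indicator (cball (0::real^3) (3 * h)) z * ennreal ((f (x + z))\<^sup>2) \<partial>lborel) \<partial>lborel)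
     \<le> ennreal ((ball_const * (\<kappa> * h) ^ 3) * (27 / \<kappa> ^ 3 * (L2_norm \<Omega> f)\<^sup>2))"
    using local_mass_total[OF f open_dom bdd_dom, of "3 * h"] by simp
  have "(ball_const * (\<kappa> * h) ^ 3) * (L2_norm \<Omega> (quasi_interp f))\<^sup>2 \<le> (ball_const * (\<kappa> * h) ^ 3) * (27 / \<kappa> ^ 3 * (L2_norm \<Omega> f)\<^sup>2)"
  proof (rule L2_from_pointwise[OF _ _ m _ _ i])
    show "quasi_interp f \<in> L2 \<Omega>" by (intro H1_0_L2 quasi_interp_H1_0 f)
    show "ennreal (ball_const * (\<kappa> * h) ^ 3 * (norm (quasi_interp f x))\<^sup>2)
       \<le> (\<integral>\<^sup>+z. indicator (cball 0 (3 * h)) z * ennreal ((f (x + z))\<^sup>2) \<partial>lborel)" if "K \<in> \<T>" "x \<in> interior K" for K x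
      using quasi_interp_deviation[OF f that(1), of x 0] that(2) interior_subset[of K] by auto
  qed (use sample_volume_pos \<kappa>_pos in auto)
  then have "(L2_norm \<Omega> (quasi_interp f))\<^sup>2 \<le> 27 / \<kappa> ^ 3 * (L2_norm \<Omega> f)\<^sup>2"
    using sample_volume_pos by (simp only: mult_le_cancel_left_pos)
  \<comment> \<open>The mass needs the volume ratio only; rounding up keeps a single constant for
    all interpolation bounds.\<close>
  also have "\<dots> \<le> interp_const * (L2_norm \<Omega> f)\<^sup>2"
    using \<kappa>_pos by (intro mult_right_mono) (auto simp: interp_const_def divide_right_mono)
  finally show ?thesis .
qed

definition fortin :: "scalar_field \<Rightarrow> scalar_field" where
  "fortin f x = quasi_interp f x + bubble_part (\<lambda>x. f x - quasi_interp f x) x"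

text \<open>The first two terms bound the \<open>L2\<close> norm and the last bounds the gradient.
  As their sum it serves both, and hence every combination weighted by \<epsilon>.\<close>

definition fortin_const :: real where
  "fortin_const = 2 * interp_const + 4 * bubble_const * (1 + interp_const) + 8 / c\<^sup>2 * interp_const * (1 + bubble_const)"

lemma bubble_const_nonneg: "bubble_const \<ge> 0" using c_pos by (simp add: bubble_const_def)

lemma interp_P1: "interp K W \<in> P_k 1"
proof -
  have "interp K W = (\<lambda>x. (interp K W 0) + (\<Sum>v\<in>verts K. W v *\<^sub>R bary_grad K v) \<bullet> x)"
  proof
    fix x
    show "interp K W x = (interp K W 0) + (\<Sum>v\<in>verts K. W v *\<^sub>R bary_grad K v) \<bullet> x"
      using interp_diff[of K W x 0] by simp
  qed
  then show ?thesis by (rule ssubst[where P = "\<lambda>p. p \<in> P_k 1"]) (rule P_k_affine, simp)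
qed

text \<open>The gradient bound is where the scaling balances: the correction costs
  \<open>1 / h\<close> and acts on an interpolation error of order \<open>h\<close>. As values and
  gradients are controlled separately, the weighted norm is bounded with a constant free of
  \<epsilon>.\<close>

lemma fortin_properties:
  assumes f: "f \<in> test_functions \<Omega>"
  shows "fortin f \<in> H1_0 \<Omega>"
    "\<And>K. K \<in> \<T> \<Longrightarrow> \<exists>p\<in>P_k 1. \<exists>b\<in>B_4 K. AE x in lebesgue_on K. fortin f x = p x + b x"
    "\<And>K. K \<in> \<T> \<Longrightarrow> (LINT x|lebesgue_on (interior K). fortin f x) = (LINT x|lebesgue_on (interior K). f x)"
    "(L2_norm \<Omega> (fortin f))\<^sup>2 \<le> fortin_const * (L2_norm \<Omega> f)\<^sup>2"
    "(L2_norm \<Omega> (weak_grad \<Omega> (fortin f)))\<^sup>2 \<le> fortin_const * (L2_norm \<Omega> (weak_grad \<Omega> f))\<^sup>2"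
proof -
  let ?w = "quasi_interp f" let ?e = "\<lambda>x. f x - quasi_interp f x"
  let ?A = "(L2_norm \<Omega> (classical_grad f))\<^sup>2" let ?F = "(L2_norm \<Omega> f)\<^sup>2"
  have fL: "f \<in> L2 \<Omega>" by (rule test_L2[OF f dom_sets])
  have wL: "?w \<in> L2 \<Omega>" by (intro H1_0_L2 quasi_interp_H1_0 f)
  have eL: "?e \<in> L2 \<Omega>" by (intro L2_diff fL wL)
  have bL: "bubble_part ?e \<in> L2 \<Omega>" by (intro H1_0_L2 bubble_part_H1_0)
  show H: "fortin f \<in> H1_0 \<Omega>" unfolding fortin_def[abs_def]
    by (intro H1_0_add open_dom bdd_dom quasi_interp_H1_0 bubble_part_H1_0 f)
  show "\<exists>p\<in>P_k 1. \<exists>b\<in>B_4 K. AE x in lebesgue_on K. fortin f x = p x + b x" if K: "K \<in> \<T>" for K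
  proof -
    obtain b where b: "b \<in> B_4 K" "\<forall>x\<in>interior K. bubble_part ?e x = b x" using bubble_part_B_4[OF K] by blast
    have "AE x in lebesgue_on K. fortin f x = interp K (node_value f) x + b x"
      using AE_cell_interior[OF K]
    proof (rule eventually_mono)
      fix x assume x: "x \<in> interior K"
      then have "x \<in> K" using interior_subset by blast
      then show "fortin f x = interp K (node_value f) x + b x"
        using b(2) x by (simp add: fortin_def quasi_interp_cell[OF f K])
    qed
    then show ?thesis using b(1) interp_P1 by blast
  qed
  show "(LINT x|lebesgue_on (interior K). fortin f x) = (LINT x|lebesgue_on (interior K). f x)" if K: "K \<in> \<T>" for K
  proof -
    have i: "integrable (lebesgue_on (interior K)) g" if "g \<in> L2 \<Omega>" for g :: scalar_field
      by (rule L2_L1[OF interior_cell_bounded[OF K] interior_sets L2_cell[OF that K]])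
    have "(LINT x|lebesgue_on (interior K). fortin f x) = (LINT x|lebesgue_on (interior K). ?w x) + (LINT x|lebesgue_on (interior K). bubble_part ?e x)"
      unfolding fortin_def by (rule Bochner_Integration.integral_add[OF i[OF wL] i[OF bL]])
    also have "(LINT x|lebesgue_on (interior K). bubble_part ?e x) = (LINT x|lebesgue_on (interior K). ?e x)"
      by (rule bubble_part_mean[OF K])
    also have "\<dots> = (LINT x|lebesgue_on (interior K). f x) - (LINT x|lebesgue_on (interior K). ?w x)"
      by (rule Bochner_Integration.integral_diff[OF i[OF fL] i[OF wL]])
    finally show ?thesis by simp
  qed
  have cn: "interp_const \<ge> 0" "bubble_const \<ge> 0" "0 \<le> 8 / c\<^sup>2"
    by (auto simp: interp_const_nonneg bubble_const_nonneg)
  show "(L2_norm \<Omega> (fortin f))\<^sup>2 \<le> fortin_const * ?F"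
  proof -
    have e: "(L2_norm \<Omega> ?e)\<^sup>2 \<le> 2 * ?F + 2 * (interp_const * ?F)"
    proof -
      have "(L2_norm \<Omega> (\<lambda>x. f x + (- ?w x)))\<^sup>2 \<le> 2 * ?F + 2 * (L2_norm \<Omega> (\<lambda>x. - ?w x))\<^sup>2"
        by (rule L2_norm_add_sq[OF fL L2_uminus[OF wL]])
      also have "(L2_norm \<Omega> (\<lambda>x. - ?w x))\<^sup>2 = (L2_norm \<Omega> ?w)\<^sup>2" by (simp add: L2_norm_sq_integral)
      finally show ?thesis using quasi_interp_L2_bound[OF f] by simp
    qed
    have "(L2_norm \<Omega> (fortin f))\<^sup>2 \<le> 2 * (L2_norm \<Omega> ?w)\<^sup>2 + 2 * (L2_norm \<Omega> (bubble_part ?e))\<^sup>2"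
      unfolding fortin_def[abs_def] by (rule L2_norm_add_sq[OF wL bL])
    also have "\<dots> \<le> 2 * (interp_const * ?F) + 2 * (bubble_const * (2 * ?F + 2 * (interp_const * ?F)))"
      by (intro add_mono mult_left_mono quasi_interp_L2_bound f order_trans[OF bubble_part_L2_bound[OF eL]] e cn) auto
    also have "\<dots> = (2 * interp_const + 4 * bubble_const * (1 + interp_const)) * ?F" by (simp add: algebra_simps)
    also have "\<dots> \<le> fortin_const * ?F"
      unfolding fortin_const_def using cn by (intro mult_right_mono) auto
    finally show ?thesis .
  qed
  have gL: "quasi_interp_grad f \<in> L2 \<Omega>" "bubble_part_grad ?e \<in> L2 \<Omega>"
    using quasi_interp_grad_L2 bubble_part_H1_0(2) by (auto simp: is_weak_grad_def)
  have wg: "is_weak_grad \<Omega> (fortin f) (\<lambda>x. quasi_interp_grad f x + bubble_part_grad ?e x)"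
    unfolding fortin_def[abs_def] by (intro is_weak_grad_add dom_sets wL bL quasi_interp_H1_0 bubble_part_H1_0 f)
  show "(L2_norm \<Omega> (weak_grad \<Omega> (fortin f)))\<^sup>2 \<le> fortin_const * (L2_norm \<Omega> (weak_grad \<Omega> f))\<^sup>2"
  proof -
    have A: "L2_norm \<Omega> (weak_grad \<Omega> f) = L2_norm \<Omega> (classical_grad f)"
      by (rule L2_norm_weak_grad[OF open_dom test_is_weak_grad(1)[OF open_dom f bdd_dom] fL])
    have bg: "(L2_norm \<Omega> (bubble_part_grad ?e))\<^sup>2 \<le> 4 / c\<^sup>2 * bubble_const * interp_const * ?A"
    proof -
      have "(L2_norm \<Omega> (bubble_part_grad ?e))\<^sup>2 \<le> (2 / (c * h))\<^sup>2 * bubble_const * (L2_norm \<Omega> ?e)\<^sup>2"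
        by (rule bubble_part_grad_bound[OF eL])
      also have "\<dots> \<le> (2 / (c * h))\<^sup>2 * bubble_const * (interp_const * h\<^sup>2 * ?A)"
        by (intro mult_left_mono quasi_interp_error f) (simp add: bubble_const_nonneg)
      also have "\<dots> = 4 / c\<^sup>2 * bubble_const * interp_const * ?A"
        using h_pos by (simp add: power_divide power_mult_distrib)
      finally show ?thesis .
    qed
    have "L2_norm \<Omega> (weak_grad \<Omega> (fortin f)) = L2_norm \<Omega> (\<lambda>x. quasi_interp_grad f x + bubble_part_grad ?e x)"
      by (rule L2_norm_weak_grad[OF open_dom wg H1_0_L2[OF H]])
    then have "(L2_norm \<Omega> (weak_grad \<Omega> (fortin f)))\<^sup>2 \<le> 2 * (L2_norm \<Omega> (quasi_interp_grad f))\<^sup>2 + 2 * (L2_norm \<Omega> (bubble_part_grad ?e))\<^sup>2"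
      using L2_norm_add_sq[OF gL] by simp
    also have "\<dots> \<le> 2 * (4 / c\<^sup>2 * interp_const * ?A) + 2 * (4 / c\<^sup>2 * bubble_const * interp_const * ?A)"
      by (intro add_mono mult_left_mono quasi_interp_grad_bound f bg) auto
    also have "\<dots> = (8 / c\<^sup>2 * interp_const * (1 + bubble_const)) * ?A"
      by (simp add: algebra_simps add_divide_distrib)
    also have "\<dots> \<le> fortin_const * ?A"
      unfolding fortin_const_def using cn by (intro mult_right_mono) auto
    finally show ?thesis unfolding A .
  qed
qed

end

section \<open>Curl and divergence of discrete fields\<close>

text \<open>For a test function in place of \<open>u\<close> this is the definition of the weak
  gradient of \<open>p\<close>. The defect \<open>T\<close> depends continuously on \<open>u\<close>
  in the \<open>H1\<close> norm, so it vanishes by density.\<close>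

lemma H1_0_integration_by_parts:
  assumes \<Omega>: "open \<Omega>" "bounded \<Omega>" and u: "u \<in> H1_0 \<Omega>" and p: "p \<in> H1 \<Omega>"
  shows "(LINT x|lebesgue_on \<Omega>. weak_grad \<Omega> u x $ i * p x) = - (LINT x|lebesgue_on \<Omega>. u x * weak_grad \<Omega> p x $ i)"
proof -
  have m: "\<Omega> \<in> sets lebesgue" using \<Omega>(1) by (rule open_sets_lebesgue)
  have uH: "u \<in> H1 \<Omega>" using u by (simp add: H1_0_def)
  have L: "u \<in> L2 \<Omega>" "p \<in> L2 \<Omega>" using uH p by (auto simp: H1_def)
  have gL: "(\<lambda>x. weak_grad \<Omega> v x $ i) \<in> L2 \<Omega>" if "v \<in> H1 \<Omega>" for v
    using weak_grad_L2[OF that] L2_components by blast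
  define S where "S = L2_norm \<Omega> p + L2_norm \<Omega> (\<lambda>x. weak_grad \<Omega> p x $ i)"
  have S0: "S \<ge> 0" by (simp add: S_def L2_norm_nonneg)
  define T where "T = (LINT x|lebesgue_on \<Omega>. weak_grad \<Omega> u x $ i * p x) + (LINT x|lebesgue_on \<Omega>. u x * weak_grad \<Omega> p x $ i)"
  have "\<bar>T\<bar> \<le> 0 + \<delta>" if d: "\<delta> > 0" for \<delta>
  proof -
    \<comment> \<open>\<open>S\<close> bounds the defect relative to the \<open>H1\<close> norm of
      the approximation error; adding one keeps the quotient meaningful when \<open>S\<close>
      vanishes.\<close>
    have d': "\<delta> / (S + 1) > 0" using d S0 by simp
    obtain f where f: "f \<in> test_functions \<Omega>" "H1_norm \<Omega> (\<lambda>x. u x - f x) < \<delta> / (S + 1)"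
      using H1_0_approx[OF u d'] by (elim bexE)
    define v where "v = (\<lambda>x. u x - f x)"
    define gv where "gv = (\<lambda>x. weak_grad \<Omega> u x - classical_grad f x)"
    note ft = test_is_weak_grad[OF \<Omega>(1) f(1) \<Omega>(2)]
    have vg: "is_weak_grad \<Omega> v gv" unfolding v_def gv_def
      by (intro is_weak_grad_diff m L ft is_weak_grad_weak_grad uH)
    have vL: "v \<in> L2 \<Omega>" unfolding v_def by (intro L2_diff L ft)
    have gvL: "gv \<in> L2 \<Omega>" using vg by (simp add: is_weak_grad_def)
    have gvi: "(\<lambda>x. gv x $ i) \<in> L2 \<Omega>" using gvL L2_components by blast
    have fi: "(\<lambda>x. classical_grad f x $ i) \<in> L2 \<Omega>" using ft(2) L2_components by blast
    have Hn: "H1_norm \<Omega> v = sqrt ((L2_norm \<Omega> v)\<^sup>2 + (L2_norm \<Omega> gv)\<^sup>2)"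
      by (simp add: H1_norm_def L2_norm_weak_grad[OF \<Omega>(1) vg vL])
    have n1: "L2_norm \<Omega> v \<le> H1_norm \<Omega> v" unfolding Hn by (rule real_le_rsqrt) simp
    have "(L2_norm \<Omega> (\<lambda>x. gv x $ i))\<^sup>2 \<le> (L2_norm \<Omega> gv)\<^sup>2"
      by (rule L2_norm_mono[OF gvL]) (simp add: component_le_norm_cart)
    then have n2: "L2_norm \<Omega> (\<lambda>x. gv x $ i) \<le> H1_norm \<Omega> v" unfolding Hn
      by (intro real_le_rsqrt) (use zero_le_power2[of "L2_norm \<Omega> v"] in linarith)
    have z: "(LINT x|lebesgue_on \<Omega>. classical_grad f x $ i * p x) + (LINT x|lebesgue_on \<Omega>. f x * weak_grad \<Omega> p x $ i) = 0"
      using is_weak_grad_weak_grad[OF p] f(1) by (simp add: is_weak_grad_def classical_grad_def mult.commute)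
    have "T = (LINT x|lebesgue_on \<Omega>. gv x $ i * p x) + (LINT x|lebesgue_on \<Omega>. v x * weak_grad \<Omega> p x $ i)"
    proof -
      have "(LINT x|lebesgue_on \<Omega>. gv x $ i * p x) = (LINT x|lebesgue_on \<Omega>. weak_grad \<Omega> u x $ i * p x) - (LINT x|lebesgue_on \<Omega>. classical_grad f x $ i * p x)"
        using L2_mult_integrable[OF gL[OF uH] L(2)] L2_mult_integrable[OF fi L(2)] by (simp add: gv_def left_diff_distrib)
      moreover have "(LINT x|lebesgue_on \<Omega>. v x * weak_grad \<Omega> p x $ i) = (LINT x|lebesgue_on \<Omega>. u x * weak_grad \<Omega> p x $ i) - (LINT x|lebesgue_on \<Omega>. f x * weak_grad \<Omega> p x $ i)"
        using L2_mult_integrable[OF L(1) gL[OF p]] L2_mult_integrable[OF ft(3) gL[OF p]] by (simp add: v_def left_diff_distrib)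
      ultimately show ?thesis using z by (simp add: T_def)
    qed
    also have "\<bar>\<dots>\<bar> \<le> \<bar>LINT x|lebesgue_on \<Omega>. gv x $ i * p x\<bar> + \<bar>LINT x|lebesgue_on \<Omega>. v x * weak_grad \<Omega> p x $ i\<bar>"
      by (rule abs_triangle_ineq)
    also have "\<dots> \<le> L2_norm \<Omega> (\<lambda>x. gv x $ i) * L2_norm \<Omega> p + L2_norm \<Omega> v * L2_norm \<Omega> (\<lambda>x. weak_grad \<Omega> p x $ i)"
      using L2_Cauchy_Schwarz[OF gvi L(2)] L2_Cauchy_Schwarz[OF vL gL[OF p]] by (simp add: L2_inner_def)
    also have "\<dots> \<le> H1_norm \<Omega> v * L2_norm \<Omega> p + H1_norm \<Omega> v * L2_norm \<Omega> (\<lambda>x. weak_grad \<Omega> p x $ i)"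
      by (intro add_mono mult_right_mono n1 n2 L2_norm_nonneg)
    also have "\<dots> = H1_norm \<Omega> v * S" by (simp add: S_def distrib_left)
    also have "\<dots> \<le> \<delta> / (S + 1) * (S + 1)"
      using f(2) S0 H1_norm_nonneg[of \<Omega> v] by (intro mult_mono) (auto simp: v_def)
    also have "\<dots> = \<delta>" using S0 by simp
    finally show ?thesis by simp
  qed
  then have "\<bar>T\<bar> \<le> 0" by (rule field_le_epsilon)
  then show ?thesis by (simp add: T_def)
qed

text \<open>The curl assembled from weak partial derivatives of the components: an explicit
  representative with which the arbitrary choice \<open>weak_curl\<close> can be compared for
  \<open>H1\<close> fields.\<close>

definition grad_curl :: "(real^3) set \<Rightarrow> vector_field \<Rightarrow> vector_field" where
  "grad_curl \<Omega> u x = vector [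
     weak_grad \<Omega> (\<lambda>y. u y $ 3) x $ 2 - weak_grad \<Omega> (\<lambda>y. u y $ 2) x $ 3,
     weak_grad \<Omega> (\<lambda>y. u y $ 1) x $ 3 - weak_grad \<Omega> (\<lambda>y. u y $ 3) x $ 1,
     weak_grad \<Omega> (\<lambda>y. u y $ 2) x $ 1 - weak_grad \<Omega> (\<lambda>y. u y $ 1) x $ 2]"

definition grad_div :: "(real^3) set \<Rightarrow> vector_field \<Rightarrow> scalar_field" where
  "grad_div \<Omega> u x = (\<Sum>i\<in>UNIV. weak_grad \<Omega> (\<lambda>y. u y $ i) x $ i)"

lemma H1_vec_L2: "u \<in> H1_vec \<Omega> \<Longrightarrow> u \<in> L2 \<Omega>"
  unfolding L2_components by (simp add: H1_vec_def H1_def)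

lemma H1_0_vec_H1_vec: "u \<in> H1_0_vec \<Omega> \<Longrightarrow> u \<in> H1_vec \<Omega>"
  by (simp add: H1_vec_def H1_0_vec_def H1_0_def)

lemma weak_grad_component_L2: "u \<in> H1_vec \<Omega> \<Longrightarrow> (\<lambda>x. weak_grad \<Omega> (\<lambda>y. u y $ i) x $ j) \<in> L2 \<Omega>"
  using weak_grad_L2[of "\<lambda>y. u y $ i" \<Omega>] L2_components by (auto simp: H1_vec_def)

lemma grad_curl_L2: "u \<in> H1_vec \<Omega> \<Longrightarrow> grad_curl \<Omega> u \<in> L2 \<Omega>"
  unfolding L2_components forall_3 grad_curl_def vector_3
  by (intro conjI L2_diff weak_grad_component_L2)

lemma grad_div_L2: "u \<in> H1_vec \<Omega> \<Longrightarrow> grad_div \<Omega> u \<in> L2 \<Omega>"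
  unfolding grad_div_def[abs_def] by (intro L2_sum weak_grad_component_L2)

lemma inner_3_expand: "(x::real^3) \<bullet> y = x $ 1 * y $ 1 + x $ 2 * y $ 2 + x $ 3 * y $ 3"
  by (simp add: inner_vec_def sum_3)

text \<open>The curl is moved across by six one-dimensional integrations by parts; the abstract hypothesis
  covers both test fields against \<open>H1\<close> and \<open>H1_0\<close> against \<open>H1\<close>.\<close>

lemma curl_transfer:
  fixes q f :: vector_field and P R :: "3 \<Rightarrow> 3 \<Rightarrow> scalar_field"
  assumes q: "\<And>i. (\<lambda>x. q x $ i) \<in> L2 \<Omega>" and f: "\<And>i. (\<lambda>x. f x $ i) \<in> L2 \<Omega>"
    and P: "\<And>i j. P i j \<in> L2 \<Omega>" and R: "\<And>i j. R i j \<in> L2 \<Omega>"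
    and ibp: "\<And>i j k. (LINT x|lebesgue_on \<Omega>. q x $ k * P i j x) = - (LINT x|lebesgue_on \<Omega>. R k j x * f x $ i)"
  shows "L2_inner \<Omega> q (\<lambda>x. vector [P 3 2 x - P 2 3 x, P 1 3 x - P 3 1 x, P 2 1 x - P 1 2 x]) =
     L2_inner \<Omega> (\<lambda>x. vector [R 3 2 x - R 2 3 x, R 1 3 x - R 3 1 x, R 2 1 x - R 1 2 x]) f"
proof -
  have i1: "integrable (lebesgue_on \<Omega>) (\<lambda>x. q x $ k * P i j x)" for i j k by (rule L2_mult_integrable[OF q P])
  have i2: "integrable (lebesgue_on \<Omega>) (\<lambda>x. R i j x * f x $ k)" for i j k by (rule L2_mult_integrable[OF R f])
  have "L2_inner \<Omega> q (\<lambda>x. vector [P 3 2 x - P 2 3 x, P 1 3 x - P 3 1 x, P 2 1 x - P 1 2 x]) =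
     (LINT x|lebesgue_on \<Omega>. q x $ 1 * P 3 2 x - q x $ 1 * P 2 3 x + q x $ 2 * P 1 3 x - q x $ 2 * P 3 1 x
        + q x $ 3 * P 2 1 x - q x $ 3 * P 1 2 x)"
    unfolding L2_inner_def by (intro Bochner_Integration.integral_cong) (auto simp: inner_3_expand algebra_simps)
  also have "\<dots> = (LINT x|lebesgue_on \<Omega>. q x $ 1 * P 3 2 x) - (LINT x|lebesgue_on \<Omega>. q x $ 1 * P 2 3 x)
     + (LINT x|lebesgue_on \<Omega>. q x $ 2 * P 1 3 x) - (LINT x|lebesgue_on \<Omega>. q x $ 2 * P 3 1 x)
     + (LINT x|lebesgue_on \<Omega>. q x $ 3 * P 2 1 x) - (LINT x|lebesgue_on \<Omega>. q x $ 3 * P 1 2 x)"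
    by (simp add: i1)
  also have "\<dots> = (LINT x|lebesgue_on \<Omega>. R 3 2 x * f x $ 1) - (LINT x|lebesgue_on \<Omega>. R 2 3 x * f x $ 1)
     + (LINT x|lebesgue_on \<Omega>. R 1 3 x * f x $ 2) - (LINT x|lebesgue_on \<Omega>. R 3 1 x * f x $ 2)
     + (LINT x|lebesgue_on \<Omega>. R 2 1 x * f x $ 3) - (LINT x|lebesgue_on \<Omega>. R 1 2 x * f x $ 3)"
    unfolding ibp by simp
  also have "\<dots> = (LINT x|lebesgue_on \<Omega>. R 3 2 x * f x $ 1 - R 2 3 x * f x $ 1 + R 1 3 x * f x $ 2 - R 3 1 x * f x $ 2
        + R 2 1 x * f x $ 3 - R 1 2 x * f x $ 3)"
    by (simp add: i2)
  also have "\<dots> = L2_inner \<Omega> (\<lambda>x. vector [R 3 2 x - R 2 3 x, R 1 3 x - R 3 1 x, R 2 1 x - R 1 2 x]) f"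
    unfolding L2_inner_def by (intro Bochner_Integration.integral_cong) (auto simp: inner_3_expand algebra_simps)
  finally show ?thesis .
qed

lemma is_weak_curl_grad_curl:
  assumes \<Omega>: "open \<Omega>" and u: "u \<in> H1_vec \<Omega>"
  shows "is_weak_curl \<Omega> u (grad_curl \<Omega> u)"
  unfolding is_weak_curl_def
proof (intro conjI allI impI grad_curl_L2 u)
  fix f :: vector_field assume f: "\<forall>i. (\<lambda>x. f x $ i) \<in> test_functions \<Omega>"
  have m: "\<Omega> \<in> sets lebesgue" using \<Omega> by (rule open_sets_lebesgue)
  have e: "classical_curl f = (\<lambda>x. vector [partial 2 (\<lambda>y. f y $ 3) x - partial 3 (\<lambda>y. f y $ 2) x,
             partial 3 (\<lambda>y. f y $ 1) x - partial 1 (\<lambda>y. f y $ 3) x,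
             partial 1 (\<lambda>y. f y $ 2) x - partial 2 (\<lambda>y. f y $ 1) x])"
    by (rule ext) (simp add: classical_curl_def)
  have e2: "grad_curl \<Omega> u = (\<lambda>x. vector [
     weak_grad \<Omega> (\<lambda>y. u y $ 3) x $ 2 - weak_grad \<Omega> (\<lambda>y. u y $ 2) x $ 3,
     weak_grad \<Omega> (\<lambda>y. u y $ 1) x $ 3 - weak_grad \<Omega> (\<lambda>y. u y $ 3) x $ 1,
     weak_grad \<Omega> (\<lambda>y. u y $ 2) x $ 1 - weak_grad \<Omega> (\<lambda>y. u y $ 1) x $ 2])"
    by (rule ext) (simp add: grad_curl_def)
  show "L2_inner \<Omega> u (classical_curl f) = L2_inner \<Omega> (grad_curl \<Omega> u) f"
    unfolding e e2
  proof (rule curl_transfer[where P = "\<lambda>i j. partial j (\<lambda>y. f y $ i)" and R = "\<lambda>i j x. weak_grad \<Omega> (\<lambda>y. u y $ i) x $ j"])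
    show "(\<lambda>x. u x $ i) \<in> L2 \<Omega>" for i using H1_vec_L2[OF u] L2_components by blast
    show "(\<lambda>x. f x $ i) \<in> L2 \<Omega>" for i using f m by (intro test_L2) auto
    show "partial j (\<lambda>y. f y $ i) \<in> L2 \<Omega>" for i j using f m by (intro test_L2 partial_test) auto
    show "(\<lambda>x. weak_grad \<Omega> (\<lambda>y. u y $ i) x $ j) \<in> L2 \<Omega>" for i j by (rule weak_grad_component_L2[OF u])
    have "is_weak_grad \<Omega> (\<lambda>y. u y $ k) (weak_grad \<Omega> (\<lambda>y. u y $ k))" for k
      using u by (intro is_weak_grad_weak_grad) (simp add: H1_vec_def)
    then show "(LINT x|lebesgue_on \<Omega>. u x $ k * partial j (\<lambda>y. f y $ i) x) = - (LINT x|lebesgue_on \<Omega>. weak_grad \<Omega> (\<lambda>y. u y $ k) x $ j * f x $ i)" for i j k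
      using f unfolding is_weak_grad_def by blast
  qed
qed

lemma weak_curl_AE:
  assumes "open \<Omega>" "u \<in> H1_vec \<Omega>"
  shows "AE x in lebesgue_on \<Omega>. weak_curl \<Omega> u x = grad_curl \<Omega> u x"
  using weak_curl_unique[OF assms(1) _ is_weak_curl_grad_curl[OF assms]]
    someI[of "is_weak_curl \<Omega> u", OF is_weak_curl_grad_curl[OF assms]]
  unfolding weak_curl_def by blast

lemma weak_curl_L2:
  assumes "open \<Omega>" "u \<in> H1_vec \<Omega>" shows "weak_curl \<Omega> u \<in> L2 \<Omega>"
proof -
  have "is_weak_curl \<Omega> u (weak_curl \<Omega> u)"
    unfolding weak_curl_def by (rule someI[of "is_weak_curl \<Omega> u", OF is_weak_curl_grad_curl[OF assms]])
  then show ?thesis by (simp only: is_weak_curl_def)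
qed

lemma is_weak_div_grad_div:
  assumes \<Omega>: "open \<Omega>" and u: "u \<in> H1_vec \<Omega>"
  shows "is_weak_div \<Omega> u (grad_div \<Omega> u)"
  unfolding is_weak_div_def
proof (intro conjI ballI grad_div_L2 u)
  fix f assume f: "f \<in> test_functions \<Omega>"
  have m: "\<Omega> \<in> sets lebesgue" using \<Omega> by (rule open_sets_lebesgue)
  have i1: "integrable (lebesgue_on \<Omega>) (\<lambda>x. u x $ i * partial i f x)" for i
    using H1_vec_L2[OF u] L2_components by (intro L2_mult_integrable[OF _ test_L2[OF partial_test[OF f] m]]) blast
  have i2: "integrable (lebesgue_on \<Omega>) (\<lambda>x. weak_grad \<Omega> (\<lambda>y. u y $ i) x $ i * f x)" for i
    by (intro L2_mult_integrable weak_grad_component_L2 u test_L2 f m)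
  have w: "is_weak_grad \<Omega> (\<lambda>y. u y $ i) (weak_grad \<Omega> (\<lambda>y. u y $ i))" for i
    using u by (intro is_weak_grad_weak_grad) (simp add: H1_vec_def)
  have "L2_inner \<Omega> u (classical_grad f) = (\<Sum>i\<in>UNIV. LINT x|lebesgue_on \<Omega>. u x $ i * partial i f x)"
    unfolding L2_inner_def inner_vec_def classical_grad_def by (simp add: i1)
  also have "\<dots> = (\<Sum>i\<in>UNIV. - (LINT x|lebesgue_on \<Omega>. weak_grad \<Omega> (\<lambda>y. u y $ i) x $ i * f x))"
    using w f unfolding is_weak_grad_def by (intro sum.cong) auto
  also have "\<dots> = - L2_inner \<Omega> (grad_div \<Omega> u) f"
    by (simp add: L2_inner_def grad_div_def sum_distrib_right i2 sum_negf)
  finally show "L2_inner \<Omega> u (classical_grad f) = - L2_inner \<Omega> (grad_div \<Omega> u) f" .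
qed

lemma weak_div_AE:
  assumes "open \<Omega>" "u \<in> H1_vec \<Omega>"
  shows "AE x in lebesgue_on \<Omega>. weak_div \<Omega> u x = grad_div \<Omega> u x"
  using weak_div_unique[OF assms(1) _ is_weak_div_grad_div[OF assms]]
    someI[of "is_weak_div \<Omega> u", OF is_weak_div_grad_div[OF assms]]
  unfolding weak_div_def by blast

lemma weak_div_L2:
  assumes "open \<Omega>" "u \<in> H1_vec \<Omega>" shows "weak_div \<Omega> u \<in> L2 \<Omega>"
proof -
  have "is_weak_div \<Omega> u (weak_div \<Omega> u)"
    unfolding weak_div_def by (rule someI[of "is_weak_div \<Omega> u", OF is_weak_div_grad_div[OF assms]])
  then show ?thesis by (simp only: is_weak_div_def)
qed

text \<open>For positive \<epsilon> the curl is moved from \<psi> to \<open>q\<close>, which leaves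
  no boundary term since \<psi> has zero trace. Both forms of the pairing thus become the
  \<open>L2\<close> product of \<psi> with the curl of \<open>q\<close>, and the cases can share the
  later argument.\<close>

lemma curl_pairing_eq:
  assumes \<Omega>: "open \<Omega>" "bounded \<Omega>" and \<psi>: "\<psi> \<in> V_space \<Omega> \<epsilon>" and q: "q \<in> H1_vec \<Omega>"
  shows "curl_pairing \<Omega> \<epsilon> \<psi> q = L2_inner \<Omega> \<psi> (weak_curl \<Omega> q)"
proof (cases "\<epsilon> > 0")
  case True
  then have v: "\<psi> \<in> H1_0_vec \<Omega>" using \<psi> by (simp add: V_space_def)
  then have vH: "\<psi> \<in> H1_vec \<Omega>" by (rule H1_0_vec_H1_vec)
  have "L2_inner \<Omega> (weak_curl \<Omega> \<psi>) q = L2_inner \<Omega> (grad_curl \<Omega> \<psi>) q"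
    by (intro L2_inner_cong_AE weak_curl_AE weak_curl_L2 grad_curl_L2 H1_vec_L2 \<Omega> vH q) auto
  also have "\<dots> = L2_inner \<Omega> q (grad_curl \<Omega> \<psi>)" by (rule L2_inner_commute)
  also have "\<dots> = L2_inner \<Omega> (grad_curl \<Omega> q) \<psi>"
  proof -
    have e: "grad_curl \<Omega> w = (\<lambda>x. vector [
       weak_grad \<Omega> (\<lambda>y. w y $ 3) x $ 2 - weak_grad \<Omega> (\<lambda>y. w y $ 2) x $ 3,
       weak_grad \<Omega> (\<lambda>y. w y $ 1) x $ 3 - weak_grad \<Omega> (\<lambda>y. w y $ 3) x $ 1,
       weak_grad \<Omega> (\<lambda>y. w y $ 2) x $ 1 - weak_grad \<Omega> (\<lambda>y. w y $ 1) x $ 2])" for w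
      by (rule ext) (simp add: grad_curl_def)
    show ?thesis unfolding e
    proof (rule curl_transfer[where P = "\<lambda>i j x. weak_grad \<Omega> (\<lambda>y. \<psi> y $ i) x $ j" and R = "\<lambda>i j x. weak_grad \<Omega> (\<lambda>y. q y $ i) x $ j"])
      show "(\<lambda>x. q x $ i) \<in> L2 \<Omega>" "(\<lambda>x. \<psi> x $ i) \<in> L2 \<Omega>" for i
        using H1_vec_L2[OF q] H1_vec_L2[OF vH] L2_components by blast+
      show "(LINT x|lebesgue_on \<Omega>. q x $ k * weak_grad \<Omega> (\<lambda>y. \<psi> y $ i) x $ j) = - (LINT x|lebesgue_on \<Omega>. weak_grad \<Omega> (\<lambda>y. q y $ k) x $ j * \<psi> x $ i)" for i j k
        using H1_0_integration_by_parts[OF \<Omega>, of "\<lambda>y. \<psi> y $ i" "\<lambda>y. q y $ k" j] v q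
        by (simp add: H1_0_vec_def H1_vec_def mult.commute)
    qed (intro weak_grad_component_L2 vH q)+
  qed
  also have "\<dots> = L2_inner \<Omega> \<psi> (grad_curl \<Omega> q)" by (rule L2_inner_commute)
  also have "\<dots> = L2_inner \<Omega> \<psi> (weak_curl \<Omega> q)"
  proof (rule L2_inner_cong_AE)
    show "AE x in lebesgue_on \<Omega>. grad_curl \<Omega> q x = weak_curl \<Omega> q x"
      using weak_curl_AE[OF \<Omega>(1) q] by (rule eventually_mono) simp
  qed (auto intro: weak_curl_L2 grad_curl_L2 H1_vec_L2 \<Omega> vH q)
  finally show ?thesis using True by (simp add: curl_pairing_def)
qed (simp add: curl_pairing_def)

section \<open>Cellwise constant derivatives of discrete fields\<close>

lemma is_weak_grad_restrict:
  assumes g: "is_weak_grad \<Omega> u g" and O: "O' \<subseteq> \<Omega>" "O' \<in> sets lebesgue" "\<Omega> \<in> sets lebesgue"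
  shows "is_weak_grad O' u g"
  unfolding is_weak_grad_def
proof (intro conjI ballI allI)
  show "g \<in> L2 O'" using g by (intro L2_subset[OF _ O]) (simp add: is_weak_grad_def)
  fix f i assume f: "f \<in> test_functions O'"
  have "f x = 0" "partial i f x = 0" if "x \<in> \<Omega> - O'" for x
    using that test_functionsD(3)[OF f] closure_nonzero_zero[of x f] partial_zero_outside[of x f i] by blast+
  then have "(LINT x|lebesgue_on \<Omega>. u x * partial i f x) = (LINT x|lebesgue_on O'. u x * partial i f x)"
    "(LINT x|lebesgue_on \<Omega>. g x $ i * f x) = (LINT x|lebesgue_on O'. g x $ i * f x)"
    by (intro lebesgue_on_integral_subset O; simp)+
  then show "(LINT x|lebesgue_on O'. u x * partial i f x) = - (LINT x|lebesgue_on O'. g x $ i * f x)"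
    using g test_mono[OF f O(1)] by (auto simp: is_weak_grad_def)
qed

lemma is_weak_grad_cong_AE:
  assumes g: "is_weak_grad \<Omega> u g" and e: "AE x in lebesgue_on \<Omega>. u x = v x" and uv: "u \<in> L2 \<Omega>" "v \<in> L2 \<Omega>" and m: "\<Omega> \<in> sets lebesgue"
  shows "is_weak_grad \<Omega> v g"
  unfolding is_weak_grad_def
proof (intro conjI ballI allI)
  show "g \<in> L2 \<Omega>" using g by (simp add: is_weak_grad_def)
  fix f i assume f: "f \<in> test_functions \<Omega>"
  have "(LINT x|lebesgue_on \<Omega>. v x * partial i f x) = (LINT x|lebesgue_on \<Omega>. u x * partial i f x)"
  proof (rule integral_cong_AE)
    show "AE x in lebesgue_on \<Omega>. v x * partial i f x = u x * partial i f x" using e by (rule eventually_mono) simp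
  qed (intro borel_measurable_times L2_D(1) uv test_L2 partial_test f m)+
  then show "(LINT x|lebesgue_on \<Omega>. v x * partial i f x) = - (LINT x|lebesgue_on \<Omega>. g x $ i * f x)"
    using g f by (auto simp: is_weak_grad_def)
qed

lemma affine_is_weak_grad:
  fixes g :: "real^3"
  assumes \<Omega>: "open \<Omega>" "bounded \<Omega>"
  shows "is_weak_grad \<Omega> (\<lambda>x. a + g \<bullet> x) (\<lambda>x. g)" "(\<lambda>x. a + g \<bullet> x) \<in> L2 \<Omega>"
proof -
  have m: "\<Omega> \<in> sets lebesgue" using \<Omega>(1) by (rule open_sets_lebesgue)
  have l: "(norm g)-lipschitz_on UNIV (\<lambda>x. a + g \<bullet> x)"
  proof (rule lipschitz_onI)
    fix x y :: "real^3"
    have "\<bar>g \<bullet> (x - y)\<bar> \<le> norm g * norm (x - y)" by (rule Cauchy_Schwarz_ineq2)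
    then show "dist (a + g \<bullet> x) (a + g \<bullet> y) \<le> norm g * dist x y" by (simp add: dist_norm inner_diff_right)
  qed simp
  show "is_weak_grad \<Omega> (\<lambda>x. a + g \<bullet> x) (\<lambda>x. g)"
  proof (rule is_weak_grad_lipschitz[OF \<Omega>(1) l])
    show "(\<lambda>x. g) \<in> L2 \<Omega>" by (rule L2_bounded[OF \<Omega>(2) m, of _ "norm g"]) auto
    show "AE x in lebesgue_on \<Omega>. ((\<lambda>x. a + g \<bullet> x) has_derivative (\<lambda>v. g \<bullet> v)) (at x)"
      by (intro AE_I2) (auto intro!: derivative_eq_intros)
  qed
  obtain R where R: "\<Omega> \<subseteq> ball 0 R" using bounded_subset_ballD[OF \<Omega>(2), of 0] by blast
  show "(\<lambda>x. a + g \<bullet> x) \<in> L2 \<Omega>"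
  proof (rule L2_bounded[OF \<Omega>(2) m])
    show "(\<lambda>x. a + g \<bullet> x) \<in> borel_measurable (lebesgue_on \<Omega>)"
      by (intro borel_measurable_lebesgue_on borel_measurable_continuous_onI continuous_intros)
    fix x assume "x \<in> \<Omega>"
    then have "norm x \<le> R" using R by auto
    then have "\<bar>g \<bullet> x\<bar> \<le> norm g * R" using Cauchy_Schwarz_ineq2[of g x] mult_left_mono[of "norm x" R "norm g"] by simp
    then show "norm (a + g \<bullet> x) \<le> \<bar>a\<bar> + norm g * R" by simp
  qed
qed

context fe_mesh
begin

lemma Q_h_H1_vec: "q \<in> Q_h \<Omega> \<T> \<Longrightarrow> q \<in> H1_vec \<Omega>" by (simp add: Q_h_def)

text \<open>Restricted to the interior of a cell, the global weak gradient is still a weak gradient,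
  and by uniqueness it agrees with the constant gradient of the affine polynomial there.\<close>

lemma cell_weak_grad_const:
  assumes q: "q \<in> Q_h \<Omega> \<T>" and K: "K \<in> \<T>"
  shows "\<exists>g. AE x in lebesgue_on (interior K). weak_grad \<Omega> (\<lambda>y. q y $ i) x = g"
proof -
  let ?u = "\<lambda>y. q y $ i"
  have oK: "open (interior K)" "bounded (interior K)" using interior_cell_bounded[OF K] by auto
  obtain p where p: "p \<in> P_k 1" "AE x in lebesgue_on K. q x $ i = p x" using q K unfolding Q_h_def by blast
  obtain a g where ag: "\<And>x. p x = a + g \<bullet> x" using P_k_1_affine[OF p(1)] by blast
  have Ks: "K \<in> sets lebesgue" using closed_simplex[OF simplex_mesh[OF K]] by simp
  have "AE x in lebesgue. x \<in> K \<longrightarrow> q x $ i = p x" by (rule iffD1[OF AE_lebesgue_on_iff[OF Ks] p(2)])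
  then have "AE x in lebesgue. x \<in> interior K \<longrightarrow> a + g \<bullet> x = q x $ i"
    by (rule eventually_mono) (use interior_subset ag in auto)
  then have ae: "AE x in lebesgue_on (interior K). a + g \<bullet> x = q x $ i" by (rule iffD2[OF AE_lebesgue_on_iff[OF interior_sets]])
  have uH: "?u \<in> H1 \<Omega>" using Q_h_H1_vec[OF q] by (simp add: H1_vec_def)
  then have uL: "?u \<in> L2 (interior K)" by (intro L2_cell K) (simp add: H1_def)
  have "is_weak_grad (interior K) ?u (\<lambda>x. g)"
    by (rule is_weak_grad_cong_AE[OF affine_is_weak_grad(1)[OF oK] ae affine_is_weak_grad(2)[OF oK] uL interior_sets])
  moreover have "is_weak_grad (interior K) ?u (weak_grad \<Omega> ?u)"
    by (rule is_weak_grad_restrict[OF is_weak_grad_weak_grad[OF uH] interior_cell_subset[OF K] interior_sets dom_sets])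
  ultimately show ?thesis using weak_grad_unique[OF oK(1)] by blast
qed

lemma AE_restrict_cell:
  assumes "AE x in lebesgue_on \<Omega>. P x" "K \<in> \<T>" shows "AE x in lebesgue_on (interior K). P x"
  using assms(1) unfolding AE_lebesgue_on_iff[OF dom_sets] AE_lebesgue_on_iff[OF interior_sets]
  by (rule eventually_mono) (use interior_cell_subset[OF assms(2)] in blast)

lemma cell_weak_curl_const:
  assumes q: "q \<in> Q_h \<Omega> \<T>" and K: "K \<in> \<T>"
  shows "\<exists>a. AE x in lebesgue_on (interior K). weak_curl \<Omega> q x = a"
proof -
  obtain g where g: "\<And>i. AE x in lebesgue_on (interior K). weak_grad \<Omega> (\<lambda>y. q y $ i) x = g i"
    using cell_weak_grad_const[OF q K] by metis
  have c: "AE x in lebesgue_on (interior K). weak_curl \<Omega> q x = grad_curl \<Omega> q x"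
    by (rule AE_restrict_cell[OF weak_curl_AE[OF open_dom Q_h_H1_vec[OF q]] K])
  have "AE x in lebesgue_on (interior K). weak_curl \<Omega> q x = vector [g 3 $ 2 - g 2 $ 3, g 1 $ 3 - g 3 $ 1, g 2 $ 1 - g 1 $ 2]"
    using c g[of 1] g[of 2] g[of 3] by eventually_elim (simp add: grad_curl_def)
  then show ?thesis by blast
qed

lemma cell_weak_div_const:
  assumes q: "q \<in> Q_h \<Omega> \<T>" and K: "K \<in> \<T>"
  shows "\<exists>a. AE x in lebesgue_on K. weak_div \<Omega> q x = a"
proof -
  obtain g where g: "\<And>i. AE x in lebesgue_on (interior K). weak_grad \<Omega> (\<lambda>y. q y $ i) x = g i"
    using cell_weak_grad_const[OF q K] by metis
  have c: "AE x in lebesgue_on (interior K). weak_div \<Omega> q x = grad_div \<Omega> q x"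
    by (rule AE_restrict_cell[OF weak_div_AE[OF open_dom Q_h_H1_vec[OF q]] K])
  have "AE x in lebesgue_on (interior K). weak_div \<Omega> q x = g 1 $ 1 + g 2 $ 2 + g 3 $ 3"
    using c g[of 1] g[of 2] g[of 3] by eventually_elim (simp add: grad_div_def sum_3)
  then have "AE x in lebesgue. x \<in> interior K \<longrightarrow> weak_div \<Omega> q x = g 1 $ 1 + g 2 $ 2 + g 3 $ 3"
    by (rule iffD1[OF AE_lebesgue_on_iff[OF interior_sets]])
  moreover have Ks: "K \<in> sets lebesgue" using closed_simplex[OF simplex_mesh[OF K]] by simp
  moreover have "AE x in lebesgue. x \<in> K \<longrightarrow> x \<in> interior K" by (rule iffD1[OF AE_lebesgue_on_iff[OF Ks] AE_cell_interior[OF K]])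
  ultimately have "AE x in lebesgue. x \<in> K \<longrightarrow> weak_div \<Omega> q x = g 1 $ 1 + g 2 $ 2 + g 3 $ 3"
    by (auto elim: eventually_elim2)
  then have "AE x in lebesgue_on K. weak_div \<Omega> q x = g 1 $ 1 + g 2 $ 2 + g 3 $ 3"
    by (rule iffD2[OF AE_lebesgue_on_iff[OF Ks]])
  then show ?thesis by blast
qed

text \<open>The mean vanishes by Green's formula for the test function one, as the normal trace of
  \<open>q\<close> is zero. This is what makes the divergence an admissible pressure-type test
  function.\<close>

lemma weak_div_R_h:
  assumes q: "q \<in> Q_h \<Omega> \<T>" shows "weak_div \<Omega> q \<in> R_h \<Omega> \<T>"
proof -
  have qH: "q \<in> H1_vec \<Omega>" "q \<in> H_div_0 \<Omega>" using q by (auto simp: Q_h_def)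
  have L: "weak_div \<Omega> q \<in> L2 \<Omega>" by (rule weak_div_L2[OF open_dom qH(1)])
  have one: "is_weak_grad \<Omega> (\<lambda>x. 1) (\<lambda>x. 0)" "(\<lambda>x. 1::real) \<in> L2 \<Omega>"
    using affine_is_weak_grad[OF open_dom bdd_dom, of 1 0] by auto
  then have oneH: "(\<lambda>x. 1) \<in> H1 \<Omega>" by (auto simp: H1_def)
  have "L2_inner \<Omega> q (weak_grad \<Omega> (\<lambda>x. 1)) = L2_inner \<Omega> q (\<lambda>x. 0)"
    using weak_grad_AE[OF open_dom one(1)]
    by (intro L2_inner_cong_AE H1_vec_L2 qH weak_grad_L2 oneH L2_zero) auto
  then have "L2_inner \<Omega> (weak_div \<Omega> q) (\<lambda>x. 1) = 0"
    using qH(2) oneH by (auto simp: H_div_0_def L2_inner_def)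
  then have "weak_div \<Omega> q \<in> R_space \<Omega>" using L by (simp add: R_space_def L2_inner_def)
  moreover have "\<exists>p\<in>P_k 0. AE x in lebesgue_on K. weak_div \<Omega> q x = p x" if K: "K \<in> \<T>" for K
  proof -
    obtain a where "AE x in lebesgue_on K. weak_div \<Omega> q x = a" using cell_weak_div_const[OF q K] by blast
    then show ?thesis by (intro bexI[of _ "\<lambda>x. a"] P_k_const)
  qed
  ultimately show ?thesis by (simp add: R_h_def)
qed

text \<open>Against a field constant on each cell only the cell integrals count. Hence preserving
  cell means is all that is asked of the transfer to the discrete space.\<close>

lemma L2_inner_cell_means:
  fixes \<phi> \<psi> a :: vector_field
  assumes L: "\<phi> \<in> L2 \<Omega>" "\<psi> \<in> L2 \<Omega>" "a \<in> L2 \<Omega>"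
    and a: "\<And>K. K \<in> \<T> \<Longrightarrow> \<exists>v. AE x in lebesgue_on (interior K). a x = v"
    and e: "\<And>K i. K \<in> \<T> \<Longrightarrow> (LINT x|lebesgue_on (interior K). \<phi> x $ i) = (LINT x|lebesgue_on (interior K). \<psi> x $ i)"
  shows "L2_inner \<Omega> \<phi> a = L2_inner \<Omega> \<psi> a"
proof -
  have key: "(LINT x|lebesgue_on (interior K). w x \<bullet> a x) = v \<bullet> (\<chi> i. (LINT x|lebesgue_on (interior K). w x $ i))"
    if K: "K \<in> \<T>" and v: "AE x in lebesgue_on (interior K). a x = v" and w: "w \<in> L2 \<Omega>" for w :: vector_field and K and v :: "real^3"
  proof -
    have i: "integrable (lebesgue_on (interior K)) (\<lambda>x. w x $ i)" for i
      using w L2_components by (intro L2_L1[OF interior_cell_bounded[OF K] interior_sets] L2_cell[OF _ K]) blast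
    have mw: "w \<in> borel_measurable (lebesgue_on (interior K))" "a \<in> borel_measurable (lebesgue_on (interior K))"
      using L2_D(1)[OF L2_subset[OF w interior_cell_subset[OF K] interior_sets dom_sets]]
        L2_D(1)[OF L2_subset[OF L(3) interior_cell_subset[OF K] interior_sets dom_sets]] by auto
    have "(LINT x|lebesgue_on (interior K). w x \<bullet> a x) = (LINT x|lebesgue_on (interior K). (\<Sum>i\<in>UNIV. v $ i * w x $ i))"
    proof (rule integral_cong_AE)
      show "AE x in lebesgue_on (interior K). w x \<bullet> a x = (\<Sum>i\<in>UNIV. v $ i * w x $ i)"
        using v by (rule eventually_mono) (simp add: inner_vec_def mult.commute)
      show "(\<lambda>x. \<Sum>i\<in>UNIV. v $ i * w x $ i) \<in> borel_measurable (lebesgue_on (interior K))"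
        using i by (intro borel_measurable_sum borel_measurable_times) auto
    qed (use mw in auto)
    also have "\<dots> = v \<bullet> (\<chi> i. (LINT x|lebesgue_on (interior K). w x $ i))"
      using i by (simp add: inner_vec_def)
    finally show ?thesis .
  qed
  have "L2_inner \<Omega> \<phi> a = (\<Sum>K\<in>\<T>. LINT x|lebesgue_on (interior K). \<phi> x \<bullet> a x)"
    unfolding L2_inner_def by (rule cell_integral[OF L2_inner_integrable[OF L(1,3)]])
  also have "\<dots> = (\<Sum>K\<in>\<T>. LINT x|lebesgue_on (interior K). \<psi> x \<bullet> a x)"
  proof (rule sum.cong[OF refl])
    fix K assume K: "K \<in> \<T>"
    obtain v where v: "AE x in lebesgue_on (interior K). a x = v" using a[OF K] by blast
    show "(LINT x|lebesgue_on (interior K). \<phi> x \<bullet> a x) = (LINT x|lebesgue_on (interior K). \<psi> x \<bullet> a x)"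
      unfolding key[OF K v L(1)] key[OF K v L(2)] by (simp add: e[OF K])
  qed
  also have "\<dots> = L2_inner \<Omega> \<psi> a"
    unfolding L2_inner_def by (rule cell_integral[OF L2_inner_integrable[OF L(2,3)], symmetric])
  finally show ?thesis .
qed

end

section \<open>The parameter-dependent norms\<close>

lemma L2_matrix:
  fixes F :: "real^3 \<Rightarrow> real^3^3"
  assumes F: "\<And>i. (\<lambda>x. F x $ i) \<in> L2 \<Omega>"
  shows "F \<in> L2 \<Omega>" "(L2_norm \<Omega> F)\<^sup>2 = (\<Sum>i\<in>UNIV. (L2_norm \<Omega> (\<lambda>x. F x $ i))\<^sup>2)"
proof -
  have n: "(norm (F x))\<^sup>2 = (\<Sum>i\<in>UNIV. (norm (F x $ i))\<^sup>2)" for x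
    by (simp add: power2_norm_eq_inner inner_vec_def)
  have "F \<in> borel_measurable (lebesgue_on \<Omega>)"
  proof (subst borel_measurable_euclidean_space, intro ballI)
    fix b :: "real^3^3" assume "b \<in> Basis"
    then obtain i b' where b: "b = axis i b'" by (auto simp: Basis_vec_def)
    show "(\<lambda>x. F x \<bullet> b) \<in> borel_measurable (lebesgue_on \<Omega>)"
      unfolding b inner_axis by (intro borel_measurable_inner L2_D(1)[OF F]) simp
  qed
  moreover have i: "integrable (lebesgue_on \<Omega>) (\<lambda>x. (norm (F x $ i))\<^sup>2)" for i by (rule L2_D(2)[OF F])
  ultimately show "F \<in> L2 \<Omega>" by (simp add: L2_def n)
  show "(L2_norm \<Omega> F)\<^sup>2 = (\<Sum>i\<in>UNIV. (L2_norm \<Omega> (\<lambda>x. F x $ i))\<^sup>2)"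
    unfolding L2_norm_sq_integral n by (simp add: i)
qed

lemma L2_norm_vector:
  fixes \<psi> :: vector_field
  assumes "\<psi> \<in> L2 \<Omega>"
  shows "(L2_norm \<Omega> \<psi>)\<^sup>2 = (\<Sum>i\<in>UNIV. (L2_norm \<Omega> (\<lambda>x. \<psi> x $ i))\<^sup>2)"
  unfolding L2_norm_sq by (rule L2_inner_components[OF assms assms])

lemma weak_jacobian_L2:
  assumes "\<psi> \<in> H1_vec \<Omega>"
  shows "weak_jacobian \<Omega> \<psi> \<in> L2 \<Omega>"
    "(L2_norm \<Omega> (weak_jacobian \<Omega> \<psi>))\<^sup>2 = (\<Sum>i\<in>UNIV. (L2_norm \<Omega> (weak_grad \<Omega> (\<lambda>y. \<psi> y $ i)))\<^sup>2)"
proof -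
  have e: "(\<lambda>x. weak_jacobian \<Omega> \<psi> x $ i) = weak_grad \<Omega> (\<lambda>y. \<psi> y $ i)" for i
    by (rule ext) (simp add: weak_jacobian_def)
  have "(\<lambda>x. weak_jacobian \<Omega> \<psi> x $ i) \<in> L2 \<Omega>" for i
    unfolding e using assms by (intro weak_grad_L2) (simp add: H1_vec_def)
  from L2_matrix[of "weak_jacobian \<Omega> \<psi>", OF this] show "weak_jacobian \<Omega> \<psi> \<in> L2 \<Omega>"
    "(L2_norm \<Omega> (weak_jacobian \<Omega> \<psi>))\<^sup>2 = (\<Sum>i\<in>UNIV. (L2_norm \<Omega> (weak_grad \<Omega> (\<lambda>y. \<psi> y $ i)))\<^sup>2)"
    unfolding e by auto
qed

lemma weak_jacobian_linear_AE:
  assumes \<Omega>: "open \<Omega>" and v: "\<phi> \<in> H1_vec \<Omega>" "\<psi> \<in> H1_vec \<Omega>"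
  shows "AE x in lebesgue_on \<Omega>. weak_jacobian \<Omega> (\<lambda>x. \<phi> x + c *\<^sub>R \<psi> x) x = weak_jacobian \<Omega> \<phi> x + c *\<^sub>R weak_jacobian \<Omega> \<psi> x"
proof -
  have "AE x in lebesgue_on \<Omega>. weak_grad \<Omega> (\<lambda>y. (\<phi> y + c *\<^sub>R \<psi> y) $ i) x = weak_grad \<Omega> (\<lambda>y. \<phi> y $ i) x + c *\<^sub>R weak_grad \<Omega> (\<lambda>y. \<psi> y $ i) x" for i
  proof -
    have h: "(\<lambda>y. \<phi> y $ i) \<in> H1 \<Omega>" "(\<lambda>y. \<psi> y $ i) \<in> H1 \<Omega>" using v by (auto simp: H1_vec_def)
    then have l: "(\<lambda>y. \<phi> y $ i) \<in> L2 \<Omega>" "(\<lambda>y. \<psi> y $ i) \<in> L2 \<Omega>" by (auto simp: H1_def)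
    have "is_weak_grad \<Omega> (\<lambda>y. \<phi> y $ i + c * \<psi> y $ i) (\<lambda>x. weak_grad \<Omega> (\<lambda>y. \<phi> y $ i) x + c *\<^sub>R weak_grad \<Omega> (\<lambda>y. \<psi> y $ i) x)"
      by (intro is_weak_grad_add is_weak_grad_cmult is_weak_grad_weak_grad open_sets_lebesgue \<Omega> h l L2_mult)
    from weak_grad_AE[OF \<Omega> this] show ?thesis by simp
  qed
  then have "AE x in lebesgue_on \<Omega>. \<forall>i\<in>UNIV. weak_grad \<Omega> (\<lambda>y. (\<phi> y + c *\<^sub>R \<psi> y) $ i) x = weak_grad \<Omega> (\<lambda>y. \<phi> y $ i) x + c *\<^sub>R weak_grad \<Omega> (\<lambda>y. \<psi> y $ i) x"
    by (intro AE_finite_allI) auto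
  then show ?thesis by (rule eventually_mono) (simp add: weak_jacobian_def vec_eq_iff)
qed

text \<open>The combination is required almost everywhere only, because chosen weak Jacobians are
  linear in their argument just up to null sets.\<close>

lemma L2_inner_linear_AE:
  assumes "f \<in> L2 \<Omega>" "g \<in> L2 \<Omega>" "k \<in> L2 \<Omega>" "AE x in lebesgue_on \<Omega>. k x = f x + c *\<^sub>R g x"
  shows "L2_inner \<Omega> k k = L2_inner \<Omega> f f + 2 * c * L2_inner \<Omega> f g + c\<^sup>2 * L2_inner \<Omega> g g"
    "L2_inner \<Omega> f k = L2_inner \<Omega> f f + c * L2_inner \<Omega> f g"
proof -
  note cg = L2_scaleR[OF assms(2), of c]
  note s = L2_add[OF assms(1) cg]
  have "L2_inner \<Omega> k k = L2_inner \<Omega> (\<lambda>x. f x + c *\<^sub>R g x) (\<lambda>x. f x + c *\<^sub>R g x)"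
    by (intro L2_inner_cong_AE assms s)
  also have "\<dots> = L2_inner \<Omega> f f + 2 * c * L2_inner \<Omega> f g + c\<^sup>2 * L2_inner \<Omega> g g"
    unfolding L2_inner_add_left[OF assms(1) cg s] L2_inner_add_right[OF assms(1) cg assms(1)] L2_inner_scaleR_left
      L2_inner_add_right[OF assms(1) cg assms(2)] L2_inner_scaleR_right L2_inner_commute[of \<Omega> g f]
    by (simp add: power2_eq_square algebra_simps)
  finally show "L2_inner \<Omega> k k = L2_inner \<Omega> f f + 2 * c * L2_inner \<Omega> f g + c\<^sup>2 * L2_inner \<Omega> g g" .
  have "L2_inner \<Omega> f k = L2_inner \<Omega> f (\<lambda>x. f x + c *\<^sub>R g x)"
    by (intro L2_inner_cong_AE assms s) auto
  then show "L2_inner \<Omega> f k = L2_inner \<Omega> f f + c * L2_inner \<Omega> f g"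
    unfolding L2_inner_add_right[OF assms(1) cg assms(1)] L2_inner_scaleR_right .
qed

lemma V_space_H1_vec: "\<epsilon> > 0 \<Longrightarrow> \<psi> \<in> V_space \<Omega> \<epsilon> \<Longrightarrow> \<psi> \<in> H1_vec \<Omega>"
  by (intro H1_0_vec_H1_vec) (simp add: V_space_def)

lemma V_space_L2: "\<psi> \<in> V_space \<Omega> \<epsilon> \<Longrightarrow> \<psi> \<in> L2 \<Omega>"
  using V_space_H1_vec[of \<epsilon> \<psi> \<Omega>] H1_vec_L2[of \<psi> \<Omega>] by (cases "\<epsilon> > 0") (auto simp: V_space_def)

lemma V_space_linear:
  assumes "open \<Omega>" "bounded \<Omega>" "\<phi> \<in> V_space \<Omega> \<epsilon>" "\<psi> \<in> V_space \<Omega> \<epsilon>"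
  shows "(\<lambda>x. \<phi> x + c *\<^sub>R \<psi> x) \<in> V_space \<Omega> \<epsilon>"
proof (cases "\<epsilon> > 0")
  case True
  then have "(\<lambda>x. \<phi> x $ i + c * \<psi> x $ i) \<in> H1_0 \<Omega>" for i
    using assms by (intro H1_0_add H1_0_cmult assms(1,2)) (auto simp: V_space_def H1_0_vec_def)
  then show ?thesis using True by (simp add: V_space_def H1_0_vec_def)
next
  case False
  then show ?thesis using assms(3,4) by (auto simp: V_space_def intro: L2_add L2_scaleR)
qed

lemma V_norm_sq: "(V_norm \<Omega> \<epsilon> \<psi>)\<^sup>2 = a1 \<Omega> \<epsilon> \<psi> \<psi>"
  by (simp add: V_norm_def a1_def L2_norm_sq L2_inner_self_nonneg)

lemma V_norm_nonneg: "V_norm \<Omega> \<epsilon> \<psi> \<ge> 0" by (simp add: V_norm_def)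

lemma a1_nonneg: "a1 \<Omega> \<epsilon> \<psi> \<psi> \<ge> 0"
  using V_norm_sq[of \<Omega> \<epsilon> \<psi>] by (metis zero_le_power2)

text \<open>The expansions for values and for weak Jacobians have the same coefficients, so they add
  up with the weight \<open>\<epsilon>\<^sup>2\<close>. The stability argument perturbs a field by a
  multiple of another one and uses these two expansions of the form.\<close>

lemma a1_linear:
  fixes \<phi> \<psi> :: vector_field and c :: real
  assumes \<Omega>: "open \<Omega>" "bounded \<Omega>" and v: "\<phi> \<in> V_space \<Omega> \<epsilon>" "\<psi> \<in> V_space \<Omega> \<epsilon>"
  defines "\<theta> \<equiv> \<lambda>x. \<phi> x + c *\<^sub>R \<psi> x"
  shows "a1 \<Omega> \<epsilon> \<theta> \<theta> = a1 \<Omega> \<epsilon> \<phi> \<phi> + 2 * c * a1 \<Omega> \<epsilon> \<phi> \<psi> + c\<^sup>2 * a1 \<Omega> \<epsilon> \<psi> \<psi>"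
    "a1 \<Omega> \<epsilon> \<phi> \<theta> = a1 \<Omega> \<epsilon> \<phi> \<phi> + c * a1 \<Omega> \<epsilon> \<phi> \<psi>"
proof -
  have k: "\<theta> \<in> V_space \<Omega> \<epsilon>" unfolding \<theta>_def by (rule V_space_linear[OF \<Omega> v])
  note L = V_space_L2[OF v(1)] V_space_L2[OF v(2)] V_space_L2[OF k]
  have ae: "AE x in lebesgue_on \<Omega>. \<theta> x = \<phi> x + c *\<^sub>R \<psi> x" by (simp add: \<theta>_def)
  note e0 = L2_inner_linear_AE[OF L ae]
  have e1: "L2_inner \<Omega> (weak_jacobian \<Omega> \<theta>) (weak_jacobian \<Omega> \<theta>) = L2_inner \<Omega> (weak_jacobian \<Omega> \<phi>) (weak_jacobian \<Omega> \<phi>)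
       + 2 * c * L2_inner \<Omega> (weak_jacobian \<Omega> \<phi>) (weak_jacobian \<Omega> \<psi>) + c\<^sup>2 * L2_inner \<Omega> (weak_jacobian \<Omega> \<psi>) (weak_jacobian \<Omega> \<psi>)"
    "L2_inner \<Omega> (weak_jacobian \<Omega> \<phi>) (weak_jacobian \<Omega> \<theta>) = L2_inner \<Omega> (weak_jacobian \<Omega> \<phi>) (weak_jacobian \<Omega> \<phi>)
       + c * L2_inner \<Omega> (weak_jacobian \<Omega> \<phi>) (weak_jacobian \<Omega> \<psi>)" if pos: "\<epsilon> > 0"
  proof -
    note H = V_space_H1_vec[OF pos v(1)] V_space_H1_vec[OF pos v(2)] V_space_H1_vec[OF pos k]
    note J = weak_jacobian_L2(1)[OF H(1)] weak_jacobian_L2(1)[OF H(2)] weak_jacobian_L2(1)[OF H(3)]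
    note ae = weak_jacobian_linear_AE[OF \<Omega>(1) H(1,2), of c, folded \<theta>_def]
    show "L2_inner \<Omega> (weak_jacobian \<Omega> \<theta>) (weak_jacobian \<Omega> \<theta>) = L2_inner \<Omega> (weak_jacobian \<Omega> \<phi>) (weak_jacobian \<Omega> \<phi>)
       + 2 * c * L2_inner \<Omega> (weak_jacobian \<Omega> \<phi>) (weak_jacobian \<Omega> \<psi>) + c\<^sup>2 * L2_inner \<Omega> (weak_jacobian \<Omega> \<psi>) (weak_jacobian \<Omega> \<psi>)"
      by (rule L2_inner_linear_AE(1)[OF J ae])
    show "L2_inner \<Omega> (weak_jacobian \<Omega> \<phi>) (weak_jacobian \<Omega> \<theta>) = L2_inner \<Omega> (weak_jacobian \<Omega> \<phi>) (weak_jacobian \<Omega> \<phi>)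
       + c * L2_inner \<Omega> (weak_jacobian \<Omega> \<phi>) (weak_jacobian \<Omega> \<psi>)"
      by (rule L2_inner_linear_AE(2)[OF J ae])
  qed
  show "a1 \<Omega> \<epsilon> \<theta> \<theta> = a1 \<Omega> \<epsilon> \<phi> \<phi> + 2 * c * a1 \<Omega> \<epsilon> \<phi> \<psi> + c\<^sup>2 * a1 \<Omega> \<epsilon> \<psi> \<psi>"
    by (cases "\<epsilon> > 0") (simp_all add: a1_def e0 e1 algebra_simps)
  show "a1 \<Omega> \<epsilon> \<phi> \<theta> = a1 \<Omega> \<epsilon> \<phi> \<phi> + c * a1 \<Omega> \<epsilon> \<phi> \<psi>"
    by (cases "\<epsilon> > 0") (simp_all add: a1_def e0 e1 algebra_simps)
qed

lemma V_norm_scaleR: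
  assumes \<Omega>: "open \<Omega>" "bounded \<Omega>" and v: "\<psi> \<in> V_space \<Omega> \<epsilon>"
  shows "V_norm \<Omega> \<epsilon> (\<lambda>x. c *\<^sub>R \<psi> x) = \<bar>c\<bar> * V_norm \<Omega> \<epsilon> \<psi>"
proof -
  \<comment> \<open>Writing the multiple as \<psi> plus \<open>c - 1\<close> times \<psi> makes
    homogeneity a case of \<open>a1_linear\<close>.\<close>
  have e: "(\<lambda>x. \<psi> x + (c - 1) *\<^sub>R \<psi> x) = (\<lambda>x. c *\<^sub>R \<psi> x)" by (simp add: algebra_simps)
  have "(V_norm \<Omega> \<epsilon> (\<lambda>x. c *\<^sub>R \<psi> x))\<^sup>2 = (\<bar>c\<bar> * V_norm \<Omega> \<epsilon> \<psi>)\<^sup>2"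
    using a1_linear(1)[OF \<Omega> v v, of "c - 1"] unfolding e power_mult_distrib V_norm_sq power2_abs
    by (simp add: power2_eq_square algebra_simps)
  then show ?thesis by (rule power2_eq_imp_eq) (auto simp: V_norm_nonneg)
qed

lemma V_norm_pos:
  assumes "\<psi> \<in> V_space \<Omega> \<epsilon>" "\<not> ae_zero \<Omega> \<psi>"
  shows "V_norm \<Omega> \<epsilon> \<psi> > 0" "L2_norm \<Omega> \<psi> \<le> V_norm \<Omega> \<epsilon> \<psi>"
proof -
  have L: "\<psi> \<in> L2 \<Omega>" using assms(1) by (rule V_space_L2)
  show le: "L2_norm \<Omega> \<psi> \<le> V_norm \<Omega> \<epsilon> \<psi>"
    unfolding V_norm_def by (rule real_le_rsqrt) simp
  have "L2_norm \<Omega> \<psi> \<noteq> 0"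
  proof
    assume "L2_norm \<Omega> \<psi> = 0"
    then have "(LINT x|lebesgue_on \<Omega>. (norm (\<psi> x))\<^sup>2) = 0" using L2_norm_sq_integral[of \<Omega> \<psi>] by simp
    then have "AE x in lebesgue_on \<Omega>. (norm (\<psi> x))\<^sup>2 = 0"
      using integral_nonneg_eq_0_iff_AE[OF L2_D(2)[OF L]] by simp
    then show False using assms(2) by (simp add: ae_zero_def)
  qed
  then show "V_norm \<Omega> \<epsilon> \<psi> > 0" using le L2_norm_nonneg[of \<Omega> \<psi>] by linarith
qed

lemma L2_norm_ae_zero:
  assumes "ae_zero \<Omega> f" shows "L2_norm \<Omega> f = 0"
proof -
  have "(LINT x|lebesgue_on \<Omega>. f x \<bullet> f x) = 0"
    using assms unfolding ae_zero_def by (intro integral_eq_zero_AE) (auto elim: eventually_mono)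
  then show ?thesis by (simp add: L2_norm_def L2_inner_def)
qed

lemma V_norm_sq_components:
  assumes "\<epsilon> > 0" "\<psi> \<in> H1_vec \<Omega>"
  shows "(V_norm \<Omega> \<epsilon> \<psi>)\<^sup>2 = (\<Sum>i\<in>UNIV. \<epsilon>\<^sup>2 * (L2_norm \<Omega> (weak_grad \<Omega> (\<lambda>y. \<psi> y $ i)))\<^sup>2 + (L2_norm \<Omega> (\<lambda>y. \<psi> y $ i))\<^sup>2)"
  using assms weak_jacobian_L2(2)[OF assms(2)] L2_norm_vector[OF H1_vec_L2[OF assms(2)]]
  by (simp add: V_norm_def sum.distrib sum_distrib_left sum_nonneg)

section \<open>Sign change of discrete fields\<close>

lemma weak_div_uminus:
  assumes \<Omega>: "open \<Omega>" and q: "q \<in> H1_vec \<Omega>"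
  shows "AE x in lebesgue_on \<Omega>. weak_div \<Omega> (\<lambda>x. - q x) x = - weak_div \<Omega> q x"
    "is_weak_div \<Omega> (\<lambda>x. - q x) (\<lambda>x. - weak_div \<Omega> q x)"
proof -
  have "is_weak_div \<Omega> q (weak_div \<Omega> q)"
    unfolding weak_div_def by (rule someI[of "is_weak_div \<Omega> q", OF is_weak_div_grad_div[OF \<Omega> q]])
  then show w: "is_weak_div \<Omega> (\<lambda>x. - q x) (\<lambda>x. - weak_div \<Omega> q x)"
    by (auto simp: is_weak_div_def L2_inner_uminus_left L2_uminus)
  have "is_weak_div \<Omega> (\<lambda>x. - q x) (weak_div \<Omega> (\<lambda>x. - q x))"
    unfolding weak_div_def by (rule someI[of "is_weak_div \<Omega> (\<lambda>x. - q x)", OF w])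
  then show "AE x in lebesgue_on \<Omega>. weak_div \<Omega> (\<lambda>x. - q x) x = - weak_div \<Omega> q x"
    using weak_div_unique[OF \<Omega> _ w] by blast
qed

lemma weak_curl_uminus:
  assumes \<Omega>: "open \<Omega>" and q: "q \<in> H1_vec \<Omega>"
  shows "AE x in lebesgue_on \<Omega>. weak_curl \<Omega> (\<lambda>x. - q x) x = - weak_curl \<Omega> q x"
proof -
  have "is_weak_curl \<Omega> q (weak_curl \<Omega> q)"
    unfolding weak_curl_def by (rule someI[of "is_weak_curl \<Omega> q", OF is_weak_curl_grad_curl[OF \<Omega> q]])
  then have w: "is_weak_curl \<Omega> (\<lambda>x. - q x) (\<lambda>x. - weak_curl \<Omega> q x)"
    by (auto simp: is_weak_curl_def L2_inner_uminus_left L2_uminus)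
  have "is_weak_curl \<Omega> (\<lambda>x. - q x) (weak_curl \<Omega> (\<lambda>x. - q x))"
    unfolding weak_curl_def by (rule someI[of "is_weak_curl \<Omega> (\<lambda>x. - q x)", OF w])
  then show ?thesis using weak_curl_unique[OF \<Omega> _ w] by blast
qed

lemma H1_vec_uminus: "q \<in> H1_vec \<Omega> \<Longrightarrow> (\<lambda>x. - q x) \<in> H1_vec \<Omega>"
  using H1_cmult[of _ \<Omega> "-1"] by (fastforce simp: H1_vec_def)

lemma Q_h_uminus:
  assumes \<Omega>: "open \<Omega>" and q: "q \<in> Q_h \<Omega> \<T>"
  shows "(\<lambda>x. - q x) \<in> Q_h \<Omega> \<T>"
proof -
  have qH: "q \<in> H1_vec \<Omega>" "q \<in> H_div_0 \<Omega>" using q by (auto simp: Q_h_def)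
  note w = weak_div_uminus[OF \<Omega> qH(1)]
  have qL: "(\<lambda>x. - q x) \<in> L2 \<Omega>" by (intro L2_uminus H1_vec_L2 qH)
  have "(\<lambda>x. - q x) \<in> H_div_0 \<Omega>"
    unfolding H_div_0_def H_div_def
  proof (intro CollectI conjI ballI qL exI[of _ "\<lambda>x. - weak_div \<Omega> q x"] w(2))
    fix v assume v: "v \<in> H1 \<Omega>"
    have "L2_inner \<Omega> (weak_div \<Omega> (\<lambda>x. - q x)) v = L2_inner \<Omega> (\<lambda>x. - weak_div \<Omega> q x) v"
    proof (rule L2_inner_cong_AE[OF w(1)])
      show "v \<in> L2 \<Omega>" "v \<in> L2 \<Omega>" using v by (auto simp: H1_def)
    qed (auto intro: weak_div_L2 \<Omega> H1_vec_uminus qH L2_uminus)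
    then show "L2_inner \<Omega> (\<lambda>x. - q x) (weak_grad \<Omega> v) + L2_inner \<Omega> (weak_div \<Omega> (\<lambda>x. - q x)) v = 0"
      using qH(2) v by (auto simp: H_div_0_def L2_inner_uminus_left)
  qed
  moreover have "\<exists>p\<in>P_k 1. AE x in lebesgue_on K. (- q x) $ i = p x" if K: "K \<in> \<T>" for K i
  proof -
    obtain p where p: "p \<in> P_k 1" "AE x in lebesgue_on K. q x $ i = p x" using q K unfolding Q_h_def by blast
    show ?thesis by (intro bexI[OF _ P_k_cmult[OF p(1), of "-1"]] eventually_mono[OF p(2)]) simp
  qed
  ultimately show ?thesis using H1_vec_uminus[OF qH(1)] by (simp add: Q_h_def)
qed

text \<open>The supremum runs over signed quotients, so invariance comes from the map \<psi> to
  \<open>- \<psi>\<close>, which permutes the nonzero elements of the space and preserves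
  \<open>V_norm\<close>. It is needed because the stability argument tests with
  \<open>- p\<close>.\<close>

lemma Q_norm_uminus:
  assumes \<Omega>: "open \<Omega>" "bounded \<Omega>" and q: "q \<in> H1_vec \<Omega>"
  shows "Q_norm \<Omega> \<epsilon> (\<lambda>x. - q x) = Q_norm \<Omega> \<epsilon> q"
proof -
  let ?S = "{\<psi> \<in> V_space \<Omega> \<epsilon>. \<not> ae_zero \<Omega> \<psi>}"
  note qm = H1_vec_uminus[OF q]
  have "L2_norm \<Omega> (weak_div \<Omega> (\<lambda>x. - q x)) = L2_norm \<Omega> (\<lambda>x. - weak_div \<Omega> q x)"
    by (intro L2_norm_cong_AE weak_div_uminus weak_div_L2 L2_uminus \<Omega> q qm)
  then have d: "L2_norm \<Omega> (weak_div \<Omega> (\<lambda>x. - q x)) = L2_norm \<Omega> (weak_div \<Omega> q)"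
    by (simp add: L2_norm_def L2_inner_uminus_left L2_inner_uminus_right)
  have neg: "(\<lambda>x. - \<psi> x) \<in> ?S" if "\<psi> \<in> ?S" for \<psi>
    using that V_space_linear[OF \<Omega>, of \<psi> \<epsilon> \<psi> "-2"] by (simp add: ae_zero_def scaleR_2 algebra_simps)
  have val: "curl_pairing \<Omega> \<epsilon> \<psi> (\<lambda>x. - q x) / V_norm \<Omega> \<epsilon> \<psi> = curl_pairing \<Omega> \<epsilon> (\<lambda>x. - \<psi> x) q / V_norm \<Omega> \<epsilon> (\<lambda>x. - \<psi> x)" if s: "\<psi> \<in> ?S" for \<psi>
  proof -
    have v: "\<psi> \<in> V_space \<Omega> \<epsilon>" "(\<lambda>x. - \<psi> x) \<in> V_space \<Omega> \<epsilon>" using s neg[OF s] by auto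
    have "L2_inner \<Omega> \<psi> (weak_curl \<Omega> (\<lambda>x. - q x)) = L2_inner \<Omega> \<psi> (\<lambda>x. - weak_curl \<Omega> q x)"
      by (intro L2_inner_cong_AE weak_curl_uminus weak_curl_L2 L2_uminus \<Omega> q qm V_space_L2[OF v(1)]) auto
    then have "curl_pairing \<Omega> \<epsilon> \<psi> (\<lambda>x. - q x) = curl_pairing \<Omega> \<epsilon> (\<lambda>x. - \<psi> x) q"
      by (simp add: curl_pairing_eq[OF \<Omega> v(1) qm] curl_pairing_eq[OF \<Omega> v(2) q] L2_inner_uminus_left L2_inner_uminus_right)
    moreover have "V_norm \<Omega> \<epsilon> (\<lambda>x. - \<psi> x) = V_norm \<Omega> \<epsilon> \<psi>" using V_norm_scaleR[OF \<Omega> v(1), of "-1"] by simp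
    ultimately show ?thesis by simp
  qed
  have "(\<lambda>\<psi>. curl_pairing \<Omega> \<epsilon> \<psi> (\<lambda>x. - q x) / V_norm \<Omega> \<epsilon> \<psi>) ` ?S = (\<lambda>\<psi>. curl_pairing \<Omega> \<epsilon> \<psi> q / V_norm \<Omega> \<epsilon> \<psi>) ` ?S"
    (is "?f ` _ = ?g ` _")
  proof
    show "?f ` ?S \<subseteq> ?g ` ?S"
    proof
      fix y assume "y \<in> ?f ` ?S"
      then obtain \<psi> where p: "\<psi> \<in> ?S" "y = ?f \<psi>" by blast
      then have "y = ?g (\<lambda>x. - \<psi> x)" using val[OF p(1)] by simp
      then show "y \<in> ?g ` ?S" using neg[OF p(1)] by (rule image_eqI)
    qed
    show "?g ` ?S \<subseteq> ?f ` ?S"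
    proof
      fix y assume "y \<in> ?g ` ?S"
      then obtain \<psi> where p: "\<psi> \<in> ?S" "y = ?g \<psi>" by blast
      have "?f (\<lambda>x. - \<psi> x) = ?g (\<lambda>x. - (- \<psi> x))" by (rule val[OF neg[OF p(1)]])
      then have "y = ?f (\<lambda>x. - \<psi> x)" using p(2) by simp
      then show "y \<in> ?f ` ?S" using neg[OF p(1)] by (rule image_eqI)
    qed
  qed
  then show ?thesis by (simp add: Q_norm_def d)
qed

section \<open>Discrete spaces and the transfer of test fields\<close>

context fe_mesh
begin

lemma V_h_linear:
  assumes v: "\<phi> \<in> V_h \<Omega> \<T> \<epsilon>" "\<psi> \<in> V_h \<Omega> \<T> \<epsilon>"
  shows "(\<lambda>x. \<phi> x + a *\<^sub>R \<psi> x) \<in> V_h \<Omega> \<T> \<epsilon>"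
  unfolding V_h_def
proof (intro CollectI conjI ballI allI)
  show "(\<lambda>x. \<phi> x + a *\<^sub>R \<psi> x) \<in> V_space \<Omega> \<epsilon>"
    using v by (intro V_space_linear open_dom bdd_dom) (auto simp: V_h_def)
  fix K i assume K: "K \<in> \<T>"
  obtain p b where 1: "p \<in> P_k 1" "b \<in> B_4 K" "AE x in lebesgue_on K. \<phi> x $ i = p x + b x"
    using v(1) K unfolding V_h_def by blast
  obtain p' b' where 2: "p' \<in> P_k 1" "b' \<in> B_4 K" "AE x in lebesgue_on K. \<psi> x $ i = p' x + b' x"
    using v(2) K unfolding V_h_def by blast
  have "AE x in lebesgue_on K. (\<phi> x + a *\<^sub>R \<psi> x) $ i = (p x + a * p' x) + (b x + a * b' x)"
    using 1(3) 2(3) by eventually_elim (simp add: distrib_left)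
  moreover have "(\<lambda>x. p x + a * p' x) \<in> P_k 1" by (intro P_k_add P_k_cmult 1 2)
  moreover have "(\<lambda>x. b x + a * b' x) \<in> B_4 K" by (intro B_4_add B_4_cmult 1 2 cell_bounded K)
  ultimately show "\<exists>p\<in>P_k 1. \<exists>b\<in>B_4 K. AE x in lebesgue_on K. (\<phi> x + a *\<^sub>R \<psi> x) $ i = p x + b x"
    by (intro bexI[of _ "\<lambda>x. p x + a * p' x"] bexI[of _ "\<lambda>x. b x + a * b' x"])
qed

lemma V_h_V_space: "\<psi> \<in> V_h \<Omega> \<T> \<epsilon> \<Longrightarrow> \<psi> \<in> V_space \<Omega> \<epsilon>" by (simp add: V_h_def)

lemma V_h_zero: "(\<lambda>x. 0) \<in> V_h \<Omega> \<T> \<epsilon>"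
  unfolding V_h_def
proof (intro CollectI conjI ballI allI)
  show "(\<lambda>x. 0) \<in> V_space \<Omega> \<epsilon>"
    by (simp add: V_space_def L2_zero H1_0_vec_def H1_0_zero open_dom bdd_dom)
  fix K and i :: 3 assume K: "K \<in> \<T>"
  have "(\<lambda>x. 0) \<in> B_4 K"
    using interior_cell_bounded[OF K] by (simp add: B_4_def P_k_zero H1_0_zero)
  then show "\<exists>p\<in>P_k 1. \<exists>b\<in>B_4 K. AE x in lebesgue_on K. (0::real^3) $ i = p x + b x"
    by (intro bexI[OF _ P_k_zero] bexI[of _ "\<lambda>x. 0"]) auto
qed

lemma R_h_linear:
  assumes r: "r \<in> R_h \<Omega> \<T>" "s \<in> R_h \<Omega> \<T>"
  shows "(\<lambda>x. r x + a * s x) \<in> R_h \<Omega> \<T>"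
proof -
  have L: "r \<in> L2 \<Omega>" "s \<in> L2 \<Omega>" using r by (auto simp: R_h_def R_space_def)
  have "integrable (lebesgue_on \<Omega>) r" "integrable (lebesgue_on \<Omega>) s"
    by (intro L2_L1[OF bdd_dom dom_sets] L)+
  then have "(LINT x|lebesgue_on \<Omega>. r x + a * s x) = 0" using r by (simp add: R_h_def R_space_def)
  then have "(\<lambda>x. r x + a * s x) \<in> R_space \<Omega>" using L by (simp add: R_space_def L2_add L2_mult)
  moreover have "\<exists>p\<in>P_k 0. AE x in lebesgue_on K. r x + a * s x = p x" if K: "K \<in> \<T>" for K
  proof -
    obtain p where p: "p \<in> P_k 0" "AE x in lebesgue_on K. r x = p x" using r(1) K unfolding R_h_def by blast
    obtain q where q: "q \<in> P_k 0" "AE x in lebesgue_on K. s x = q x" using r(2) K unfolding R_h_def by blast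
    have "AE x in lebesgue_on K. r x + a * s x = p x + a * q x" using p(2) q(2) by eventually_elim simp
    moreover have "(\<lambda>x. p x + a * q x) \<in> P_k 0" by (intro P_k_add P_k_cmult p q)
    ultimately show ?thesis by (intro bexI[of _ "\<lambda>x. p x + a * q x"])
  qed
  ultimately show ?thesis by (simp add: R_h_def)
qed

lemma interp_const_pos: "interp_const > 0" using \<kappa>_pos by (simp add: interp_const_def)

lemma fortin_const_pos: "fortin_const > 0" "bubble_const \<le> fortin_const"
proof -
  have n: "0 \<le> 4 * bubble_const * (1 + interp_const)" "0 \<le> 8 / c\<^sup>2 * interp_const * (1 + bubble_const)"
    using interp_const_pos bubble_const_nonneg by auto
  then show "fortin_const > 0" unfolding fortin_const_def using interp_const_pos by linarith
  have "bubble_const * 1 \<le> bubble_const * (4 * (1 + interp_const))"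
    using interp_const_pos bubble_const_nonneg by (intro mult_left_mono) auto
  then show "bubble_const \<le> fortin_const"
    unfolding fortin_const_def using n(2) interp_const_pos by (simp add: mult_ac)
qed

text \<open>The averaging operator acts on test functions, so \<psi> is replaced by nearby ones,
  component by component. The approximation may spoil at most half of the pairing and raise the
  squared norm at most by the factor three; a finer tolerance would not help the later argument
  qualitatively.\<close>

lemma discrete_transfer_H1:
  assumes pos: "\<epsilon> > 0" and \<psi>: "\<psi> \<in> V_space \<Omega> \<epsilon>" and V: "V_norm \<Omega> \<epsilon> \<psi> > 0" and q: "q \<in> Q_h \<Omega> \<T>"
    and b: "L2_inner \<Omega> \<psi> (weak_curl \<Omega> q) > 0"
  shows "\<exists>\<theta>\<in>V_h \<Omega> \<T> \<epsilon>. (V_norm \<Omega> \<epsilon> \<theta>)\<^sup>2 \<le> 3 * fortin_const * (V_norm \<Omega> \<epsilon> \<psi>)\<^sup>2 \<and>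
    L2_inner \<Omega> \<psi> (weak_curl \<Omega> q) / 2 \<le> L2_inner \<Omega> \<theta> (weak_curl \<Omega> q)"
proof -
  define w where "w = weak_curl \<Omega> q"
  define \<beta> where "\<beta> = L2_inner \<Omega> \<psi> w"
  let ?V = "V_norm \<Omega> \<epsilon> \<psi>" let ?n = "L2_norm \<Omega> w"
  have wL: "w \<in> L2 \<Omega>" unfolding w_def by (intro weak_curl_L2 open_dom Q_h_H1_vec q)
  have \<beta>: "\<beta> > 0" using b by (simp add: \<beta>_def w_def)
  have \<psi>0: "\<psi> \<in> H1_0_vec \<Omega>" using \<psi> pos by (simp add: V_space_def)
  have \<psi>H: "\<psi> \<in> H1_vec \<Omega>" by (rule H1_0_vec_H1_vec[OF \<psi>0])
  have \<psi>L: "\<psi> \<in> L2 \<Omega>" by (rule H1_vec_L2[OF \<psi>H])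
  have n0: "?n \<ge> 0" by (rule L2_norm_nonneg)
  \<comment> \<open>The first bound limits the change of the pairing to \<open>\<beta> / 2\<close>.
    The second makes \<open>(\<epsilon> + 1) * \<delta>\<close> at most a third of the norm of
    \<psi>, so that the three components add no more than one squared norm to twice the original
    one.\<close>
  define \<delta> where "\<delta> = min (\<beta> / (4 * (?n + 1))) (?V / (3 * (\<epsilon> + 1)))"
  have \<delta>: "\<delta> > 0" "\<delta> \<le> \<beta> / (4 * (?n + 1))" "\<delta> \<le> ?V / (3 * (\<epsilon> + 1))"
    using \<beta> V pos n0 by (auto simp: \<delta>_def)
  have "\<exists>f\<in>test_functions \<Omega>. H1_norm \<Omega> (\<lambda>x. \<psi> x $ i - f x) < \<delta>" for i
    using \<psi>0 \<delta>(1) by (intro H1_0_approx) (auto simp: H1_0_vec_def)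
  then obtain f where f: "\<And>i. f i \<in> test_functions \<Omega>" "\<And>i. H1_norm \<Omega> (\<lambda>x. \<psi> x $ i - f i x) < \<delta>" by metis
  define F where "F = (\<lambda>x. (\<chi> i. f i x) :: real^3)"
  define \<theta> where "\<theta> = (\<lambda>x. (\<chi> i. fortin (f i) x) :: real^3)"
  define d where "d i = (\<lambda>x. f i x - \<psi> x $ i)" for i
  define N where "N u = \<epsilon>\<^sup>2 * (L2_norm \<Omega> (weak_grad \<Omega> u))\<^sup>2 + (L2_norm \<Omega> u)\<^sup>2" for u
  have fH: "f i \<in> H1 \<Omega>" for i by (rule test_H1[OF open_dom bdd_dom f(1)])
  have \<psi>i: "(\<lambda>x. \<psi> x $ i) \<in> H1 \<Omega>" for i using \<psi>H by (simp add: H1_vec_def)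
  have dH: "d i \<in> H1 \<Omega>" for i
    using H1_add[OF open_dom fH[of i] H1_cmult[OF \<psi>i[of i], of "-1"]] by (simp add: d_def)
  have dn: "H1_norm \<Omega> (d i) < \<delta>" for i
  proof -
    have "H1_norm \<Omega> (\<lambda>x. (-1) * d i x) = H1_norm \<Omega> (d i)" using H1_norm_cmult[OF open_dom dH[of i], of "-1"] by simp
    then show ?thesis using f(2)[of i] by (simp add: d_def)
  qed
  have dn2: "(L2_norm \<Omega> (d i))\<^sup>2 + (L2_norm \<Omega> (weak_grad \<Omega> (d i)))\<^sup>2 \<le> \<delta>\<^sup>2" for i
  proof -
    have "(H1_norm \<Omega> (d i))\<^sup>2 \<le> \<delta>\<^sup>2" using dn[of i] H1_norm_nonneg[of \<Omega> "d i"] by (intro power_mono) auto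
    then show ?thesis by (simp add: H1_norm_def)
  qed
  have Nd: "N (d i) \<le> (\<epsilon> + 1)\<^sup>2 * \<delta>\<^sup>2" for i
  proof -
    have e: "\<epsilon>\<^sup>2 \<le> (\<epsilon> + 1)\<^sup>2" "1 \<le> (\<epsilon> + 1)\<^sup>2" using pos by (auto simp: power2_eq_square algebra_simps)
    have "N (d i) \<le> (\<epsilon> + 1)\<^sup>2 * (L2_norm \<Omega> (weak_grad \<Omega> (d i)))\<^sup>2 + (\<epsilon> + 1)\<^sup>2 * (L2_norm \<Omega> (d i))\<^sup>2"
      unfolding N_def using mult_right_mono[OF e(1), of "(L2_norm \<Omega> (weak_grad \<Omega> (d i)))\<^sup>2"] mult_right_mono[OF e(2), of "(L2_norm \<Omega> (d i))\<^sup>2"] by simp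
    also have "\<dots> = (\<epsilon> + 1)\<^sup>2 * ((L2_norm \<Omega> (d i))\<^sup>2 + (L2_norm \<Omega> (weak_grad \<Omega> (d i)))\<^sup>2)" by (simp add: algebra_simps)
    also have "\<dots> \<le> (\<epsilon> + 1)\<^sup>2 * \<delta>\<^sup>2" by (intro mult_left_mono dn2) simp
    finally show ?thesis .
  qed
  have Nf: "N (f i) \<le> 2 * N (\<lambda>x. \<psi> x $ i) + 2 * N (d i)" for i
  proof -
    have e: "(\<lambda>x. \<psi> x $ i + d i x) = f i" by (auto simp: d_def)
    have L: "(\<lambda>x. \<psi> x $ i) \<in> L2 \<Omega>" "d i \<in> L2 \<Omega>" using \<psi>i dH by (auto simp: H1_def)
    have wg: "is_weak_grad \<Omega> (\<lambda>x. \<psi> x $ i + d i x) (\<lambda>x. weak_grad \<Omega> (\<lambda>x. \<psi> x $ i) x + weak_grad \<Omega> (d i) x)"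
      by (intro is_weak_grad_add dom_sets L is_weak_grad_weak_grad \<psi>i dH)
    have "L2_norm \<Omega> (weak_grad \<Omega> (f i)) = L2_norm \<Omega> (\<lambda>x. weak_grad \<Omega> (\<lambda>x. \<psi> x $ i) x + weak_grad \<Omega> (d i) x)"
      using L2_norm_weak_grad[OF open_dom wg L2_add[OF L]] unfolding e .
    then have g: "(L2_norm \<Omega> (weak_grad \<Omega> (f i)))\<^sup>2 \<le> 2 * (L2_norm \<Omega> (weak_grad \<Omega> (\<lambda>x. \<psi> x $ i)))\<^sup>2 + 2 * (L2_norm \<Omega> (weak_grad \<Omega> (d i)))\<^sup>2"
      using L2_norm_add_sq[OF weak_grad_L2[OF \<psi>i] weak_grad_L2[OF dH]] by simp
    have v: "(L2_norm \<Omega> (f i))\<^sup>2 \<le> 2 * (L2_norm \<Omega> (\<lambda>x. \<psi> x $ i))\<^sup>2 + 2 * (L2_norm \<Omega> (d i))\<^sup>2"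
      using L2_norm_add_sq[OF L] unfolding e .
    show ?thesis unfolding N_def using mult_left_mono[OF g, of "\<epsilon>\<^sup>2"] v by (simp add: algebra_simps)
  qed
  have VN: "?V\<^sup>2 = (\<Sum>i\<in>UNIV. N (\<lambda>x. \<psi> x $ i))" unfolding N_def by (rule V_norm_sq_components[OF pos \<psi>H])
  have sumNf: "(\<Sum>i\<in>UNIV. N (f i)) \<le> 3 * ?V\<^sup>2"
  proof -
    have "(\<Sum>i\<in>UNIV. N (f i)) \<le> (\<Sum>i\<in>UNIV. 2 * N (\<lambda>x. \<psi> x $ i) + 2 * ((\<epsilon> + 1)\<^sup>2 * \<delta>\<^sup>2))"
      using Nf Nd by (intro sum_mono) (meson add_left_mono mult_left_mono order_trans zero_le_numeral)
    also have "\<dots> = 2 * ?V\<^sup>2 + 6 * ((\<epsilon> + 1) * \<delta>)\<^sup>2"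
      by (simp add: VN sum.distrib sum_distrib_left power_mult_distrib)
    also have "((\<epsilon> + 1) * \<delta>)\<^sup>2 \<le> (?V / 3)\<^sup>2"
    proof (rule power_mono)
      show "(\<epsilon> + 1) * \<delta> \<le> ?V / 3" using \<delta>(3) pos by (simp add: field_simps)
    qed (use \<delta>(1) pos in auto)
    also have "2 * ?V\<^sup>2 + 6 * (?V / 3)\<^sup>2 \<le> 3 * ?V\<^sup>2" by (simp add: power_divide)
    finally show ?thesis by simp
  qed
  have fp: "fortin (f i) \<in> H1_0 \<Omega>" for i by (rule fortin_properties(1)[OF f(1)])
  have \<theta>V: "\<theta> \<in> V_space \<Omega> \<epsilon>" using pos fp by (simp add: V_space_def H1_0_vec_def \<theta>_def)
  have \<theta>Vh: "\<theta> \<in> V_h \<Omega> \<T> \<epsilon>"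
    unfolding V_h_def using \<theta>V fortin_properties(2)[OF f(1)] by (simp add: \<theta>_def)
  have \<theta>H: "\<theta> \<in> H1_vec \<Omega>" by (rule V_space_H1_vec[OF pos \<theta>V])
  have "(V_norm \<Omega> \<epsilon> \<theta>)\<^sup>2 = (\<Sum>i\<in>UNIV. N (fortin (f i)))"
    unfolding V_norm_sq_components[OF pos \<theta>H] N_def by (simp add: \<theta>_def)
  also have "\<dots> \<le> (\<Sum>i\<in>UNIV. fortin_const * N (f i))"
  proof (rule sum_mono)
    fix i
    show "N (fortin (f i)) \<le> fortin_const * N (f i)"
      unfolding N_def using mult_left_mono[OF fortin_properties(5)[OF f(1), of i], of "\<epsilon>\<^sup>2"] fortin_properties(4)[OF f(1), of i]
      by (simp add: algebra_simps)
  qed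
  also have "\<dots> \<le> fortin_const * (3 * ?V\<^sup>2)"
    unfolding sum_distrib_left[symmetric] using fortin_const_pos(1) by (intro mult_left_mono sumNf) simp
  finally have nb: "(V_norm \<Omega> \<epsilon> \<theta>)\<^sup>2 \<le> 3 * fortin_const * ?V\<^sup>2" by simp
  have FL: "F \<in> L2 \<Omega>" unfolding L2_components using fH by (simp add: F_def H1_def)
  have "L2_inner \<Omega> \<theta> w = L2_inner \<Omega> F w"
  proof (rule L2_inner_cell_means[OF V_space_L2[OF \<theta>V] FL wL])
    show "\<exists>v. AE x in lebesgue_on (interior K). w x = v" if "K \<in> \<T>" for K
      unfolding w_def by (rule cell_weak_curl_const[OF q that])
    show "(LINT x|lebesgue_on (interior K). \<theta> x $ i) = (LINT x|lebesgue_on (interior K). F x $ i)" if "K \<in> \<T>" for K i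
      using fortin_properties(3)[OF f(1) that] by (simp add: \<theta>_def F_def)
  qed
  moreover have "\<bar>L2_inner \<Omega> (\<lambda>x. F x - \<psi> x) w\<bar> \<le> \<beta> / 2"
  proof -
    have DL: "(\<lambda>x. F x - \<psi> x) \<in> L2 \<Omega>" by (rule L2_diff[OF FL \<psi>L])
    have "(L2_norm \<Omega> (\<lambda>x. F x - \<psi> x))\<^sup>2 = (\<Sum>i\<in>UNIV. (L2_norm \<Omega> (d i))\<^sup>2)"
      unfolding L2_norm_vector[OF DL] by (simp add: F_def d_def)
    also have "\<dots> \<le> (\<Sum>i\<in>(UNIV::3 set). \<delta>\<^sup>2)"
    proof (rule sum_mono)
      fix i show "(L2_norm \<Omega> (d i))\<^sup>2 \<le> \<delta>\<^sup>2" using dn2[of i] zero_le_power2[of "L2_norm \<Omega> (weak_grad \<Omega> (d i))"] by linarith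
    qed
    \<comment> \<open>Three components, rounded up to the square of two.\<close>
    also have "\<dots> \<le> (2 * \<delta>)\<^sup>2" by (simp add: power_mult_distrib)
    finally have D: "L2_norm \<Omega> (\<lambda>x. F x - \<psi> x) \<le> 2 * \<delta>" by (rule power2_le_imp_le) (use \<delta>(1) in simp)
    have "\<bar>L2_inner \<Omega> (\<lambda>x. F x - \<psi> x) w\<bar> \<le> L2_norm \<Omega> (\<lambda>x. F x - \<psi> x) * ?n" by (rule L2_Cauchy_Schwarz[OF DL wL])
    also have "\<dots> \<le> (2 * \<delta>) * (?n + 1)" using D n0 \<delta>(1) by (intro mult_mono) auto
    also have "\<dots> \<le> \<beta> / 2" using \<delta>(2) n0 by (simp add: field_simps)
    finally show ?thesis .
  qed
  moreover have "L2_inner \<Omega> (\<lambda>x. F x - \<psi> x) w = L2_inner \<Omega> F w - \<beta>"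
    unfolding \<beta>_def by (rule L2_inner_diff_left[OF FL \<psi>L wL])
  ultimately have "\<beta> / 2 \<le> L2_inner \<Omega> \<theta> w" by linarith
  then show ?thesis using nb \<theta>Vh unfolding \<beta>_def w_def by blast
qed

text \<open>With \<epsilon> not positive neither gradients nor continuity across faces are at stake,
  so the bubbles carrying the cell means of \<psi> already form the discrete field, with zero linear
  part.\<close>

lemma discrete_transfer_L2:
  assumes pos: "\<not> \<epsilon> > 0" and \<psi>: "\<psi> \<in> V_space \<Omega> \<epsilon>" and q: "q \<in> Q_h \<Omega> \<T>"
  shows "\<exists>\<theta>\<in>V_h \<Omega> \<T> \<epsilon>. (V_norm \<Omega> \<epsilon> \<theta>)\<^sup>2 \<le> fortin_const * (V_norm \<Omega> \<epsilon> \<psi>)\<^sup>2 \<and>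
    L2_inner \<Omega> \<psi> (weak_curl \<Omega> q) = L2_inner \<Omega> \<theta> (weak_curl \<Omega> q)"
proof -
  have L: "\<psi> \<in> L2 \<Omega>" by (rule V_space_L2[OF \<psi>])
  then have Li: "(\<lambda>x. \<psi> x $ i) \<in> L2 \<Omega>" for i using L2_components by blast
  define \<theta> where "\<theta> = (\<lambda>x. (\<chi> i. bubble_part (\<lambda>x. \<psi> x $ i) x) :: real^3)"
  have bL: "bubble_part e \<in> L2 \<Omega>" for e by (intro H1_0_L2 bubble_part_H1_0)
  have \<theta>L: "\<theta> \<in> L2 \<Omega>" unfolding L2_components by (simp add: \<theta>_def bL)
  have V: "(V_norm \<Omega> \<epsilon> u)\<^sup>2 = (L2_norm \<Omega> u)\<^sup>2" for u using pos by (simp add: V_norm_def)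
  have \<theta>Vh: "\<theta> \<in> V_h \<Omega> \<T> \<epsilon>"
    unfolding V_h_def
  proof (intro CollectI conjI ballI allI)
    show "\<theta> \<in> V_space \<Omega> \<epsilon>" using \<theta>L pos by (simp add: V_space_def)
    fix K i assume K: "K \<in> \<T>"
    obtain b where b: "b \<in> B_4 K" "\<forall>x\<in>interior K. bubble_part (\<lambda>x. \<psi> x $ i) x = b x" using bubble_part_B_4[OF K] by blast
    have "AE x in lebesgue_on K. \<theta> x $ i = 0 + b x"
      using AE_cell_interior[OF K] by (rule eventually_mono) (simp add: \<theta>_def b(2))
    then show "\<exists>p\<in>P_k 1. \<exists>b\<in>B_4 K. AE x in lebesgue_on K. \<theta> x $ i = p x + b x"
      by (intro bexI[OF _ P_k_zero] bexI[OF _ b(1)])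
  qed
  have "(L2_norm \<Omega> \<theta>)\<^sup>2 = (\<Sum>i\<in>UNIV. (L2_norm \<Omega> (bubble_part (\<lambda>x. \<psi> x $ i)))\<^sup>2)"
    unfolding L2_norm_vector[OF \<theta>L] by (simp add: \<theta>_def)
  also have "\<dots> \<le> (\<Sum>i\<in>UNIV. bubble_const * (L2_norm \<Omega> (\<lambda>x. \<psi> x $ i))\<^sup>2)"
    by (intro sum_mono bubble_part_L2_bound Li)
  also have "\<dots> = bubble_const * (L2_norm \<Omega> \<psi>)\<^sup>2" by (simp add: L2_norm_vector[OF L] sum_distrib_left)
  also have "\<dots> \<le> fortin_const * (L2_norm \<Omega> \<psi>)\<^sup>2" by (intro mult_right_mono fortin_const_pos) simp
  finally have nb: "(V_norm \<Omega> \<epsilon> \<theta>)\<^sup>2 \<le> fortin_const * (V_norm \<Omega> \<epsilon> \<psi>)\<^sup>2" by (simp add: V)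
  have "L2_inner \<Omega> \<psi> (weak_curl \<Omega> q) = L2_inner \<Omega> \<theta> (weak_curl \<Omega> q)"
  proof (rule L2_inner_cell_means[OF L \<theta>L weak_curl_L2[OF open_dom Q_h_H1_vec[OF q]] cell_weak_curl_const[OF q]])
    show "(LINT x|lebesgue_on (interior K). \<psi> x $ i) = (LINT x|lebesgue_on (interior K). \<theta> x $ i)" if "K \<in> \<T>" for K i
      using bubble_part_mean[OF that, of "\<lambda>x. \<psi> x $ i"] by (simp add: \<theta>_def)
  qed
  then show ?thesis using nb \<theta>Vh by blast
qed

lemma discrete_transfer:
  assumes \<psi>: "\<psi> \<in> V_space \<Omega> \<epsilon>" and V: "V_norm \<Omega> \<epsilon> \<psi> > 0" and q: "q \<in> Q_h \<Omega> \<T>"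
    and b: "L2_inner \<Omega> \<psi> (weak_curl \<Omega> q) > 0"
  shows "\<exists>\<theta>\<in>V_h \<Omega> \<T> \<epsilon>. V_norm \<Omega> \<epsilon> \<theta> \<le> sqrt (3 * fortin_const) * V_norm \<Omega> \<epsilon> \<psi> \<and>
    L2_inner \<Omega> \<psi> (weak_curl \<Omega> q) / 2 \<le> L2_inner \<Omega> \<theta> (weak_curl \<Omega> q)"
proof -
  have "\<exists>\<theta>\<in>V_h \<Omega> \<T> \<epsilon>. (V_norm \<Omega> \<epsilon> \<theta>)\<^sup>2 \<le> 3 * fortin_const * (V_norm \<Omega> \<epsilon> \<psi>)\<^sup>2 \<and>
    L2_inner \<Omega> \<psi> (weak_curl \<Omega> q) / 2 \<le> L2_inner \<Omega> \<theta> (weak_curl \<Omega> q)"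
  proof (cases "\<epsilon> > 0")
    case True then show ?thesis by (rule discrete_transfer_H1[OF _ \<psi> V q b])
  next
    case False
    obtain \<theta> where t: "\<theta> \<in> V_h \<Omega> \<T> \<epsilon>" "(V_norm \<Omega> \<epsilon> \<theta>)\<^sup>2 \<le> fortin_const * (V_norm \<Omega> \<epsilon> \<psi>)\<^sup>2"
      "L2_inner \<Omega> \<psi> (weak_curl \<Omega> q) = L2_inner \<Omega> \<theta> (weak_curl \<Omega> q)"
      using discrete_transfer_L2[OF False \<psi> q] by blast
    have "0 \<le> fortin_const * (V_norm \<Omega> \<epsilon> \<psi>)\<^sup>2" using fortin_const_pos(1) by simp
    then show ?thesis using t b by (intro bexI[OF _ t(1)]) auto
  qed
  then obtain \<theta> where t: "\<theta> \<in> V_h \<Omega> \<T> \<epsilon>" "(V_norm \<Omega> \<epsilon> \<theta>)\<^sup>2 \<le> 3 * fortin_const * (V_norm \<Omega> \<epsilon> \<psi>)\<^sup>2"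
    "L2_inner \<Omega> \<psi> (weak_curl \<Omega> q) / 2 \<le> L2_inner \<Omega> \<theta> (weak_curl \<Omega> q)" by blast
  have "V_norm \<Omega> \<epsilon> \<theta> \<le> sqrt (3 * fortin_const * (V_norm \<Omega> \<epsilon> \<psi>)\<^sup>2)" using t(2) by (rule real_le_rsqrt)
  also have "\<dots> = sqrt (3 * fortin_const) * V_norm \<Omega> \<epsilon> \<psi>" by (simp add: real_sqrt_mult V_norm_nonneg)
  finally show ?thesis using t by blast
qed

section \<open>The curl part of the norm and its discrete inf-sup condition\<close>

definition curl_sup :: "real \<Rightarrow> vector_field \<Rightarrow> real" where
  "curl_sup \<epsilon> q = (SUP \<psi> \<in> {\<psi> \<in> V_space \<Omega> \<epsilon>. \<not> ae_zero \<Omega> \<psi>}. curl_pairing \<Omega> \<epsilon> \<psi> q / V_norm \<Omega> \<epsilon> \<psi>)"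

text \<open>After the pairing is rewritten as an \<open>L2\<close> product, Cauchy-Schwarz bounds
  every quotient by the norm of the weak curl. Without a bound the real supremum would carry no
  information.\<close>

lemma curl_sup_bdd:
  assumes q: "q \<in> Q_h \<Omega> \<T>"
  shows "bdd_above ((\<lambda>\<psi>. curl_pairing \<Omega> \<epsilon> \<psi> q / V_norm \<Omega> \<epsilon> \<psi>) ` {\<psi> \<in> V_space \<Omega> \<epsilon>. \<not> ae_zero \<Omega> \<psi>})"
proof (rule bdd_aboveI2)
  fix \<psi> assume p: "\<psi> \<in> {\<psi> \<in> V_space \<Omega> \<epsilon>. \<not> ae_zero \<Omega> \<psi>}"
  let ?n = "L2_norm \<Omega> (weak_curl \<Omega> q)"
  have v: "\<psi> \<in> V_space \<Omega> \<epsilon>" "V_norm \<Omega> \<epsilon> \<psi> > 0" "L2_norm \<Omega> \<psi> \<le> V_norm \<Omega> \<epsilon> \<psi>" using p V_norm_pos by auto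
  have "curl_pairing \<Omega> \<epsilon> \<psi> q = L2_inner \<Omega> \<psi> (weak_curl \<Omega> q)" by (rule curl_pairing_eq[OF open_dom bdd_dom v(1) Q_h_H1_vec[OF q]])
  also have "\<dots> \<le> L2_norm \<Omega> \<psi> * ?n"
    using L2_Cauchy_Schwarz[OF V_space_L2[OF v(1)] weak_curl_L2[OF open_dom Q_h_H1_vec[OF q]]] by linarith
  also have "\<dots> \<le> V_norm \<Omega> \<epsilon> \<psi> * ?n" by (intro mult_right_mono v L2_norm_nonneg)
  finally show "curl_pairing \<Omega> \<epsilon> \<psi> q / V_norm \<Omega> \<epsilon> \<psi> \<le> ?n" using v(2) by (simp add: pos_divide_le_eq mult.commute)
qed

text \<open>A single bubble repeated in all components. It shows that the supremum in the norm of
  \<open>q\<close> is taken over a nonempty set and that nonzero test triples exist.\<close>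

lemma V_nontrivial:
  assumes "\<Omega> \<noteq> {}"
  obtains \<psi> where "\<psi> \<in> V_h \<Omega> \<T> \<epsilon>" "\<not> ae_zero \<Omega> \<psi>"
proof -
  have "closure \<Omega> \<noteq> {}" using assms by simp
  then have "\<exists>x. x \<in> closure \<Omega>" by (simp only: ex_in_conv simp_thms)
  then obtain x where "x \<in> closure \<Omega>" ..
  then obtain K where K: "K \<in> \<T>" unfolding cover[symmetric] by blast
  obtain z where z: "cball z (c * h) \<subseteq> K" using inball[OF K] by blast
  have ch: "c * h > 0" using c_pos h_pos by simp
  define \<psi> where "\<psi> = (\<lambda>x. (\<chi> i. bubble K x) :: real^3)"
  have bH: "bubble K \<in> H1_0 \<Omega>"
    by (rule bubble_H1_0(1)[OF simplex_mesh[OF K] z ch open_dom bdd_dom interior_cell_subset[OF K]])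
  have "\<psi> \<in> V_space \<Omega> \<epsilon>"
    using bH H1_0_L2[OF bH] L2_components[of \<psi> \<Omega>] by (simp add: V_space_def H1_0_vec_def \<psi>_def)
  moreover have "\<exists>p\<in>P_k 1. \<exists>b\<in>B_4 K'. AE x in lebesgue_on K'. \<psi> x $ i = p x + b x" if K': "K' \<in> \<T>" for K' i
  proof (cases "K' = K")
    case True
    have "AE x in lebesgue_on K. \<psi> x $ i = 0 + bubble_poly K x"
      by (rule AE_I2) (simp add: \<psi>_def bubble_def)
    then show ?thesis unfolding True
      by (intro bexI[OF _ P_k_zero] bexI[OF _ bubble_poly_B4[OF simplex_mesh[OF K] z ch]])
  next
    case False
    have "AE x in lebesgue_on K'. \<psi> x $ i = 0 + 0 * bubble_poly K' x"
      using AE_cell_interior[OF K']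
    proof (rule eventually_mono)
      fix x assume "x \<in> interior K'"
      then have "x \<notin> K" using cells_disjoint[OF K' K False] by blast
      then show "\<psi> x $ i = 0 + 0 * bubble_poly K' x" by (simp add: \<psi>_def bubble_def)
    qed
    moreover obtain z' where z': "cball z' (c * h) \<subseteq> K'" using inball[OF K'] by blast
    ultimately show ?thesis
      by (intro bexI[OF _ P_k_zero] bexI[OF _ B_4_cmult[OF bubble_poly_B4[OF simplex_mesh[OF K'] z' ch] cell_bounded[OF K'], of 0]])
  qed
  ultimately have "\<psi> \<in> V_h \<Omega> \<T> \<epsilon>" by (simp add: V_h_def)
  moreover have "\<not> ae_zero \<Omega> \<psi>"
  proof
    assume "ae_zero \<Omega> \<psi>"
    then have "AE x in lebesgue_on \<Omega>. bubble K x = 0" unfolding ae_zero_def by (rule eventually_mono) (simp add: \<psi>_def vec_eq_iff)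
    then have "AE x in lebesgue_on (interior K). bubble K x = 0" by (rule AE_restrict_cell[OF _ K])
    then have "bubble_mass K = 0" unfolding bubble_mass_def by (rule integral_eq_zero_AE)
    then show False using bubble_mass_pos[OF K] by simp
  qed
  ultimately show ?thesis using that by blast
qed

text \<open>The quotients of \<psi> and \<open>- \<psi>\<close> are opposite numbers, and the
  supremum is above both.\<close>

lemma curl_sup_nonneg:
  assumes ne: "\<Omega> \<noteq> {}" and q: "q \<in> Q_h \<Omega> \<T>" shows "curl_sup \<epsilon> q \<ge> 0"
proof -
  obtain \<psi> where p: "\<psi> \<in> V_h \<Omega> \<T> \<epsilon>" "\<not> ae_zero \<Omega> \<psi>" using V_nontrivial[OF ne] by blast
  have v: "\<psi> \<in> V_space \<Omega> \<epsilon>" by (rule V_h_V_space[OF p(1)])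
  have m: "(\<lambda>x. - \<psi> x) \<in> V_space \<Omega> \<epsilon>" using V_space_linear[OF open_dom bdd_dom v v, of "-2"] by (simp add: scaleR_2 algebra_simps)
  have nz: "\<not> ae_zero \<Omega> (\<lambda>x. - \<psi> x)" using p(2) by (simp add: ae_zero_def)
  have 1: "curl_pairing \<Omega> \<epsilon> \<psi> q / V_norm \<Omega> \<epsilon> \<psi> \<le> curl_sup \<epsilon> q"
    unfolding curl_sup_def by (intro cSUP_upper curl_sup_bdd q) (use v p in auto)
  have 2: "curl_pairing \<Omega> \<epsilon> (\<lambda>x. - \<psi> x) q / V_norm \<Omega> \<epsilon> (\<lambda>x. - \<psi> x) \<le> curl_sup \<epsilon> q"
    unfolding curl_sup_def using m nz by (intro cSUP_upper[where x = "\<lambda>x. - \<psi> x"] curl_sup_bdd q) auto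
  have "curl_pairing \<Omega> \<epsilon> (\<lambda>x. - \<psi> x) q = - curl_pairing \<Omega> \<epsilon> \<psi> q"
    by (simp add: curl_pairing_eq[OF open_dom bdd_dom v Q_h_H1_vec[OF q]] curl_pairing_eq[OF open_dom bdd_dom m Q_h_H1_vec[OF q]] L2_inner_uminus_left)
  moreover have "V_norm \<Omega> \<epsilon> (\<lambda>x. - \<psi> x) = V_norm \<Omega> \<epsilon> \<psi>" using V_norm_scaleR[OF open_dom bdd_dom v, of "-1"] by simp
  ultimately show ?thesis using 1 2 by simp
qed

text \<open>One factor \<open>1 / 2\<close> pays for a near-maximiser in place of a maximiser,
  another for the transfer to the discrete space, and the rest for the growth of the norm in the
  transfer. The added one keeps the constant below one.\<close>

definition stab_const :: real where "stab_const = 1 / (4 * (1 + sqrt (3 * fortin_const)))"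

lemma stab_const_pos: "stab_const > 0" "stab_const \<le> 1"
proof -
  define t where "t = sqrt (3 * fortin_const)"
  have "t \<ge> 0" using fortin_const_pos(1) by (simp add: t_def)
  moreover have "stab_const = 1 / (4 * (1 + t))" by (simp add: stab_const_def t_def)
  ultimately show "stab_const > 0" "stab_const \<le> 1" by simp_all
qed

text \<open>The supremum need not be attained, so a field reaching half of it is transferred and
  rescaled. Normalising to the size of the supremum turns the linear bound into the quadratic one
  that the stability argument adds to the squared divergence.\<close>

lemma discrete_curl_inf_sup:
  assumes ne: "\<Omega> \<noteq> {}" and q: "q \<in> Q_h \<Omega> \<T>"
  shows "\<exists>\<theta>\<in>V_h \<Omega> \<T> \<epsilon>. V_norm \<Omega> \<epsilon> \<theta> \<le> curl_sup \<epsilon> q \<and> stab_const * (curl_sup \<epsilon> q)\<^sup>2 \<le> L2_inner \<Omega> \<theta> (weak_curl \<Omega> q)"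
proof (cases "curl_sup \<epsilon> q = 0")
  case True
  have "V_norm \<Omega> \<epsilon> (\<lambda>x. 0) = 0"
    using V_norm_scaleR[OF open_dom bdd_dom V_h_V_space[OF V_h_zero], of \<epsilon> 0] by simp
  then show ?thesis using True by (intro bexI[OF _ V_h_zero]) (simp add: L2_inner_def)
next
  case False
  define N where "N = curl_sup \<epsilon> q"
  have N: "N > 0" using False curl_sup_nonneg[OF ne q, of \<epsilon>] by (simp add: N_def)
  let ?S = "{\<psi> \<in> V_space \<Omega> \<epsilon>. \<not> ae_zero \<Omega> \<psi>}"
  obtain \<psi>0 where p0: "\<psi>0 \<in> V_h \<Omega> \<T> \<epsilon>" "\<not> ae_zero \<Omega> \<psi>0" using V_nontrivial[OF ne] by blast
  then have Sne: "?S \<noteq> {}" using V_h_V_space by blast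
  have "N / 2 < (SUP \<psi> \<in> ?S. curl_pairing \<Omega> \<epsilon> \<psi> q / V_norm \<Omega> \<epsilon> \<psi>)" using N by (simp add: N_def curl_sup_def)
  then obtain \<psi> where p: "\<psi> \<in> ?S" "N / 2 < curl_pairing \<Omega> \<epsilon> \<psi> q / V_norm \<Omega> \<epsilon> \<psi>"
    using less_cSUP_iff[OF Sne curl_sup_bdd[OF q]] by blast
  have v: "\<psi> \<in> V_space \<Omega> \<epsilon>" "V_norm \<Omega> \<epsilon> \<psi> > 0" using p V_norm_pos by auto
  define B where "B = L2_inner \<Omega> \<psi> (weak_curl \<Omega> q)"
  define M where "M = 1 + sqrt (3 * fortin_const)"
  have M: "M > 0" "sqrt (3 * fortin_const) \<le> M" using fortin_const_pos(1) by (auto simp: M_def add_pos_nonneg)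
  have B: "B > N / 2 * V_norm \<Omega> \<epsilon> \<psi>"
    using p(2) v curl_pairing_eq[OF open_dom bdd_dom v(1) Q_h_H1_vec[OF q]] by (simp add: pos_less_divide_eq B_def)
  then have B0: "B > 0" using N v(2) by (meson half_gt_zero less_trans mult_pos_pos)
  obtain \<theta> where t: "\<theta> \<in> V_h \<Omega> \<T> \<epsilon>" "V_norm \<Omega> \<epsilon> \<theta> \<le> sqrt (3 * fortin_const) * V_norm \<Omega> \<epsilon> \<psi>"
    "B / 2 \<le> L2_inner \<Omega> \<theta> (weak_curl \<Omega> q)"
    using discrete_transfer[OF v q] B0 unfolding B_def by blast
  \<comment> \<open>Chosen so that the guaranteed norm bound
    \<open>M * V_norm \<Omega> \<epsilon> \<psi>\<close> of the transferred field is scaled to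
    exactly \<open>N\<close>.\<close>
  define s where "s = N / (M * V_norm \<Omega> \<epsilon> \<psi>)"
  have s: "s > 0" using N M v by (simp add: s_def)
  have sM: "s * (M * V_norm \<Omega> \<epsilon> \<psi>) = N" using M v by (simp add: s_def)
  have st: "(\<lambda>x. s *\<^sub>R \<theta> x) \<in> V_h \<Omega> \<T> \<epsilon>" using V_h_linear[OF V_h_zero t(1), of s] by simp
  have "V_norm \<Omega> \<epsilon> \<theta> \<le> M * V_norm \<Omega> \<epsilon> \<psi>" using t(2) mult_right_mono[OF M(2), of "V_norm \<Omega> \<epsilon> \<psi>"] v(2) by linarith
  then have "s * V_norm \<Omega> \<epsilon> \<theta> \<le> N" using mult_left_mono[of "V_norm \<Omega> \<epsilon> \<theta>" "M * V_norm \<Omega> \<epsilon> \<psi>" s] s sM by simp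
  then have n: "V_norm \<Omega> \<epsilon> (\<lambda>x. s *\<^sub>R \<theta> x) \<le> N"
    using V_norm_scaleR[OF open_dom bdd_dom V_h_V_space[OF t(1)], of s] s by simp
  have "stab_const * N\<^sup>2 = N * (s * (M * V_norm \<Omega> \<epsilon> \<psi>)) / (4 * M)" unfolding sM by (simp add: stab_const_def M_def power2_eq_square)
  also have "\<dots> = s * (N / 2 * V_norm \<Omega> \<epsilon> \<psi> / 2)" using M by simp
  also have "\<dots> \<le> s * (B / 2)" using B s by (intro mult_left_mono) auto
  also have "\<dots> \<le> s * L2_inner \<Omega> \<theta> (weak_curl \<Omega> q)" using t(3) s by (intro mult_left_mono) auto
  also have "\<dots> = L2_inner \<Omega> (\<lambda>x. s *\<^sub>R \<theta> x) (weak_curl \<Omega> q)" by (simp add: L2_inner_scaleR_left)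
  finally show ?thesis using n st unfolding N_def by (intro bexI[OF _ st] conjI)
qed

lemma VR_norm_sq: "(VR_norm \<Omega> \<epsilon> \<phi> r)\<^sup>2 = a1 \<Omega> \<epsilon> \<phi> \<phi> + a2 \<Omega> r r"
  by (simp add: VR_norm_def V_norm_sq a2_def L2_norm_sq a1_nonneg L2_inner_self_nonneg)

lemma VR_norm_nonneg: "VR_norm \<Omega> \<epsilon> \<phi> r \<ge> 0" by (simp add: VR_norm_def)

lemma Q_norm_sq: "(Q_norm \<Omega> \<epsilon> q)\<^sup>2 = (curl_sup \<epsilon> q)\<^sup>2 + (L2_norm \<Omega> (weak_div \<Omega> q))\<^sup>2"
  by (simp add: Q_norm_def curl_sup_def)

lemma Q_norm_nonneg: "Q_norm \<Omega> \<epsilon> q \<ge> 0" by (simp add: Q_norm_def)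

text \<open>The sign of \<open>- p\<close> cancels the mixed terms. The weight \<beta> is the
  inf-sup constant itself: the gain is \<open>\<beta>\<^sup>2 * P\<^sup>2\<close>, the cross term
  costs half of \<open>X\<^sup>2 + \<beta>\<^sup>2 * W\<close> with
  \<open>W \<le> P\<^sup>2\<close>, and half of both squares remains. The last two conclusions serve
  to show that the norm of the witness is positive.\<close>

lemma stability_witness:
  assumes ne: "\<Omega> \<noteq> {}" and \<phi>: "\<phi> \<in> V_h \<Omega> \<T> \<epsilon>" and r: "r \<in> R_h \<Omega> \<T>" and p: "p \<in> Q_h \<Omega> \<T>"
  defines "X \<equiv> VR_norm \<Omega> \<epsilon> \<phi> r" and "P \<equiv> Q_norm \<Omega> \<epsilon> p"
  shows "\<exists>\<psi>\<in>V_h \<Omega> \<T> \<epsilon>. \<exists>s\<in>R_h \<Omega> \<T>. \<exists>q\<in>Q_h \<Omega> \<T>.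
    stab_const\<^sup>2 / 4 * (X + P)\<^sup>2 \<le> B_form \<Omega> \<epsilon> \<phi> r p \<psi> s q \<and>
    VR_norm \<Omega> \<epsilon> \<psi> s + Q_norm \<Omega> \<epsilon> q \<le> 3 * (X + P) \<and>
    X\<^sup>2 / 2 - P\<^sup>2 \<le> (VR_norm \<Omega> \<epsilon> \<psi> s)\<^sup>2 \<and> Q_norm \<Omega> \<epsilon> q = P"
proof -
  define N where "N = curl_sup \<epsilon> p"
  define d where "d = weak_div \<Omega> p"
  define w where "w = weak_curl \<Omega> p"
  define \<beta> where "\<beta> = stab_const"
  have \<beta>: "\<beta> > 0" "\<beta> \<le> 1" by (simp_all add: \<beta>_def stab_const_pos)
  have pH: "p \<in> H1_vec \<Omega>" by (rule Q_h_H1_vec[OF p])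
  have pm: "(\<lambda>x. - p x) \<in> Q_h \<Omega> \<T>" by (rule Q_h_uminus[OF open_dom p])
  have dR: "d \<in> R_h \<Omega> \<T>" unfolding d_def by (rule weak_div_R_h[OF p])
  have dL: "d \<in> L2 \<Omega>" and rL: "r \<in> L2 \<Omega>" using dR r by (auto simp: R_h_def R_space_def)
  have wL: "w \<in> L2 \<Omega>" unfolding w_def by (rule weak_curl_L2[OF open_dom pH])
  obtain \<theta> where t: "\<theta> \<in> V_h \<Omega> \<T> \<epsilon>" "V_norm \<Omega> \<epsilon> \<theta> \<le> N" "\<beta> * N\<^sup>2 \<le> L2_inner \<Omega> \<theta> w"
    using discrete_curl_inf_sup[OF ne p, of \<epsilon>] unfolding N_def w_def \<beta>_def by blast
  have \<phi>V: "\<phi> \<in> V_space \<Omega> \<epsilon>" and \<theta>V: "\<theta> \<in> V_space \<Omega> \<epsilon>" using \<phi> t(1) V_h_V_space by auto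
  define \<psi> where "\<psi> = (\<lambda>x. \<phi> x + \<beta> *\<^sub>R \<theta> x)"
  define s where "s = (\<lambda>x. r x + \<beta> * d x)"
  have \<psi>h: "\<psi> \<in> V_h \<Omega> \<T> \<epsilon>" unfolding \<psi>_def by (rule V_h_linear[OF \<phi> t(1)])
  have sh: "s \<in> R_h \<Omega> \<T>" unfolding s_def by (rule R_h_linear[OF r dR])
  have sL: "s \<in> L2 \<Omega>" using sh by (simp add: R_h_def R_space_def)
  note \<psi>V = V_h_V_space[OF \<psi>h]
  have sae: "AE x in lebesgue_on \<Omega>. s x = r x + \<beta> *\<^sub>R d x" by (simp add: s_def)
  note a1e = a1_linear[OF open_dom bdd_dom \<phi>V \<theta>V, of \<beta>, folded \<psi>_def]
  note a2e = L2_inner_linear_AE[OF rL dL sL sae, folded a2_def]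
  define A where "A = a1 \<Omega> \<epsilon> \<phi> \<theta> + a2 \<Omega> r d"
  define W where "W = a1 \<Omega> \<epsilon> \<theta> \<theta> + a2 \<Omega> d d"
  have X2: "X\<^sup>2 = a1 \<Omega> \<epsilon> \<phi> \<phi> + a2 \<Omega> r r" unfolding X_def by (rule VR_norm_sq)
  have P2: "P\<^sup>2 = N\<^sup>2 + (L2_norm \<Omega> d)\<^sup>2" unfolding P_def N_def d_def by (rule Q_norm_sq)
  have W_le: "W \<le> P\<^sup>2"
  proof -
    have "(V_norm \<Omega> \<epsilon> \<theta>)\<^sup>2 \<le> N\<^sup>2" using t(2) by (intro power_mono V_norm_nonneg)
    then show ?thesis unfolding P2 W_def V_norm_sq[symmetric] by (simp add: a2_def L2_norm_sq)
  qed
  have Y2: "(VR_norm \<Omega> \<epsilon> \<psi> s)\<^sup>2 = X\<^sup>2 + 2 * \<beta> * A + \<beta>\<^sup>2 * W"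
    unfolding VR_norm_sq a1e(1) a2e(1) X2 A_def W_def by (simp add: algebra_simps)
  \<comment> \<open>The squared norm of the pair perturbed with an arbitrary weight
    \<open>c'\<close> is nonnegative. The weights \<open>- \<beta>\<close>, \<beta> and
    \<open>2 * \<beta>\<close> then bound the cross term \<open>A\<close> from both sides.\<close>
  have quad: "0 \<le> X\<^sup>2 + 2 * c' * A + c'\<^sup>2 * W" for c'
  proof -
    define \<psi>' where "\<psi>' = (\<lambda>x. \<phi> x + c' *\<^sub>R \<theta> x)"
    define s' where "s' = (\<lambda>x. r x + c' * d x)"
    have s'L: "s' \<in> L2 \<Omega>" unfolding s'_def by (intro L2_add rL L2_mult dL)
    have s'ae: "AE x in lebesgue_on \<Omega>. s' x = r x + c' *\<^sub>R d x" by (simp add: s'_def)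
    have "0 \<le> a1 \<Omega> \<epsilon> \<psi>' \<psi>' + a2 \<Omega> s' s'" by (simp add: a1_nonneg a2_def L2_inner_self_nonneg)
    then show ?thesis
      using a1_linear(1)[OF open_dom bdd_dom \<phi>V \<theta>V, of c', folded \<psi>'_def] L2_inner_linear_AE(1)[OF rL dL s'L s'ae, folded a2_def]
      unfolding X2 A_def W_def by (simp add: algebra_simps)
  qed
  have A_bound: "2 * \<beta> * A \<le> X\<^sup>2 + \<beta>\<^sup>2 * W" "- (X\<^sup>2 + \<beta>\<^sup>2 * W) \<le> 2 * \<beta> * A" "- (X\<^sup>2 + 4 * \<beta>\<^sup>2 * W) \<le> 4 * \<beta> * A"
    using quad[of "- \<beta>"] quad[of \<beta>] quad[of "2 * \<beta>"] by (simp_all add: power_mult_distrib)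
  have b1m: "b1 \<Omega> \<epsilon> \<phi> (\<lambda>x. - p x) = - L2_inner \<Omega> \<phi> w"
  proof -
    have "b1 \<Omega> \<epsilon> \<phi> (\<lambda>x. - p x) = L2_inner \<Omega> \<phi> (weak_curl \<Omega> (\<lambda>x. - p x))"
      unfolding b1_def by (rule curl_pairing_eq[OF open_dom bdd_dom \<phi>V H1_vec_uminus[OF pH]])
    also have "\<dots> = L2_inner \<Omega> \<phi> (\<lambda>x. - w x)"
      unfolding w_def by (intro L2_inner_cong_AE weak_curl_uminus weak_curl_L2 L2_uminus open_dom pH H1_vec_uminus V_space_L2[OF \<phi>V]) auto
    finally show ?thesis by (simp add: L2_inner_uminus_right)
  qed
  have b2m: "b2 \<Omega> r (\<lambda>x. - p x) = - L2_inner \<Omega> r d"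
  proof -
    have "b2 \<Omega> r (\<lambda>x. - p x) = L2_inner \<Omega> r (\<lambda>x. - d x)"
      unfolding d_def b2_def by (intro L2_inner_cong_AE weak_div_uminus weak_div_L2 L2_uminus open_dom pH H1_vec_uminus rL) auto
    then show ?thesis by (simp add: L2_inner_uminus_right)
  qed
  have b1p: "b1 \<Omega> \<epsilon> \<psi> p = L2_inner \<Omega> \<phi> w + \<beta> * L2_inner \<Omega> \<theta> w"
    unfolding b1_def curl_pairing_eq[OF open_dom bdd_dom \<psi>V pH] w_def[symmetric] unfolding \<psi>_def
    by (simp add: L2_inner_add_left[OF V_space_L2[OF \<phi>V] L2_scaleR[OF V_space_L2[OF \<theta>V]] wL] L2_inner_scaleR_left)
  have b2p: "b2 \<Omega> s p = L2_inner \<Omega> r d + \<beta> * (L2_norm \<Omega> d)\<^sup>2"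
    unfolding b2_def d_def[symmetric] s_def L2_norm_sq
    using L2_inner_add_left[OF rL L2_mult[OF dL] dL, of \<beta>] L2_inner_scaleR_left[of \<Omega> \<beta> d d] by simp
  have Bf: "B_form \<Omega> \<epsilon> \<phi> r p \<psi> s (\<lambda>x. - p x) = X\<^sup>2 + \<beta> * A + \<beta> * (L2_inner \<Omega> \<theta> w + (L2_norm \<Omega> d)\<^sup>2)"
    unfolding B_form_def b1m b2m b1p b2p a1e(2) a2e(2) X2 A_def by (simp add: algebra_simps)
  have "\<beta> * P\<^sup>2 \<le> L2_inner \<Omega> \<theta> w + (L2_norm \<Omega> d)\<^sup>2"
    using t(3) mult_right_mono[OF \<beta>(2), of "(L2_norm \<Omega> d)\<^sup>2"] unfolding P2 by (simp add: distrib_left)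
  then have "\<beta> * (\<beta> * P\<^sup>2) \<le> \<beta> * (L2_inner \<Omega> \<theta> w + (L2_norm \<Omega> d)\<^sup>2)" using \<beta> by (intro mult_left_mono) auto
  moreover have "\<beta>\<^sup>2 * W \<le> \<beta>\<^sup>2 * P\<^sup>2" using W_le by (intro mult_left_mono) auto
  \<comment> \<open>The lower bound for \<open>2 * \<beta> * A\<close> consumes half of
    \<open>X\<^sup>2\<close> and at most half of \<open>\<beta>\<^sup>2 * P\<^sup>2\<close>.\<close>
  ultimately have low: "X\<^sup>2 / 2 + \<beta>\<^sup>2 * P\<^sup>2 / 2 \<le> B_form \<Omega> \<epsilon> \<phi> r p \<psi> s (\<lambda>x. - p x)"
    unfolding Bf using A_bound(2) by (simp add: power2_eq_square)
  have X0: "X \<ge> 0" "P \<ge> 0" by (simp_all add: X_def P_def VR_norm_nonneg Q_norm_nonneg)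
  have b1: "\<beta>\<^sup>2 \<le> 1" using \<beta> by (simp add: power_le_one)
  have "stab_const\<^sup>2 / 4 * (X + P)\<^sup>2 \<le> \<beta>\<^sup>2 / 4 * (2 * X\<^sup>2 + 2 * P\<^sup>2)"
    unfolding \<beta>_def using norm_add_sq_le[of X P] by (intro mult_left_mono) auto
  also have "\<dots> = \<beta>\<^sup>2 * X\<^sup>2 / 2 + \<beta>\<^sup>2 * P\<^sup>2 / 2" by (simp add: algebra_simps)
  also have "\<dots> \<le> X\<^sup>2 / 2 + \<beta>\<^sup>2 * P\<^sup>2 / 2" using mult_right_mono[OF b1, of "X\<^sup>2"] by simp
  finally have main: "stab_const\<^sup>2 / 4 * (X + P)\<^sup>2 \<le> B_form \<Omega> \<epsilon> \<phi> r p \<psi> s (\<lambda>x. - p x)" using low by linarith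
  have "(VR_norm \<Omega> \<epsilon> \<psi> s)\<^sup>2 \<le> 2 * X\<^sup>2 + 2 * (\<beta>\<^sup>2 * P\<^sup>2)"
    using Y2 A_bound(1) \<open>\<beta>\<^sup>2 * W \<le> \<beta>\<^sup>2 * P\<^sup>2\<close> by linarith
  also have "\<dots> \<le> 2 * X\<^sup>2 + 2 * P\<^sup>2" using mult_right_mono[OF b1, of "P\<^sup>2"] by simp
  also have "\<dots> \<le> (2 * (X + P))\<^sup>2" using X0 by (simp add: power2_eq_square algebra_simps)
  finally have "VR_norm \<Omega> \<epsilon> \<psi> s \<le> 2 * (X + P)" by (rule power2_le_imp_le) (use X0 in simp)
  moreover have Qm: "Q_norm \<Omega> \<epsilon> (\<lambda>x. - p x) = P" unfolding P_def by (rule Q_norm_uminus[OF open_dom bdd_dom pH])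
  ultimately have "VR_norm \<Omega> \<epsilon> \<psi> s + Q_norm \<Omega> \<epsilon> (\<lambda>x. - p x) \<le> 3 * (X + P)" using X0 by simp
  \<comment> \<open>Here the doubled weight is used: it bounds \<open>2 * \<beta> * A\<close> below
    by \<open>- X\<^sup>2 / 2 - 2 * \<beta>\<^sup>2 * W\<close>, so half of \<open>X\<^sup>2\<close>
    survives in the norm of the perturbed pair.\<close>
  moreover have "X\<^sup>2 / 2 - P\<^sup>2 \<le> (VR_norm \<Omega> \<epsilon> \<psi> s)\<^sup>2"
    using Y2 A_bound(3) \<open>\<beta>\<^sup>2 * W \<le> \<beta>\<^sup>2 * P\<^sup>2\<close> mult_right_mono[OF b1, of "P\<^sup>2"] by simp
  ultimately show ?thesis using main \<psi>h sh pm Qm by blast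
qed

end

section \<open>The inf-sup condition\<close>

lemma ae_zero_is_weak_grad:
  assumes "ae_zero \<Omega> u" shows "is_weak_grad \<Omega> u (\<lambda>x. 0)"
  unfolding is_weak_grad_def
proof (intro conjI ballI allI L2_zero)
  fix f i
  have "(LINT x|lebesgue_on \<Omega>. u x * partial i f x) = 0"
    using assms unfolding ae_zero_def by (intro integral_eq_zero_AE) (auto elim: eventually_mono)
  then show "(LINT x|lebesgue_on \<Omega>. u x * partial i f x) = - (LINT x|lebesgue_on \<Omega>. (0::real^3) $ i * f x)" by simp
qed

lemma ae_zero_is_weak_curl:
  assumes "ae_zero \<Omega> q" shows "is_weak_curl \<Omega> q (\<lambda>x. 0)"
  unfolding is_weak_curl_def L2_inner_def
proof (intro conjI impI allI L2_zero)
  fix f :: vector_field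
  have "(LINT x|lebesgue_on \<Omega>. q x \<bullet> classical_curl f x) = 0"
    using assms unfolding ae_zero_def by (intro integral_eq_zero_AE) (auto elim: eventually_mono)
  then show "(LINT x|lebesgue_on \<Omega>. q x \<bullet> classical_curl f x) = (LINT x|lebesgue_on \<Omega>. 0 \<bullet> f x)" by simp
qed

lemma ae_zero_is_weak_div:
  assumes "ae_zero \<Omega> q" shows "is_weak_div \<Omega> q (\<lambda>x. 0)"
  unfolding is_weak_div_def L2_inner_def
proof (intro conjI ballI L2_zero)
  fix f
  have "(LINT x|lebesgue_on \<Omega>. q x \<bullet> classical_grad f x) = 0"
    using assms unfolding ae_zero_def by (intro integral_eq_zero_AE) (auto elim: eventually_mono)
  then show "(LINT x|lebesgue_on \<Omega>. q x \<bullet> classical_grad f x) = - (LINT x|lebesgue_on \<Omega>. 0 \<bullet> f x)" by simp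
qed

lemma ae_zero_V_norm:
  fixes \<psi> :: vector_field
  assumes \<Omega>: "open \<Omega>" and z: "ae_zero \<Omega> \<psi>"
  shows "V_norm \<Omega> \<epsilon> \<psi> = 0"
proof -
  have "AE x in lebesgue_on \<Omega>. weak_grad \<Omega> (\<lambda>y. \<psi> y $ i) x = 0" for i
  proof -
    have "ae_zero \<Omega> (\<lambda>y. \<psi> y $ i)" using z unfolding ae_zero_def by (rule eventually_mono) simp
    from weak_grad_AE[OF \<Omega> ae_zero_is_weak_grad[OF this]] show ?thesis .
  qed
  then have "AE x in lebesgue_on \<Omega>. \<forall>i\<in>UNIV. weak_grad \<Omega> (\<lambda>y. \<psi> y $ i) x = 0" by (intro AE_finite_allI) auto
  then have "ae_zero \<Omega> (weak_jacobian \<Omega> \<psi>)"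
    unfolding ae_zero_def by (rule eventually_mono) (simp add: weak_jacobian_def vec_eq_iff)
  from L2_norm_ae_zero[OF this] L2_norm_ae_zero[OF z] show ?thesis by (simp add: V_norm_def)
qed

text \<open>The weak curl is zero almost everywhere, so all quotients vanish; nonemptiness of the
  index set is what gives the supremum of the constant zero its value.\<close>

lemma ae_zero_Q_norm:
  assumes \<Omega>: "open \<Omega>" "bounded \<Omega>" and q: "q \<in> H1_vec \<Omega>" and z: "ae_zero \<Omega> q"
    and ne: "\<exists>\<psi>\<in>V_space \<Omega> \<epsilon>. \<not> ae_zero \<Omega> \<psi>"
  shows "Q_norm \<Omega> \<epsilon> q = 0"
proof -
  have c: "is_weak_curl \<Omega> q (weak_curl \<Omega> q)"
    unfolding weak_curl_def by (rule someI[of "is_weak_curl \<Omega> q", OF ae_zero_is_weak_curl[OF z]])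
  have d: "is_weak_div \<Omega> q (weak_div \<Omega> q)"
    unfolding weak_div_def by (rule someI[of "is_weak_div \<Omega> q", OF ae_zero_is_weak_div[OF z]])
  have "AE x in lebesgue_on \<Omega>. weak_curl \<Omega> q x = 0" by (rule weak_curl_unique[OF \<Omega>(1) c ae_zero_is_weak_curl[OF z]])
  then have "L2_inner \<Omega> \<psi> (weak_curl \<Omega> q) = 0" for \<psi>
    unfolding L2_inner_def by (intro integral_eq_zero_AE) (auto elim: eventually_mono)
  then have "curl_pairing \<Omega> \<epsilon> \<psi> q = 0" if "\<psi> \<in> V_space \<Omega> \<epsilon>" for \<psi>
    using curl_pairing_eq[OF \<Omega> that q] by simp
  then have "(SUP \<psi> \<in> {\<psi> \<in> V_space \<Omega> \<epsilon>. \<not> ae_zero \<Omega> \<psi>}. curl_pairing \<Omega> \<epsilon> \<psi> q / V_norm \<Omega> \<epsilon> \<psi>)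
    = (SUP \<psi> \<in> {\<psi> \<in> V_space \<Omega> \<epsilon>. \<not> ae_zero \<Omega> \<psi>}. 0)" by (intro SUP_cong) auto
  also have "\<dots> = 0" using ne by (intro cSUP_const) auto
  finally show ?thesis
    using L2_norm_ae_zero[of \<Omega> "weak_div \<Omega> q"] weak_div_unique[OF \<Omega>(1) d ae_zero_is_weak_div[OF z]]
    by (simp add: Q_norm_def ae_zero_def)
qed

lemma a1_eq_0:
  assumes v: "\<phi> \<in> V_space \<Omega> \<epsilon>" "\<psi> \<in> V_space \<Omega> \<epsilon>" and 0: "V_norm \<Omega> \<epsilon> \<phi> = 0"
  shows "a1 \<Omega> \<epsilon> \<phi> \<psi> = 0" "L2_norm \<Omega> \<phi> = 0"
proof -
  have s: "(if \<epsilon> > 0 then \<epsilon>\<^sup>2 * (L2_norm \<Omega> (weak_jacobian \<Omega> \<phi>))\<^sup>2 else 0) + (L2_norm \<Omega> \<phi>)\<^sup>2 = 0"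
    using 0 by (simp add: V_norm_def)
  have "0 \<le> (if \<epsilon> > 0 then \<epsilon>\<^sup>2 * (L2_norm \<Omega> (weak_jacobian \<Omega> \<phi>))\<^sup>2 else 0)" by simp
  then have "(L2_norm \<Omega> \<phi>)\<^sup>2 = 0" using s zero_le_power2[of "L2_norm \<Omega> \<phi>"] by linarith
  then show n: "L2_norm \<Omega> \<phi> = 0" by simp
  have i: "L2_inner \<Omega> \<phi> \<psi> = 0" using L2_Cauchy_Schwarz[OF V_space_L2[OF v(1)] V_space_L2[OF v(2)]] n by simp
  have "L2_inner \<Omega> (weak_jacobian \<Omega> \<phi>) (weak_jacobian \<Omega> \<psi>) = 0" if pos: "\<epsilon> > 0"
  proof -
    have "L2_norm \<Omega> (weak_jacobian \<Omega> \<phi>) = 0" using s n pos by simp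
    then show ?thesis
      using L2_Cauchy_Schwarz[OF weak_jacobian_L2(1)[OF V_space_H1_vec[OF pos v(1)]] weak_jacobian_L2(1)[OF V_space_H1_vec[OF pos v(2)]]] by simp
  qed
  then show "a1 \<Omega> \<epsilon> \<phi> \<psi> = 0" using i by (simp add: a1_def)
qed

context fe_mesh
begin

text \<open>When the right-hand side of the inf-sup bound vanishes, the usual witness may be null
  and hence inadmissible. Keeping \<open>r\<close> and \<open>p\<close> and choosing the sign of a
  nonzero discrete field leaves only nonnegative terms, as the vanishing norms of \<phi> and
  \<open>r\<close> eliminate the others by Cauchy-Schwarz.\<close>

lemma inf_sup_trivial:
  assumes ne: "\<Omega> \<noteq> {}" and \<phi>: "\<phi> \<in> V_h \<Omega> \<T> \<epsilon>" and r: "r \<in> R_h \<Omega> \<T>" and p: "p \<in> Q_h \<Omega> \<T>"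
    and 0: "VR_norm \<Omega> \<epsilon> \<phi> r = 0"
  shows "\<exists>(\<psi>, s, q)\<in>nonzero_triples \<Omega> \<T> \<epsilon>. 0 \<le> B_form \<Omega> \<epsilon> \<phi> r p \<psi> s q"
proof -
  obtain \<psi>0 where p0: "\<psi>0 \<in> V_h \<Omega> \<T> \<epsilon>" "\<not> ae_zero \<Omega> \<psi>0" using V_nontrivial[OF ne] by blast
  note pH = Q_h_H1_vec[OF p]
  have m: "(\<lambda>x. - \<psi>0 x) \<in> V_h \<Omega> \<T> \<epsilon>" using V_h_linear[OF p0(1) p0(1), of "-2"] by (simp add: scaleR_2 algebra_simps)
  have mz: "\<not> ae_zero \<Omega> (\<lambda>x. - \<psi>0 x)" using p0(2) by (simp add: ae_zero_def)
  have mb: "b1 \<Omega> \<epsilon> (\<lambda>x. - \<psi>0 x) p = - b1 \<Omega> \<epsilon> \<psi>0 p"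
    unfolding b1_def curl_pairing_eq[OF open_dom bdd_dom V_h_V_space[OF p0(1)] pH] curl_pairing_eq[OF open_dom bdd_dom V_h_V_space[OF m] pH]
    by (rule L2_inner_uminus_left)
  have "\<exists>\<psi>\<in>V_h \<Omega> \<T> \<epsilon>. \<not> ae_zero \<Omega> \<psi> \<and> b1 \<Omega> \<epsilon> \<psi> p \<ge> 0"
  proof (cases "b1 \<Omega> \<epsilon> \<psi>0 p \<ge> 0")
    case True then show ?thesis using p0 by blast
  next
    case False then show ?thesis using m mz mb by (intro bexI[OF _ m]) simp
  qed
  then obtain \<psi> where q: "\<psi> \<in> V_h \<Omega> \<T> \<epsilon>" "\<not> ae_zero \<Omega> \<psi>" "b1 \<Omega> \<epsilon> \<psi> p \<ge> 0" by blast
  have s0: "(V_norm \<Omega> \<epsilon> \<phi>)\<^sup>2 + (L2_norm \<Omega> r)\<^sup>2 = 0" using 0 by (simp add: VR_norm_def)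
  then have Vz: "V_norm \<Omega> \<epsilon> \<phi> = 0" and Rz: "L2_norm \<Omega> r = 0" by (auto simp: sum_power2_eq_zero_iff)
  note f = a1_eq_0[OF V_h_V_space[OF \<phi>] V_h_V_space[OF q(1)] Vz]
  have rL: "r \<in> L2 \<Omega>" using r by (simp add: R_h_def R_space_def)
  have "b1 \<Omega> \<epsilon> \<phi> p = 0"
    unfolding b1_def curl_pairing_eq[OF open_dom bdd_dom V_h_V_space[OF \<phi>] pH]
    using L2_Cauchy_Schwarz[OF V_space_L2[OF V_h_V_space[OF \<phi>]] weak_curl_L2[OF open_dom pH]] f(2) by simp
  moreover have "b2 \<Omega> r p = 0"
    unfolding b2_def using L2_Cauchy_Schwarz[OF rL weak_div_L2[OF open_dom pH]] Rz by simp
  ultimately have "0 \<le> B_form \<Omega> \<epsilon> \<phi> r p \<psi> r p"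
    using f(1) q(3) by (simp add: B_form_def a2_def L2_inner_self_nonneg)
  moreover have "(\<psi>, r, p) \<in> nonzero_triples \<Omega> \<T> \<epsilon>" using q r p by (simp add: nonzero_triples_def)
  ultimately show ?thesis by (intro bexI[where x = "(\<psi>, r, p)"]) auto
qed

text \<open>The factor \<open>1 / 12\<close> is the \<open>1 / 4\<close> of the witness divided by
  the three in the bound for its norm. Exhibiting one triple avoids any question about the supremum
  itself.\<close>

theorem discrete_inf_sup:
  assumes ne: "\<Omega> \<noteq> {}" and \<phi>: "\<phi> \<in> V_h \<Omega> \<T> \<epsilon>" and r: "r \<in> R_h \<Omega> \<T>" and p: "p \<in> Q_h \<Omega> \<T>"
  shows "\<exists>(\<psi>, s, q)\<in>nonzero_triples \<Omega> \<T> \<epsilon>. stab_const\<^sup>2 / 12 * (VR_norm \<Omega> \<epsilon> \<phi> r + Q_norm \<Omega> \<epsilon> p)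
     \<le> B_form \<Omega> \<epsilon> \<phi> r p \<psi> s q / (VR_norm \<Omega> \<epsilon> \<psi> s + Q_norm \<Omega> \<epsilon> q)"
proof -
  define X where "X = VR_norm \<Omega> \<epsilon> \<phi> r"
  define P where "P = Q_norm \<Omega> \<epsilon> p"
  have XP: "X \<ge> 0" "P \<ge> 0" by (simp_all add: X_def P_def VR_norm_nonneg Q_norm_nonneg)
  show ?thesis
  proof (cases "X + P = 0")
    case True
    then have z: "VR_norm \<Omega> \<epsilon> \<phi> r = 0" "Q_norm \<Omega> \<epsilon> p = 0" using XP by (auto simp: X_def P_def)
    obtain \<psi> s q where t: "(\<psi>, s, q) \<in> nonzero_triples \<Omega> \<T> \<epsilon>" "0 \<le> B_form \<Omega> \<epsilon> \<phi> r p \<psi> s q"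
      using inf_sup_trivial[OF ne \<phi> r p z(1)] by blast
    then show ?thesis by (intro bexI[OF _ t(1)]) (simp add: z VR_norm_nonneg Q_norm_nonneg)
  next
    case False
    then have pos: "X + P > 0" using XP by simp
    obtain \<psi> s q where t: "\<psi> \<in> V_h \<Omega> \<T> \<epsilon>" "s \<in> R_h \<Omega> \<T>" "q \<in> Q_h \<Omega> \<T>"
      "stab_const\<^sup>2 / 4 * (X + P)\<^sup>2 \<le> B_form \<Omega> \<epsilon> \<phi> r p \<psi> s q"
      "VR_norm \<Omega> \<epsilon> \<psi> s + Q_norm \<Omega> \<epsilon> q \<le> 3 * (X + P)"
      "X\<^sup>2 / 2 - P\<^sup>2 \<le> (VR_norm \<Omega> \<epsilon> \<psi> s)\<^sup>2" "Q_norm \<Omega> \<epsilon> q = P"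
      using stability_witness[OF ne \<phi> r p] unfolding X_def P_def by blast
    define D where "D = VR_norm \<Omega> \<epsilon> \<psi> s + Q_norm \<Omega> \<epsilon> q"
    \<comment> \<open>The quotient would be zero by convention for a vanishing denominator.
      Positivity comes from the second norm, equal to \<open>P\<close>, or, if \<open>P\<close> is
      zero, from the lower bound \<open>X\<^sup>2 / 2\<close> for the squared first norm.\<close>
    have D: "D > 0"
    proof (cases "P > 0")
      case True then show ?thesis using t(7) VR_norm_nonneg[of \<epsilon> \<psi> s] by (simp add: D_def)
    next
      case False
      then have P0: "P = 0" using XP by simp
      then have "X > 0" using pos by simp
      then have "0 < X\<^sup>2 / 2" by simp
      then have "VR_norm \<Omega> \<epsilon> \<psi> s \<noteq> 0" using t(6) P0 by auto
      then show ?thesis using VR_norm_nonneg[of \<epsilon> \<psi> s] Q_norm_nonneg[of \<epsilon> q] unfolding D_def by linarith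
    qed
    have "\<not> (ae_zero \<Omega> \<psi> \<and> ae_zero \<Omega> s \<and> ae_zero \<Omega> q)"
    proof
      assume z: "ae_zero \<Omega> \<psi> \<and> ae_zero \<Omega> s \<and> ae_zero \<Omega> q"
      have n: "\<exists>\<psi>\<in>V_space \<Omega> \<epsilon>. \<not> ae_zero \<Omega> \<psi>" using V_nontrivial[OF ne, of \<epsilon>] V_h_V_space by blast
      have "VR_norm \<Omega> \<epsilon> \<psi> s = 0" using z ae_zero_V_norm[OF open_dom, of \<psi> \<epsilon>] L2_norm_ae_zero[of \<Omega> s] by (simp add: VR_norm_def)
      moreover have "Q_norm \<Omega> \<epsilon> q = 0" using z by (intro ae_zero_Q_norm open_dom bdd_dom Q_h_H1_vec t n) auto
      ultimately show False using D by (simp add: D_def)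
    qed
    then have nz: "(\<psi>, s, q) \<in> nonzero_triples \<Omega> \<T> \<epsilon>" using t by (simp add: nonzero_triples_def)
    have "stab_const\<^sup>2 / 12 * (X + P) * D \<le> stab_const\<^sup>2 / 12 * (X + P) * (3 * (X + P))"
      using t(5) pos unfolding D_def by (intro mult_left_mono) auto
    also have "\<dots> = stab_const\<^sup>2 / 4 * (X + P)\<^sup>2" by (simp add: power2_eq_square)
    also note t(4)
    finally have "stab_const\<^sup>2 / 12 * (X + P) \<le> B_form \<Omega> \<epsilon> \<phi> r p \<psi> s q / D" using D by (simp add: pos_le_divide_eq)
    then show ?thesis using nz unfolding X_def P_def D_def by blast
  qed
qed

end

text \<open>Some inscribed ball has a diameter exceeding half the supremum, so its radius exceeds a
  quarter of it.\<close>

lemma inball_exists: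
  assumes "0 < inball_diameter K" "K \<noteq> {}"
  shows "\<exists>x. cball x (inball_diameter K / 4) \<subseteq> K"
proof -
  obtain z where z: "z \<in> K" using assms(2) by blast
  have "cball z 0 \<subseteq> K" using z by simp
  then have ne: "{2 * \<rho> | \<rho>. \<rho> \<ge> 0 \<and> (\<exists>x. cball x \<rho> \<subseteq> K)} \<noteq> {}" by blast
  have "inball_diameter K / 2 < Sup {2 * \<rho> | \<rho>. \<rho> \<ge> 0 \<and> (\<exists>x. cball x \<rho> \<subseteq> K)}"
    using assms(1) by (simp add: inball_diameter_def)
  from less_cSupE[OF this ne] obtain y where y: "y \<in> {2 * \<rho> | \<rho>. \<rho> \<ge> 0 \<and> (\<exists>x. cball x \<rho> \<subseteq> K)}" "inball_diameter K / 2 < y" .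
  then obtain \<rho> x where r: "y = 2 * \<rho>" "cball x \<rho> \<subseteq> K" by blast
  have "cball x (inball_diameter K / 4) \<subseteq> cball x \<rho>" using y(2) r(1) by (intro subset_cball) simp
  then show ?thesis using r(2) by blast
qed

text \<open>Quasi-uniformity compares \<open>h\<close> with the diameter of each cell and shape
  regularity compares that diameter with an inscribed ball; the exterior balls depend on \<Omega>
  alone once \<open>h\<close> is known to be at most its diameter. So one pair of constants serves
  every mesh.\<close>

lemma fe_mesh_family:
  assumes dom: "bounded_polyhedral_domain \<Omega>" and H: "H \<subseteq> {0<..}"
    and mesh: "\<And>h. h \<in> H \<Longrightarrow> tetrahedral_mesh \<Omega> (\<T> h)"
    and size: "\<And>h. h \<in> H \<Longrightarrow> h = mesh_size (\<T> h)"
    and shape: "shape_regular H \<T>" and quasi: "quasi_uniform H \<T>"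
  shows "\<exists>c \<kappa>. \<forall>h\<in>H. fe_mesh \<Omega> (\<T> h) h c \<kappa>"
proof -
  have O: "\<Omega> \<noteq> {}" "open \<Omega>" "bounded \<Omega>" "\<Omega> = interior (closure \<Omega>)"
    using dom by (auto simp: bounded_polyhedral_domain_def)
  obtain \<sigma> where \<sigma>: "\<sigma> > 0" "\<And>h K. h \<in> H \<Longrightarrow> K \<in> \<T> h \<Longrightarrow> diameter K \<le> \<sigma> * inball_diameter K"
    using shape unfolding shape_regular_def by blast
  obtain \<tau> where \<tau>: "\<tau> > 0" "\<And>h K. h \<in> H \<Longrightarrow> K \<in> \<T> h \<Longrightarrow> mesh_size (\<T> h) \<le> \<tau> * diameter K"
    using quasi unfolding quasi_uniform_def by blast
  \<comment> \<open>The added one leaves room to replace a point of the closure of \<Omega> by a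
    nearby point of \<Omega>, as the exterior ball property asks for.\<close>
  define D where "D = diameter (closure \<Omega>) + 1"
  have bc: "bounded (closure \<Omega>)" by (rule bounded_closure[OF O(3)])
  have D: "D > 0" using diameter_ge_0[OF bc] by (simp add: D_def)
  obtain \<kappa> where \<kappa>: "0 < \<kappa>" "\<kappa> \<le> 1" and ext: "\<And>h b. 0 < h \<Longrightarrow> h \<le> D \<Longrightarrow> b \<notin> \<Omega> \<Longrightarrow> (\<exists>x\<in>\<Omega>. dist x b \<le> D) \<Longrightarrow>
    \<exists>y. cball y (\<kappa> * h) \<subseteq> cball b h \<and> cball y (\<kappa> * h) \<inter> \<Omega> = {}"
    using exterior_ball[OF dom D] by blast
  \<comment> \<open>From \<open>h \<le> \<tau> * diameter K\<close>,
    \<open>diameter K \<le> \<sigma> * inball_diameter K\<close> and an inscribed ball whose radius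
    is a quarter of \<open>inball_diameter K\<close>.\<close>
  define c where "c = 1 / (4 * \<tau> * \<sigma>)"
  have "fe_mesh \<Omega> (\<T> h) h c \<kappa>" if h: "h \<in> H" for h
  proof -
    have h0: "h > 0" using H h by auto
    have tri: "triangulation (\<T> h)" and sim: "\<And>K. K \<in> \<T> h \<Longrightarrow> 3 simplex K" and cov: "\<Union>(\<T> h) = closure \<Omega>"
      using mesh[OF h] by (auto simp: tetrahedral_mesh_def)
    have fin: "finite (\<T> h)" using tri by (simp add: triangulation_def)
    have diam: "diameter K \<le> h" if "K \<in> \<T> h" for K
    proof -
      have "diameter K \<le> mesh_size (\<T> h)" unfolding mesh_size_def using fin that by (intro Max_ge) auto
      then show ?thesis using size[OF h] by linarith
    qed
    have hD: "h \<le> diameter (closure \<Omega>)"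
    proof -
      have "\<T> h \<noteq> {}" using cov O(1) closure_subset[of \<Omega>] by blast
      then have "mesh_size (\<T> h) \<in> diameter ` \<T> h" unfolding mesh_size_def using fin by (intro Max_in) auto
      then obtain K where K: "K \<in> \<T> h" "mesh_size (\<T> h) = diameter K" by auto
      have "diameter K \<le> diameter (closure \<Omega>)" using cov K(1) bc by (intro diameter_subset) auto
      then show ?thesis using size[OF h] K(2) by linarith
    qed
    show ?thesis
    proof
      show "\<exists>z. cball z (c * h) \<subseteq> K" if K: "K \<in> \<T> h" for K
      proof -
        have 1: "h \<le> \<tau> * diameter K" using \<tau>(2)[OF h K] size[OF h] by linarith
        have "0 < \<tau> * diameter K" using 1 h0 by linarith
        then have d0: "0 < diameter K" using \<tau>(1) by (simp add: zero_less_mult_iff)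
        have 2: "diameter K \<le> \<sigma> * inball_diameter K" by (rule \<sigma>(2)[OF h K])
        then have "0 < \<sigma> * inball_diameter K" using d0 by linarith
        then have i0: "0 < inball_diameter K" using \<sigma>(1) by (simp add: zero_less_mult_iff)
        have "K \<noteq> {}" using d0 by auto
        then obtain z where z: "cball z (inball_diameter K / 4) \<subseteq> K" using inball_exists[OF i0] by blast
        have "h \<le> \<tau> * (\<sigma> * inball_diameter K)" using 1 mult_left_mono[OF 2 less_imp_le[OF \<tau>(1)]] by linarith
        then have "c * h \<le> inball_diameter K / 4" using \<tau>(1) \<sigma>(1) by (simp add: c_def field_simps)
        then show ?thesis using z subset_cball[of "c * h" "inball_diameter K / 4" z] by blast
      qed
      show "\<exists>y. cball y (\<kappa> * h) \<subseteq> cball b h \<and> cball y (\<kappa> * h) \<inter> \<Omega> = {}"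
        if b: "b \<notin> \<Omega>" "x \<in> closure \<Omega>" "dist x b \<le> h" for b x
      proof (rule ext[OF h0 _ b(1)])
        show "h \<le> D" using hD by (simp add: D_def)
        obtain x' where x': "x' \<in> \<Omega>" "dist x' x < 1" using b(2) closure_approachable[of x \<Omega>] zero_less_one by blast
        have "dist x' b \<le> dist x' x + dist x b" by (rule dist_triangle)
        then show "\<exists>x\<in>\<Omega>. dist x b \<le> D" using x' b(3) hD by (intro bexI[OF _ x'(1)]) (simp add: D_def)
      qed
      show "(K \<inter> K') face_of K" if "K \<in> \<T> h" "K' \<in> \<T> h" for K K'
        using tri that by (simp add: triangulation_def)
      show "c > 0" using \<sigma>(1) \<tau>(1) by (simp add: c_def)
    qed (fact O \<kappa> fin h0 cov sim diam)+
  qed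
  then show ?thesis by blast
qed

theorem theorem3p1:
  fixes \<Omega> :: "(real^3) set" and \<epsilon>\<^sub>0 :: real
    and H :: "real set" and \<T> :: "real \<Rightarrow> (real^3) set set"
  assumes "bounded_polyhedral_domain \<Omega>"
    and "\<epsilon>\<^sub>0 > 0"
    and "H \<subseteq> {0<..}"
    and "\<And>h. h \<in> H \<Longrightarrow> tetrahedral_mesh \<Omega> (\<T> h)"
    and "\<And>h. h \<in> H \<Longrightarrow> h = mesh_size (\<T> h)"
    and "shape_regular H \<T>"
    and "quasi_uniform H \<T>"
  shows "\<exists>C>0. \<forall>\<epsilon> \<in> {0..\<epsilon>\<^sub>0}. \<forall>h \<in> H.
           \<forall>\<phi> \<in> V_h \<Omega> (\<T> h) \<epsilon>. \<forall>r \<in> R_h \<Omega> (\<T> h). \<forall>p \<in> Q_h \<Omega> (\<T> h).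
             (SUP (\<psi>, s, q) \<in> nonzero_triples \<Omega> (\<T> h) \<epsilon>.
                ereal (B_form \<Omega> \<epsilon> \<phi> r p \<psi> s q / (VR_norm \<Omega> \<epsilon> \<psi> s + Q_norm \<Omega> \<epsilon> q)))
             \<ge> ereal (C * (VR_norm \<Omega> \<epsilon> \<phi> r + Q_norm \<Omega> \<epsilon> p))"
proof -
  obtain c \<kappa> where m: "\<And>h. h \<in> H \<Longrightarrow> fe_mesh \<Omega> (\<T> h) h c \<kappa>"
    using fe_mesh_family[OF assms(1,3-7)] by blast
  have ne: "\<Omega> \<noteq> {}" using assms(1) by (simp add: bounded_polyhedral_domain_def)
  \<comment> \<open>For an empty family there is no mesh from which the positivity of
    \<open>stab_const\<close> could be obtained, so any positive value is taken.\<close>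
  define C where "C = (if H = {} then 1 else (fe_mesh.stab_const c \<kappa>)\<^sup>2 / 12)"
  have "C > 0"
  proof (cases "H = {}")
    case False
    then obtain h where "h \<in> H" by blast
    then have "fe_mesh.stab_const c \<kappa> > 0" using fe_mesh.stab_const_pos(1)[OF m] by blast
    then show ?thesis by (simp add: C_def)
  qed (simp add: C_def)
  moreover have "ereal (C * (VR_norm \<Omega> \<epsilon> \<phi> r + Q_norm \<Omega> \<epsilon> p)) \<le> (SUP (\<psi>, s, q) \<in> nonzero_triples \<Omega> (\<T> h) \<epsilon>.
                ereal (B_form \<Omega> \<epsilon> \<phi> r p \<psi> s q / (VR_norm \<Omega> \<epsilon> \<psi> s + Q_norm \<Omega> \<epsilon> q)))"
    if h: "h \<in> H" and v: "\<phi> \<in> V_h \<Omega> (\<T> h) \<epsilon>" "r \<in> R_h \<Omega> (\<T> h)" "p \<in> Q_h \<Omega> (\<T> h)" for \<epsilon> h \<phi> r p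
  proof -
    have C: "C = (fe_mesh.stab_const c \<kappa>)\<^sup>2 / 12" using h by (auto simp: C_def)
    obtain \<psi> s q where t: "(\<psi>, s, q) \<in> nonzero_triples \<Omega> (\<T> h) \<epsilon>" "C * (VR_norm \<Omega> \<epsilon> \<phi> r + Q_norm \<Omega> \<epsilon> p)
       \<le> B_form \<Omega> \<epsilon> \<phi> r p \<psi> s q / (VR_norm \<Omega> \<epsilon> \<psi> s + Q_norm \<Omega> \<epsilon> q)"
      using fe_mesh.discrete_inf_sup[OF m[OF h] ne v] unfolding C by blast
    show ?thesis using t(2) by (intro SUP_upper2[OF t(1)]) simp
  qed
  ultimately show ?thesis by (intro exI[of _ C]) blast
qed

end
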